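(* For each dimension $d\ge2$ there is an appropriate constant $C_d>0$ depending only on $d$ such that the following holds. Let $0<T\le\infty$, $\alpha,\beta>0$, $$K_\beta=C_d\Big[\|b_2\|_{L^1(\mathbb{S}^{d-1})}\Big(\beta^{-d/2}+\frac{1}{d+\gamma_2-1}\Big)+\|b_3\|_{L^1(\mathbb{S}^{2d-1})}\Big(\beta^{-d}+\frac{1}{2d+\gamma_3-1}\Big)\Big],\qquad \lambda_{\alpha,\beta}=\min\Big\{\frac{\alpha^{1/2}}{24K_\beta},\frac{\alpha^{1/4}}{2\sqrt{6K_\beta}}\Big\}.$$ Consider $f_0\in\mathcal{M}_{\alpha,\beta}^+$ and $(l_0^\#,u_0^\#)\in\mathcal{M}_{\alpha,\beta}^+\times\mathcal{M}_{\alpha,\beta}^+$ (independent of $t$) with $\|u_0^\#\|_{\mathcal{M}_{\alpha,\beta}}<\lambda_{\alpha,\beta}$. Let $l_1,u_1$ be the unique mild solutions on $[0,T)$ of the linear problems $$\partial_t l_1+v\cdot\nabla_x l_1=G(l_0,l_0,l_0)-L(l_1,u_0,u_0),\quad l_1(0)=f_0,$$ $$\partial_t u_1+v\cdot\nabla_x u_1=G(u_0,u_0,u_0)-L(u_1,l_0,l_0),\quad u_1(0)=f_0,$$ and assume the beginning condition $$0\le l_0^\#\le l_1^\#(t)\le u_1^\#(t)\le u_0^\#,\quad\forall t\in[0,T).$$ Then: (i) There are unique sequences $(l_n)_n,(u_n)_n$ such that for every $n\in\mathbb{N}$, $n\ge1$, $l_n$ and $u_n$ are respectively the mild solutions on $[0,T)$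 of $$\partial_t l_n+v\cdot\nabla_x l_n=G(l_{n-1},l_{n-1},l_{n-1})-L(l_n,u_{n-1},u_{n-1}),\quad l_n(0)=f_0,$$ $$\partial_t u_n+v\cdot\nabla_x u_n=G(u_{n-1},u_{n-1},u_{n-1})-L(u_n,l_{n-1},l_{n-1}),\quad u_n(0)=f_0.$$ Moreover, for any $n$, $$0\le l_0^\#\le l_1^\#(t)\le\dots\le l_n^\#(t)\le u_n^\#(t)\le\dots\le u_1^\#(t)\le u_0^\#,\quad\forall t\in[0,T).$$ (ii) For all $t\in[0,T)$ the sequences $(l_n^\#(t))_n$, $(u_n^\#(t))_n$ converge in $\mathcal{M}_{\alpha,\beta}$ (in the sense $\overset{\mathcal{M}_{\alpha,\beta}}{\longrightarrow}$). Setting $l^\#(t):=\lim_n l_n^\#(t)$, $u^\#(t):=\lim_n u_n^\#(t)$, one has $l^\#,u^\#\in C^0([0,T),L^{1,+}_{x,v})\cap L^\infty([0,T),\mathcal{M}_{\alpha,\beta}^+)$, $L^\#(l,u,u),L^\#(u,l,l),G^\#(l,l,l),G^\#(u,u,u)\in L^\infty([0,T),L^{1,+}_{x,v})$, and for all $t\in[0,T)$ $$l^\#(t)+\int_0^tL^\#(l,u,u)(\tau)\,d\tau=f_0+\int_0^tG^\#(l,l,l)(\tau)\,d\tau,$$ $$u^\#(t)+\int_0^tL^\#(u,l,l)(\tau)\,d\tau=f_0+\int_0^tG^\#(u,u,u)(\tau)\,d\tau.$$ (iii) The limits coincide: $u=l$. (iv) Let $f:=l=u$. Then $f$ is the unique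 mild solution of the binary-ternary Boltzmann equation $\partial_tf+v\cdot\nabla_xf=Q_2(f,f)+Q_3(f,f,f)$ in $[0,T)$ with initial data $f_0$ satisfying $|||f^\#|||_\infty\le\|u_0^\#\|_{\mathcal{M}_{\alpha,\beta}}$. (Uniqueness is in the class of mild solutions satisfying this bound.)
   Context: Collision kernels. Fix $d\ge2$, $\gamma_2\in(-d+1,1]$, $\gamma_3\in(-2d+1,1]$. Let $b_2:[-1,1]\to[0,\infty)$ be measurable, even, with $\|b_2\|_{L^1(\mathbb{S}^{d-1})}:=|\mathbb{S}^{d-2}|\int_{-1}^1 b_2(z)(1-z^2)^{\frac{d-3}{2}}dz<\infty$ (this equals $\int_{\mathbb{S}^{d-1}}b_2(e\cdot\omega)\,d\omega$ for any unit vector $e$). Let $b_3:[-1,1]\times[-\frac12,\frac12]\to[0,\infty)$ be measurable, with $b_3(-z,w)=b_3(z,w)$ and $\|b_3\|_{L^1(\mathbb{S}^{2d-1})}:=\sup_{\boldsymbol\nu\in\mathbb{E}^{2d-1}}\int_{\mathbb{S}^{2d-1}}b_3(\boldsymbol\nu\cdot\boldsymbol\omega,\omega_1\cdot\omega_2)\,d\boldsymbol\omega<\infty$, where $\boldsymbol\omega=(\omega_1,\omega_2)\in\mathbb{S}^{2d-1}\subset\mathbb{R}^d\times\mathbb{R}^d$ and $\mathbb{E}^{2d-1}=\{(\nu_1,\nu_2)\in\mathbb{R}^{2d}:|\nu_1|^2+|\nu_2|^2+|\nu_1-\nu_2|^2=1\}$. No normalization of $b_2,b_3$ is imposed; at least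 one of $b_2,b_3$ is not trivially zero, so that $\|b_2\|_{L^1(\mathbb{S}^{d-1})}+\|b_3\|_{L^1(\mathbb{S}^{2d-1})}>0$. Binary: for $v,v_1\in\mathbb{R}^d$, $\omega\in\mathbb{S}^{d-1}$, put $u=v_1-v$ (relative velocity; not to be confused with the functions $u_n,u$ of the iteration), $\hat u=u/|u|$, $B_2(u,\omega)=|u|^{\gamma_2}b_2(\hat u\cdot\omega)$, $v'=v+(\omega\cdot u)\omega$, $v_1'=v_1-(\omega\cdot u)\omega$. Ternary: for $v,v_1,v_2\in\mathbb{R}^d$, $\boldsymbol\omega=(\omega_1,\omega_2)\in\mathbb{S}^{2d-1}$, put $\boldsymbol u=(v_1-v,v_2-v)\in\mathbb{R}^{2d}$, $|\widetilde{\boldsymbol u}|=\sqrt{|v-v_1|^2+|v-v_2|^2+|v_1-v_2|^2}$, $\bar{\boldsymbol u}=\boldsymbol u/|\widetilde{\boldsymbol u}|$, $B_3(\boldsymbol u,\boldsymbol\omega)=|\widetilde{\boldsymbol u}|^{\gamma_3}b_3(\bar{\boldsymbol u}\cdot\boldsymbol\omega,\omega_1\cdot\omega_2)$, and with $c=\frac{\omega_1\cdot(v_1-v)+\omega_2\cdot(v_2-v)}{1+\omega_1\cdot\omega_2}$: $v^*=v+c(\omega_1+\omega_2)$, $v_1^*=v_1-c\,\omega_1$, $v_2^*=v_2-c\,\omega_2$. Operators (functions of $(t,x,v)$; $t,x$ suppressed): $G_2(f,g)(v)=\int_{\mathbb{S}^{d-1}\times\mathbb{R}^d}B_2 f(v')g(v_1')\,d\omega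 dv_1$, $L_2(f,g)(v)=\int_{\mathbb{S}^{d-1}\times\mathbb{R}^d} B_2 f(v)g(v_1)\,d\omega dv_1$, $G_3(f,g,h)(v)=\int_{\mathbb{S}^{2d-1}\times\mathbb{R}^{2d}}B_3 f(v^* )g(v_1^* )h(v_2^* )\,d\boldsymbol\omega dv_1dv_2$, $L_3(f,g,h)(v)=\int_{\mathbb{S}^{2d-1}\times\mathbb{R}^{2d}}B_3 f(v)g(v_1)h(v_2)\,d\boldsymbol\omega dv_1dv_2$; $G(f,g,h)=G_2(f,g)+G_3(f,g,h)$, $L(f,g,h)=L_2(f,g)+L_3(f,g,h)$; $Q_2=G_2-L_2$, $Q_3=G_3-L_3$. Function spaces. $F_{x,v}$: measurable functions $\mathbb{R}^d\times\mathbb{R}^d\to\overline{\mathbb{R}}$; $F_{x,v}^+$: those that are a.e. nonnegative; (in)equalities in $F_{x,v}$ are a.e. $L^1_{x,v}=L^1(\mathbb{R}^d\times\mathbb{R}^d)$, $L^{1,+}_{x,v}=L^1_{x,v}\cap F^+_{x,v}$. $M_{\alpha,\beta}(x,v)=e^{-\alpha|x|^2-\beta|v|^2}$, $\|f\|_{\mathcal{M}_{\alpha,\beta}}=\|fM_{\alpha,\beta}^{-1}\|_{L^\infty(\mathbb{R}^d\times\mathbb{R}^d)}$, $\mathcal{M}_{\alpha,\beta}=\{f\in F_{x,v}:\|f\|_{\mathcal{M}_{\alpha,\beta}}<\infty\}$, $\mathcal{M}_{\alpha,\beta}^+=\mathcal{M}_{\alpha,\beta}\cap F_{x,v}^+$.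 $f_n\overset{\mathcal{M}_{\alpha,\beta}}{\longrightarrow}f$ means $f_n\to f$ a.e. and $\sup_n\|f_n\|_{\mathcal{M}_{\alpha,\beta}}<\infty$. $\mathcal{F}_T=\{f:[0,T)\to F_{x,v}\}$, $\mathcal{F}_T^+=\{f:[0,T)\to F^+_{x,v}\}$. $|||f|||_\infty=\sup_{t\in[0,T)}\|f(t)\|_{\mathcal{M}_{\alpha,\beta}}$ (supremum over all $t$); $L^\infty([0,T),\mathcal{M}_{\alpha,\beta}^+)=\{f\in\mathcal{F}_T^+:|||f|||_\infty<\infty\}$. $C^0([0,T),L^{1,+}_{x,v})$, $L^1_{loc}([0,T),L^{1,+}_{x,v})$, $L^\infty([0,T),L^{1,+}_{x,v})$ are the intersections of $C^0([0,T),L^1_{x,v})$, $L^1_{loc}([0,T),L^1_{x,v})$, $L^\infty([0,T),L^1_{x,v})$ with $\mathcal{F}_T^+$. Transport. For $f\in\mathcal{F}_T$, $f^\#(t,x,v)=f(t,x+tv,v)$; this map is invertible, with inverse $f^{-\#}(t,x,v)=f(t,x-tv,v)$. When $f^\#$ is specified directly, $f$ denotes $(f^\#)^{-\#}$. $L^\#(f,g,h)=(L(f,g,h))^\#$, $G^\#(f,g,h)=(G(f,g,h))^\#$. Mild solution of the linear problem. For $f_0\in L^{1,+}_{x,v}$, $g^\#\in L^\infty([0,T),\mathcal{M}_{\alpha,\beta}^+)$, $h^\#\in L^1_{loc}([0,T),L^{1,+}_{x,v})$, a mild solution of $\partial_tf+v\cdot\nabla_xf=h-L(f,g,g)$, $f(0)=f_0$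 in $[0,T)$ is $f\in\mathcal{F}_T^+$ with $f^\#\in C^0([0,T),L^{1,+}_{x,v})$, $L^\#(f,g,g)\in L^1_{loc}([0,T),L^{1,+}_{x,v})$, $f^\#$ weakly differentiable in $t$ with $\frac{df^\#}{dt}+L^\#(f,g,g)=h^\#$ (equality of $L^1_{x,v}$-valued distributions) and $f^\#(0)=f_0$. Mild solution of the binary-ternary Boltzmann equation. For $f_0\in\mathcal{M}_{\alpha,\beta}^+$, a mild solution in $[0,T)$ with initial data $f_0$ is $f\in\mathcal{F}_T^+$ such that $f^\#\in C^0([0,T),L^{1,+}_{x,v})\cap L^\infty([0,T),\mathcal{M}_{\alpha,\beta}^+)$; $L^\#(f,f,f),G^\#(f,f,f)\in L^\infty([0,T),L^{1,+}_{x,v})$; and $f^\#$ is weakly differentiable in $t$ with $\frac{df^\#}{dt}+L^\#(f,f,f)=G^\#(f,f,f)$, $f^\#(0)=f_0$. *)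

theory Defs
  imports "HOL-Analysis.Analysis" "HOL-Probability.Essential_Supremum"
begin

section \<open>The Banach space of classes of Lebesgue integrable functions\<close>

text \<open>The type \<open>'a L1\<close> is \<open>L\<^sup>1\<close> of the Euclidean space \<open>'a\<close>, modulo equality almost everywhere. It is
  shown to be a separable Banach space, so that continuity and the Bochner integral of
  \<open>L\<^sup>1\<close>-valued functions are those of the library. Every class has a Borel measurable representative.\<close>

quotient_type (overloaded) 'a L1 = "'a::euclidean_space \<Rightarrow> real" / partial:
  "\<lambda>f g. integrable lborel f \<and> integrable lborel g \<and> (AE x in lborel. f x = g x)"
  by (rule part_equivpI) (auto intro!: sympI transpI exI[of _ "\<lambda>x. 0"])

instantiation L1 :: (euclidean_space) real_vector
begin
lift_definition zero_L1 :: "'a L1" is "\<lambda>x. 0" by simp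
lift_definition plus_L1 :: "'a L1 \<Rightarrow> 'a L1 \<Rightarrow> 'a L1" is "\<lambda>f g x. f x + g x" by auto
lift_definition minus_L1 :: "'a L1 \<Rightarrow> 'a L1 \<Rightarrow> 'a L1" is "\<lambda>f g x. f x - g x" by auto
lift_definition uminus_L1 :: "'a L1 \<Rightarrow> 'a L1" is "\<lambda>f x. - f x" by auto
lift_definition scaleR_L1 :: "real \<Rightarrow> 'a L1 \<Rightarrow> 'a L1" is "\<lambda>c f x. c * f x" by auto
instance
  by standard (transfer; auto simp: algebra_simps)+
end

instantiation L1 :: (euclidean_space) real_normed_vector
begin
lift_definition norm_L1 :: "'a L1 \<Rightarrow> real" is "\<lambda>f. \<integral>x. \<bar>f x\<bar> \<partial>lborel"
  by (rule integral_cong_AE) auto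
definition dist_L1 :: "'a L1 \<Rightarrow> 'a L1 \<Rightarrow> real" where "dist_L1 f g = norm (f - g)"
definition sgn_L1 :: "'a L1 \<Rightarrow> 'a L1" where "sgn_L1 f = f /\<^sub>R norm f"
definition uniformity_L1 :: "('a L1 \<times> 'a L1) filter"
  where "uniformity_L1 = (INF e\<in>{0<..}. principal {(x, y). dist x y < e})"
definition open_L1 :: "'a L1 set \<Rightarrow> bool"
  where "open_L1 U = (\<forall>x\<in>U. eventually (\<lambda>(x', y). x' = x \<longrightarrow> y \<in> U) uniformity)"
instance
proof
  fix f g :: "'a L1" and c :: real
  show "norm f = 0 \<longleftrightarrow> f = 0"
    by transfer (simp add: integral_nonneg_eq_0_iff_AE)
  show "norm (f + g) \<le> norm f + norm g"
  proof transfer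
    fix f g :: "'a \<Rightarrow> real"
    assume "integrable lborel f \<and> integrable lborel f \<and> (AE x in lborel. f x = f x)"
      "integrable lborel g \<and> integrable lborel g \<and> (AE x in lborel. g x = g x)"
    then have f: "integrable lborel f" and g: "integrable lborel g" by auto
    have "(\<integral>x. \<bar>f x + g x\<bar> \<partial>lborel) \<le> (\<integral>x. \<bar>f x\<bar> + \<bar>g x\<bar> \<partial>lborel)"
      using f g by (intro integral_mono) auto
    also have "\<dots> = (\<integral>x. \<bar>f x\<bar> \<partial>lborel) + (\<integral>x. \<bar>g x\<bar> \<partial>lborel)"
      using f g by simp
    finally show "(\<integral>x. \<bar>f x + g x\<bar> \<partial>lborel) \<le> (\<integral>x. \<bar>f x\<bar> \<partial>lborel) + (\<integral>x. \<bar>g x\<bar> \<partial>lborel)" .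
  qed
  show "norm (c *\<^sub>R f) = \<bar>c\<bar> * norm f"
    by transfer (simp add: abs_mult)
qed (simp_all add: dist_L1_def sgn_L1_def uniformity_L1_def open_L1_def)
end

text \<open>The class of an integrable function; functions that are not integrable are sent to \<open>0\<close>.\<close>
definition L1_class :: "('a::euclidean_space \<Rightarrow> real) \<Rightarrow> 'a L1"
  where "L1_class f = (if integrable lborel f then abs_L1 f else 0)"

lemma L1_class_cases: obtains f where "integrable lborel f" "F = L1_class f"
  by (induction F rule: L1.abs_induct) (auto simp: L1_class_def)

lemma norm_L1_class: "integrable lborel f \<Longrightarrow> norm (L1_class f) = (\<integral>x. \<bar>f x\<bar> \<partial>lborel)"
  by (simp add: L1_class_def norm_L1.abs_eq)

lemma L1_class_add:
  "\<lbrakk>integrable lborel f; integrable lborel g\<rbrakk> \<Longrightarrow> L1_class (\<lambda>x. f x + g x) = L1_class f + L1_class g"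
  by (simp add: L1_class_def plus_L1.abs_eq)

lemma L1_class_diff:
  "\<lbrakk>integrable lborel f; integrable lborel g\<rbrakk> \<Longrightarrow> L1_class (\<lambda>x. f x - g x) = L1_class f - L1_class g"
  by (simp add: L1_class_def minus_L1.abs_eq)

lemma L1_class_scale: "integrable lborel f \<Longrightarrow> L1_class (\<lambda>x. c * f x) = c *\<^sub>R L1_class f"
  by (simp add: L1_class_def scaleR_L1.abs_eq)

lemma L1_class_cong_AE:
  assumes [measurable]: "f \<in> borel_measurable borel" "g \<in> borel_measurable borel"
    and "AE x in lborel. f x = g x"
  shows "L1_class f = L1_class g"
proof -
  have "integrable lborel f = integrable lborel g"
    using assms by (intro integrable_cong_AE) auto
  then show ?thesis using assms(3) by (auto simp: L1_class_def intro!: Quotient_rel_abs[OF Quotient_L1])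
qed

lemma L1_class_tendsto:
  assumes f: "\<And>n. integrable lborel (f n)" and w: "integrable lborel w"
    and g [measurable]: "g \<in> borel_measurable borel"
    and lim: "AE x in lborel. (\<lambda>n. f n x) \<longlonglongrightarrow> g x"
    and bound: "\<And>n. AE x in lborel. \<bar>f n x\<bar> \<le> w x"
  shows "(\<lambda>n. L1_class (f n)) \<longlonglongrightarrow> L1_class g"
proof -
  have [measurable]: "\<And>n. f n \<in> borel_measurable borel" using f[THEN borel_measurable_integrable] by simp
  have [measurable]: "w \<in> borel_measurable borel" using w[THEN borel_measurable_integrable] by simp
  have ig: "integrable lborel g"
    by (rule integrable_dominated_convergence[of g lborel f w]) (use w lim bound in auto)
  have "AE x in lborel. \<forall>n. \<bar>f n x\<bar> \<le> w x" using bound by (simp add: AE_all_countable)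
  then have "AE x in lborel. \<forall>n. \<bar>f n x - g x\<bar> \<le> 2 * w x"
    using lim
  proof eventually_elim
    case (elim x)
    have "\<bar>g x\<bar> \<le> w x"
      by (rule LIMSEQ_le_const2[OF tendsto_rabs[OF elim(2)]]) (use elim in auto)
    show ?case
    proof
      fix n
      show "\<bar>f n x - g x\<bar> \<le> 2 * w x" using elim(1)[rule_format, of n] \<open>\<bar>g x\<bar> \<le> w x\<close> by linarith
    qed
  qed
  then have b: "\<And>n. AE x in lborel. norm \<bar>f n x - g x\<bar> \<le> 2 * w x"
    by auto
  have "(\<lambda>n. \<integral>x. \<bar>f n x - g x\<bar> \<partial>lborel) \<longlonglongrightarrow> (\<integral>x. 0 \<partial>(lborel :: 'a measure))"
  proof (rule integral_dominated_convergence[where w="\<lambda>x. 2 * w x"])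
    show "AE x in lborel. (\<lambda>n. \<bar>f n x - g x\<bar>) \<longlonglongrightarrow> 0"
      using lim by eventually_elim (simp add: LIM_zero tendsto_rabs_zero)
  qed (use w b in auto)
  then have "(\<lambda>n. norm (L1_class (f n) - L1_class g)) \<longlonglongrightarrow> 0"
    using f ig by (simp add: L1_class_diff[symmetric] norm_L1_class)
  then show ?thesis by (simp add: LIM_zero_cancel tendsto_norm_zero_iff)
qed

text \<open>Separability: the rational combinations of indicators of finite intersections of basic open
  sets, cut off to balls, are dense.\<close>

definition L1_cells :: "'a::euclidean_space set set"
  where "L1_cells = Inter ` {b. finite b \<and> b \<subseteq> (SOME B. countable B \<and> topological_basis B)}"

definition L1_dense :: "'a::euclidean_space L1 set"
  where "L1_dense = (\<lambda>xs. \<Sum>(q, A, n)\<leftarrow>xs. of_rat q *\<^sub>R L1_class (indicator (A \<inter> ball 0 (real n))))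
    ` lists (UNIV \<times> L1_cells \<times> UNIV)"

lemma countable_L1_cells: "countable (L1_cells :: 'a::euclidean_space set set)"
  and sigma_L1_cells: "sets (borel :: 'a measure) = sigma_sets UNIV L1_cells"
  and Int_stable_L1_cells: "Int_stable (L1_cells :: 'a set set)"
  and UNIV_L1_cells: "UNIV \<in> (L1_cells :: 'a set set)"
proof -
  define B :: "'a set set" where "B = (SOME B. countable B \<and> topological_basis B)"
  have "\<exists>B::'a set set. countable B \<and> topological_basis B" by (rule ex_countable_basis)
  then have B: "countable B" "topological_basis B" unfolding B_def by (metis (lifting) someI_ex)+
  have c: "L1_cells = Inter ` {b. finite b \<and> b \<subseteq> B}" by (simp add: L1_cells_def B_def)
  show "countable (L1_cells :: 'a set set)"
    unfolding c using B(1) by (intro countable_image countable_Collect_finite_subset)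
  have "Int_stable (Inter ` {b. finite b \<and> b \<subseteq> B})"
  proof (rule Int_stableI, safe)
    fix b d :: "'a set set" assume "finite b" "b \<subseteq> B" "finite d" "d \<subseteq> B"
    then show "\<Inter>b \<inter> \<Inter>d \<in> Inter ` {b. finite b \<and> b \<subseteq> B}"
      by (intro image_eqI[of _ _ "b \<union> d"]) auto
  qed
  then show "Int_stable (L1_cells :: 'a set set)" by (simp add: c)
  show "UNIV \<in> (L1_cells :: 'a set set)"
    unfolding c by (rule image_eqI[of _ _ "{}"]) auto
  have op: "open A" if A: "A \<in> L1_cells" for A :: "'a set"
  proof -
    obtain b where "finite b" "b \<subseteq> B" "A = \<Inter>b" using A unfolding c by auto
    then show ?thesis using topological_basis_open[OF B(2)] by (simp add: open_Inter subset_iff)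
  qed
  have sub: "B \<subseteq> L1_cells" unfolding c by (auto intro!: image_eqI[of _ _ "{_}"])
  have "sets (borel :: 'a measure) = sigma_sets UNIV B"
    unfolding borel_eq_countable_basis[OF B] by (rule sets_measure_of) simp
  also have "\<dots> \<subseteq> sigma_sets UNIV L1_cells" using sub by (rule sigma_sets_mono')
  finally show "sets (borel :: 'a measure) = sigma_sets UNIV L1_cells"
    using op sets.sigma_sets_subset[of L1_cells "borel :: 'a measure"] by force
qed

lemma L1_cells_Pow: "L1_cells \<subseteq> Pow UNIV" by simp

lemma closure_L1_dense: "closure (L1_dense :: 'a::euclidean_space L1 set) = UNIV"
proof -
  let ?V = "closure (L1_dense :: 'a L1 set)"
  have fin: "emeasure lborel (A \<inter> ball 0 (real n)) < \<infinity>" if "A \<in> sets borel" for A :: "'a set" and n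
  proof -
    have "emeasure lborel (A \<inter> ball 0 (real n)) \<le> emeasure lborel (ball (0::'a) (real n))"
      using that by (intro emeasure_mono) auto
    also have "\<dots> < \<infinity>" by (rule emeasure_lborel_ball_finite)
    finally show ?thesis .
  qed
  have int: "integrable lborel (indicator (A \<inter> ball 0 (real n)) :: 'a \<Rightarrow> real)"
    if "A \<in> sets borel" for A n
    using fin[OF that, of n] that by (intro integrable_real_indicator) auto
  have seqV: "l \<in> ?V" if "f \<longlonglongrightarrow> l" "\<And>n. f n \<in> ?V" for f l
    by (rule closed_sequentially[OF closed_closure that(2,1)])
  have addD: "f + g \<in> L1_dense" if "f \<in> L1_dense" "g \<in> L1_dense" for f g :: "'a L1"
    using that unfolding L1_dense_def
    apply clarify
    subgoal for xs ys by (rule image_eqI[of _ _ "xs @ ys"]) auto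
    done
  have scaleD: "of_rat q *\<^sub>R f \<in> L1_dense" if f: "f \<in> L1_dense" for q and f :: "'a L1"
  proof -
    obtain xs where xs: "xs \<in> lists (UNIV \<times> L1_cells \<times> UNIV)"
      "f = (\<Sum>(q, A, n)\<leftarrow>xs. of_rat q *\<^sub>R L1_class (indicator (A \<inter> ball 0 (real n))))"
      using f unfolding L1_dense_def by auto
    have "of_rat q *\<^sub>R f = (\<Sum>(q, A, n)\<leftarrow>map (\<lambda>(p, A, n). (q * p, A, n)) xs.
        of_rat q *\<^sub>R L1_class (indicator (A \<inter> ball 0 (real n))))"
      unfolding xs(2) by (induction xs) (auto simp: scaleR_add_right of_rat_mult)
    moreover have "map (\<lambda>(p, A, n). (q * p, A, n)) xs \<in> lists (UNIV \<times> L1_cells \<times> UNIV)"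
      using xs(1) by auto
    ultimately show ?thesis unfolding L1_dense_def by blast
  qed
  have addV: "f + g \<in> ?V" if "f \<in> ?V" "g \<in> ?V" for f g
  proof -
    obtain a b where "\<And>n. a n \<in> L1_dense" "a \<longlonglongrightarrow> f" "\<And>n. b n \<in> L1_dense" "b \<longlonglongrightarrow> g"
      using \<open>f \<in> ?V\<close> \<open>g \<in> ?V\<close> unfolding closure_sequential by metis
    then show ?thesis unfolding closure_sequential
      by (intro exI[of _ "\<lambda>n. a n + b n"]) (auto intro: addD tendsto_intros)
  qed
  have scaleV1: "of_rat q *\<^sub>R f \<in> ?V" if "f \<in> ?V" for q f
  proof -
    obtain a where "\<And>n. a n \<in> L1_dense" "a \<longlonglongrightarrow> f"
      using \<open>f \<in> ?V\<close> unfolding closure_sequential by metis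
    then show ?thesis unfolding closure_sequential
      by (intro exI[of _ "\<lambda>n. of_rat q *\<^sub>R a n"]) (auto intro: scaleD tendsto_intros)
  qed
  have scaleV: "c *\<^sub>R f \<in> ?V" if "f \<in> ?V" for c f
  proof -
    have "c \<in> closure \<rat>" using Rats_closure_real by simp
    then obtain q where q: "\<And>n. q n \<in> \<rat>" "q \<longlonglongrightarrow> c" unfolding closure_sequential by blast
    have "q n *\<^sub>R f \<in> ?V" for n
      using q(1)[of n] by (rule Rats_cases) (simp only: scaleV1[OF that])
    moreover have "(\<lambda>n. q n *\<^sub>R f) \<longlonglongrightarrow> c *\<^sub>R f" using q(2) by (intro tendsto_intros)
    ultimately show ?thesis by (rule seqV[rotated])
  qed
  have diffV: "f - g \<in> ?V" if "f \<in> ?V" "g \<in> ?V" for f g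
    using addV[OF that(1) scaleV[OF that(2), of "-1"]] by simp
  have zeroD: "0 \<in> L1_dense" unfolding L1_dense_def by (rule image_eqI[of _ _ "[]"]) auto
  then have zeroV: "0 \<in> ?V" using closure_subset by auto
  have class0: "L1_class (\<lambda>x::'a. 0) = 0" by (simp add: L1_class_def zero_L1.abs_eq)
  have cell: "L1_class (indicator (A \<inter> ball 0 (real n))) \<in> ?V" if "A \<in> sets borel" for A :: "'a set" and n
  proof -
    have "A \<in> sigma_sets UNIV L1_cells" using that by (simp add: sigma_L1_cells)
    then have
      "A \<in> sets borel \<and> L1_class (indicator (A \<inter> ball 0 (real n))) \<in> ?V"
    proof (induction rule: sigma_sets_induct_disjoint[OF Int_stable_L1_cells L1_cells_Pow, consumes 1, case_names basic empty compl union])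
      case (basic A)
      have "L1_class (indicator (A \<inter> ball 0 (real n))) \<in> L1_dense"
        unfolding L1_dense_def using basic by (intro image_eqI[of _ _ "[(1, A, n)]"]) auto
      then show ?case using basic closure_subset by (auto simp: sigma_L1_cells)
    next
      case empty
      show ?case using zeroV by (simp add: class0 indicator_def)
    next
      case (compl A)
      have U: "L1_class (indicator (UNIV \<inter> ball 0 (real n))) \<in> ?V"
      proof -
        have "L1_class (indicator (UNIV \<inter> ball 0 (real n))) \<in> L1_dense"
          unfolding L1_dense_def using UNIV_L1_cells by (intro image_eqI[of _ _ "[(1, UNIV, n)]"]) auto
        then show ?thesis using closure_subset by auto
      qed
      have "indicator ((UNIV - A) \<inter> ball 0 (real n)) =
        (\<lambda>x::'a. indicator (UNIV \<inter> ball 0 (real n)) x - indicator (A \<inter> ball 0 (real n)) x :: real)"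
        by (auto simp: indicator_def fun_eq_iff)
      then have "L1_class (indicator ((UNIV - A) \<inter> ball 0 (real n))) =
          L1_class (indicator (UNIV \<inter> ball 0 (real n))) - L1_class (indicator (A \<inter> ball 0 (real n)))"
        using L1_class_diff[OF int[of UNIV n] int[of A n]] compl by simp
      then show ?case using diffV[OF U] compl by auto
    next
      case (union A)
      have m: "A i \<in> sets borel" for i using union by auto
      have sum: "L1_class (\<lambda>x. \<Sum>i<k. indicator (A i \<inter> ball 0 (real n)) x) \<in> ?V" for k
      proof (induction k)
        case 0
        show ?case using zeroV by (simp add: class0)
      next
        case (Suc k)
        have "integrable lborel (\<lambda>x. \<Sum>i<k. indicator (A i \<inter> ball 0 (real n)) x :: real)"
          using int[OF m] by auto
        then have "L1_class (\<lambda>x. \<Sum>i<Suc k. indicator (A i \<inter> ball 0 (real n)) x) =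
          L1_class (\<lambda>x. \<Sum>i<k. indicator (A i \<inter> ball 0 (real n)) x) +
          L1_class (indicator (A k \<inter> ball 0 (real n)))"
          using L1_class_add[OF _ int[OF m]] by simp
        then show ?case using addV[OF Suc.IH] union by auto
      qed
      have disj: "disjoint_family (\<lambda>i. A i \<inter> ball 0 (real n))"
        using union(1) by (auto simp: disjoint_family_on_def)
      have eq: "(\<Sum>i<k. indicator (A i \<inter> ball 0 (real n)) x) =
          (indicator (\<Union>i<k. A i \<inter> ball 0 (real n)) x :: real)" for k x
        by (rule indicator_UN_disjoint[symmetric])
          (use disj in \<open>auto simp: disjoint_family_on_def\<close>)
      have "(\<lambda>k. L1_class (\<lambda>x. \<Sum>i<k. indicator (A i \<inter> ball 0 (real n)) x)) \<longlonglongrightarrow>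
          L1_class (indicator (\<Union> (range A) \<inter> ball 0 (real n)))"
      proof (rule L1_class_tendsto[where w="indicator (ball 0 (real n))"])
        show "integrable lborel (indicator (ball (0::'a) (real n)) :: 'a \<Rightarrow> real)"
          using int[of UNIV n] by simp
        show "integrable lborel (\<lambda>x. \<Sum>i<k. indicator (A i \<inter> ball 0 (real n)) x :: real)" for k
          using int[OF m] by auto
        have "(\<lambda>k. indicator (\<Union>i<k. A i \<inter> ball 0 (real n)) x :: real) \<longlonglongrightarrow>
           indicator (\<Union>i. A i \<inter> ball 0 (real n)) x" for x
          by (rule LIMSEQ_indicator_UN)
        moreover have "(\<Union>i. A i \<inter> ball 0 (real n)) = \<Union> (range A) \<inter> ball 0 (real n)" by auto
        ultimately show "AE x in lborel. (\<lambda>k. \<Sum>i<k. indicator (A i \<inter> ball 0 (real n)) x :: real)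
            \<longlonglongrightarrow> indicator (\<Union> (range A) \<inter> ball 0 (real n)) x"
          by (simp add: eq)
        show "AE x in lborel. \<bar>\<Sum>i<k. indicator (A i \<inter> ball 0 (real n)) x :: real\<bar>
            \<le> indicator (ball 0 (real n)) x" for k
          unfolding eq by (rule AE_I2) (auto simp: indicator_def)
      qed (use m in \<open>auto intro!: borel_measurable_indicator\<close>)
      then have "L1_class (indicator (\<Union> (range A) \<inter> ball 0 (real n))) \<in> ?V"
        by (rule seqV) (rule sum)
      then show ?case using m by auto
    qed
    then show ?thesis by simp
  qed
  have "L1_class f \<in> ?V" if "integrable lborel f" for f :: "'a \<Rightarrow> real"
    using that
  proof (induction rule: integrable_induct)
    case (base A c)
    have "(\<lambda>n. L1_class (indicator (A \<inter> ball 0 (real n)))) \<longlonglongrightarrow> L1_class (indicator A)"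
    proof (rule L1_class_tendsto[where w="indicator A"])
      show "AE x in lborel. (\<lambda>n. indicator (A \<inter> ball 0 (real n)) x :: real) \<longlonglongrightarrow> indicator A x"
      proof (rule AE_I2)
        fix x :: 'a
        obtain N :: nat where "norm x < real N" using reals_Archimedean2 by blast
        then have "\<forall>n\<ge>N. indicator (A \<inter> ball 0 (real n)) x = (indicator A x :: real)"
          by (auto simp: indicator_def)
        then show "(\<lambda>n. indicator (A \<inter> ball 0 (real n)) x :: real) \<longlonglongrightarrow> indicator A x"
          by (intro tendsto_eventually) (auto simp: eventually_sequentially)
      qed
      show "AE x in lborel. \<bar>indicator (A \<inter> ball 0 (real n)) x :: real\<bar> \<le> indicator A x" for n
        by (simp add: indicator_def)
    qed (use base int in auto)
    then have "L1_class (indicator A) \<in> ?V"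
      by (rule seqV) (use cell base in auto)
    then have "c *\<^sub>R L1_class (indicator A) \<in> ?V" by (rule scaleV)
    moreover have "(\<lambda>x. indicator A x *\<^sub>R c) = (\<lambda>x. c * indicator A x)" by auto
    ultimately show ?case using base by (simp add: L1_class_scale)
  next
    case (add f g)
    then show ?case using addV by (simp add: L1_class_add)
  next
    case (lim f s)
    have "(\<lambda>i. L1_class (s i)) \<longlonglongrightarrow> L1_class f"
      by (rule L1_class_tendsto[where w="\<lambda>x. 2 * \<bar>f x\<bar>"]) (use lim in auto)
    then show ?case by (rule seqV) (use lim in auto)
  qed
  then show ?thesis by (metis L1_class_cases UNIV_eq_I)
qed

instance L1 :: (euclidean_space) second_countable_topology
proof
  let ?D = "L1_dense :: 'a L1 set"
  have D: "countable ?D"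
    unfolding L1_dense_def
    by (intro countable_image countable_lists countable_SIGMA countable_L1_cells) auto
  define B where "B = (\<lambda>(x, n). ball x (1 / Suc n)) ` (?D \<times> (UNIV :: nat set))"
  have "countable B" unfolding B_def using D by (intro countable_image countable_SIGMA) auto
  moreover have "topological_basis B"
  proof (rule topological_basisI)
    show "open U" if "U \<in> B" for U using that by (auto simp: B_def)
    fix U :: "'a L1 set" and x assume "open U" "x \<in> U"
    then obtain e where e: "e > 0" "ball x e \<subseteq> U" using openE by blast
    obtain n :: nat where n: "1 / Suc n < e / 2" using e(1) nat_approx_posE[of "e/2"] by auto
    have "x \<in> closure ?D" by (simp add: closure_L1_dense)
    then obtain y where y: "y \<in> ?D" "dist y x < 1 / Suc n"
      using closure_approachable[of x ?D] by (meson divide_pos_pos of_nat_0_less_iff zero_less_Suc zero_less_one)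
    have "ball y (1 / Suc n) \<subseteq> ball x e"
    proof
      fix z assume "z \<in> ball y (1 / Suc n)"
      then have "dist x z < e" using y n dist_triangle[of x z y] by (simp add: dist_commute)
      then show "z \<in> ball x e" by simp
    qed
    then show "\<exists>V\<in>B. x \<in> V \<and> V \<subseteq> U" using y e
      by (intro bexI[of _ "ball y (1 / Suc n)"]) (auto simp: B_def)
  qed
  ultimately show "\<exists>B::'a L1 set set. countable B \<and> open = generate_topology B"
    by (metis (full_types) topological_basis_imp_subbasis ext)
qed

instance L1 :: (euclidean_space) banach
proof
  fix X :: "nat \<Rightarrow> 'a L1" assume C: "Cauchy X"
  have "\<exists>N. \<forall>m\<ge>N. \<forall>n\<ge>N. norm (X m - X n) < (1/2)^k" for k
    using C unfolding Cauchy_iff by simp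
  then obtain M where M: "\<And>k m n. m \<ge> M k \<Longrightarrow> n \<ge> M k \<Longrightarrow> norm (X m - X n) < (1/2)^k" by metis
  define r where "r k = (\<Sum>i\<le>k. M i) + k" for k
  have r: "strict_mono r" by (rule strict_mono_Suc_iff[THEN iffD2]) (simp add: r_def)
  have rM: "r k \<ge> M k" for k unfolding r_def by (simp add: member_le_sum trans_le_add1)
  have "norm (X (r (Suc k)) - X (r k)) < (1/2)^k" for k
  proof (rule M)
    show "M k \<le> r k" by (rule rM)
    show "M k \<le> r (Suc k)" using rM[of k] r strict_mono_less_eq[of r k "Suc k"] by simp
  qed
  then have nb: "norm (X (r (Suc k)) - X (r k)) \<le> (1/2)^k" for k by (simp add: less_imp_le)
  have "\<exists>f. integrable lborel f \<and> X (r k) = L1_class f" for k by (metis L1_class_cases)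
  then obtain f where f: "\<And>k. integrable lborel (f k)" "\<And>k. X (r k) = L1_class (f k)" by metis
  have [measurable]: "\<And>k. f k \<in> borel_measurable borel" using f(1)[THEN borel_measurable_integrable] by simp
  let ?d = "\<lambda>k x. f (Suc k) x - f k x"
  have idb: "(\<integral>x. \<bar>?d k x\<bar> \<partial>lborel) \<le> (1/2)^k" for k
    using nb[of k] f by (simp add: L1_class_diff[symmetric] norm_L1_class)
  have id: "integrable lborel (?d k)" for k using f by auto
  have "(\<integral>\<^sup>+x. (\<Sum>k. ennreal \<bar>?d k x\<bar>) \<partial>lborel) = (\<Sum>k. \<integral>\<^sup>+x. ennreal \<bar>?d k x\<bar> \<partial>lborel)"
    by (intro nn_integral_suminf) auto
  also have "\<dots> = (\<Sum>k. ennreal (\<integral>x. \<bar>?d k x\<bar> \<partial>lborel))"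
    using id by (simp add: nn_integral_eq_integral)
  also have "\<dots> \<le> (\<Sum>k. ennreal ((1/2)^k))"
    using idb by (intro suminf_le) (auto intro: ennreal_leI)
  also have "\<dots> < \<infinity>"
    by (subst suminf_ennreal2) (auto simp: summable_geometric)
  finally have fin: "(\<integral>\<^sup>+x. (\<Sum>k. ennreal \<bar>?d k x\<bar>) \<partial>lborel) \<noteq> \<infinity>" by simp
  then have "AE x in lborel. (\<Sum>k. ennreal \<bar>?d k x\<bar>) \<noteq> \<infinity>"
    by (intro nn_integral_noteq_infinite) auto
  then have sm: "AE x in lborel. summable (\<lambda>k. \<bar>?d k x\<bar>)"
    by eventually_elim (rule summable_suminf_not_top, auto)
  have sumint: "summable (\<lambda>k. \<integral>x. norm (?d k x) \<partial>lborel)"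
    by (rule summable_comparison_test'[of "\<lambda>k. (1/2::real)^k" 0])
      (use idb in \<open>auto simp: summable_geometric\<close>)
  define w where "w x = (\<Sum>k. norm (?d k x))" for x
  have w: "integrable lborel w" unfolding w_def
    by (rule integrable_suminf) (use id sm sumint in auto)
  define g where "g x = lim (\<lambda>n. f n x)" for x
  have [measurable]: "g \<in> borel_measurable borel" unfolding g_def by measurable
  have part: "f n x = f 0 x + (\<Sum>k<n. ?d k x)" for n x
    by (simp add: sum_lessThan_telescope[of "\<lambda>k. f k x" n])
  have "(\<lambda>k. L1_class (f k)) \<longlonglongrightarrow> L1_class g"
  proof (rule L1_class_tendsto[where w="\<lambda>x. \<bar>f 0 x\<bar> + w x"])
    show "integrable lborel (\<lambda>x. \<bar>f 0 x\<bar> + w x)" using f w by auto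
    show "AE x in lborel. (\<lambda>n. f n x) \<longlonglongrightarrow> g x"
      using sm
    proof eventually_elim
      case (elim x)
      then have "summable (\<lambda>k. ?d k x)" by (rule summable_rabs_cancel)
      then have "convergent (\<lambda>n. f 0 x + (\<Sum>k<n. ?d k x))"
        by (intro convergent_add convergent_const) (simp add: summable_iff_convergent)
      then have "convergent (\<lambda>n. f n x)" by (simp only: part[symmetric])
      then show ?case by (simp add: g_def convergent_LIMSEQ_iff)
    qed
    show "AE x in lborel. \<bar>f n x\<bar> \<le> \<bar>f 0 x\<bar> + w x" for n
      using sm
    proof eventually_elim
      case (elim x)
      have "\<bar>\<Sum>k<n. ?d k x\<bar> \<le> (\<Sum>k<n. \<bar>?d k x\<bar>)" by (rule sum_abs)
      also have "\<dots> \<le> w x" unfolding w_def using elim by (auto intro: sum_le_suminf)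
      finally show ?case using part[of n x] by linarith
    qed
  qed (use f in auto)
  then have "(X \<circ> r) \<longlonglongrightarrow> L1_class g" using f(2) by (simp add: o_def)
  then have "X \<longlonglongrightarrow> L1_class g" using C r by (rule Cauchy_converges_subseq[rotated 2])
  then show "convergent X" by (rule convergentI)
qed

section \<open>Function spaces on phase space\<close>

text \<open>Phase space is \<open>'a \<times> 'a\<close> with points \<open>(x, v)\<close>. Elements of \<open>F\<^sub>x\<^sub>,\<^sub>v\<close> are represented by Borel functions;
  all (in)equalities between them are meant almost everywhere.\<close>

type_synonym 'a phase_fun = "'a \<times> 'a \<Rightarrow> ereal"

definition F_space :: "'a::euclidean_space phase_fun set"
  where "F_space = borel_measurable borel"

definition F_pos :: "'a::euclidean_space phase_fun set"
  where "F_pos = {f \<in> F_space. AE z in lborel. 0 \<le> f z}"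

definition L1_space :: "'a::euclidean_space phase_fun set"
  where "L1_space = {f \<in> F_space. (\<integral>\<^sup>+z. e2ennreal \<bar>f z\<bar> \<partial>lborel) < \<infinity>}"

text \<open>Meaningful for \<open>f \<in> L1_space\<close>, where \<open>f\<close> is finite almost everywhere.\<close>
definition to_L1 :: "'a::euclidean_space phase_fun \<Rightarrow> ('a \<times> 'a) L1"
  where "to_L1 f = L1_class (\<lambda>z. real_of_ereal (f z))"

definition maxwellian :: "real \<Rightarrow> real \<Rightarrow> 'a::euclidean_space \<times> 'a \<Rightarrow> real"
  where "maxwellian \<alpha> \<beta> = (\<lambda>(x, v). exp (- \<alpha> * (norm x)\<^sup>2 - \<beta> * (norm v)\<^sup>2))"

definition norm_M :: "real \<Rightarrow> real \<Rightarrow> 'a::euclidean_space phase_fun \<Rightarrow> ereal"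
  where "norm_M \<alpha> \<beta> f = esssup lborel (\<lambda>z. \<bar>f z\<bar> / ereal (maxwellian \<alpha> \<beta> z))"

definition M_space :: "real \<Rightarrow> real \<Rightarrow> 'a::euclidean_space phase_fun set"
  where "M_space \<alpha> \<beta> = {f \<in> F_space. norm_M \<alpha> \<beta> f < \<infinity>}"

definition M_pos :: "real \<Rightarrow> real \<Rightarrow> 'a::euclidean_space phase_fun set"
  where "M_pos \<alpha> \<beta> = M_space \<alpha> \<beta> \<inter> F_pos"

definition converges_M ::
    "real \<Rightarrow> real \<Rightarrow> (nat \<Rightarrow> 'a::euclidean_space phase_fun) \<Rightarrow> 'a phase_fun \<Rightarrow> bool"
  where "converges_M \<alpha> \<beta> fs f \<longleftrightarrow>
    (\<forall>n. fs n \<in> F_space) \<and> f \<in> F_space \<and>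
    (AE z in lborel. (\<lambda>n. fs n z) \<longlonglongrightarrow> f z) \<and> (SUP n. norm_M \<alpha> \<beta> (fs n)) < \<infinity>"

section \<open>Time dependent functions\<close>

text \<open>Functions on \<open>[0,T)\<close>, \<open>0 < T \<le> \<infinity>\<close>, are total functions of \<open>t\<close> whose values outside \<open>[0,T)\<close>
  are never used.\<close>

type_synonym 'a evol = "real \<Rightarrow> 'a phase_fun"

definition time_int :: "ereal \<Rightarrow> real set"
  where "time_int T = {t. 0 \<le> t \<and> ereal t < T}"

definition FT_pos :: "ereal \<Rightarrow> 'a::euclidean_space evol set"
  where "FT_pos T = {f. \<forall>t\<in>time_int T. f t \<in> F_pos}"

definition norm_sup :: "ereal \<Rightarrow> real \<Rightarrow> real \<Rightarrow> 'a::euclidean_space evol \<Rightarrow> ereal"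
  where "norm_sup T \<alpha> \<beta> f = (SUP t\<in>time_int T. norm_M \<alpha> \<beta> (f t))"

definition Linf_M_pos :: "ereal \<Rightarrow> real \<Rightarrow> real \<Rightarrow> 'a::euclidean_space evol set"
  where "Linf_M_pos T \<alpha> \<beta> = {f \<in> FT_pos T. norm_sup T \<alpha> \<beta> f < \<infinity>}"

definition C0_L1_pos :: "ereal \<Rightarrow> 'a::euclidean_space evol set"
  where "C0_L1_pos T = {f \<in> FT_pos T.
    (\<forall>t\<in>time_int T. f t \<in> L1_space) \<and> continuous_on (time_int T) (\<lambda>t. to_L1 (f t))}"

text \<open>The next two spaces consist of classes in \<open>t\<close>, so membership in \<open>L\<^sup>1\<close> is required for almost
  every \<open>t\<close> only. As \<open>'a L1\<close> is separable, measurability is strong (Bochner) measurability.\<close>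

definition L1loc_L1_pos :: "ereal \<Rightarrow> 'a::euclidean_space evol set"
  where "L1loc_L1_pos T = {f \<in> FT_pos T.
    (AE t in lebesgue. t \<in> time_int T \<longrightarrow> f t \<in> L1_space) \<and>
    (\<forall>s\<in>time_int T. set_integrable lebesgue {0..s} (\<lambda>t. to_L1 (f t)))}"

definition Linf_L1_pos :: "ereal \<Rightarrow> 'a::euclidean_space evol set"
  where "Linf_L1_pos T = {f \<in> FT_pos T.
    (AE t in lebesgue. t \<in> time_int T \<longrightarrow> f t \<in> L1_space) \<and>
    set_borel_measurable lebesgue (time_int T) (\<lambda>t. to_L1 (f t)) \<and>
    (\<exists>C. AE t in lebesgue. t \<in> time_int T \<longrightarrow> norm (to_L1 (f t)) \<le> C)}"

definition sharp :: "'a::euclidean_space evol \<Rightarrow> 'a evol"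
  where "sharp f = (\<lambda>t (x, v). f t (x + t *\<^sub>R v, v))"

definition unsharp :: "'a::euclidean_space evol \<Rightarrow> 'a evol"
  where "unsharp f = (\<lambda>t (x, v). f t (x - t *\<^sub>R v, v))"

definition test_function :: "ereal \<Rightarrow> (real \<Rightarrow> real) \<Rightarrow> bool"
  where "test_function T \<phi> \<longleftrightarrow>
    (\<forall>n t. ((deriv ^^ n) \<phi>) differentiable (at t)) \<and>
    (\<exists>a b. 0 < a \<and> a \<le> b \<and> ereal b < T \<and> (\<forall>t. t \<notin> {a..b} \<longrightarrow> \<phi> t = 0))"

definition has_weak_derivative ::
    "ereal \<Rightarrow> (real \<Rightarrow> 'b::{banach, second_countable_topology}) \<Rightarrow> (real \<Rightarrow> 'b) \<Rightarrow> bool"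
  where "has_weak_derivative T F D \<longleftrightarrow>
    (\<forall>a b. 0 < a \<and> ereal b < T \<longrightarrow>
      set_integrable lebesgue {a..b} F \<and> set_integrable lebesgue {a..b} D) \<and>
    (\<forall>\<phi>. test_function T \<phi> \<longrightarrow>
      set_lebesgue_integral lebesgue {t. 0 < t \<and> ereal t < T} (\<lambda>t. deriv \<phi> t *\<^sub>R F t) =
      - set_lebesgue_integral lebesgue {t. 0 < t \<and> ereal t < T} (\<lambda>t. \<phi> t *\<^sub>R D t))"

section \<open>Collision kernels\<close>

text \<open>The surface measure of the unit sphere of \<open>'a\<close>, in polar form: the image of \<open>DIM('a)\<close> times Lebesgue
  measure on the unit ball under \<open>x \<mapsto> x / |x|\<close>. It is a measure on \<open>'a\<close> concentrated on \<open>sphere 0 1\<close>.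
  The \<open>2d-1\<close>-sphere is the case of the Euclidean space \<open>'a \<times> 'a\<close>.\<close>
definition sphere_measure :: "'a::euclidean_space measure"
  where "sphere_measure =
    distr (density lborel (\<lambda>x. of_nat DIM('a) * indicator (ball 0 1) x)) borel sgn"

record kernels =
  gam2 :: real
  b2 :: "real \<Rightarrow> real"
  gam3 :: real
  b3 :: "real \<Rightarrow> real \<Rightarrow> real"

text \<open>\<open>|S\<^sup>n\<^sup>-\<^sup>1| = n * unit_ball_vol n\<close>, here for \<open>n = d - 1\<close>.\<close>
definition b2_norm :: "'a::euclidean_space itself \<Rightarrow> kernels \<Rightarrow> ennreal"
  where "b2_norm _ K = (let d = real DIM('a) in
    ennreal ((d - 1) * unit_ball_vol (d - 1)) *
    (\<integral>\<^sup>+z\<in>{-1..1}. ennreal (b2 K z * (1 - z\<^sup>2) powr ((d - 3) / 2)) \<partial>lborel))"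

definition ellipsoid :: "('a::euclidean_space \<times> 'a) set"
  where "ellipsoid = {(\<nu>1, \<nu>2). (norm \<nu>1)\<^sup>2 + (norm \<nu>2)\<^sup>2 + (norm (\<nu>1 - \<nu>2))\<^sup>2 = 1}"

definition b3_norm :: "'a::euclidean_space itself \<Rightarrow> kernels \<Rightarrow> ennreal"
  where "b3_norm _ K = (SUP \<nu>\<in>(ellipsoid :: ('a \<times> 'a) set).
    \<integral>\<^sup>+\<omega>. ennreal (b3 K (\<nu> \<bullet> \<omega>) (fst \<omega> \<bullet> snd \<omega>)) \<partial>sphere_measure)"

definition admissible :: "'a::euclidean_space itself \<Rightarrow> kernels \<Rightarrow> bool"
  where "admissible TA K \<longleftrightarrow>
    - real DIM('a) + 1 < gam2 K \<and> gam2 K \<le> 1 \<and>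
    - 2 * real DIM('a) + 1 < gam3 K \<and> gam3 K \<le> 1 \<and>
    set_borel_measurable borel {-1..1} (b2 K) \<and>
    (\<forall>z\<in>{-1..1}. 0 \<le> b2 K z \<and> b2 K (- z) = b2 K z) \<and>
    b2_norm TA K < \<infinity> \<and>
    set_borel_measurable borel ({-1..1} \<times> {-1/2..1/2}) (\<lambda>(z, w). b3 K z w) \<and>
    (\<forall>z\<in>{-1..1}. \<forall>w\<in>{-1/2..1/2}. 0 \<le> b3 K z w \<and> b3 K (- z) w = b3 K z w) \<and>
    b3_norm TA K < \<infinity> \<and>
    0 < b2_norm TA K + b3_norm TA K"

text \<open>\<open>sgn u\<close> is \<open>u / |u|\<close> (and \<open>0\<close> for \<open>u = 0\<close>, a null set).\<close>
definition B2 :: "kernels \<Rightarrow> 'a::euclidean_space \<Rightarrow> 'a \<Rightarrow> real"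
  where "B2 K u \<omega> = norm u powr gam2 K * b2 K (sgn u \<bullet> \<omega>)"

definition tnorm :: "'a::euclidean_space \<times> 'a \<Rightarrow> real"
  where "tnorm = (\<lambda>(u1, u2). sqrt ((norm u1)\<^sup>2 + (norm u2)\<^sup>2 + (norm (u1 - u2))\<^sup>2))"

definition B3 :: "kernels \<Rightarrow> 'a::euclidean_space \<times> 'a \<Rightarrow> 'a \<times> 'a \<Rightarrow> real"
  where "B3 K u \<omega> = tnorm u powr gam3 K * b3 K ((u /\<^sub>R tnorm u) \<bullet> \<omega>) (fst \<omega> \<bullet> snd \<omega>)"

section \<open>Collision operators\<close>

text \<open>The Lebesgue integral of an extended real valued function, with value in the extended reals.\<close>
definition ereal_integral :: "'b measure \<Rightarrow> ('b \<Rightarrow> ereal) \<Rightarrow> ereal"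
  where "ereal_integral M f =
    enn2ereal (\<integral>\<^sup>+x. e2ennreal (f x) \<partial>M) - enn2ereal (\<integral>\<^sup>+x. e2ennreal (- f x) \<partial>M)"

definition G2 :: "kernels \<Rightarrow> 'a::euclidean_space phase_fun \<Rightarrow> 'a phase_fun \<Rightarrow> 'a phase_fun"
  where "G2 K f g = (\<lambda>(x, v). ereal_integral (sphere_measure \<Otimes>\<^sub>M lborel)
    (\<lambda>(\<omega>, v1). let c = \<omega> \<bullet> (v1 - v) in
      ereal (B2 K (v1 - v) \<omega>) * f (x, v + c *\<^sub>R \<omega>) * g (x, v1 - c *\<^sub>R \<omega>)))"

definition L2 :: "kernels \<Rightarrow> 'a::euclidean_space phase_fun \<Rightarrow> 'a phase_fun \<Rightarrow> 'a phase_fun"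
  where "L2 K f g = (\<lambda>(x, v). ereal_integral (sphere_measure \<Otimes>\<^sub>M lborel)
    (\<lambda>(\<omega>, v1). ereal (B2 K (v1 - v) \<omega>) * f (x, v) * g (x, v1)))"

definition G3 :: "kernels \<Rightarrow> 'a::euclidean_space phase_fun \<Rightarrow> 'a phase_fun \<Rightarrow> 'a phase_fun
    \<Rightarrow> 'a phase_fun"
  where "G3 K f g h = (\<lambda>(x, v). ereal_integral (sphere_measure \<Otimes>\<^sub>M lborel)
    (\<lambda>((\<omega>1, \<omega>2), (v1, v2)).
      let c = (\<omega>1 \<bullet> (v1 - v) + \<omega>2 \<bullet> (v2 - v)) / (1 + \<omega>1 \<bullet> \<omega>2) in
      ereal (B3 K (v1 - v, v2 - v) (\<omega>1, \<omega>2)) *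
      f (x, v + c *\<^sub>R (\<omega>1 + \<omega>2)) * g (x, v1 - c *\<^sub>R \<omega>1) * h (x, v2 - c *\<^sub>R \<omega>2)))"

definition L3 :: "kernels \<Rightarrow> 'a::euclidean_space phase_fun \<Rightarrow> 'a phase_fun \<Rightarrow> 'a phase_fun
    \<Rightarrow> 'a phase_fun"
  where "L3 K f g h = (\<lambda>(x, v). ereal_integral (sphere_measure \<Otimes>\<^sub>M lborel)
    (\<lambda>((\<omega>1, \<omega>2), (v1, v2)).
      ereal (B3 K (v1 - v, v2 - v) (\<omega>1, \<omega>2)) * f (x, v) * g (x, v1) * h (x, v2)))"

definition gain :: "kernels \<Rightarrow> 'a::euclidean_space evol \<Rightarrow> 'a evol \<Rightarrow> 'a evol \<Rightarrow> 'a evol"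
  where "gain K f g h = (\<lambda>t z. G2 K (f t) (g t) z + G3 K (f t) (g t) (h t) z)"

definition loss :: "kernels \<Rightarrow> 'a::euclidean_space evol \<Rightarrow> 'a evol \<Rightarrow> 'a evol \<Rightarrow> 'a evol"
  where "loss K f g h = (\<lambda>t z. L2 K (f t) (g t) z + L3 K (f t) (g t) (h t) z)"

section \<open>Mild solutions\<close>

text \<open>\<open>f\<close> is a mild solution on \<open>[0,T)\<close> of \<open>\<partial>\<^sub>t f + v \<cdot> \<nabla>\<^sub>x f = h - L(f,g,g)\<close>, \<open>f(0) = f\<^sub>0\<close>; the standing assumptions
  on the data \<open>f\<^sub>0\<close>, \<open>g\<close>, \<open>h\<close> are part of the notion.\<close>
definition mild_linear :: "kernels \<Rightarrow> ereal \<Rightarrow> real \<Rightarrow> real \<Rightarrow> 'a::euclidean_space phase_fun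
    \<Rightarrow> 'a evol \<Rightarrow> 'a evol \<Rightarrow> 'a evol \<Rightarrow> bool"
  where "mild_linear K T \<alpha> \<beta> f0 g h f \<longleftrightarrow>
    f0 \<in> L1_space \<inter> F_pos \<and> sharp g \<in> Linf_M_pos T \<alpha> \<beta> \<and> sharp h \<in> L1loc_L1_pos T \<and>
    f \<in> FT_pos T \<and> sharp f \<in> C0_L1_pos T \<and> sharp (loss K f g g) \<in> L1loc_L1_pos T \<and>
    has_weak_derivative T (\<lambda>t. to_L1 (sharp f t))
      (\<lambda>t. to_L1 (sharp h t) - to_L1 (sharp (loss K f g g) t)) \<and>
    (AE z in lborel. sharp f 0 z = f0 z)"

definition mild_boltzmann :: "kernels \<Rightarrow> ereal \<Rightarrow> real \<Rightarrow> real \<Rightarrow> 'a::euclidean_space phase_fun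
    \<Rightarrow> 'a evol \<Rightarrow> bool"
  where "mild_boltzmann K T \<alpha> \<beta> f0 f \<longleftrightarrow>
    f0 \<in> M_pos \<alpha> \<beta> \<and>
    f \<in> FT_pos T \<and> sharp f \<in> C0_L1_pos T \<inter> Linf_M_pos T \<alpha> \<beta> \<and>
    sharp (loss K f f f) \<in> Linf_L1_pos T \<and> sharp (gain K f f f) \<in> Linf_L1_pos T \<and>
    has_weak_derivative T (\<lambda>t. to_L1 (sharp f t))
      (\<lambda>t. to_L1 (sharp (gain K f f f) t) - to_L1 (sharp (loss K f f f) t)) \<and>
    (AE z in lborel. sharp f 0 z = f0 z)"

text \<open>The terms of index at least 1 of \<open>l\<close>, \<open>u\<close> solve the Kaniel--Shinbrot iteration.\<close>
definition ks_iteration :: "kernels \<Rightarrow> ereal \<Rightarrow> real \<Rightarrow> real \<Rightarrow> 'a::euclidean_space phase_fun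
    \<Rightarrow> (nat \<Rightarrow> 'a evol) \<Rightarrow> (nat \<Rightarrow> 'a evol) \<Rightarrow> bool"
  where "ks_iteration K T \<alpha> \<beta> f0 l u \<longleftrightarrow> (\<forall>n\<ge>1.
    mild_linear K T \<alpha> \<beta> f0 (u (n - 1)) (gain K (l (n - 1)) (l (n - 1)) (l (n - 1))) (l n) \<and>
    mild_linear K T \<alpha> \<beta> f0 (l (n - 1)) (gain K (u (n - 1)) (u (n - 1)) (u (n - 1))) (u n))"

definition K_const :: "'a::euclidean_space itself \<Rightarrow> real \<Rightarrow> kernels \<Rightarrow> real \<Rightarrow> real"
  where "K_const TA C K \<beta> = (let d = real DIM('a) in
    C * (enn2real (b2_norm TA K) * (\<beta> powr (- d / 2) + 1 / (d + gam2 K - 1)) +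
         enn2real (b3_norm TA K) * (\<beta> powr (- d) + 1 / (2 * d + gam3 K - 1))))"

definition lambda_const :: "'a::euclidean_space itself \<Rightarrow> real \<Rightarrow> kernels \<Rightarrow> real \<Rightarrow> real \<Rightarrow> real"
  where "lambda_const TA C K \<alpha> \<beta> = (let k = K_const TA C K \<beta> in
    min (\<alpha> powr (1 / 2) / (24 * k)) (\<alpha> powr (1 / 4) / (2 * sqrt (6 * k))))"

end

theory Submission
  imports Defs "HOL-Probability.Distributions"
begin

text \<open>
  Along the free flow, that is for \<open>f\<^sup>#(t, x, v) = f(t, x + t v, v)\<close>, the Boltzmann equation becomes at each point
  \<open>z = (x, v)\<close> an ordinary differential equation \<open>y' = G - R y\<close>, whose gain \<open>G\<close> and loss rate \<open>R\<close> are increasing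
  functionals of the density. In the linear problems of the iteration \<open>G\<close> and \<open>R\<close> are known, and variation of
  constants solves them (\<open>lin_sol\<close>). The solution increases with \<open>G\<close> and decreases with \<open>R\<close>. This alone propagates
  the beginning condition: the \<open>l\<^sub>n\<close> increase, the \<open>u\<^sub>n\<close> decrease, and \<open>l\<^sub>n \<le> u\<^sub>n\<close> (\<open>ordered\<close>).

  That the two limits coincide is a consequence of dispersion. Let \<open>M\<close> be the Maxwellian and let the densities be at
  most \<open>k M\<close> along the free flow. Collisions conserve the product of Maxwellians (\<open>maxwellian_binary\<close>,
  \<open>maxwellian_ternary\<close>), whence \<open>G \<le> k M P\<close> and \<open>R \<le> P\<close>, where \<open>P\<close> is the collision frequency against \<open>k M\<close>. Two
  particles with relative velocity \<open>u\<close> are together near the origin only for a time of order \<open>1 / |u|\<close>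
  (\<open>nn_integral_free_flight\<close>). Therefore the integral of \<open>P\<close> over all times is finite, and the smallness condition
  makes it at most \<open>1 / 12\<close> (\<open>nn_integral_coll_freq\<close>, \<open>small_collisions_lambda\<close>). As \<open>G\<close> and \<open>R\<close> are Lipschitz with
  constants \<open>3\<close> and \<open>2\<close> relative to \<open>k M P\<close> and \<open>P\<close>, each step of the iteration halves distances in the norm
  weighted by \<open>M\<close> (\<open>contraction\<close>). Hence \<open>u\<^sub>n - l\<^sub>n \<rightarrow> 0\<close> (\<open>gap\<close>), the common limit solves the equation
  (\<open>limit_evolves\<close>), and two mild solutions below \<open>k M\<close> agree (\<open>mild_boltzmann_unique\<close>). The locales \<open>kaniel_shinbrot\<close>
  and \<open>kaniel_shinbrot_start\<close> contain the iteration for abstract \<open>G\<close>, \<open>R\<close> and \<open>P\<close>.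

  Solutions of the linear problems are not assumed to be bounded by a Maxwellian, and the loss rate is bounded only
  locally in velocity. The difference \<open>w\<close> of two of them satisfies \<open>|w'| \<le> \<rho> |w|\<close>, and Gronwall's argument on the sets
  where \<open>\<rho> \<le> N\<close> shows that it vanishes (\<open>evolves_eq_zero\<close>, \<open>mild_linear_unique\<close>).

  Mild solutions are curves of classes of integrable functions. For a dominated family the Bochner integral is
  the class of the pointwise integral (\<open>dominated_curve_integral\<close>), and for a continuous curve a weak derivative
  amounts to an integral equation (\<open>weak_derivative_imp_integral\<close>, \<open>integral_imp_weak_derivative\<close>). The two facts
  connect the definitions with the pointwise equation. Densities are determined only up to null sets, although the
  collision operators evaluate them at the velocities after a collision. This is legitimate because the
  collision maps are reflections and preserve Lebesgue measure (\<open>AE_binary\<close>, \<open>AE_ternary\<close>).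
\<close>

section \<open>Lebesgue measure and linear isometries\<close>

lemma lborel_reflect: "distr lborel borel uminus = (lborel :: 'a::euclidean_space measure)"
  by (subst lborel_affine[of "-1" 0]) (simp_all add: density_1 distr_density_distr distr_distr o_def)

lemma nn_integral_lborel_add:
  fixes f :: "'a::euclidean_space \<Rightarrow> ennreal"
  assumes [measurable]: "f \<in> borel_measurable borel"
  shows "(\<integral>\<^sup>+x. f (c + x) \<partial>lborel) = (\<integral>\<^sup>+x. f x \<partial>lborel)"
proof -
  have "(\<integral>\<^sup>+x. f x \<partial>lborel) = (\<integral>\<^sup>+x. f x \<partial>distr lborel borel ((+) c))"
    by (simp add: lborel_distr_plus)
  also have "\<dots> = (\<integral>\<^sup>+x. f (c + x) \<partial>lborel)" by (rule nn_integral_distr) auto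
  finally show ?thesis ..
qed

lemma nn_integral_lborel_uminus:
  fixes f :: "'a::euclidean_space \<Rightarrow> ennreal"
  assumes [measurable]: "f \<in> borel_measurable borel"
  shows "(\<integral>\<^sup>+x. f (- x) \<partial>lborel) = (\<integral>\<^sup>+x. f x \<partial>lborel)"
proof -
  have "(\<integral>\<^sup>+x. f x \<partial>lborel) = (\<integral>\<^sup>+x. f x \<partial>distr lborel borel uminus)"
    by (simp add: lborel_reflect)
  also have "\<dots> = (\<integral>\<^sup>+x. f (- x) \<partial>lborel)" by (rule nn_integral_distr) auto
  finally show ?thesis ..
qed

text \<open>Uniqueness of Haar measure: Fubini's theorem for the product of the two measures shows that they are
  proportional, and the unit ball fixes the factor.\<close>

lemma translation_invariant_eq_lborel:
  fixes \<mu> :: "'a::euclidean_space measure"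
  assumes "sigma_finite_measure \<mu>" and sets[measurable_cong]: "sets \<mu> = sets borel"
    and inv: "\<And>c. distr \<mu> borel ((+) c) = \<mu>"
    and ball: "emeasure \<mu> (ball 0 1) = emeasure lborel (ball (0::'a) 1)"
  shows "\<mu> = lborel"
proof (rule measure_eqI)
  interpret mu: sigma_finite_measure \<mu> by fact
  interpret pair_sigma_finite \<mu> "lborel :: 'a measure" ..
  have shift: "(\<integral>\<^sup>+x. h (c + x) \<partial>\<mu>) = (\<integral>\<^sup>+x. h x \<partial>\<mu>)" if [measurable]: "h \<in> borel_measurable borel" for h c
  proof -
    have "(\<integral>\<^sup>+x. h x \<partial>\<mu>) = (\<integral>\<^sup>+x. h x \<partial>distr \<mu> borel ((+) c))" by (simp add: inv)
    also have "\<dots> = (\<integral>\<^sup>+x. h (c + x) \<partial>\<mu>)"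
    proof (rule nn_integral_distr)
      have "(+) c \<in> borel \<rightarrow>\<^sub>M borel" by measurable
      then show "(+) c \<in> \<mu> \<rightarrow>\<^sub>M borel" using sets by (simp cong: measurable_cong_sets)
    qed simp
    finally show ?thesis ..
  qed
  \<comment> \<open>Integrate \<open>f x * g (y + x)\<close> in both orders, translating the inner variable.\<close>
  have key: "(\<integral>\<^sup>+x. f x \<partial>\<mu>) * (\<integral>\<^sup>+y. g y \<partial>lborel) = (\<integral>\<^sup>+x. g x \<partial>\<mu>) * (\<integral>\<^sup>+y. f y \<partial>lborel)"
    if [measurable]: "f \<in> borel_measurable borel" "g \<in> borel_measurable borel" for f g :: "'a \<Rightarrow> ennreal"
  proof -
    have "(\<integral>\<^sup>+x. f x \<partial>\<mu>) * (\<integral>\<^sup>+y. g y \<partial>lborel) = (\<integral>\<^sup>+x. f x * (\<integral>\<^sup>+y. g (x + y) \<partial>lborel) \<partial>\<mu>)"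
      by (simp add: nn_integral_lborel_add nn_integral_multc)
    also have "\<dots> = (\<integral>\<^sup>+x. (\<integral>\<^sup>+y. f x * g (x + y) \<partial>lborel) \<partial>\<mu>)"
      by (simp add: nn_integral_cmult)
    also have "\<dots> = (\<integral>\<^sup>+y. (\<integral>\<^sup>+x. f x * g (x + y) \<partial>\<mu>) \<partial>lborel)"
      by (rule Fubini'[symmetric]) measurable
    also have "\<dots> = (\<integral>\<^sup>+y. (\<integral>\<^sup>+x. f (x - y) * g x \<partial>\<mu>) \<partial>lborel)"
    proof (rule nn_integral_cong)
      fix y :: 'a
      show "(\<integral>\<^sup>+x. f x * g (x + y) \<partial>\<mu>) = (\<integral>\<^sup>+x. f (x - y) * g x \<partial>\<mu>)"
        using shift[of "\<lambda>x. f (x - y) * g x" y] by (simp add: add.commute)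
    qed
    also have "\<dots> = (\<integral>\<^sup>+x. (\<integral>\<^sup>+y. f (x - y) * g x \<partial>lborel) \<partial>\<mu>)"
      by (rule Fubini') measurable
    also have "\<dots> = (\<integral>\<^sup>+x. g x * (\<integral>\<^sup>+y. f (x + - y) \<partial>lborel) \<partial>\<mu>)"
      by (simp add: nn_integral_multc mult.commute[of _ "g _"] nn_integral_cmult)
    also have "\<dots> = (\<integral>\<^sup>+x. g x * (\<integral>\<^sup>+y. f y \<partial>lborel) \<partial>\<mu>)"
    proof (rule nn_integral_cong)
      fix x
      show "g x * (\<integral>\<^sup>+y. f (x + - y) \<partial>lborel) = g x * (\<integral>\<^sup>+y. f y \<partial>lborel)"
        using nn_integral_lborel_uminus[of "\<lambda>y. f (x + y)"] nn_integral_lborel_add[of f x] by simp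
    qed
    also have "\<dots> = (\<integral>\<^sup>+x. g x \<partial>\<mu>) * (\<integral>\<^sup>+y. f y \<partial>lborel)"
      by (simp add: nn_integral_multc)
    finally show ?thesis .
  qed
  show "sets \<mu> = sets lborel" using sets by simp
  fix A assume "A \<in> sets \<mu>"
  then have [measurable]: "A \<in> sets borel" using sets by simp
  have A: "A \<in> sets \<mu>" "ball 0 1 \<in> sets \<mu>" using sets by auto
  have "emeasure lborel (ball (0::'a) 1) * emeasure lborel A = emeasure \<mu> A * emeasure lborel (ball (0::'a) 1)"
    using key[of "indicator (ball 0 1)" "indicator A"] A by (simp add: ball)
  moreover have "emeasure lborel (ball (0::'a) 1) \<noteq> 0" "emeasure lborel (ball (0::'a) 1) \<noteq> \<infinity>"
    using emeasure_lborel_ball_finite[of "0::'a" 1] unit_ball_vol_pos[of "real DIM('a)"]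
    by (auto simp: emeasure_ball less_le simp del: unit_ball_vol_pos)
  ultimately show "emeasure \<mu> A = emeasure lborel A"
    by (metis ennreal_mult_cancel_left infinity_ennreal_def mult.commute)
qed

text \<open>The image measure is translation invariant because the isometry is linear and onto, and it gives the
  unit ball, which is mapped to itself, the right volume.\<close>

lemma lborel_linear_isometry:
  fixes T :: "'a::euclidean_space \<Rightarrow> 'a"
  assumes T: "linear T" and iso: "\<And>x. norm (T x) = norm x"
  shows "distr lborel borel T = lborel"
proof (rule translation_invariant_eq_lborel)
  have inj: "inj T" by (rule linear_injective_0[OF T, THEN iffD2]) (metis iso norm_eq_zero)
  then have surj: "surj T" by (rule linear_inj_imp_surj[OF T])
  have [measurable]: "T \<in> borel \<rightarrow>\<^sub>M borel"
    by (intro borel_measurable_continuous_onI linear_continuous_on linear_conv_bounded_linear[THEN iffD1] T)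
  have vim: "T -` ball 0 r = ball 0 r" for r by (auto simp: iso)
  show "sets (distr lborel borel T) = sets borel" by simp
  show "emeasure (distr lborel borel T) (ball 0 1) = emeasure lborel (ball (0::'a) 1)"
    by (subst emeasure_distr) (simp_all add: vim)
  show "sigma_finite_measure (distr lborel borel T)"
  proof
    show "\<exists>A. countable A \<and> A \<subseteq> sets (distr lborel borel T) \<and> \<Union> A = space (distr lborel borel T) \<and>
        (\<forall>a\<in>A. emeasure (distr lborel borel T) a \<noteq> \<infinity>)"
    proof (intro exI[of _ "range (\<lambda>n::nat. ball 0 (real n))"] conjI ballI)
      show "\<Union>(range (\<lambda>n::nat. ball 0 (real n))) = space (distr lborel borel T)"
        using reals_Archimedean2 by auto
      fix a assume "a \<in> range (\<lambda>n::nat. ball (0::'a) (real n))"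
      then show "emeasure (distr lborel borel T) a \<noteq> \<infinity>"
        using emeasure_lborel_ball_finite[of "0::'a"] by (auto simp: emeasure_distr vim less_le)
    qed auto
  qed
  fix c
  obtain d where d: "c = T d" using surj by (metis surjD)
  have "distr (distr lborel borel T) borel ((+) c) = distr (distr lborel borel ((+) d)) borel T"
    by (simp add: distr_distr o_def d linear_add[OF T])
  then show "distr (distr lborel borel T) borel ((+) c) = distr lborel borel T"
    by (simp add: lborel_distr_plus)
qed

lemma AE_linear_isometry:
  fixes T :: "'a::euclidean_space \<Rightarrow> 'a"
  assumes T: "linear T" and iso: "\<And>x. norm (T x) = norm x" and Q: "AE x in lborel. Q x"
  shows "AE x in lborel. Q (T x)"
proof -
  have "T \<in> lborel \<rightarrow>\<^sub>M borel"
    by (simp, intro borel_measurable_continuous_onI linear_continuous_on linear_conv_bounded_linear[THEN iffD1] T)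
  then show ?thesis
    by (rule AE_distrD) (simp only: lborel_linear_isometry[OF T iso] Q)
qed

text \<open>The reflection in the hyperplane orthogonal to \<open>n\<close>; it is the identity for \<open>n = 0\<close>.\<close>

definition reflection :: "'a::real_inner \<Rightarrow> 'a \<Rightarrow> 'a"
  where "reflection n x = x - (2 * (x \<bullet> n) / (n \<bullet> n)) *\<^sub>R n"

lemma linear_reflection: "linear (reflection n)"
  by (rule linearI) (auto simp: reflection_def algebra_simps add_divide_distrib)

lemma norm_reflection: "norm (reflection n x) = norm x"
proof (cases "n = 0")
  case False
  then have "n \<bullet> n \<noteq> 0" by simp
  then have "reflection n x \<bullet> reflection n x = x \<bullet> x"
    by (simp add: reflection_def inner_diff_left inner_diff_right inner_commute field_simps)
  then show ?thesis by (simp add: norm_eq_sqrt_inner)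
qed (simp add: reflection_def)

lemma reflection_exchange:
  assumes "norm x = norm y"
  shows "reflection (x - y) x = y"
proof (cases "x = y")
  case False
  have xy: "x \<bullet> x = y \<bullet> y" using assms by (simp add: norm_eq)
  then have "(x - y) \<bullet> (x - y) = 2 * (x \<bullet> (x - y))"
    by (simp add: inner_diff_left inner_diff_right inner_commute)
  moreover have "(x - y) \<bullet> (x - y) \<noteq> 0" using False by simp
  ultimately show ?thesis by (simp add: reflection_def)
qed (simp add: reflection_def)

lemma inner_reflection: "reflection n x \<bullet> y = x \<bullet> reflection n y"
  by (simp add: reflection_def inner_diff_left inner_diff_right inner_commute)

section \<open>Integration over the unit sphere\<close>

lemma ball_borel_measurable [measurable]: "ball c r \<in> sets (borel :: 'a::euclidean_space measure)"
  by simp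

lemma sgn_borel_measurable [measurable]: "sgn \<in> borel \<rightarrow>\<^sub>M (borel :: 'a::euclidean_space measure)"
  unfolding sgn_div_norm[abs_def] by measurable

lemma sets_sphere_measure [measurable_cong, simp]: "sets sphere_measure = sets borel"
  by (simp add: sphere_measure_def)

lemma space_sphere_measure [simp]: "space sphere_measure = UNIV"
  by (simp add: sphere_measure_def)

lemma nn_integral_sphere_measure:
  fixes \<phi> :: "'a::euclidean_space \<Rightarrow> ennreal"
  assumes [measurable]: "\<phi> \<in> borel_measurable borel"
  shows "(\<integral>\<^sup>+\<omega>. \<phi> \<omega> \<partial>sphere_measure) =
    of_nat DIM('a) * (\<integral>\<^sup>+x. indicator (ball 0 1) x * \<phi> (sgn x) \<partial>lborel)"
proof -
  have [measurable]: "(\<lambda>x::'a. of_nat DIM('a) * indicator (ball 0 1) x :: ennreal) \<in> borel_measurable borel"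
    by (intro borel_measurable_times_ennreal borel_measurable_indicator) auto
  show ?thesis unfolding sphere_measure_def
    by (simp add: nn_integral_distr nn_integral_density nn_integral_cmult mult.assoc)
qed

lemma finite_sphere_measure: "finite_measure (sphere_measure :: 'a::euclidean_space measure)"
proof
  have "emeasure sphere_measure (UNIV :: 'a set) = (\<integral>\<^sup>+\<omega>. indicator UNIV (\<omega> :: 'a) \<partial>sphere_measure)"
    by (rule nn_integral_indicator[symmetric]) simp
  also have "\<dots> = of_nat DIM('a) * emeasure lborel (ball (0::'a) 1)"
    by (subst nn_integral_sphere_measure) simp_all
  also have "\<dots> < \<infinity>"
    using emeasure_lborel_ball_finite[of "0::'a" 1] by (simp add: ennreal_mult_less_top of_nat_less_top)
  finally show "emeasure sphere_measure (space (sphere_measure :: 'a measure)) \<noteq> \<infinity>" by simp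
qed

lemma AE_sphere_measure: "AE \<omega> in (sphere_measure :: 'a::euclidean_space measure). norm \<omega> = 1"
proof -
  have z: "AE x in lborel. (x::'a) \<noteq> 0" by (rule AE_lborel_singleton)
  have "AE x in density lborel (\<lambda>x. of_nat DIM('a) * indicator (ball 0 1) x). norm (sgn x :: 'a) = 1"
  proof (subst AE_density)
    show "(\<lambda>x::'a. of_nat DIM('a) * indicator (ball 0 1) x :: ennreal) \<in> borel_measurable lborel"
      by measurable
  qed (use z in \<open>auto simp: norm_sgn elim!: eventually_mono\<close>)
  then show ?thesis unfolding sphere_measure_def
    by (subst AE_distr_iff) auto
qed

lemma nn_integral_real_le_bounded:
  fixes h :: "real \<Rightarrow> ennreal"
  assumes [measurable]: "h \<in> borel_measurable borel"
    and le: "\<And>N::nat. (\<integral>\<^sup>+x. h x * indicator {- real N..real N} x \<partial>lborel) \<le> C"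
  shows "(\<integral>\<^sup>+x. h x \<partial>lborel) \<le> C"
proof -
  have "(\<lambda>N::nat. h x * indicator {- real N..real N} x) \<longlonglongrightarrow> h x" for x
  proof -
    obtain N :: nat where "\<bar>x\<bar> \<le> real N" using real_arch_simple by blast
    then have "\<forall>n\<ge>N. h x * indicator {- real n..real n} x = h x"
      by (auto simp: indicator_def)
    then show ?thesis by (intro tendsto_eventually) (auto simp: eventually_sequentially)
  qed
  then have "(\<lambda>N::nat. \<integral>\<^sup>+x. h x * indicator {- real N..real N} x \<partial>lborel) \<longlonglongrightarrow> (\<integral>\<^sup>+x. h x \<partial>lborel)"
    by (intro nn_integral_LIMSEQ)
      (auto simp: incseq_def le_fun_def indicator_def)
  then show ?thesis by (rule LIMSEQ_le_const2) (use le in auto)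
qed

text \<open>The substitution \<open>z = r / sqrt (1 + r\<^sup>2)\<close>, which passes from the cotangent of an angle to its cosine;
  the third power is its derivative.\<close>

lemma nn_integral_stereographic_le:
  fixes F :: "real \<Rightarrow> ennreal"
  assumes [measurable]: "F \<in> borel_measurable borel"
  shows "(\<integral>\<^sup>+r. F (r / sqrt (1 + r\<^sup>2)) * ennreal ((1 / sqrt (1 + r\<^sup>2)) ^ 3) \<partial>lborel) \<le>
    (\<integral>\<^sup>+z. F z * indicator {-1..1} z \<partial>lborel)"
proof (rule nn_integral_real_le_bounded)
  fix N :: nat
  define g where "g r = r / sqrt (1 + r\<^sup>2)" for r :: real
  have pos: "1 + r\<^sup>2 > 0" for r :: real by (simp add: add_pos_nonneg)
  have dg: "(g has_real_derivative (1 / sqrt (1 + r\<^sup>2)) ^ 3) (at r)" for r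
  proof -
    have sq: "sqrt (1 + r\<^sup>2) * sqrt (1 + r\<^sup>2) = 1 + r\<^sup>2" using pos[of r] by simp
    have "(g has_real_derivative (1 * sqrt (1 + r\<^sup>2) - r * (r / sqrt (1 + r\<^sup>2))) / (sqrt (1 + r\<^sup>2) * sqrt (1 + r\<^sup>2))) (at r)"
      unfolding g_def[abs_def] using pos[of r]
      by (auto intro!: derivative_eq_intros simp: field_simps)
    also have "(1 * sqrt (1 + r\<^sup>2) - r * (r / sqrt (1 + r\<^sup>2))) / (sqrt (1 + r\<^sup>2) * sqrt (1 + r\<^sup>2)) = (1 / sqrt (1 + r\<^sup>2)) ^ 3"
    proof -
      have "(1 * sqrt (1 + r\<^sup>2) - r * (r / sqrt (1 + r\<^sup>2))) = 1 / sqrt (1 + r\<^sup>2)"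
        using pos[of r] sq by (simp add: field_simps power2_eq_square)
      then show ?thesis by (simp add: power3_eq_cube)
    qed
    finally show ?thesis .
  qed
  have rng: "\<bar>g r\<bar> \<le> 1" for r
    using real_sqrt_le_mono[of "r\<^sup>2" "1 + r\<^sup>2"] pos[of r] by (simp add: g_def)
  have "(\<integral>\<^sup>+r. F (g r) * ennreal ((1 / sqrt (1 + r\<^sup>2)) ^ 3) * indicator {- real N..real N} r \<partial>lborel)
    = (\<integral>\<^sup>+z. F z * indicator {g (- real N)..g (real N)} z \<partial>lborel)"
  proof (cases "N = 0")
    case False
    show ?thesis
    proof (rule nn_integral_substitution_aux[symmetric])
      show "continuous_on {- real N..real N} (\<lambda>r. (1 / sqrt (1 + r\<^sup>2)) ^ 3)"
        using pos by (intro continuous_intros) (auto simp: less_imp_neq[symmetric])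
    qed (use dg False pos in auto)
  next
    case True
    have "AE z in lborel. z \<noteq> (0::real)" by (rule AE_lborel_singleton)
    then show ?thesis unfolding True
      by (intro nn_integral_cong_AE) (auto simp: g_def)
  qed
  also have "\<dots> \<le> (\<integral>\<^sup>+z. F z * indicator {-1..1} z \<partial>lborel)"
    using rng[of "- real N"] rng[of "real N"] by (intro nn_integral_mono) (auto simp: indicator_def)
  finally show "(\<integral>\<^sup>+r. F (r / sqrt (1 + r\<^sup>2)) * ennreal ((1 / sqrt (1 + r\<^sup>2)) ^ 3) * indicator {- real N..real N} r \<partial>lborel)
    \<le> (\<integral>\<^sup>+z. F z * indicator {-1..1} z \<partial>lborel)" by (simp add: g_def)
qed measurable

text \<open>A function of \<open>e \<bullet> \<omega>\<close> is integrated over the unit ball in the coordinates \<open>s\<close> along \<open>e\<close> and \<open>y\<close> across it.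
  For \<open>s = |y| r\<close> the direction of the point depends on \<open>r\<close> alone, so integrating over \<open>y\<close> first needs only
  the volume of balls in dimension \<open>d - 1\<close>, and no polar coordinates. The factor \<open>|y|\<close> is bounded by its
  maximum; integrating it would give \<open>d - 1\<close> in place of \<open>d\<close>, so at most a factor \<open>2\<close> is lost.\<close>

lemma nn_integral_sphere_zonal_le:
  fixes e :: "'a::euclidean_space" and b :: "real \<Rightarrow> ennreal"
  assumes d: "2 \<le> DIM('a)" and e: "norm e = 1" and [measurable]: "b \<in> borel_measurable borel"
  shows "(\<integral>\<^sup>+\<omega>. b (e \<bullet> \<omega>) \<partial>sphere_measure) \<le>
    ennreal (real DIM('a) * unit_ball_vol (real DIM('a) - 1)) *
    (\<integral>\<^sup>+z. b z * ennreal ((1 - z\<^sup>2) powr ((real DIM('a) - 3) / 2)) * indicator {-1..1} z \<partial>lborel)"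
proof -
  obtain i :: 'a where i: "i \<in> Basis" using SOME_Basis by blast
  define I where "I = Basis - {i}"
  have I: "finite I" "i \<notin> I" "insert i I = Basis" "card I = DIM('a) - 1"
    using i by (auto simp: I_def card_Diff_singleton)
  interpret product_sigma_finite "\<lambda>_::'a. lborel :: real measure" ..
  interpret fp: finite_product_sigma_finite "\<lambda>_::'a. lborel :: real measure" I
    by standard (rule I)
  define Y where "Y y = sqrt (\<Sum>j\<in>I. (y j)\<^sup>2)" for y :: "'a \<Rightarrow> real"
  have [measurable]: "Y \<in> borel_measurable (Pi\<^sub>M I (\<lambda>_. lborel))" unfolding Y_def by measurable
  have Y0: "0 \<le> Y y" for y by (simp add: Y_def sum_nonneg)
  let ?PI = "Pi\<^sub>M I (\<lambda>_. lborel :: real measure)"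
  let ?c = "unit_ball_vol (real (card I))"
  have Ycball: "emeasure ?PI ({y. Y y \<le> r} \<inter> space ?PI) = ennreal (?c * r ^ card I)" if "r > 0" for r
    using emeasure_cball_aux[OF I(1) that] by (simp add: Y_def)
  define F where "F s q = indicator {..<1} (s\<^sup>2 + q\<^sup>2) * b (s / sqrt (s\<^sup>2 + q\<^sup>2))" for s q :: real
  have [measurable]: "case_prod F \<in> borel_measurable (borel \<Otimes>\<^sub>M borel)"
    unfolding F_def by measurable
  \<comment> \<open>A reflection moves the axis \<open>e\<close> to the coordinate vector \<open>i\<close>.\<close>
  have "(\<integral>\<^sup>+x. indicator (ball 0 1) x * b (e \<bullet> sgn x) \<partial>lborel) =
    (\<integral>\<^sup>+x. indicator (ball 0 1) x * b (e \<bullet> sgn x) \<partial>distr lborel borel (reflection (e - i)))"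
    by (simp add: lborel_linear_isometry linear_reflection norm_reflection)
  also have "\<dots> = (\<integral>\<^sup>+x. indicator (ball 0 1) (reflection (e - i) x) * b (e \<bullet> sgn (reflection (e - i) x)) \<partial>lborel)"
  proof (rule nn_integral_distr)
    show "reflection (e - i) \<in> lborel \<rightarrow>\<^sub>M borel"
      by (simp, intro borel_measurable_continuous_onI linear_continuous_on
          linear_conv_bounded_linear[THEN iffD1] linear_reflection)
  qed measurable
  also have "\<dots> = (\<integral>\<^sup>+x. indicator (ball 0 1) x * b (i \<bullet> sgn x) \<partial>lborel)"
  proof (rule nn_integral_cong)
    fix x :: 'a
    have "e \<bullet> sgn (reflection (e - i) x) = i \<bullet> sgn x"
      using reflection_exchange[of e i] e i
      by (simp add: sgn_div_norm norm_reflection inner_reflection[symmetric] inner_commute[of _ "reflection _ _"])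
    then show "indicator (ball 0 1) (reflection (e - i) x) * b (e \<bullet> sgn (reflection (e - i) x)) =
      indicator (ball 0 1) x * b (i \<bullet> sgn x)"
      by (simp add: indicator_def norm_reflection)
  qed
  also have "\<dots> = (\<integral>\<^sup>+f. F (f i) (Y f) \<partial>Pi\<^sub>M Basis (\<lambda>_. lborel))"
  proof (subst lborel_eq, subst nn_integral_distr, goal_cases)
    case 3
    show ?case
    proof (rule nn_integral_cong)
      fix f :: "'a \<Rightarrow> real"
      have "(norm (\<Sum>j\<in>Basis. f j *\<^sub>R j))\<^sup>2 = (\<Sum>j\<in>Basis. (f j)\<^sup>2)"
        using euclidean_dist_l2[of 0 "\<Sum>j\<in>Basis. f j *\<^sub>R j"] by (simp add: L2_set_def sum_nonneg)
      also have "\<dots> = (f i)\<^sup>2 + (\<Sum>j\<in>I. (f j)\<^sup>2)"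
        using sum.insert[OF I(1,2), of "\<lambda>j. (f j)\<^sup>2"] I(3) by simp
      finally have n: "(norm (\<Sum>j\<in>Basis. f j *\<^sub>R j))\<^sup>2 = (f i)\<^sup>2 + (Y f)\<^sup>2"
        by (simp add: Y_def sum_nonneg)
      then have n': "norm (\<Sum>j\<in>Basis. f j *\<^sub>R j) = sqrt ((f i)\<^sup>2 + (Y f)\<^sup>2)"
        by (metis norm_ge_zero real_sqrt_unique)
      have "i \<bullet> sgn (\<Sum>j\<in>Basis. f j *\<^sub>R j) = f i / sqrt ((f i)\<^sup>2 + (Y f)\<^sup>2)"
        using i by (simp add: sgn_div_norm n' inner_commute[of i] divide_inverse_commute)
      then show "indicator (ball 0 1) (\<Sum>j\<in>Basis. f j *\<^sub>R j) * b (i \<bullet> sgn (\<Sum>j\<in>Basis. f j *\<^sub>R j)) = F (f i) (Y f)"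
        by (auto simp: F_def indicator_def n')
    qed
  qed auto
  also have "\<dots> = (\<integral>\<^sup>+y. (\<integral>\<^sup>+s. F ((y(i := s)) i) (Y (y(i := s))) \<partial>lborel) \<partial>?PI)"
  proof (subst I(3)[symmetric], rule product_nn_integral_insert[OF I(1,2)])
    have "Y \<in> borel_measurable (Pi\<^sub>M (insert i I) (\<lambda>_. lborel))" unfolding Y_def by measurable
    then show "(\<lambda>f. F (f i) (Y f)) \<in> borel_measurable (Pi\<^sub>M (insert i I) (\<lambda>_. lborel))"
      unfolding F_def by measurable
  qed
  also have "\<dots> = (\<integral>\<^sup>+y. (\<integral>\<^sup>+s. F s (Y y) \<partial>lborel) \<partial>?PI)"
  proof -
    have "Y (y(i := s)) = Y y" for y s
      unfolding Y_def using I(2) by (metis (mono_tags, lifting) fun_upd_other sum.cong)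
    then show ?thesis by simp
  qed
  \<comment> \<open>Substitute \<open>s = |y| r\<close>; the line \<open>y = 0\<close> is a null set because \<open>d \<ge> 2\<close>.\<close>
  also have "\<dots> = (\<integral>\<^sup>+y. (\<integral>\<^sup>+r. ennreal (Y y) * F (Y y * r) (Y y) \<partial>lborel) \<partial>?PI)"
  proof (rule nn_integral_cong_AE)
    have "emeasure ?PI ({y. Y y \<le> 0} \<inter> space ?PI) = 0"
    proof -
      have "emeasure ?PI ({y. Y y \<le> 0} \<inter> space ?PI) \<le> ennreal (?c * r ^ card I)" if "r > 0" for r
        unfolding Ycball[OF that, symmetric] using that by (intro emeasure_mono) auto
      moreover have "((\<lambda>r. ennreal (?c * r ^ card I)) \<longlongrightarrow> ennreal (?c * 0 ^ card I)) (at_right 0)"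
        by (intro tendsto_intros)
      ultimately have "emeasure ?PI ({y. Y y \<le> 0} \<inter> space ?PI) \<le> ennreal (?c * 0 ^ card I)"
        by (intro tendsto_lowerbound[where F="at_right 0"]) (auto intro: eventually_mono[OF eventually_at_right_less])
      then show ?thesis using I(4) d by (simp add: power_0_left)
    qed
    then have "AE y in ?PI. \<not> Y y \<le> 0"
      by (intro AE_I'[of "{y. Y y \<le> 0} \<inter> space ?PI"]) (auto simp: null_sets_def)
    then show "AE y in ?PI. (\<integral>\<^sup>+s. F s (Y y) \<partial>lborel) = (\<integral>\<^sup>+r. ennreal (Y y) * F (Y y * r) (Y y) \<partial>lborel)"
    proof eventually_elim
      case (elim y)
      then show ?case
        using nn_integral_real_affine[of "\<lambda>s. F s (Y y)" "Y y" 0]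
        by (simp add: nn_integral_cmult)
    qed
  qed
  also have "\<dots> = (\<integral>\<^sup>+r. (\<integral>\<^sup>+y. ennreal (Y y) * F (Y y * r) (Y y) \<partial>?PI) \<partial>lborel)"
  proof -
    interpret pair_sigma_finite ?PI "lborel :: real measure" ..
    show ?thesis by (rule Fubini'[symmetric]) measurable
  qed
  \<comment> \<open>In the new coordinates the unit ball is \<open>|y| < 1 / sqrt (1 + r\<^sup>2)\<close>.\<close>
  also have "\<dots> \<le> (\<integral>\<^sup>+r. b (r / sqrt (1 + r\<^sup>2)) * ennreal (?c * (1 / sqrt (1 + r\<^sup>2)) ^ DIM('a)) \<partial>lborel)"
  proof (rule nn_integral_mono)
    fix r :: real
    have pos: "1 + r\<^sup>2 > 0" by (simp add: add_pos_nonneg)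
    let ?R = "1 / sqrt (1 + r\<^sup>2)"
    have R: "?R > 0" using pos by simp
    have "(\<integral>\<^sup>+y. ennreal (Y y) * F (Y y * r) (Y y) \<partial>?PI) \<le>
      (\<integral>\<^sup>+y. b (r / sqrt (1 + r\<^sup>2)) * ennreal ?R * indicator ({y. Y y \<le> ?R} \<inter> space ?PI) y \<partial>?PI)"
    proof (rule nn_integral_mono)
      fix y assume y: "y \<in> space ?PI"
      have eq: "(Y y * r)\<^sup>2 + (Y y)\<^sup>2 = (Y y)\<^sup>2 * (1 + r\<^sup>2)" by (simp add: algebra_simps power_mult_distrib)
      show "ennreal (Y y) * F (Y y * r) (Y y) \<le>
        b (r / sqrt (1 + r\<^sup>2)) * ennreal ?R * indicator ({y. Y y \<le> ?R} \<inter> space ?PI) y"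
      proof (cases "(Y y)\<^sup>2 * (1 + r\<^sup>2) < 1 \<and> Y y \<noteq> 0")
        case True
        have "sqrt ((Y y)\<^sup>2 * (1 + r\<^sup>2)) < 1" using True by simp
        then have "Y y * sqrt (1 + r\<^sup>2) < 1" using Y0 by (simp add: real_sqrt_mult)
        then have le: "Y y \<le> ?R" using pos by (simp add: field_simps)
        have "Y y * r / sqrt ((Y y)\<^sup>2 * (1 + r\<^sup>2)) = r / sqrt (1 + r\<^sup>2)"
          using True Y0[of y] by (simp add: real_sqrt_mult)
        then have "ennreal (Y y) * F (Y y * r) (Y y) = ennreal (Y y) * b (r / sqrt (1 + r\<^sup>2))"
          using True by (simp add: F_def eq)
        also have "\<dots> \<le> ennreal ?R * b (r / sqrt (1 + r\<^sup>2))"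
          using le by (intro mult_right_mono ennreal_leI) auto
        finally show ?thesis using le y by (simp add: mult.commute)
      qed (auto simp: F_def eq)
    qed
    also have "\<dots> = b (r / sqrt (1 + r\<^sup>2)) * ennreal ?R * ennreal (?c * ?R ^ card I)"
      by (subst nn_integral_cmult_indicator) (auto simp only: Ycball[OF R], measurable)
    also have "\<dots> = b (r / sqrt (1 + r\<^sup>2)) * ennreal (?c * ?R ^ DIM('a))"
    proof -
      have "?R * (?c * ?R ^ card I) = ?c * ?R ^ DIM('a)"
        using I(4) d by (simp add: power_eq_if)
      then show ?thesis using R by (simp only: mult.assoc ennreal_mult'[symmetric] less_imp_le)
    qed
    finally show "(\<integral>\<^sup>+y. ennreal (Y y) * F (Y y * r) (Y y) \<partial>?PI) \<le>
       b (r / sqrt (1 + r\<^sup>2)) * ennreal (?c * ?R ^ DIM('a))" .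
  qed
  also have "\<dots> = ennreal ?c * (\<integral>\<^sup>+r. (b (r / sqrt (1 + r\<^sup>2)) *
      ennreal ((1 - (r / sqrt (1 + r\<^sup>2))\<^sup>2) powr ((real DIM('a) - 3) / 2))) * ennreal ((1 / sqrt (1 + r\<^sup>2)) ^ 3) \<partial>lborel)"
  proof (subst nn_integral_cmult[symmetric], measurable, rule nn_integral_cong)
    fix r :: real
    have pos: "1 + r\<^sup>2 > 0" by (simp add: add_pos_nonneg)
    let ?R = "1 / sqrt (1 + r\<^sup>2)"
    have R: "?R > 0" using pos by simp
    have "1 - (r / sqrt (1 + r\<^sup>2))\<^sup>2 = ?R\<^sup>2"
      using pos by (simp add: power_divide field_simps)
    also have "\<dots> = ?R powr 2" using powr_realpow[OF R, of 2] by simp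
    finally have "(1 - (r / sqrt (1 + r\<^sup>2))\<^sup>2) powr ((real DIM('a) - 3) / 2) = ?R powr (real DIM('a) - 3)"
      by (simp only: powr_powr) (simp add: diff_divide_distrib)
    moreover have "?R powr (real DIM('a) - 3) * ?R ^ 3 = ?R ^ DIM('a)"
    proof -
      have "?R powr (real DIM('a) - 3) * ?R ^ 3 = ?R powr real DIM('a)"
        using powr_add[of ?R "real DIM('a) - 3" 3] powr_realpow[OF R, of 3] by simp
      then show ?thesis using powr_realpow[OF R, of "DIM('a)"] by simp
    qed
    ultimately have eq: "?R ^ DIM('a) = (1 - (r / sqrt (1 + r\<^sup>2))\<^sup>2) powr ((real DIM('a) - 3) / 2) * ?R ^ 3"
      by simp
    have "ennreal (?c * ?R ^ DIM('a)) = ennreal ?c * ennreal (?R ^ DIM('a))"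
      by (rule ennreal_mult) (use pos in auto)
    also have "ennreal (?R ^ DIM('a)) =
      ennreal ((1 - (r / sqrt (1 + r\<^sup>2))\<^sup>2) powr ((real DIM('a) - 3) / 2)) * ennreal (?R ^ 3)"
      unfolding eq by (rule ennreal_mult) (use pos in auto)
    finally have "ennreal (?c * ?R ^ DIM('a)) =
      ennreal ?c * (ennreal ((1 - (r / sqrt (1 + r\<^sup>2))\<^sup>2) powr ((real DIM('a) - 3) / 2)) * ennreal (?R ^ 3))" .
    then show "b (r / sqrt (1 + r\<^sup>2)) * ennreal (?c * ?R ^ DIM('a)) = ennreal ?c * (b (r / sqrt (1 + r\<^sup>2)) *
      ennreal ((1 - (r / sqrt (1 + r\<^sup>2))\<^sup>2) powr ((real DIM('a) - 3) / 2)) * ennreal (?R ^ 3))"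
      by (simp only: mult_ac)
  qed
  also have "\<dots> \<le> ennreal ?c * (\<integral>\<^sup>+z. b z * ennreal ((1 - z\<^sup>2) powr ((real DIM('a) - 3) / 2)) * indicator {-1..1} z \<partial>lborel)"
    by (intro mult_left_mono nn_integral_stereographic_le) auto
  finally have main: "(\<integral>\<^sup>+x. indicator (ball 0 1) x * b (e \<bullet> sgn x) \<partial>lborel) \<le> \<dots>" .
  have cI: "real (card I) = real DIM('a) - 1" using I(4) d by simp
  have "(\<integral>\<^sup>+\<omega>. b (e \<bullet> \<omega>) \<partial>sphere_measure) = of_nat DIM('a) * (\<integral>\<^sup>+x. indicator (ball 0 1) x * b (e \<bullet> sgn x) \<partial>lborel)"
    by (subst nn_integral_sphere_measure) auto
  also have "\<dots> \<le> of_nat DIM('a) * (ennreal ?c * (\<integral>\<^sup>+z. b z * ennreal ((1 - z\<^sup>2) powr ((real DIM('a) - 3) / 2)) * indicator {-1..1} z \<partial>lborel))"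
    by (intro mult_left_mono main) simp
  finally show ?thesis
    unfolding cI using d by (simp add: ennreal_mult' mult.assoc ennreal_of_nat_eq_real_of_nat)
qed

section \<open>Velocity integrals\<close>

lemma nn_integral_gaussian:
  fixes c x0 :: real
  assumes c: "0 < c"
  shows "(\<integral>\<^sup>+x. ennreal (exp (- c * (x - x0)\<^sup>2)) \<partial>lborel) = ennreal (sqrt (pi / c))"
proof -
  define s where "s = sqrt (1 / (2 * c))"
  have s: "s > 0" "s\<^sup>2 = 1 / (2 * c)" using c by (auto simp: s_def)
  have "exp (- c * (x - x0)\<^sup>2) = sqrt (pi / c) * normal_density x0 s x" for x
    using c by (simp add: normal_density_def s(2) real_sqrt_divide field_simps)
  then have "(\<integral>\<^sup>+x. ennreal (exp (- c * (x - x0)\<^sup>2)) \<partial>lborel) =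
      (\<integral>\<^sup>+x. ennreal (sqrt (pi / c)) * ennreal (normal_density x0 s x) \<partial>lborel)"
    using c by (simp add: ennreal_mult'[symmetric])
  also have "\<dots> = ennreal (sqrt (pi / c)) * (\<integral>\<^sup>+x. ennreal (normal_density x0 s x) \<partial>lborel)"
    by (rule nn_integral_cmult) simp
  also have "(\<integral>\<^sup>+x. ennreal (normal_density x0 s x) \<partial>lborel) = ennreal 1"
    using s(1) by (subst nn_integral_eq_integral) auto
  finally show ?thesis by simp
qed

lemma nn_integral_gaussian_euclidean:
  assumes c: "0 < c"
  shows "(\<integral>\<^sup>+(x::'a::euclidean_space). ennreal (exp (- c * (norm x)\<^sup>2)) \<partial>lborel) = ennreal (sqrt (pi / c) ^ DIM('a))"
proof -
  have "(\<integral>\<^sup>+(x::'a). ennreal (exp (- c * (norm x)\<^sup>2)) \<partial>lborel) =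
    (\<integral>\<^sup>+(x::'a). (\<Prod>b\<in>Basis. ennreal (exp (- c * (x \<bullet> b)\<^sup>2))) \<partial>lborel)"
  proof (rule nn_integral_cong)
    fix x :: 'a
    have "(norm x)\<^sup>2 = (\<Sum>b\<in>Basis. (x \<bullet> b)\<^sup>2)"
      using euclidean_dist_l2[of 0 x] by (simp add: L2_set_def sum_nonneg)
    then have "- c * (norm x)\<^sup>2 = (\<Sum>b\<in>Basis. - c * (x \<bullet> b)\<^sup>2)" by (simp add: sum_distrib_left)
    then show "ennreal (exp (- c * (norm x)\<^sup>2)) = (\<Prod>b\<in>Basis. ennreal (exp (- c * (x \<bullet> b)\<^sup>2)))"
      by (simp add: exp_sum prod_ennreal)
  qed
  also have "\<dots> = (\<Prod>b\<in>(Basis :: 'a set). (\<integral>\<^sup>+x. ennreal (exp (- c * x\<^sup>2)) \<partial>lborel))"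
    by (rule nn_integral_lborel_prod) auto
  also have "\<dots> = ennreal (sqrt (pi / c) ^ DIM('a))"
    using nn_integral_gaussian[OF c, of 0] c by (simp add: ennreal_power)
  finally show ?thesis .
qed

text \<open>Write \<open>|u|\<^sup>p - 1\<close> as the integral of \<open>- p r\<^sup>p\<^sup>-\<^sup>1\<close> over \<open>r \<in> [|u|, 1]\<close> and integrate over \<open>u\<close> first:
  only the volume of balls is needed, no polar coordinates.\<close>

lemma nn_integral_ball_powr:
  assumes p: "- real DIM('a) < p" "p \<le> 0"
  shows "(\<integral>\<^sup>+(u::'a::euclidean_space). ennreal (norm u powr p) * indicator (ball 0 1) u \<partial>lborel) \<le>
    ennreal (unit_ball_vol (real DIM('a)) * real DIM('a) / (real DIM('a) + p))"
proof -
  let ?D = "real DIM('a)" and ?V = "unit_ball_vol (real DIM('a))"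
  let ?f = "\<lambda>r u. ennreal (- p * r powr (p - 1)) * indicator {norm (u::'a)..1} r"
  have "(\<integral>\<^sup>+(u::'a). ennreal (norm u powr p) * indicator (ball 0 1) u \<partial>lborel) =
    (\<integral>\<^sup>+(u::'a). (1 + (\<integral>\<^sup>+r. ?f r u \<partial>lborel)) * indicator (ball 0 1) u \<partial>lborel)"
  proof (rule nn_integral_cong_AE)
    have "AE u in lborel. (u::'a) \<noteq> 0" by (rule AE_lborel_singleton)
    then show "AE (u::'a) in lborel. ennreal (norm u powr p) * indicator (ball 0 1) u =
      (1 + (\<integral>\<^sup>+r. ?f r u \<partial>lborel)) * indicator (ball 0 1) u"
    proof eventually_elim
      case (elim u)
      show ?case
      proof (cases "norm u < 1")
        case True
        have "(\<integral>\<^sup>+r. ?f r u \<partial>lborel) = ennreal (- (1 powr p) - - (norm u powr p))"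
        proof (rule nn_integral_FTC_Icc)
          show "((\<lambda>r. - (r powr p)) has_real_derivative - p * r powr (p - 1)) (at r)" if "r \<in> {norm u..1}" for r
            using that elim by (auto intro!: derivative_eq_intros) (smt (verit) zero_less_norm_iff)
        qed (use True p in \<open>auto intro!: mult_nonpos_nonneg simp: mult_le_0_iff\<close>)
        moreover have "norm u powr p \<ge> 1"
          using powr_mono2'[of p "norm u" 1] True p elim by simp
        ultimately show ?thesis
          using True by (simp flip: ennreal_plus ennreal_1)
      qed simp
    qed
  qed
  also have "\<dots> \<le> (\<integral>\<^sup>+(u::'a). indicator (ball 0 1) u + (\<integral>\<^sup>+r. ?f r u \<partial>lborel) \<partial>lborel)"
    by (intro nn_integral_mono) (auto simp: indicator_def)
  also have "\<dots> = emeasure lborel (ball (0::'a) 1) + (\<integral>\<^sup>+(u::'a). (\<integral>\<^sup>+r. ?f r u \<partial>lborel) \<partial>lborel)"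
    by (subst nn_integral_add) (auto simp: atLeastAtMost_iff indicator_def)
  also have "(\<integral>\<^sup>+(u::'a). (\<integral>\<^sup>+r. ?f r u \<partial>lborel) \<partial>lborel) = (\<integral>\<^sup>+r. (\<integral>\<^sup>+(u::'a). ?f r u \<partial>lborel) \<partial>lborel)"
    by (rule lborel_pair.Fubini') (auto simp: indicator_def)
  also have "\<dots> = (\<integral>\<^sup>+r. ennreal (- p * ?V * r powr (?D + p - 1)) * indicator {0..1} r \<partial>lborel)"
  proof (rule nn_integral_cong_AE)
    have "AE r in lborel. r \<noteq> (0::real)" by (rule AE_lborel_singleton)
    then show "AE r in lborel. (\<integral>\<^sup>+(u::'a). ?f r u \<partial>lborel) = ennreal (- p * ?V * r powr (?D + p - 1)) * indicator {0..1} r"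
    proof eventually_elim
      case (elim r)
      show ?case
      proof (cases "0 < r \<and> r \<le> 1")
        case True
        have "(\<integral>\<^sup>+(u::'a). ?f r u \<partial>lborel) = (\<integral>\<^sup>+(u::'a). ennreal (- p * r powr (p - 1)) * indicator (cball 0 r) u \<partial>lborel)"
          using True by (intro nn_integral_cong) (auto simp: indicator_def)
        also have "\<dots> = ennreal (- p * r powr (p - 1)) * ennreal (?V * r ^ DIM('a))"
          using True by (subst nn_integral_cmult_indicator) (auto simp: emeasure_cball)
        also have "\<dots> = ennreal (- p * r powr (p - 1) * (?V * r ^ DIM('a)))"
          using True p by (intro ennreal_mult[symmetric]) (auto simp: mult_le_0_iff)
        also have "- p * r powr (p - 1) * (?V * r ^ DIM('a)) = - p * ?V * r powr (?D + p - 1)"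
        proof -
          have "r powr (p - 1) * r ^ DIM('a) = r powr (?D + p - 1)"
            using True by (subst powr_realpow[symmetric]) (auto simp: powr_add[symmetric] algebra_simps)
          then show ?thesis by (simp add: mult_ac)
        qed
        finally show ?thesis using True by simp
      next
        case False
        then have z: "?f r u = 0" for u using elim norm_ge_zero[of u] by (auto simp: indicator_def simp del: norm_ge_zero)
        show ?thesis unfolding z using False elim by (auto simp: indicator_def)
      qed
    qed
  qed
  also have "\<dots> = ennreal (- p * ?V / (?D + p))"
  proof -
    have "((\<lambda>r. r powr (?D + p - 1)) has_integral (1 powr (?D + p - 1 + 1) / (?D + p - 1 + 1))) {0..1}"
      by (rule has_integral_powr_from_0) (use p in auto)
    then have "((\<lambda>r. - p * ?V * r powr (?D + p - 1)) has_integral (- p * ?V * (1 / (?D + p)))) {0..1}"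
      by (intro has_integral_mult_right) simp
    then show ?thesis
      using p nn_integral_has_integral_lebesgue'[of "{0..1}" "\<lambda>r. - p * ?V * r powr (?D + p - 1)"]
      by (simp add: mult_le_0_iff zero_le_mult_iff)
  qed
  also have "emeasure lborel (ball (0::'a) 1) + ennreal (- p * ?V / (?D + p)) = ennreal (?V + - p * ?V / (?D + p))"
    using p by (subst ennreal_plus) (auto simp: emeasure_ball intro!: divide_nonpos_pos mult_nonpos_nonneg)
  also have "?V + - p * ?V / (?D + p) = ?V * ?D / (?D + p)"
    using p by (simp add: field_simps)
  finally show ?thesis .
qed

text \<open>The first summand bounds the integral of \<open>|u|\<^sup>p\<close> over the unit ball, the second is the integral of the
  Gaussian.\<close>

definition singular_const :: "'a::euclidean_space itself \<Rightarrow> real \<Rightarrow> real \<Rightarrow> real"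
  where "singular_const _ p c = unit_ball_vol (real DIM('a)) * real DIM('a) / (real DIM('a) + p) + sqrt (pi / c) ^ DIM('a)"

text \<open>Within distance \<open>1\<close> of \<open>w\<close> the Gaussian is bounded by \<open>1\<close>, farther away the power is, as \<open>p \<le> 0\<close>.\<close>

lemma nn_integral_powr_gaussian:
  fixes w :: "'a::euclidean_space"
  assumes p: "- real DIM('a) < p" "p \<le> 0" and c: "0 < c"
  shows "(\<integral>\<^sup>+u. ennreal (norm (u - w) powr p * exp (- c * (norm u)\<^sup>2)) \<partial>lborel) \<le> ennreal (singular_const TYPE('a) p c)"
proof -
  have "(\<integral>\<^sup>+u. ennreal (norm (u - w) powr p * exp (- c * (norm u)\<^sup>2)) \<partial>lborel) \<le>
    (\<integral>\<^sup>+u. ennreal (norm (u - w) powr p) * indicator (ball 0 1) (u - w) + ennreal (exp (- c * (norm u)\<^sup>2)) \<partial>lborel)"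
  proof (rule nn_integral_mono)
    fix u :: 'a
    show "ennreal (norm (u - w) powr p * exp (- c * (norm u)\<^sup>2)) \<le>
      ennreal (norm (u - w) powr p) * indicator (ball 0 1) (u - w) + ennreal (exp (- c * (norm u)\<^sup>2))"
    proof (cases "norm (u - w) < 1")
      case True
      have "norm (u - w) powr p * exp (- c * (norm u)\<^sup>2) \<le> norm (u - w) powr p * 1"
        using c by (intro mult_left_mono) auto
      then have "ennreal (norm (u - w) powr p * exp (- c * (norm u)\<^sup>2)) \<le> ennreal (norm (u - w) powr p)"
        by (simp add: ennreal_leI)
      then show ?thesis using True by (simp add: add_increasing2)
    next
      case False
      then have "norm (u - w) powr p \<le> 1" using powr_mono2'[of p 1 "norm (u - w)"] p by simp
      then have "norm (u - w) powr p * exp (- c * (norm u)\<^sup>2) \<le> 1 * exp (- c * (norm u)\<^sup>2)"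
        by (intro mult_right_mono) auto
      then show ?thesis using False by (simp add: ennreal_leI)
    qed
  qed
  also have "\<dots> = (\<integral>\<^sup>+u. ennreal (norm (- w + u) powr p) * indicator (ball 0 1) (- w + u) \<partial>lborel) +
      (\<integral>\<^sup>+(u::'a). ennreal (exp (- c * (norm u)\<^sup>2)) \<partial>lborel)"
    by (subst nn_integral_add) auto
  also have "\<dots> = (\<integral>\<^sup>+(u::'a). ennreal (norm u powr p) * indicator (ball 0 1) u \<partial>lborel) + ennreal (sqrt (pi / c) ^ DIM('a))"
    by (subst nn_integral_lborel_add[where f="\<lambda>u. ennreal (norm u powr p) * indicator (ball 0 1) u"])
      (auto simp: nn_integral_gaussian_euclidean[OF c, simplified])
  also have "\<dots> \<le> ennreal (unit_ball_vol (real DIM('a)) * real DIM('a) / (real DIM('a) + p)) + ennreal (sqrt (pi / c) ^ DIM('a))"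
    by (intro add_right_mono nn_integral_ball_powr p)
  also have "\<dots> = ennreal (singular_const TYPE('a) p c)"
    unfolding singular_const_def using p c by (intro ennreal_plus[symmetric]) auto
  finally show ?thesis .
qed

text \<open>By the Cauchy--Schwarz inequality \<open>|X - t u|\<close> is at least the length of its component along \<open>u\<close>, which is
  an affine function of \<open>t\<close>. This is the dispersion that makes collisions rare: two particles with relative
  velocity \<open>u\<close> are both near the origin only for a time of order \<open>1 / |u|\<close>.\<close>

lemma nn_integral_free_flight:
  fixes X u :: "'a::euclidean_space"
  assumes a: "0 < a" and u: "u \<noteq> 0"
  shows "(\<integral>\<^sup>+t. ennreal (exp (- a * (norm (X - t *\<^sub>R u))\<^sup>2)) \<partial>lborel) \<le> ennreal (sqrt (pi / a) / norm u)"
proof -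
  let ?t0 = "(X \<bullet> u) / (norm u)\<^sup>2"
  have nu: "norm u > 0" using u by simp
  have "(\<integral>\<^sup>+t. ennreal (exp (- a * (norm (X - t *\<^sub>R u))\<^sup>2)) \<partial>lborel) \<le>
    (\<integral>\<^sup>+t. ennreal (exp (- (a * (norm u)\<^sup>2) * (t - ?t0)\<^sup>2)) \<partial>lborel)"
  proof (intro nn_integral_mono ennreal_leI)
    fix t :: real
    have "(X - t *\<^sub>R u) \<bullet> u = X \<bullet> u - t * (norm u)\<^sup>2"
      by (simp add: inner_diff_left power2_norm_eq_inner)
    also have "\<dots> = (norm u)\<^sup>2 * (?t0 - t)" using nu by (simp add: field_simps)
    finally have e: "(X - t *\<^sub>R u) \<bullet> u = (norm u)\<^sup>2 * (?t0 - t)" .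
    have "((norm u)\<^sup>2 * (?t0 - t))\<^sup>2 \<le> (norm (X - t *\<^sub>R u) * norm u)\<^sup>2"
      unfolding e[symmetric] using Cauchy_Schwarz_ineq2[of "X - t *\<^sub>R u" u] by (metis abs_le_square_iff abs_of_nonneg mult_nonneg_nonneg norm_ge_zero)
    then have "(norm u)\<^sup>2 * ((norm u)\<^sup>2 * (?t0 - t)\<^sup>2) \<le> (norm u)\<^sup>2 * (norm (X - t *\<^sub>R u))\<^sup>2"
      by (simp add: power_mult_distrib power2_eq_square mult_ac)
    then have "(norm u)\<^sup>2 * (?t0 - t)\<^sup>2 \<le> (norm (X - t *\<^sub>R u))\<^sup>2"
      by (rule mult_left_le_imp_le) (use nu in simp)
    then have "a * ((norm u)\<^sup>2 * (t - ?t0)\<^sup>2) \<le> a * (norm (X - t *\<^sub>R u))\<^sup>2"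
      using a by (simp add: power2_commute)
    then show "exp (- a * (norm (X - t *\<^sub>R u))\<^sup>2) \<le> exp (- (a * (norm u)\<^sup>2) * (t - ?t0)\<^sup>2)"
      by (simp add: mult.assoc)
  qed
  also have "\<dots> = ennreal (sqrt (pi / (a * (norm u)\<^sup>2)))"
    by (rule nn_integral_gaussian) (use a nu in simp)
  also have "sqrt (pi / (a * (norm u)\<^sup>2)) = sqrt (pi / a) / norm u"
    using nu by (simp add: real_sqrt_divide real_sqrt_mult)
  finally show ?thesis .
qed

text \<open>The rate at which a particle, moving freely with velocity \<open>V0\<close> along the trajectory labelled \<open>X\<close>, meets
  the particles of a Maxwellian that moves freely as well. For binary collisions \<open>\<tau>\<close> is the norm; for
  ternary ones it is \<open>tnorm\<close>, and \<open>X\<close>, \<open>V0\<close> are doubled.\<close>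

definition coll_freq :: "('b::euclidean_space \<Rightarrow> real) \<Rightarrow> real \<Rightarrow> real \<Rightarrow> real \<Rightarrow> real \<Rightarrow> 'b \<Rightarrow> 'b \<Rightarrow> ennreal"
  where "coll_freq \<tau> \<gamma> a c t X V0 =
    (\<integral>\<^sup>+V. ennreal (\<tau> (V - V0) powr \<gamma> * exp (- a * (norm (X - t *\<^sub>R (V - V0)))\<^sup>2 - c * (norm V)\<^sup>2)) \<partial>lborel)"

text \<open>One factor \<open>|u|\<close> is split off because free flight provides a factor \<open>1 / |u|\<close>; the power that is left
  has a nonpositive exponent, so that the lower bound on \<open>\<tau>\<close> can be used.\<close>

lemma powr_equivalent_norm:
  fixes \<tau> :: "'b::real_normed_vector \<Rightarrow> real"
  assumes \<tau>: "norm u \<le> \<tau> u" "\<tau> u \<le> 2 * norm u" and \<gamma>: "\<gamma> \<le> 1"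
  shows "\<tau> u powr \<gamma> \<le> 2 * norm u powr (\<gamma> - 1) * norm u"
proof (cases "u = 0")
  case False
  then have nu: "norm u > 0" by simp
  have "\<tau> u powr \<gamma> = \<tau> u powr (\<gamma> - 1) * \<tau> u"
    using nu \<tau> powr_add[of "\<tau> u" "\<gamma> - 1" 1] by simp
  also have "\<dots> \<le> norm u powr (\<gamma> - 1) * (2 * norm u)"
    using nu \<tau> \<gamma> by (intro mult_mono powr_mono2') auto
  finally show ?thesis by simp
qed (use \<tau> in simp)

text \<open>Integrate over time first.\<close>

lemma nn_integral_coll_freq:
  fixes \<tau> :: "'b::euclidean_space \<Rightarrow> real"
  assumes \<tau>: "\<And>u. norm u \<le> \<tau> u" "\<And>u. \<tau> u \<le> 2 * norm u" and [measurable]: "\<tau> \<in> borel_measurable borel"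
    and \<gamma>: "1 - real DIM('b) < \<gamma>" "\<gamma> \<le> 1" and a: "0 < a" and c: "0 < c"
  shows "(\<integral>\<^sup>+t. coll_freq \<tau> \<gamma> a c t X V0 \<partial>lborel) \<le> ennreal (2 * sqrt (pi / a) * singular_const TYPE('b) (\<gamma> - 1) c)"
proof -
  have "(\<integral>\<^sup>+t. coll_freq \<tau> \<gamma> a c t X V0 \<partial>lborel) =
    (\<integral>\<^sup>+V. (\<integral>\<^sup>+t. ennreal (\<tau> (V - V0) powr \<gamma> * exp (- a * (norm (X - t *\<^sub>R (V - V0)))\<^sup>2 - c * (norm V)\<^sup>2)) \<partial>lborel) \<partial>lborel)"
    unfolding coll_freq_def by (rule lborel_pair.Fubini') measurable
  also have "\<dots> \<le> (\<integral>\<^sup>+V. ennreal (2 * sqrt (pi / a)) * ennreal (norm (V - V0) powr (\<gamma> - 1) * exp (- c * (norm V)\<^sup>2)) \<partial>lborel)"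
  proof (rule nn_integral_mono_AE)
    have "AE V in lborel. V \<noteq> V0" by (rule AE_lborel_singleton)
    then show "AE V in lborel. (\<integral>\<^sup>+t. ennreal (\<tau> (V - V0) powr \<gamma> * exp (- a * (norm (X - t *\<^sub>R (V - V0)))\<^sup>2 - c * (norm V)\<^sup>2)) \<partial>lborel)
      \<le> ennreal (2 * sqrt (pi / a)) * ennreal (norm (V - V0) powr (\<gamma> - 1) * exp (- c * (norm V)\<^sup>2))"
    proof eventually_elim
      case (elim V)
      let ?u = "V - V0"
      have u: "norm ?u > 0" using elim by simp
      let ?A = "\<tau> ?u powr \<gamma> * exp (- c * (norm V)\<^sup>2)"
      have A: "0 \<le> ?A" by simp
      have "(\<integral>\<^sup>+t. ennreal (\<tau> ?u powr \<gamma> * exp (- a * (norm (X - t *\<^sub>R ?u))\<^sup>2 - c * (norm V)\<^sup>2)) \<partial>lborel) =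
        (\<integral>\<^sup>+t. ennreal ?A * ennreal (exp (- a * (norm (X - t *\<^sub>R ?u))\<^sup>2)) \<partial>lborel)"
        by (simp add: ennreal_mult'[symmetric] exp_diff exp_minus field_simps)
      also have "\<dots> = ennreal ?A * (\<integral>\<^sup>+t. ennreal (exp (- a * (norm (X - t *\<^sub>R ?u))\<^sup>2)) \<partial>lborel)"
        by (rule nn_integral_cmult) measurable
      also have "\<dots> \<le> ennreal ?A * ennreal (sqrt (pi / a) / norm ?u)"
        using u by (intro mult_left_mono nn_integral_free_flight a) auto
      also have "\<dots> = ennreal (?A * (sqrt (pi / a) / norm ?u))"
        using A by (simp only: ennreal_mult'[symmetric])
      also have "\<dots> \<le> ennreal ((2 * norm ?u powr (\<gamma> - 1) * norm ?u) * exp (- c * (norm V)\<^sup>2) * (sqrt (pi / a) / norm ?u))"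
        using a by (intro ennreal_leI mult_right_mono powr_equivalent_norm \<tau> \<gamma>) auto
      also have "(2 * norm ?u powr (\<gamma> - 1) * norm ?u) * exp (- c * (norm V)\<^sup>2) * (sqrt (pi / a) / norm ?u) =
        2 * sqrt (pi / a) * (norm ?u powr (\<gamma> - 1) * exp (- c * (norm V)\<^sup>2))"
        using u by simp
      finally show ?case using a by (simp only: ennreal_mult'[of "2 * sqrt (pi / a)"] mult_nonneg_nonneg real_sqrt_ge_zero pi_ge_zero divide_nonneg_pos zero_le_numeral)
    qed
  qed
  also have "\<dots> = ennreal (2 * sqrt (pi / a)) * (\<integral>\<^sup>+V. ennreal (norm (V - V0) powr (\<gamma> - 1) * exp (- c * (norm V)\<^sup>2)) \<partial>lborel)"
    by (rule nn_integral_cmult) measurable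
  also have "\<dots> \<le> ennreal (2 * sqrt (pi / a)) * ennreal (singular_const TYPE('b) (\<gamma> - 1) c)"
    using \<gamma> c by (intro mult_left_mono nn_integral_powr_gaussian) auto
  also have "\<dots> = ennreal (2 * sqrt (pi / a) * singular_const TYPE('b) (\<gamma> - 1) c)"
    using a by (simp add: ennreal_mult')
  finally show ?thesis .
qed

lemma linear_times_gaussian_le:
  fixes c s :: real
  assumes c: "0 < c" and "0 \<le> s"
  shows "s * exp (- (c / 2) * s\<^sup>2) \<le> 1 / (2 * sqrt (c / 2))"
proof -
  have "2 * (sqrt (c / 2) * s) \<le> 1 + (sqrt (c / 2) * s)\<^sup>2"
    using zero_le_power2[of "1 - sqrt (c / 2) * s"] by (simp add: power2_diff)
  also have "\<dots> = 1 + (c / 2) * s\<^sup>2" using c by (simp add: power_mult_distrib)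
  also have "\<dots> \<le> exp ((c / 2) * s\<^sup>2)" by (rule exp_ge_add_one_self)
  finally have "s * (2 * sqrt (c / 2)) \<le> exp ((c / 2) * s\<^sup>2)" by (simp add: mult_ac)
  then have "s \<le> 1 / (2 * sqrt (c / 2)) * exp ((c / 2) * s\<^sup>2)" using c by (simp add: pos_le_divide_eq)
  then show ?thesis by (simp add: exp_minus field_simps)
qed

text \<open>Without the integration over time the factor \<open>|u| \<le> |V0| + |V|\<close> remains; half of the Gaussian absorbs
  \<open>|V|\<close>. The linear growth in \<open>V0\<close> is harmless, as Maxwellians have first moments.\<close>

lemma coll_freq_le:
  fixes \<tau> :: "'b::euclidean_space \<Rightarrow> real"
  assumes \<tau>: "\<And>u. norm u \<le> \<tau> u" "\<And>u. \<tau> u \<le> 2 * norm u"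
    and \<gamma>: "1 - real DIM('b) < \<gamma>" "\<gamma> \<le> 1" and a: "0 < a" and c: "0 < c"
  shows "coll_freq \<tau> \<gamma> a c t X V0 \<le>
    ennreal (2 * (norm V0 + 1 / (2 * sqrt (c / 2))) * singular_const TYPE('b) (\<gamma> - 1) (c / 2))"
proof -
  let ?q = "1 / (2 * sqrt (c / 2))" and ?e = "\<lambda>V::'b. exp (- (c / 2) * (norm V)\<^sup>2)"
  note q = linear_times_gaussian_le[OF c]
  have "coll_freq \<tau> \<gamma> a c t X V0 \<le> (\<integral>\<^sup>+V. ennreal (2 * (norm V0 + ?q)) * ennreal (norm (V - V0) powr (\<gamma> - 1) * ?e V) \<partial>lborel)"
    unfolding coll_freq_def
  proof (rule nn_integral_mono)
    fix V
    let ?u = "V - V0"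
    have "\<tau> ?u powr \<gamma> * exp (- a * (norm (X - t *\<^sub>R ?u))\<^sup>2 - c * (norm V)\<^sup>2) \<le>
      (2 * norm ?u powr (\<gamma> - 1) * (norm V0 + norm V)) * (?e V * ?e V)"
    proof (intro mult_mono)
      have "\<tau> ?u powr \<gamma> \<le> 2 * norm ?u powr (\<gamma> - 1) * norm ?u" by (intro powr_equivalent_norm \<tau> \<gamma>)
      also have "\<dots> \<le> 2 * norm ?u powr (\<gamma> - 1) * (norm V0 + norm V)"
        by (intro mult_left_mono) (auto intro: order_trans[OF norm_triangle_ineq4])
      finally show "\<tau> ?u powr \<gamma> \<le> 2 * norm ?u powr (\<gamma> - 1) * (norm V0 + norm V)" .
      have "?e V * ?e V = exp (- c * (norm V)\<^sup>2)" by (simp add: exp_add[symmetric])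
      then show "exp (- a * (norm (X - t *\<^sub>R ?u))\<^sup>2 - c * (norm V)\<^sup>2) \<le> ?e V * ?e V" using a by simp
    qed auto
    also have "\<dots> = 2 * norm ?u powr (\<gamma> - 1) * ?e V * (norm V0 * ?e V + norm V * ?e V)"
      by (simp add: algebra_simps)
    also have "\<dots> \<le> 2 * norm ?u powr (\<gamma> - 1) * ?e V * (norm V0 * 1 + ?q)"
      using c by (intro mult_left_mono add_mono q) auto
    also have "\<dots> = 2 * (norm V0 + ?q) * (norm ?u powr (\<gamma> - 1) * ?e V)" by (simp add: algebra_simps)
    finally have "ennreal (\<tau> ?u powr \<gamma> * exp (- a * (norm (X - t *\<^sub>R ?u))\<^sup>2 - c * (norm V)\<^sup>2)) \<le>
       ennreal (2 * (norm V0 + ?q) * (norm ?u powr (\<gamma> - 1) * ?e V))" by (rule ennreal_leI)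
    also have "\<dots> = ennreal (2 * (norm V0 + ?q)) * ennreal (norm ?u powr (\<gamma> - 1) * ?e V)"
      by (rule ennreal_mult) (use c in auto)
    finally show "ennreal (\<tau> ?u powr \<gamma> * exp (- a * (norm (X - t *\<^sub>R ?u))\<^sup>2 - c * (norm V)\<^sup>2)) \<le> \<dots>" .
  qed
  also have "\<dots> = ennreal (2 * (norm V0 + ?q)) * (\<integral>\<^sup>+V. ennreal (norm (V - V0) powr (\<gamma> - 1) * ?e V) \<partial>lborel)"
    by (rule nn_integral_cmult) measurable
  also have "\<dots> \<le> ennreal (2 * (norm V0 + ?q)) * ennreal (singular_const TYPE('b) (\<gamma> - 1) (c / 2))"
    using \<gamma> c by (intro mult_left_mono nn_integral_powr_gaussian) auto
  also have "\<dots> = ennreal (2 * (norm V0 + ?q) * singular_const TYPE('b) (\<gamma> - 1) (c / 2))"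
    using c by (intro ennreal_mult'[symmetric]) auto
  finally show ?thesis .
qed

section \<open>Curves of integrable functions\<close>

lemma L1_class_eq_iff:
  assumes "integrable lborel f" "integrable lborel g"
  shows "L1_class f = L1_class g \<longleftrightarrow> (AE x in lborel. f x = g x)"
proof -
  have "L1_class f = L1_class g \<longleftrightarrow> norm (L1_class f - L1_class g) = 0" by simp
  also have "\<dots> \<longleftrightarrow> (\<integral>x. \<bar>f x - g x\<bar> \<partial>lborel) = 0"
    using assms by (simp add: L1_class_diff[symmetric] norm_L1_class)
  also have "\<dots> \<longleftrightarrow> (AE x in lborel. f x = g x)"
    using assms by (subst integral_nonneg_eq_0_iff_AE) auto
  finally show ?thesis .
qed

lift_definition L1_integral :: "'a::euclidean_space L1 \<Rightarrow> real" is "\<lambda>f. \<integral>x. f x \<partial>lborel"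
  by (rule integral_cong_AE) auto

text \<open>Sets that are not Borel are replaced by the empty set, which makes the restriction a total function.\<close>

lift_definition L1_restrict :: "'a::euclidean_space set \<Rightarrow> 'a L1 \<Rightarrow> 'a L1"
  is "\<lambda>A f x. indicator (if A \<in> sets borel then A else {}) x * f x"
proof -
  fix A :: "'a set" and f g :: "'a \<Rightarrow> real"
  assume H: "integrable lborel f \<and> integrable lborel g \<and> (AE x in lborel. f x = g x)"
  let ?A = "if A \<in> sets borel then A else {}"
  have "?A \<in> sets borel" by simp
  then have "integrable lborel (\<lambda>x. indicator ?A x * h x)" if "integrable lborel h" for h :: "'a \<Rightarrow> real"
    using integrable_mult_indicator[of ?A lborel h] that by simp
  then show "integrable lborel (\<lambda>x. indicator ?A x * f x) \<and> integrable lborel (\<lambda>x. indicator ?A x * g x) \<and>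
      (AE x in lborel. indicator ?A x * f x = indicator ?A x * g x)"
    using H by (auto elim!: eventually_mono)
qed

lemma L1_integral_class: "integrable lborel f \<Longrightarrow> L1_integral (L1_class f) = (\<integral>x. f x \<partial>lborel)"
  by (simp add: L1_class_def L1_integral.abs_eq)

lemma integrable_indicator_mult:
  fixes f :: "'a::euclidean_space \<Rightarrow> real"
  assumes "A \<in> sets borel" "integrable lborel f"
  shows "integrable lborel (\<lambda>x. indicator A x * f x)"
  using integrable_mult_indicator[of A lborel f] assms by simp

lemma L1_restrict_class:
  assumes "A \<in> sets borel" "integrable lborel f"
  shows "L1_restrict A (L1_class f) = L1_class (\<lambda>x. indicator A x * f x)"
  using assms by (simp add: L1_class_def L1_restrict.abs_eq integrable_indicator_mult)

lemma bounded_linear_L1_integral: "bounded_linear L1_integral"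
proof (rule bounded_linear_intro[where K=1])
  fix F G :: "'a L1" and c :: real
  obtain f g where f: "integrable lborel f" "F = L1_class f" and g: "integrable lborel g" "G = L1_class g"
    by (metis L1_class_cases)
  show "L1_integral (F + G) = L1_integral F + L1_integral G"
    using f g by (simp add: L1_class_add[symmetric] L1_integral_class)
  show "L1_integral (c *\<^sub>R F) = c *\<^sub>R L1_integral F"
    using f by (simp add: L1_class_scale[symmetric] L1_integral_class)
  show "norm (L1_integral F) \<le> norm F * 1"
    using f integral_norm_bound[of lborel f] by (simp add: norm_L1_class L1_integral_class)
qed

lemma bounded_linear_L1_restrict:
  assumes A: "A \<in> sets borel"
  shows "bounded_linear (L1_restrict A)"
proof (rule bounded_linear_intro[where K=1])
  fix F G :: "'a L1" and c :: real
  obtain f g where f: "integrable lborel f" "F = L1_class f" and g: "integrable lborel g" "G = L1_class g"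
    by (metis L1_class_cases)
  note i = integrable_indicator_mult[OF A]
  show "L1_restrict A (F + G) = L1_restrict A F + L1_restrict A G"
    using f g A i[OF f(1)] i[OF g(1)]
    by (simp add: L1_class_add[symmetric] L1_restrict_class algebra_simps)
  show "L1_restrict A (c *\<^sub>R F) = c *\<^sub>R L1_restrict A F"
    using f A i[OF f(1)] by (simp add: L1_class_scale[symmetric] L1_restrict_class algebra_simps)
  have "(\<integral>x. \<bar>indicator A x * f x\<bar> \<partial>lborel) \<le> (\<integral>x. \<bar>f x\<bar> \<partial>lborel)"
    by (rule integral_mono[OF integrable_abs[OF i[OF f(1)]] integrable_abs[OF f(1)]]) (simp add: indicator_def)
  then show "norm (L1_restrict A F) \<le> norm F * 1"
    using f A i[OF f(1)] by (simp add: norm_L1_class L1_restrict_class)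
qed

lemma L1_restrict_integral_class:
  assumes "A \<in> sets borel" "integrable lborel f"
  shows "L1_integral (L1_restrict A (L1_class f)) = (\<integral>x. indicator A x * f x \<partial>lborel)"
  using assms by (simp add: L1_restrict_class L1_integral_class integrable_indicator_mult)

text \<open>It suffices to test with the sets where one representative exceeds the other.\<close>

lemma L1_eqI:
  assumes eq: "\<And>A. A \<in> sets borel \<Longrightarrow> L1_integral (L1_restrict A F) = L1_integral (L1_restrict A G)"
  shows "F = G"
proof -
  obtain f g where f: "integrable lborel f" "F = L1_class f" and g: "integrable lborel g" "G = L1_class g"
    by (metis L1_class_cases)
  have [measurable]: "f \<in> borel_measurable borel" "g \<in> borel_measurable borel" using f g by auto
  let ?P = "{x. f x > g x}" and ?N = "{x. f x < g x}"
  have "(\<integral>x. indicator A x * (f x - g x) \<partial>lborel) = 0" if A: "A \<in> sets borel" for A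
    using eq[OF A] f g A integrable_indicator_mult[OF A f(1)] integrable_indicator_mult[OF A g(1)]
    by (simp add: L1_restrict_integral_class right_diff_distrib)
  then have 0: "(\<integral>x. indicator ?P x * (f x - g x) \<partial>lborel) = 0" "(\<integral>x. indicator ?N x * (f x - g x) \<partial>lborel) = 0"
    by simp_all
  have "(\<integral>x. \<bar>f x - g x\<bar> \<partial>lborel) = (\<integral>x. indicator ?P x * (f x - g x) - indicator ?N x * (f x - g x) \<partial>lborel)"
    by (intro Bochner_Integration.integral_cong) (auto simp: indicator_def)
  also have "\<dots> = 0"
    using f g 0 by (subst Bochner_Integration.integral_diff) (auto intro!: integrable_indicator_mult)
  finally show ?thesis using f g by (simp add: L1_class_eq_iff integral_nonneg_eq_0_iff_AE)
qed

text \<open>An open set of classes is a countable union of balls, by Lindelof's theorem, and the distance to the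
  centre of a ball is an integral that depends measurably on the parameter.\<close>

lemma L1_class_borel_measurable:
  fixes f :: "'b \<Rightarrow> 'a::euclidean_space \<Rightarrow> real"
  assumes [measurable]: "case_prod f \<in> borel_measurable (N \<Otimes>\<^sub>M borel)"
    and int: "\<And>s. s \<in> space N \<Longrightarrow> integrable lborel (f s)"
  shows "(\<lambda>s. L1_class (f s)) \<in> borel_measurable N"
proof (rule borel_measurableI)
  fix U :: "'a L1 set" assume U: "open U"
  define B where "B = {ball F r | F r. ball F r \<subseteq> U}"
  have "\<Union>B = U"
  proof (intro equalityI subsetI)
    fix F assume "F \<in> U"
    then obtain e where "0 < e" "ball F e \<subseteq> U" using openE[OF U \<open>F \<in> U\<close>] by blast
    then show "F \<in> \<Union>B" unfolding B_def by (intro UnionI[of "ball F e"]) auto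
  qed (auto simp: B_def)
  obtain B' where B': "B' \<subseteq> B" "countable B'" "\<Union>B' = \<Union>B"
    by (rule Lindelof[of B]) (auto simp: B_def)
  have "(\<lambda>s. L1_class (f s)) -` b \<inter> space N \<in> sets N" if b': "b \<in> B" for b
  proof -
    obtain F r where b: "b = ball F r" using b' unfolding B_def by blast
    obtain g where g: "integrable lborel g" "F = L1_class g" by (metis L1_class_cases)
    have [measurable]: "g \<in> borel_measurable borel" using g by auto
    have "(\<lambda>s. L1_class (f s)) -` b \<inter> space N = {s \<in> space N. (\<integral>x. \<bar>g x - f s x\<bar> \<partial>lborel) < r}"
      using int g by (auto simp: b dist_norm L1_class_diff[symmetric] norm_L1_class)
    also have "\<dots> \<in> sets N" by measurable
    finally show ?thesis .
  qed
  then have "(\<Union>b\<in>B'. (\<lambda>s. L1_class (f s)) -` b \<inter> space N) \<in> sets N"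
    using B' by (intro sets.countable_UN') auto
  also have "(\<Union>b\<in>B'. (\<lambda>s. L1_class (f s)) -` b \<inter> space N) = (\<lambda>s. L1_class (f s)) -` U \<inter> space N"
    using B'(3) \<open>\<Union>B = U\<close> by auto
  finally show "(\<lambda>s. L1_class (f s)) -` U \<inter> space N \<in> sets N" .
qed

lemma set_integrable_lebesgue_bounded:
  fixes D :: "real \<Rightarrow> 'b::{banach, second_countable_topology}"
  assumes "set_borel_measurable lebesgue {a..b} D" and bd: "AE s in lebesgue. s \<in> {a..b} \<longrightarrow> norm (D s) \<le> C"
  shows "set_integrable lebesgue {a..b} D"
  unfolding set_integrable_def
proof (rule integrableI_bounded_set[where A="{a..b}" and B=C])
  show "(\<lambda>x. indicator {a..b} x *\<^sub>R D x) \<in> borel_measurable lebesgue"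
    using assms(1) by (simp add: set_borel_measurable_def)
  show "AE x in lebesgue. x \<in> {a..b} \<longrightarrow> norm (indicator {a..b} x *\<^sub>R D x) \<le> C"
    using bd by eventually_elim auto
  show "emeasure lebesgue {a..b} < \<infinity>"
    by (simp add: emeasure_lborel_Icc_eq)
qed auto

lemma borel_measurable_lebesgueI [intro]:
  "f \<in> borel_measurable borel \<Longrightarrow> f \<in> borel_measurable lebesgue"
  by (rule measurable_completion) simp

context
  fixes d :: "real \<Rightarrow> 'a::euclidean_space \<Rightarrow> real" and q :: "'a \<Rightarrow> real"
  assumes d [measurable]: "case_prod d \<in> borel_measurable (borel \<Otimes>\<^sub>M borel)"
    and q: "integrable lborel q" and bound: "\<And>s z. \<bar>d s z\<bar> \<le> q z"
begin

text \<open>A jointly measurable family with an integrable majorant that does not depend on the parameter defines a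
  bounded measurable curve of classes.\<close>

lemma dominated_slice_integrable: "integrable lborel (d s)"
  by (rule Bochner_Integration.integrable_bound[OF q]) (use bound in \<open>auto intro: order_trans[OF _ abs_ge_self]\<close>)

lemma dominated_curve_measurable: "(\<lambda>s. L1_class (d s)) \<in> borel_measurable borel"
  by (rule L1_class_borel_measurable) (use dominated_slice_integrable in auto)

lemma dominated_curve_norm: "norm (L1_class (d s)) \<le> (\<integral>z. q z \<partial>lborel)"
  using dominated_slice_integrable[of s] q bound by (auto simp: norm_L1_class intro!: integral_mono)

lemma dominated_curve_set_integrable: "set_integrable lebesgue {a..b} (\<lambda>s. L1_class (d s))"
proof (rule set_integrable_lebesgue_bounded)
  show "set_borel_measurable lebesgue {a..b} (\<lambda>s. L1_class (d s))"
    unfolding set_borel_measurable_def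
    using dominated_curve_measurable by (intro borel_measurable_lebesgueI) measurable
qed (use dominated_curve_norm in auto)

lemma dominated_integral_integrable: "integrable lborel (\<lambda>z. LINT s:{a..b}|lborel. d s z)"
proof (rule Bochner_Integration.integrable_bound)
  show "integrable lborel (\<lambda>z. measure lborel {a..b} * q z)" using q by simp
  show "(\<lambda>z. LINT s:{a..b}|lborel. d s z) \<in> borel_measurable lborel"
    unfolding set_lebesgue_integral_def by measurable
  have "\<bar>LINT s:{a..b}|lborel. d s z\<bar> \<le> measure lborel {a..b} * q z" for z
  proof -
    have i: "integrable lborel (\<lambda>s. indicator {a..b} s * q z)"
      by (intro integrable_mult_left integrable_real_indicator) (auto simp: emeasure_lborel_Icc_eq)
    have "norm (LINT s:{a..b}|lborel. d s z) \<le> (LINT s|lborel. indicator {a..b} s * q z)"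
      unfolding set_lebesgue_integral_def
    proof (rule Bochner_Integration.integral_norm_bound_integral)
      show "integrable lborel (\<lambda>s. indicator {a..b} s *\<^sub>R d s z)"
      proof (rule Bochner_Integration.integrable_bound[OF i])
        have "norm (indicator {a..b} s *\<^sub>R d s z) \<le> norm (indicator {a..b} s * q z)" for s
          using bound[of s z] by (simp add: indicator_def)
        then show "AE s in lborel. norm (indicator {a..b} s *\<^sub>R d s z) \<le> norm (indicator {a..b} s * q z)" by simp
      qed measurable
      show "norm (indicator {a..b} s *\<^sub>R d s z) \<le> indicator {a..b} s * q z" for s
        using bound[of s z] by (simp add: indicator_def)
    qed (rule i)
    then show ?thesis by simp
  qed
  then show "AE z in lborel. norm (LINT s:{a..b}|lborel. d s z) \<le> norm (measure lborel {a..b} * q z)"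
    by (intro AE_I2) (metis abs_ge_self order_trans real_norm_def)
qed

text \<open>The Bochner integral of the curve is the class of the pointwise integral: both have the same
  integral over every Borel set, by Fubini.\<close>

lemma dominated_curve_integral:
  "(LINT s:{a..b}|lebesgue. L1_class (d s)) = L1_class (\<lambda>z. LINT s:{a..b}|lborel. d s z)"
proof (rule L1_eqI)
  fix A :: "'a set" assume A [measurable]: "A \<in> sets borel"
  have abound: "\<bar>d s z\<bar> \<le> \<bar>q z\<bar>" for s z using bound[of s z] by linarith
  have bl: "bounded_linear (\<lambda>F. L1_integral (L1_restrict A F))"
    by (rule bounded_linear_compose[OF bounded_linear_L1_integral bounded_linear_L1_restrict[OF A]])
  have "L1_integral (L1_restrict A (LINT s:{a..b}|lebesgue. L1_class (d s))) =
    (LINT s|lebesgue. L1_integral (L1_restrict A (indicator {a..b} s *\<^sub>R L1_class (d s))))"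
    unfolding set_lebesgue_integral_def
    by (rule integral_bounded_linear[OF bl, symmetric])
      (use dominated_curve_set_integrable in \<open>simp add: set_integrable_def\<close>)
  also have "\<dots> = (LINT s|lebesgue. indicator {a..b} s * (\<integral>z. indicator A z * d s z \<partial>lborel))"
    using A dominated_slice_integrable
    by (simp add: linear_cmul[OF bounded_linear.linear[OF bl]] L1_restrict_integral_class)
  also have "\<dots> = (LINT s|lborel. indicator {a..b} s * (\<integral>z. indicator A z * d s z \<partial>lborel))"
    by (rule integral_completion) measurable
  also have "\<dots> = (LINT s|lborel. (\<integral>z. indicator A z * (indicator {a..b} s * d s z) \<partial>lborel))"
    by (intro Bochner_Integration.integral_cong refl) (simp add: mult.left_commute[of "indicator A _"])
  also have "\<dots> = (\<integral>z. (LINT s|lborel. indicator A z * (indicator {a..b} s * d s z)) \<partial>lborel)"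
  proof (rule lborel_pair.Fubini_integral[symmetric])
    show "integrable (lborel \<Otimes>\<^sub>M lborel) (\<lambda>(s, z). indicator A z * (indicator {a..b} s * d s z))"
    proof (rule Bochner_Integration.integrable_bound)
      show "integrable (lborel \<Otimes>\<^sub>M lborel) (\<lambda>(s, z). indicator {a..b} s * q z)"
        using q by (intro lborel_pair.Fubini_integrable) (auto simp: abs_mult emeasure_lborel_Icc_eq intro!: integrable_mult_left)
      show "AE x in lborel \<Otimes>\<^sub>M lborel. norm (case x of (s, z) \<Rightarrow> indicator A z * (indicator {a..b} s * d s z))
        \<le> norm (case x of (s, z) \<Rightarrow> indicator {a..b} s * q z)"
        using abound by (intro AE_I2) (auto simp: indicator_def)
    qed measurable
  qed
  also have "\<dots> = (\<integral>z. indicator A z * (LINT s:{a..b}|lborel. d s z) \<partial>lborel)"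
    by (simp add: set_lebesgue_integral_def)
  also have "\<dots> = L1_integral (L1_restrict A (L1_class (\<lambda>z. LINT s:{a..b}|lborel. d s z)))"
    using A dominated_integral_integrable by (simp add: L1_restrict_integral_class)
  finally show "L1_integral (L1_restrict A (LINT s:{a..b}|lebesgue. L1_class (d s))) = \<dots>" .
qed

end

lemma time_int_mono: "t \<in> time_int T \<Longrightarrow> 0 \<le> s \<Longrightarrow> s \<le> t \<Longrightarrow> s \<in> time_int T"
  using order.strict_trans1[of "ereal s" "ereal t" T] by (auto simp: time_int_def)

lemma zero_in_time_int: "t \<in> time_int T \<Longrightarrow> 0 \<in> time_int T"
  by (rule time_int_mono) (auto simp: time_int_def)

text \<open>The differential equation \<open>y' = D\<close> for classes, in integrated form. The values of \<open>y\<close> are functions and those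
  of \<open>D\<close> classes, because the right-hand sides are known only as elements of \<open>L\<^sup>1\<close> for almost every time.\<close>

definition evolves :: "ereal \<Rightarrow> (real \<Rightarrow> 'a::euclidean_space \<Rightarrow> real) \<Rightarrow> (real \<Rightarrow> 'a L1) \<Rightarrow> bool"
  where "evolves T y D \<longleftrightarrow> (\<forall>t\<in>time_int T. integrable lborel (y t) \<and> set_integrable lebesgue {0..t} D \<and>
    L1_class (y t) = L1_class (y 0) + (LINT s:{0..t}|lebesgue. D s))"

lemma evolves_diff:
  assumes "evolves T y D" "evolves T y' D'"
  shows "evolves T (\<lambda>t z. y t z - y' t z) (\<lambda>t. D t - D' t)"
  unfolding evolves_def
proof (intro ballI conjI)
  fix t assume t: "t \<in> time_int T"
  then have 0: "0 \<in> time_int T" by (rule zero_in_time_int)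
  note e = assms[unfolded evolves_def, rule_format, OF t] and e0 = assms[unfolded evolves_def, rule_format, OF 0]
  show "integrable lborel (\<lambda>z. y t z - y' t z)" using e by auto
  show "set_integrable lebesgue {0..t} (\<lambda>t. D t - D' t)" using e by (intro set_integral_diff) auto
  have "(LINT s:{0..t}|lebesgue. D s - D' s) = (LINT s:{0..t}|lebesgue. D s) - (LINT s:{0..t}|lebesgue. D' s)"
    using e by (intro set_integral_diff) auto
  then show "L1_class (\<lambda>z. y t z - y' t z) = L1_class (\<lambda>z. y 0 z - y' 0 z) + (LINT s:{0..t}|lebesgue. D s - D' s)"
    using e e0 by (simp add: L1_class_diff)
qed

lemma L1_class_AE_0: "integrable lborel f \<Longrightarrow> (AE z in lborel. f z = 0) \<Longrightarrow> L1_class f = 0"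
  using L1_class_eq_iff[of f "\<lambda>_. 0"] by (simp add: L1_class_def zero_L1.abs_eq)

lemma set_integral_power:
  assumes "0 \<le> t"
  shows "set_integrable lebesgue {0..t} (\<lambda>s. s ^ j)" "(LINT s:{0..t}|lebesgue. s ^ j) = t ^ Suc j / real (Suc j)"
proof -
  have m: "(\<lambda>s::real. indicator {0..t} s *\<^sub>R s ^ j) \<in> borel_measurable lborel" by measurable
  have 1: "set_integrable lborel {0..t} (\<lambda>s. s ^ j)"
    by (intro borel_integrable_atLeastAtMost') (auto intro!: continuous_intros)
  then show "set_integrable lebesgue {0..t} (\<lambda>s. s ^ j)"
    unfolding set_integrable_def using m by (simp add: integrable_completion)
  have "(LINT s:{0..t}|lebesgue. s ^ j) = (LINT s:{0..t}|lborel. s ^ j)"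
    unfolding set_lebesgue_integral_def by (rule integral_completion[OF m])
  also have "\<dots> = t ^ Suc j / real (Suc j) - 0 ^ Suc j / real (Suc j)"
    unfolding set_lebesgue_integral_def
  proof (rule integral_FTC_Icc[OF assms])
    show "((\<lambda>s. s ^ Suc j / real (Suc j)) has_vector_derivative x ^ j) (at x within {0..t})" for x
      using DERIV_cdivide[OF DERIV_pow[of "Suc j" x "{0..t}"], of "real (Suc j)"]
      by (simp add: has_real_derivative_iff_has_vector_derivative)
  qed (auto intro!: continuous_intros)
  finally show "(LINT s:{0..t}|lebesgue. s ^ j) = t ^ Suc j / real (Suc j)" by simp
qed

text \<open>Where the rate \<open>\<rho>\<close> is at most \<open>N\<close>, Gronwall's argument bounds the mass by
  \<open>(N t)\<^sup>j / j!\<close> for every \<open>j\<close>; these sets exhaust the space although \<open>\<rho>\<close> is unbounded.\<close>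

lemma evolves_eq_zero:
  fixes w :: "real \<Rightarrow> 'a::euclidean_space \<Rightarrow> real"
  assumes ev: "evolves T w D" and w0: "AE z in lborel. w 0 z = 0" and [measurable]: "\<rho> \<in> borel_measurable borel"
    and D: "AE s in lebesgue. s \<in> time_int T \<longrightarrow>
      (\<exists>d. integrable lborel d \<and> D s = L1_class d \<and> (AE z in lborel. \<bar>d z\<bar> \<le> \<rho> z * \<bar>w s z\<bar>))"
    and t: "t \<in> time_int T"
  shows "AE z in lborel. w t z = 0"
proof -
  note e = ev[unfolded evolves_def, rule_format]
  have wt: "integrable lborel (w t)" using e[OF t] by simp
  have w00: "L1_class (w 0) = 0" using e[OF zero_in_time_int[OF t]] w0 by (intro L1_class_AE_0) auto
  have main: "AE z in lborel. \<rho> z \<le> real N \<longrightarrow> w t z = 0" for N :: nat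
  proof -
    define A where "A = {z. \<rho> z \<le> real N}"
    have A [measurable]: "A \<in> sets borel" unfolding A_def by measurable
    note bl = bounded_linear_L1_restrict[OF A]
    define U where "U s = norm (L1_restrict A (L1_class (w s)))" for s
    define B where "B = (LINT s:{0..t}|lebesgue. norm (L1_restrict A (D s)))"
    have rD: "set_integrable lebesgue {0..s} (\<lambda>s. norm (L1_restrict A (D s)))" if "s \<in> time_int T" for s
    proof -
      have "integrable lebesgue (\<lambda>r. L1_restrict A (indicator {0..s} r *\<^sub>R D r))"
        by (rule integrable_bounded_linear[OF bl]) (use e[OF that] in \<open>simp add: set_integrable_def\<close>)
      then have "integrable lebesgue (\<lambda>r. norm (L1_restrict A (indicator {0..s} r *\<^sub>R D r)))" by auto
      then show ?thesis unfolding set_integrable_def by (simp add: linear_cmul[OF bounded_linear.linear[OF bl]])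
    qed
    have U: "U s \<le> (LINT r:{0..s}|lebesgue. norm (L1_restrict A (D r)))" if "s \<in> time_int T" for s
    proof -
      have "L1_restrict A (L1_class (w s)) = (LINT r|lebesgue. L1_restrict A (indicator {0..s} r *\<^sub>R D r))"
        using e[OF that] unfolding set_lebesgue_integral_def set_integrable_def
        by (simp add: w00 integral_bounded_linear[OF bl])
      then have "U s \<le> (LINT r|lebesgue. norm (L1_restrict A (indicator {0..s} r *\<^sub>R D r)))"
        unfolding U_def by simp
      then show ?thesis unfolding set_lebesgue_integral_def by (simp add: linear_cmul[OF bounded_linear.linear[OF bl]])
    qed
    have rate: "AE s in lebesgue. s \<in> time_int T \<longrightarrow> norm (L1_restrict A (D s)) \<le> real N * U s"
      using D
    proof eventually_elim
      case (elim s)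
      show ?case
      proof
        assume s: "s \<in> time_int T"
        then obtain d where d: "integrable lborel d" "D s = L1_class d" "AE z in lborel. \<bar>d z\<bar> \<le> \<rho> z * \<bar>w s z\<bar>"
          using elim by blast
        have ws: "integrable lborel (w s)" using e[OF s] by simp
        have "norm (L1_restrict A (D s)) = (\<integral>z. \<bar>indicator A z * d z\<bar> \<partial>lborel)"
          using d by (simp add: L1_restrict_class norm_L1_class integrable_indicator_mult)
        also have "\<dots> \<le> (\<integral>z. real N * \<bar>indicator A z * w s z\<bar> \<partial>lborel)"
        proof (rule integral_mono_AE)
          show "AE z in lborel. \<bar>indicator A z * d z\<bar> \<le> real N * \<bar>indicator A z * w s z\<bar>"
            using d(3)
          proof eventually_elim
            case (elim z)
            show ?case
            proof (cases "z \<in> A")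
              case True
              then have "\<rho> z * \<bar>w s z\<bar> \<le> real N * \<bar>w s z\<bar>" by (intro mult_right_mono) (auto simp: A_def)
              then show ?thesis using elim True by simp
            qed simp
          qed
        qed (use integrable_indicator_mult[OF A d(1)] integrable_indicator_mult[OF A ws] in auto)
        also have "\<dots> = real N * U s"
          unfolding U_def using ws by (simp add: L1_restrict_class norm_L1_class integrable_indicator_mult)
        finally show "norm (L1_restrict A (D s)) \<le> real N * U s" .
      qed
    qed
    have iter: "U s \<le> B * (real N * s) ^ j / fact j" if "0 \<le> s" "s \<le> t" for s j
      using that
    proof (induction j arbitrary: s)
      case 0
      have s: "s \<in> time_int T" using 0 time_int_mono[OF t] by simp
      have "(LINT r:{0..s}|lebesgue. norm (L1_restrict A (D r))) \<le> B"
        unfolding B_def set_lebesgue_integral_def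
        by (rule integral_mono) (use rD[OF s] rD[OF t] 0 in \<open>auto simp: set_integrable_def indicator_def\<close>)
      then show ?case using U[OF s] by simp
    next
      case (Suc j)
      have s: "s \<in> time_int T" using Suc time_int_mono[OF t] by simp
      let ?c = "real N * (B * real N ^ j / fact j)"
      have "(LINT r:{0..s}|lebesgue. norm (L1_restrict A (D r))) \<le> (LINT r:{0..s}|lebesgue. ?c * r ^ j)"
        unfolding set_lebesgue_integral_def
      proof (rule integral_mono_AE)
        show "integrable lebesgue (\<lambda>r. indicator {0..s} r *\<^sub>R (?c * r ^ j))"
          using set_integrable_mult_right[OF set_integral_power(1)[OF \<open>0 \<le> s\<close>, of j], of ?c]
          by (simp only: set_integrable_def)
        show "AE r in lebesgue. indicator {0..s} r *\<^sub>R norm (L1_restrict A (D r)) \<le> indicator {0..s} r *\<^sub>R (?c * r ^ j)"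
          using rate
        proof eventually_elim
          case (elim r)
          show ?case
          proof (cases "r \<in> {0..s}")
            case True
            then have "norm (L1_restrict A (D r)) \<le> real N * U r"
              using elim time_int_mono[OF s] by auto
            also have "\<dots> \<le> real N * (B * (real N * r) ^ j / fact j)"
              using Suc.IH[of r] True Suc.prems by (intro mult_left_mono) auto
            finally show ?thesis using True by (simp add: power_mult_distrib mult_ac)
          qed simp
        qed
      qed (use rD[OF s] in \<open>simp add: set_integrable_def\<close>)
      also have "\<dots> = ?c * (s ^ Suc j / real (Suc j))"
        using Suc.prems by (simp add: set_integral_power(2)[simplified])
      also have "\<dots> = B * (real N * s) ^ Suc j / fact (Suc j)"
        by (simp add: power_mult_distrib field_simps)
      finally show ?case using U[OF s] by simp
    qed
    have "(\<lambda>j. B * (inverse (fact j) * (real N * t) ^ j)) \<longlonglongrightarrow> B * 0"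
      by (intro tendsto_mult_left summable_LIMSEQ_zero summable_exp)
    then have "U t \<le> B * 0"
      by (rule LIMSEQ_le_const) (use iter[of t] t in \<open>auto simp: time_int_def divide_inverse mult_ac\<close>)
    then have "norm (L1_restrict A (L1_class (w t))) = 0" unfolding U_def by simp
    then have "(\<integral>z. \<bar>indicator A z * w t z\<bar> \<partial>lborel) = 0"
      using wt by (simp add: L1_restrict_class norm_L1_class integrable_indicator_mult del: norm_eq_zero)
    then have "AE z in lborel. indicator A z * w t z = 0"
      using integrable_indicator_mult[OF A wt] by (subst (asm) integral_nonneg_eq_0_iff_AE) auto
    then show ?thesis by eventually_elim (auto simp: A_def)
  qed
  then have "AE z in lborel. \<forall>N::nat. \<rho> z \<le> real N \<longrightarrow> w t z = 0"
    by (subst AE_all_countable) blast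
  then show ?thesis by eventually_elim (use real_arch_simple in blast)
qed

text \<open>Testing the integral equation with Borel sets and exchanging the integrals gives the bound integrated
  over every Borel set; the sets where \<open>w t\<close> or \<open>- w t\<close> exceeds \<open>Q\<close> then have measure zero.\<close>

lemma evolves_bound:
  fixes w :: "real \<Rightarrow> 'a::euclidean_space \<Rightarrow> real"
  assumes ev: "evolves T w D" and w0: "AE z in lborel. w 0 z = 0"
    and q [measurable]: "case_prod q \<in> borel_measurable (borel \<Otimes>\<^sub>M borel)"
    and D: "AE s in lebesgue. s \<in> {0..t} \<longrightarrow>
      (\<exists>d. integrable lborel d \<and> D s = L1_class d \<and> (AE z in lborel. \<bar>d z\<bar> \<le> q s z))"
    and t: "t \<in> time_int T" and Q: "integrable lborel Q" "\<And>z. 0 \<le> Q z"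
    and qQ: "AE z in lborel. (\<integral>\<^sup>+s. ennreal (q s z) * indicator {0..t} s \<partial>lborel) \<le> ennreal (Q z)"
  shows "AE z in lborel. \<bar>w t z\<bar> \<le> Q z"
proof -
  note e = ev[unfolded evolves_def, rule_format]
  have w00: "L1_class (w 0) = 0" using e[OF zero_in_time_int[OF t]] w0 by (intro L1_class_AE_0) auto
  have wt: "integrable lborel (w t)" using e[OF t] by simp
  have [measurable]: "w t \<in> borel_measurable borel" "Q \<in> borel_measurable borel" using wt Q(1) by auto
  have set_bound: "\<bar>\<integral>z. indicator A z * w t z \<partial>lborel\<bar> \<le> (\<integral>z. indicator A z * Q z \<partial>lborel)"
    if A [measurable]: "A \<in> sets borel" for A
  proof -
    have bl: "bounded_linear (\<lambda>F. L1_integral (L1_restrict A F))"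
      by (rule bounded_linear_compose[OF bounded_linear_L1_integral bounded_linear_L1_restrict[OF A]])
    let ?h = "\<lambda>s. L1_integral (L1_restrict A (indicator {0..t} s *\<^sub>R D s))"
    have int: "integrable lebesgue (\<lambda>s. indicator {0..t} s *\<^sub>R D s)" using e[OF t] by (simp add: set_integrable_def)
    have "(\<integral>z. indicator A z * w t z \<partial>lborel) = L1_integral (L1_restrict A (LINT s:{0..t}|lebesgue. D s))"
      using e[OF t] w00 wt by (simp add: L1_restrict_integral_class[symmetric])
    also have "\<dots> = (LINT s|lebesgue. ?h s)"
      unfolding set_lebesgue_integral_def by (rule integral_bounded_linear[OF bl int, symmetric])
    finally have "ennreal \<bar>\<integral>z. indicator A z * w t z \<partial>lborel\<bar> \<le> (\<integral>\<^sup>+s. ennreal (norm (?h s)) \<partial>lebesgue)"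
      using integral_norm_bound_ennreal[OF integrable_bounded_linear[OF bl int]] by simp
    also have "\<dots> \<le> (\<integral>\<^sup>+s. (\<integral>\<^sup>+z. indicator A z * (ennreal (q s z) * indicator {0..t} s) \<partial>lborel) \<partial>lebesgue)"
    proof (rule nn_integral_mono_AE, use D in eventually_elim)
      case (elim s)
      show ?case
      proof (cases "s \<in> {0..t}")
        case True
        then obtain d where d: "integrable lborel d" "D s = L1_class d" "AE z in lborel. \<bar>d z\<bar> \<le> q s z"
          using elim by blast
        have "ennreal (norm (?h s)) = ennreal \<bar>\<integral>z. indicator A z * d z \<partial>lborel\<bar>"
          using True d by (simp add: L1_restrict_integral_class)
        also have "\<dots> \<le> (\<integral>\<^sup>+z. ennreal (norm (indicator A z * d z)) \<partial>lborel)"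
          using integral_norm_bound_ennreal[OF integrable_indicator_mult[OF A d(1)]] by simp
        also have "\<dots> \<le> (\<integral>\<^sup>+z. indicator A z * (ennreal (q s z) * indicator {0..t} s) \<partial>lborel)"
        proof (rule nn_integral_mono_AE, use d(3) in eventually_elim)
          case (elim z)
          then show ?case using True by (auto simp: indicator_def ennreal_leI)
        qed
        finally show ?thesis .
      next
        case False
        then show ?thesis using linear_0[OF bounded_linear.linear[OF bl]] by simp
      qed
    qed
    also have "\<dots> = (\<integral>\<^sup>+s. (\<integral>\<^sup>+z. indicator A z * (ennreal (q s z) * indicator {0..t} s) \<partial>lborel) \<partial>lborel)"
      by (rule nn_integral_completion)
    also have "\<dots> = (\<integral>\<^sup>+z. (\<integral>\<^sup>+s. indicator A z * (ennreal (q s z) * indicator {0..t} s) \<partial>lborel) \<partial>lborel)"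
      by (rule lborel_pair.Fubini'[symmetric]) measurable
    also have "\<dots> = (\<integral>\<^sup>+z. indicator A z * (\<integral>\<^sup>+s. ennreal (q s z) * indicator {0..t} s \<partial>lborel) \<partial>lborel)"
      by (simp add: nn_integral_cmult)
    also have "\<dots> \<le> (\<integral>\<^sup>+z. ennreal (indicator A z * Q z) \<partial>lborel)"
      using qQ by (intro nn_integral_mono_AE, eventually_elim) (auto simp: indicator_def)
    also have "\<dots> = ennreal (\<integral>z. indicator A z * Q z \<partial>lborel)"
      using Q by (intro nn_integral_eq_integral integrable_indicator_mult) auto
    finally show ?thesis
      using Q by (subst (asm) ennreal_le_iff) (auto intro!: Bochner_Integration.integral_nonneg)
  qed
  have half: "AE z in lborel. s * w t z \<le> Q z" if s: "s = 1 \<or> s = -1" for s :: real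
  proof -
    define A where "A = {z. s * w t z > Q z}"
    have A [measurable]: "A \<in> sets borel" unfolding A_def by measurable
    have i: "integrable lborel (\<lambda>z. indicator A z * w t z)" "integrable lborel (\<lambda>z. indicator A z * Q z)"
      using wt Q by (auto intro: integrable_indicator_mult)
    have "s * (\<integral>z. indicator A z * w t z \<partial>lborel) \<le> (\<integral>z. indicator A z * Q z \<partial>lborel)"
      using set_bound[OF A] s by auto
    then have "(\<integral>z. indicator A z * (s * w t z - Q z) \<partial>lborel) \<le> 0"
      using i by (simp add: right_diff_distrib mult.left_commute)
    moreover have "(\<integral>z. indicator A z * (s * w t z - Q z) \<partial>lborel) \<ge> 0"
      by (rule Bochner_Integration.integral_nonneg) (auto simp: A_def indicator_def)
    ultimately have "(\<integral>z. indicator A z * (s * w t z - Q z) \<partial>lborel) = 0" by simp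
    moreover have "integrable lborel (\<lambda>z. indicator A z * (s * w t z - Q z))"
      by (rule integrable_indicator_mult[OF A]) (use wt Q in auto)
    moreover have "AE z in lborel. 0 \<le> indicator A z * (s * w t z - Q z)"
      by (auto simp: A_def indicator_def)
    ultimately have "AE z in lborel. indicator A z * (s * w t z - Q z) = 0"
      by (metis integral_nonneg_eq_0_iff_AE)
    then show ?thesis by eventually_elim (auto simp: A_def indicator_def split: if_splits)
  qed
  show ?thesis using half[of 1] half[of "-1"] by auto
qed

section \<open>Weak derivatives and integral equations\<close>

text \<open>The functions of this class are infinitely differentiable because the class is closed under
  differentiation; it contains a smooth step function.\<close>

inductive_set smooth_class :: "(real \<Rightarrow> real) set" where
  flat: "(\<lambda>x. if 0 < x then exp (- 1 / x) / x ^ n else 0) \<in> smooth_class"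
| const: "(\<lambda>x. c) \<in> smooth_class"
| add: "f \<in> smooth_class \<Longrightarrow> g \<in> smooth_class \<Longrightarrow> (\<lambda>x. f x + g x) \<in> smooth_class"
| mult: "f \<in> smooth_class \<Longrightarrow> g \<in> smooth_class \<Longrightarrow> (\<lambda>x. f x * g x) \<in> smooth_class"
| inverse: "f \<in> smooth_class \<Longrightarrow> (\<And>x. f x \<noteq> 0) \<Longrightarrow> (\<lambda>x. inverse (f x)) \<in> smooth_class"
| affine: "f \<in> smooth_class \<Longrightarrow> (\<lambda>x. f (a * x + b)) \<in> smooth_class"

lemma exp_inverse_power_tendsto_0: "((\<lambda>x::real. exp (- 1 / x) / x ^ n) \<longlongrightarrow> 0) (at_right 0)"
proof -
  have "((\<lambda>y::real. y ^ n / exp y) \<longlongrightarrow> 0) at_top" by (rule tendsto_power_div_exp_0)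
  then have "((\<lambda>x::real. inverse x ^ n / exp (inverse x)) \<longlongrightarrow> 0) (at_right 0)"
    by (rule filterlim_compose) (rule filterlim_inverse_at_top_right)
  moreover have "inverse x ^ n / exp (inverse x) = exp (- 1 / x) / x ^ n" for x :: real
    by (simp add: exp_minus divide_inverse power_inverse)
  ultimately show ?thesis by simp
qed

lemma flat_has_derivative:
  fixes n :: nat
  defines "f \<equiv> \<lambda>x::real. if 0 < x then exp (- 1 / x) / x ^ n else 0"
  shows "(f has_real_derivative
    (if 0 < x then exp (- 1 / x) / x ^ (n + 2) else 0) + - real n * (if 0 < x then exp (- 1 / x) / x ^ (n + 1) else 0)) (at x)"
proof (cases x "0::real" rule: linorder_cases)
  case less
  have "((\<lambda>x. 0) has_real_derivative 0) (at x)" by simp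
  then have "(f has_real_derivative 0) (at x)"
    by (rule has_field_derivative_transform_within_open[where S="{..<0}"])
      (use less in \<open>auto simp: f_def\<close>)
  then show ?thesis using less by simp
next
  case equal
  have "((\<lambda>y. (f y - f 0) / (y - 0)) \<longlongrightarrow> 0) (at 0)"
  proof (rule filterlim_split_at_real)
    have "eventually (\<lambda>y. (f y - f 0) / (y - 0) = 0) (at_left (0::real))"
      by (auto simp: eventually_at_left_field f_def intro!: exI[of _ "-1"])
    then show "((\<lambda>y. (f y - f 0) / (y - 0)) \<longlongrightarrow> 0) (at_left 0)" by (rule tendsto_eventually)
    have "eventually (\<lambda>y. exp (- 1 / y) / y ^ (n + 1) = (f y - f 0) / (y - 0)) (at_right (0::real))"
      by (auto simp: eventually_at_right_field f_def intro!: exI[of _ 1])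
    then show "((\<lambda>y. (f y - f 0) / (y - 0)) \<longlongrightarrow> 0) (at_right 0)"
      by (rule Lim_transform_eventually[OF exp_inverse_power_tendsto_0])
  qed
  then show ?thesis unfolding equal by (simp add: has_field_derivative_iff)
next
  case greater
  have "((\<lambda>x. exp (- 1 / x) / x ^ n) has_real_derivative
    (exp (- 1 / x) * (1 / x\<^sup>2) * x ^ n - exp (- 1 / x) * (real n * x ^ (n - 1))) / (x ^ n * x ^ n)) (at x)"
    using greater by (auto intro!: derivative_eq_intros simp: power2_eq_square)
  also have "(exp (- 1 / x) * (1 / x\<^sup>2) * x ^ n - exp (- 1 / x) * (real n * x ^ (n - 1))) / (x ^ n * x ^ n) =
    exp (- 1 / x) / x ^ (n + 2) + - real n * (exp (- 1 / x) / x ^ (n + 1))"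
    using greater by (cases n) (auto simp: field_simps power2_eq_square)
  finally have "((\<lambda>x. exp (- 1 / x) / x ^ n) has_real_derivative
    exp (- 1 / x) / x ^ (n + 2) + - real n * (exp (- 1 / x) / x ^ (n + 1))) (at x)" .
  then have "(f has_real_derivative exp (- 1 / x) / x ^ (n + 2) + - real n * (exp (- 1 / x) / x ^ (n + 1))) (at x)"
    by (rule has_field_derivative_transform_within_open[where S="{0<..}"]) (use greater in \<open>auto simp: f_def\<close>)
  then show ?thesis using greater by simp
qed

lemma smooth_class_derivative:
  "f \<in> smooth_class \<Longrightarrow> \<exists>f'\<in>smooth_class. \<forall>x. (f has_real_derivative f' x) (at x)"
proof (induction rule: smooth_class.induct)
  case (flat n)
  show ?case
    by (intro bexI[OF _ smooth_class.add[OF smooth_class.flat[of "n + 2"] smooth_class.mult[OF smooth_class.const[of "- real n"] smooth_class.flat[of "n + 1"]]]] allI)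
      (rule flat_has_derivative)
next
  case (const c)
  show ?case by (intro bexI[OF _ smooth_class.const[of 0]]) simp
next
  case (add f g)
  then obtain f' g' where "f' \<in> smooth_class" "g' \<in> smooth_class"
    "\<And>x. (f has_real_derivative f' x) (at x)" "\<And>x. (g has_real_derivative g' x) (at x)" by blast
  then show ?case
    by (intro bexI[of _ "\<lambda>x. f' x + g' x"]) (auto intro!: derivative_eq_intros smooth_class.intros)
next
  case (mult f g)
  then obtain f' g' where "f' \<in> smooth_class" "g' \<in> smooth_class"
    "\<And>x. (f has_real_derivative f' x) (at x)" "\<And>x. (g has_real_derivative g' x) (at x)" by blast
  then show ?case using mult
    by (intro bexI[of _ "\<lambda>x. f' x * g x + f x * g' x"])
      (auto intro!: derivative_eq_intros smooth_class.add smooth_class.mult)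
next
  case (inverse f)
  then obtain f' where f': "f' \<in> smooth_class" "\<And>x. (f has_real_derivative f' x) (at x)" by blast
  have m: "(\<lambda>x. (- 1) * (inverse (f x) * f' x * inverse (f x))) \<in> smooth_class"
    by (intro smooth_class.mult smooth_class.const smooth_class.inverse inverse.hyps f')
  have "((\<lambda>x. inverse (f x)) has_real_derivative (- 1) * (inverse (f x) * f' x * inverse (f x))) (at x)" for x
    using f'(2)[of x] inverse.hyps(2)[of x] by (auto intro!: derivative_eq_intros)
  then show ?case by (intro bexI[OF _ m] allI)
next
  case (affine f a b)
  then obtain f' where f': "f' \<in> smooth_class" "\<And>x. (f has_real_derivative f' x) (at x)" by blast
  have "((\<lambda>x. f (a * x + b)) has_real_derivative f' (a * x + b) * a) (at x)" for x
    by (rule DERIV_chain2[OF f'(2)]) (auto intro!: derivative_eq_intros)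
  then show ?case
    by (intro bexI[of _ "\<lambda>x. f' (a * x + b) * a"]) (auto intro!: smooth_class.intros f'(1))
qed

lemma smooth_class_deriv: "f \<in> smooth_class \<Longrightarrow> deriv f \<in> smooth_class"
  using smooth_class_derivative[of f] DERIV_imp_deriv by (metis ext)

lemma smooth_class_differentiable:
  assumes "f \<in> smooth_class"
  shows "((deriv ^^ n) f) differentiable (at t)"
proof -
  have "(deriv ^^ n) f \<in> smooth_class"
    using assms by (induction n) (auto intro: smooth_class_deriv)
  then show ?thesis using smooth_class_derivative real_differentiable_def by blast
qed

definition flat_fun :: "real \<Rightarrow> real"
  where "flat_fun x = (if 0 < x then exp (- 1 / x) / x ^ 0 else 0)"

text \<open>A smooth function that increases from \<open>0\<close> to \<open>1\<close> on the unit interval.\<close>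

definition smooth_step :: "real \<Rightarrow> real"
  where "smooth_step x = flat_fun x * inverse (flat_fun x + flat_fun ((- 1) * x + 1))"

lemma smooth_step_class: "smooth_step \<in> smooth_class"
proof -
  have f: "flat_fun \<in> smooth_class" using smooth_class.flat[of 0] by (simp add: flat_fun_def[abs_def])
  have pos: "flat_fun x + flat_fun ((- 1) * x + 1) \<noteq> 0" for x
    by (auto simp: flat_fun_def) (metis add_pos_pos exp_gt_zero less_irrefl)
  show ?thesis unfolding smooth_step_def[abs_def]
    by (intro smooth_class.mult smooth_class.inverse smooth_class.add smooth_class.affine f pos)
qed

lemma smooth_step_0: "x \<le> 0 \<Longrightarrow> smooth_step x = 0"
  by (simp add: smooth_step_def flat_fun_def)

lemma smooth_step_1: "1 \<le> x \<Longrightarrow> smooth_step x = 1"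
  by (simp add: smooth_step_def flat_fun_def)

lemma smooth_step_bounds: "0 \<le> smooth_step x" "smooth_step x \<le> 1"
proof -
  have "0 \<le> flat_fun y" for y by (simp add: flat_fun_def)
  then show "0 \<le> smooth_step x" "smooth_step x \<le> 1"
    unfolding smooth_step_def by (auto simp: divide_inverse[symmetric] divide_le_eq_1 intro!: add_nonneg_nonneg divide_nonneg_nonneg)
      (smt (verit))+
qed

lemma smooth_step_mono: "x \<le> y \<Longrightarrow> smooth_step x \<le> smooth_step y"
proof -
  assume xy: "x \<le> y"
  have nn: "0 \<le> flat_fun y" for y by (simp add: flat_fun_def)
  have fm: "flat_fun x \<le> flat_fun y" if "x \<le> y" for x y
    using that by (auto simp: flat_fun_def divide_left_mono)
  show ?thesis
  proof (cases "x \<le> 0")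
    case True
    then show ?thesis using smooth_step_0[of x] smooth_step_bounds(1)[of y] by simp
  next
    case False
    have pos: "flat_fun z > 0" if "z > 0" for z using that by (simp add: flat_fun_def)
    have p: "flat_fun x > 0" "flat_fun y > 0" using False xy by (auto intro: pos)
    have "flat_fun x * flat_fun ((- 1) * y + 1) \<le> flat_fun y * flat_fun ((- 1) * x + 1)"
      using xy by (intro mult_mono fm) (auto simp: nn)
    then show ?thesis
      unfolding smooth_step_def divide_inverse[symmetric] using p nn
      by (subst frac_le_eq) (auto simp: add_pos_nonneg algebra_simps intro!: divide_nonpos_pos mult_pos_pos add_pos_nonneg less_imp_neq[symmetric])
  qed
qed

lemma has_real_derivative_deriv_smooth: "f \<in> smooth_class \<Longrightarrow> (f has_real_derivative deriv f x) (at x)"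
  using smooth_class_derivative DERIV_imp_deriv by metis

lemma continuous_on_deriv_smooth: "f \<in> smooth_class \<Longrightarrow> continuous_on S (deriv f)"
  using has_real_derivative_deriv_smooth[OF smooth_class_deriv]
  by (intro continuous_at_imp_continuous_on ballI DERIV_isCont) auto

lemma deriv_smooth_step_nonneg: "0 \<le> deriv smooth_step x"
proof (rule ccontr)
  assume "\<not> 0 \<le> deriv smooth_step x"
  then obtain d where "0 < d" "\<And>h. 0 < h \<Longrightarrow> h < d \<Longrightarrow> smooth_step (x + h) < smooth_step x"
    using DERIV_neg_dec_right[OF has_real_derivative_deriv_smooth[OF smooth_step_class, of x]] by auto
  then have "smooth_step (x + d / 2) < smooth_step x" by simp
  then show False using smooth_step_mono[of x "x + d / 2"] \<open>0 < d\<close> by simp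
qed

lemma deriv_smooth_step_0:
  assumes "x < 0 \<or> 1 < x"
  shows "deriv smooth_step x = 0"
proof -
  have "(smooth_step has_real_derivative 0) (at x)"
  proof (cases "x < 0")
    case True
    show ?thesis
      by (rule has_field_derivative_transform_within_open[where S="{..<0}" and f="\<lambda>_. 0"])
        (use True in \<open>auto simp: smooth_step_0\<close>)
  next
    case False
    show ?thesis
      by (rule has_field_derivative_transform_within_open[where S="{1<..}" and f="\<lambda>_. 1"])
        (use False assms in \<open>auto simp: smooth_step_1\<close>)
  qed
  then show ?thesis by (rule DERIV_imp_deriv)
qed

lemma set_integrable_scaleR_continuous:
  fixes F :: "real \<Rightarrow> 'b::{banach, second_countable_topology}"
  assumes F: "set_integrable lebesgue {a..b} F" and g: "continuous_on UNIV g"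
  shows "set_integrable lebesgue {a..b} (\<lambda>t. g t *\<^sub>R F t)"
proof -
  have "bounded (g ` {a..b})"
    by (intro compact_imp_bounded compact_continuous_image continuous_on_subset[OF g]) auto
  then obtain K where "\<forall>t\<in>{a..b}. \<bar>g t\<bar> \<le> K" by (auto simp: bounded_iff)
  then have K: "\<And>t. t \<in> {a..b} \<Longrightarrow> \<bar>g t\<bar> \<le> K" by blast
  have [measurable]: "g \<in> borel_measurable borel" using g by (rule borel_measurable_continuous_onI)
  have gl: "g \<in> borel_measurable lebesgue" by (rule borel_measurable_lebesgueI) measurable
  have i: "integrable lebesgue (\<lambda>t. indicator {a..b} t *\<^sub>R F t)" using F by (simp add: set_integrable_def)
  show ?thesis unfolding set_integrable_def
  proof (rule Bochner_Integration.integrable_bound)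
    show "integrable lebesgue (\<lambda>t. K *\<^sub>R (indicator {a..b} t *\<^sub>R F t))"
      by (rule integrable_scaleR_right) (use i in simp)
    have "(\<lambda>t. g t *\<^sub>R (indicator {a..b} t *\<^sub>R F t)) \<in> borel_measurable lebesgue"
      by (rule borel_measurable_scaleR[OF gl borel_measurable_integrable[OF i]])
    then show "(\<lambda>t. indicator {a..b} t *\<^sub>R g t *\<^sub>R F t) \<in> borel_measurable lebesgue"
      by (simp add: mult.commute)
    show "AE t in lebesgue. norm (indicator {a..b} t *\<^sub>R g t *\<^sub>R F t) \<le> norm (K *\<^sub>R indicator {a..b} t *\<^sub>R F t)"
    proof (rule AE_I2)
      fix t
      show "norm (indicator {a..b} t *\<^sub>R g t *\<^sub>R F t) \<le> norm (K *\<^sub>R indicator {a..b} t *\<^sub>R F t)"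
      proof (cases "t \<in> {a..b}")
        case True
        then have "\<bar>g t\<bar> * norm (F t) \<le> \<bar>K\<bar> * norm (F t)" using K[of t] by (intro mult_right_mono) auto
        then show ?thesis using True by simp
      qed simp
    qed
  qed
qed

text \<open>The derivative of the rescaled step is nonnegative with integral \<open>1\<close>, so that its integral against \<open>F\<close> is
  an average of values of \<open>F\<close>.\<close>

lemma mollify:
  fixes F :: "real \<Rightarrow> 'b::{banach, second_countable_topology}"
  assumes e: "0 < e" and F: "set_integrable lebesgue {p..p + e} F"
    and close: "\<And>t. t \<in> {p..p + e} \<Longrightarrow> norm (F t - c) \<le> \<eta>"
  shows "norm ((LINT t:{p..p + e}|lebesgue. (1 / e * deriv smooth_step (1 / e * t + - (p / e))) *\<^sub>R F t) - c) \<le> \<eta>"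
proof -
  define g where "g t = 1 / e * deriv smooth_step (1 / e * t + - (p / e))" for t
  have gc: "continuous_on S g" for S
    unfolding g_def using e
    by (intro continuous_intros continuous_on_compose2[OF continuous_on_deriv_smooth[OF smooth_step_class, of UNIV]]) auto
  have [measurable]: "g \<in> borel_measurable borel" using gc by (rule borel_measurable_continuous_onI)
  have g0: "0 \<le> g t" for t unfolding g_def using e deriv_smooth_step_nonneg by simp
  have dg: "((\<lambda>t. smooth_step (1 / e * t + - (p / e))) has_real_derivative g t) (at t)" for t
  proof -
    have "((\<lambda>t. smooth_step (1 / e * t + - (p / e))) has_real_derivative deriv smooth_step (1 / e * t + - (p / e)) * (1 / e)) (at t)"
      by (rule DERIV_chain2[OF has_real_derivative_deriv_smooth[OF smooth_step_class]]) (use e in \<open>auto intro!: derivative_eq_intros\<close>)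
    then show ?thesis by (simp add: g_def)
  qed
  have hb: "has_bochner_integral lborel (\<lambda>t. g t * indicator {p..p + e} t) (smooth_step (1 / e * (p + e) + - (p / e)) - smooth_step (1 / e * p + - (p / e)))"
    by (rule has_bochner_integral_FTC_Icc_nonneg) (use dg g0 e in auto)
  moreover have "1 / e * (p + e) + - (p / e) = 1" "1 / e * p + - (p / e) = 0" using e by (auto simp: field_simps)
  ultimately have "has_bochner_integral lborel (\<lambda>t. g t * indicator {p..p + e} t) 1"
    by (simp add: smooth_step_0 smooth_step_1)
  then have gi: "integrable lebesgue (\<lambda>t. indicator {p..p + e} t * g t)" "(LINT t|lebesgue. indicator {p..p + e} t * g t) = 1"
    by (auto simp: has_bochner_integral_iff integrable_completion integral_completion mult.commute)
  have Fi: "integrable lebesgue (\<lambda>t. indicator {p..p + e} t *\<^sub>R g t *\<^sub>R F t)"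
    using set_integrable_scaleR_continuous[OF F gc] by (simp add: set_integrable_def)
  have ci: "integrable lebesgue (\<lambda>t. (indicator {p..p + e} t * g t) *\<^sub>R c)" using gi by auto
  have "(LINT t:{p..p + e}|lebesgue. g t *\<^sub>R F t) - c =
    (LINT t|lebesgue. indicator {p..p + e} t *\<^sub>R g t *\<^sub>R F t) - (LINT t|lebesgue. (indicator {p..p + e} t * g t) *\<^sub>R c)"
    using gi by (simp add: set_lebesgue_integral_def)
  also have "\<dots> = (LINT t|lebesgue. indicator {p..p + e} t *\<^sub>R g t *\<^sub>R F t - (indicator {p..p + e} t * g t) *\<^sub>R c)"
    using Fi ci by (rule Bochner_Integration.integral_diff[symmetric])
  finally have "norm ((LINT t:{p..p + e}|lebesgue. g t *\<^sub>R F t) - c) \<le>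
    (LINT t|lebesgue. (indicator {p..p + e} t * g t) * \<eta>)"
  proof (elim ssubst, intro Bochner_Integration.integral_norm_bound_integral)
    show "norm (indicator {p..p + e} t *\<^sub>R g t *\<^sub>R F t - (indicator {p..p + e} t * g t) *\<^sub>R c) \<le> (indicator {p..p + e} t * g t) * \<eta>" for t
    proof -
      have "indicator {p..p + e} t *\<^sub>R g t *\<^sub>R F t - (indicator {p..p + e} t * g t) *\<^sub>R c = (indicator {p..p + e} t * g t) *\<^sub>R (F t - c)"
        by (simp add: algebra_simps)
      then have "norm (indicator {p..p + e} t *\<^sub>R g t *\<^sub>R F t - (indicator {p..p + e} t * g t) *\<^sub>R c) = (indicator {p..p + e} t * g t) * norm (F t - c)"
        using g0[of t] by (simp add: abs_mult)
      also have "\<dots> \<le> (indicator {p..p + e} t * g t) * \<eta>"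
        using close[of t] g0[of t] by (cases "t \<in> {p..p + e}") (auto intro!: mult_left_mono)
      finally show ?thesis .
    qed
  qed (use Fi ci gi in auto)
  then show ?thesis using gi by (simp add: g_def)
qed

lemma test_functionI:
  assumes "\<phi> \<in> smooth_class" "0 < a" "a \<le> b" "ereal b < T" "\<And>t. t \<notin> {a..b} \<Longrightarrow> \<phi> t = 0"
  shows "test_function T \<phi>"
  unfolding test_function_def using assms smooth_class_differentiable by blast

text \<open>The test functions rise from \<open>0\<close> to \<open>1\<close> shortly after time \<open>0\<close> and fall back to \<open>0\<close> shortly after time \<open>t\<close>. Their
  derivatives average \<open>F\<close> near \<open>0\<close> and near \<open>t\<close>, and they converge to the indicator function of \<open>[0, t]\<close>.\<close>

lemma weak_derivative_imp_integral:
  fixes F D :: "real \<Rightarrow> 'b::{banach, second_countable_topology}"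
  assumes wd: "has_weak_derivative T F D" and cont: "continuous_on (time_int T) F"
    and D: "\<And>s. s \<in> time_int T \<Longrightarrow> set_integrable lebesgue {0..s} D" and t: "t \<in> time_int T"
  shows "F t = F 0 + (LINT s:{0..t}|lebesgue. D s)"
proof (cases "t = 0")
  case True
  have "(LINT s|lebesgue. indicator {0..0} s *\<^sub>R D s) = (LINT (s :: real)|lebesgue. (0 :: 'b))"
  proof (rule Bochner_Integration.integral_cong_AE)
    have ae: "AE s in lebesgue. s \<noteq> (0::real)" using AE_lborel_singleton[of "0::real"] by (rule AE_completion)
    then show "AE s in lebesgue. indicator {0..0} s *\<^sub>R D s = 0" by eventually_elim simp
    show "(\<lambda>s. indicator {0..0} s *\<^sub>R D s) \<in> borel_measurable lebesgue"
      using D[OF t] True by (simp add: set_integrable_def)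
  qed simp
  then show ?thesis using True by (simp add: set_lebesgue_integral_def)
next
  case False
  then have tpos: "0 < t" and tT: "ereal t < T" using t by (auto simp: time_int_def)
  obtain t' where t': "t < t'" "ereal t' < T"
    using ereal_dense2[OF tT] by auto
  have t'T: "t' \<in> time_int T" using t' tpos by (auto simp: time_int_def)
  define \<Omega> where "\<Omega> = {t. 0 < t \<and> ereal t < T}"
  have \<Omega>I: "s \<in> \<Omega>" if "0 < s" "s \<le> t'" for s
    using that time_int_mono[OF t'T, of s] by (auto simp: \<Omega>_def time_int_def)
  \<comment> \<open>The rise on \<open>[e n, 2 e n]\<close> and the fall on \<open>[t, t + e n]\<close> must not overlap and must stay below \<open>t'\<close>.\<close>
  define \<delta> where "\<delta> = min (t / 2) (t' - t)"
  define e where "e n = \<delta> / real (n + 2)" for n :: nat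
  have \<delta>: "0 < \<delta>" using tpos t' by (simp add: \<delta>_def)
  have e: "0 < e n" "e n < \<delta>" for n using \<delta> by (auto simp: e_def field_simps intro!: add_pos_nonneg)
  have e0: "e \<longlonglongrightarrow> 0"
    unfolding e_def using LIMSEQ_ignore_initial_segment[OF lim_const_over_n[of \<delta>], of 2] by simp
  define g where "g p n s = 1 / e n * deriv smooth_step (1 / e n * s + - (p / e n))" for p n s
  define \<phi> where "\<phi> n s = smooth_step (1 / e n * s + - (e n / e n)) + (- 1) * smooth_step (1 / e n * s + - (t / e n))" for n s
  have \<phi>S: "\<phi> n \<in> smooth_class" for n
    unfolding \<phi>_def[abs_def] by (intro smooth_class.add smooth_class.mult smooth_class.const smooth_class.affine smooth_step_class)
  have d\<phi>: "deriv (\<phi> n) s = g (e n) n s - g t n s" for n s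
  proof (rule DERIV_imp_deriv)
    have *: "((\<lambda>s. smooth_step (1 / e n * s + b)) has_real_derivative deriv smooth_step (1 / e n * s + b) * (1 / e n)) (at s)" for b
      by (rule DERIV_chain2[OF has_real_derivative_deriv_smooth[OF smooth_step_class]]) (use e(1)[of n] in \<open>auto intro!: derivative_eq_intros\<close>)
    show "(\<phi> n has_real_derivative g (e n) n s - g t n s) (at s)"
      unfolding \<phi>_def[abs_def] g_def
      using DERIV_add[OF *[of "- (e n / e n)"] DERIV_cmult[OF *[of "- (t / e n)"], of "-1"]] by (simp add: mult.commute)
  qed
  have \<phi>0: "\<phi> n s = 0" if "s < e n \<or> t + e n < s" for n s
  proof -
    have "s \<le> t \<or> t + e n < s" using that e(2)[of n] tpos by (auto simp: \<delta>_def)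
    then show ?thesis
      using that e[of n] tpos by (auto simp: \<phi>_def \<delta>_def smooth_step_0 smooth_step_1 field_simps)
  qed
  have g_supp: "g p n s = 0" if "s \<notin> {p..p + e n}" for p n s
    using that e(1)[of n] by (auto simp: g_def field_simps intro!: deriv_smooth_step_0)
  have test: "test_function T (\<phi> n)" for n
  proof (rule test_functionI[of _ "e n" "t + e n"])
    show "ereal (t + e n) < T"
      using e(2)[of n] t' by (intro order.strict_trans1[of "ereal (t + e n)" "ereal t'" T]) (auto simp: \<delta>_def)
  qed (use \<phi>S e[of n] \<phi>0 tpos in \<open>auto simp: \<delta>_def\<close>)
  define A where "A p n = (LINT s:{p..p + e n}|lebesgue. g p n s *\<^sub>R F s)" for p n
  have Fint: "set_integrable lebesgue {p..p + e n} F" if "0 < p" "p + e n \<le> t'" for p n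
  proof -
    have "ereal (p + e n) < T" using that \<Omega>I[of "p + e n"] e(1)[of n] by (simp add: \<Omega>_def)
    then show ?thesis using wd that unfolding has_weak_derivative_def by blast
  qed
  have gint: "integrable lebesgue (\<lambda>s. indicator \<Omega> s *\<^sub>R g p n s *\<^sub>R F s)"
    and geq: "(LINT s:\<Omega>|lebesgue. g p n s *\<^sub>R F s) = A p n"
    if p: "0 < p" "p + e n \<le> t'" for p n
  proof -
    have eq: "(\<lambda>s. indicator \<Omega> s *\<^sub>R g p n s *\<^sub>R F s) = (\<lambda>s. indicator {p..p + e n} s *\<^sub>R g p n s *\<^sub>R F s)"
    proof
      fix s show "indicator \<Omega> s *\<^sub>R g p n s *\<^sub>R F s = indicator {p..p + e n} s *\<^sub>R g p n s *\<^sub>R F s"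
        using \<Omega>I[of s] g_supp[of s p n] p by (cases "s \<in> {p..p + e n}") auto
    qed
    have gc: "continuous_on UNIV (g p n)"
      unfolding g_def[abs_def] using e(1)[of n]
      by (intro continuous_intros continuous_on_compose2[OF continuous_on_deriv_smooth[OF smooth_step_class, of UNIV]]) auto
    show "integrable lebesgue (\<lambda>s. indicator \<Omega> s *\<^sub>R g p n s *\<^sub>R F s)"
      unfolding eq using set_integrable_scaleR_continuous[OF Fint[OF p] gc] by (simp add: set_integrable_def)
    show "(LINT s:\<Omega>|lebesgue. g p n s *\<^sub>R F s) = A p n"
      unfolding A_def set_lebesgue_integral_def eq ..
  qed
  have en: "e n + e n \<le> t'" "t + e n \<le> t'" for n using e(2)[of n] t' by (auto simp: \<delta>_def)
  have weak: "A (e n) n - A t n = - (LINT s:\<Omega>|lebesgue. \<phi> n s *\<^sub>R D s)" for n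
  proof -
    have "(LINT s:\<Omega>|lebesgue. deriv (\<phi> n) s *\<^sub>R F s) = - (LINT s:\<Omega>|lebesgue. \<phi> n s *\<^sub>R D s)"
      using wd test[of n] unfolding has_weak_derivative_def \<Omega>_def by blast
    moreover have "(LINT s:\<Omega>|lebesgue. deriv (\<phi> n) s *\<^sub>R F s) = A (e n) n - A t n"
      unfolding geq[OF e(1) en(1), symmetric] geq[OF tpos en(2), symmetric] set_lebesgue_integral_def d\<phi>
      by (subst Bochner_Integration.integral_diff[symmetric])
        (auto simp: scaleR_diff_left scaleR_diff_right simp del: scaleR_scaleR intro!: gint e(1) en tpos)
    ultimately show ?thesis by simp
  qed
  have A_lim: "(\<lambda>n. A (p n) n) \<longlonglongrightarrow> F x" if x: "x \<in> time_int T" and p: "\<And>n. 0 < p n" "\<And>n. p n + e n \<le> t'"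
    "\<And>n. x \<le> p n" "\<And>n. p n \<le> x + e n" for x p
  proof (rule LIMSEQ_I)
    fix r :: real assume r: "0 < r"
    then obtain d where d: "0 < d" "\<And>s. s \<in> time_int T \<Longrightarrow> dist s x < d \<Longrightarrow> dist (F s) (F x) < r / 2"
      using cont x unfolding continuous_on_iff by (metis half_gt_zero)
    obtain N where N: "\<And>n. n \<ge> N \<Longrightarrow> e n < d / 2"
      using order_tendstoD(2)[OF e0, of "d / 2"] d by (auto simp: eventually_sequentially)
    have "norm (A (p n) n - F x) < r" if "n \<ge> N" for n
    proof -
      have "norm (A (p n) n - F x) \<le> r / 2"
        unfolding A_def g_def
      proof (rule mollify[OF e(1) Fint[OF p(1,2)]])
        fix s assume s: "s \<in> {p n..p n + e n}"
        then have "s \<in> time_int T" using p[of n] by (intro time_int_mono[OF t'T]) auto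
        moreover have "dist s x < d" using s p[of n] N[OF that] e(1)[of n] by (auto simp: dist_real_def)
        ultimately show "norm (F s - F x) \<le> r / 2" using d(2)[of s] by (simp add: dist_norm)
      qed
      then show ?thesis using r by simp
    qed
    then show "\<exists>N. \<forall>n\<ge>N. norm (A (p n) n - F x) < r" by blast
  qed
  have "(\<lambda>n. A (e n) n - A t n) \<longlonglongrightarrow> F 0 - F t"
    using e(1) en tpos zero_in_time_int[OF t] t
    by (intro tendsto_diff A_lim) (auto simp: less_imp_le)
  moreover have "(\<lambda>n. - (LINT s:\<Omega>|lebesgue. \<phi> n s *\<^sub>R D s)) \<longlonglongrightarrow> - (LINT s:{0..t}|lebesgue. D s)"
    unfolding set_lebesgue_integral_def
  proof (rule tendsto_minus, rule integral_dominated_convergence)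
    have Di: "integrable lebesgue (\<lambda>s. indicator {0..t'} s *\<^sub>R D s)" using D[OF t'T] by (simp add: set_integrable_def)
    show "integrable lebesgue (\<lambda>s. norm (indicator {0..t'} s *\<^sub>R D s))" by (rule integrable_norm[OF Di])
    show "(\<lambda>s. indicator {0..t} s *\<^sub>R D s) \<in> borel_measurable lebesgue" using D[OF t] by (simp add: set_integrable_def)
    have \<phi>b: "\<bar>\<phi> n s\<bar> \<le> 1" for n s
      using smooth_step_bounds[of "1 / e n * s + - (e n / e n)"] smooth_step_bounds[of "1 / e n * s + - (t / e n)"]
      by (auto simp: \<phi>_def abs_le_iff simp del: divide_self_if)
    have eq: "indicator \<Omega> s *\<^sub>R \<phi> n s *\<^sub>R D s = \<phi> n s *\<^sub>R (indicator {0..t'} s *\<^sub>R D s)" for n s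
    proof (cases "s \<in> \<Omega> \<longleftrightarrow> s \<in> {0..t'}")
      case False
      then have "s < e n \<or> t + e n < s" using \<Omega>I[of s] e(1)[of n] en(2)[of n] by (auto simp: \<Omega>_def)
      then show ?thesis by (simp add: \<phi>0)
    qed (auto simp: indicator_def)
    show "(\<lambda>s. indicator \<Omega> s *\<^sub>R \<phi> n s *\<^sub>R D s) \<in> borel_measurable lebesgue" for n
    proof -
      have "continuous_on UNIV (\<phi> n)"
        using has_real_derivative_deriv_smooth[OF \<phi>S] by (intro continuous_at_imp_continuous_on ballI DERIV_isCont) auto
      then have "\<phi> n \<in> borel_measurable lebesgue" by (intro borel_measurable_lebesgueI borel_measurable_continuous_onI)
      then show ?thesis unfolding eq by (rule borel_measurable_scaleR[OF _ borel_measurable_integrable[OF Di]])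
    qed
    show "AE s in lebesgue. norm (indicator \<Omega> s *\<^sub>R \<phi> n s *\<^sub>R D s) \<le> norm (indicator {0..t'} s *\<^sub>R D s)" for n
      unfolding eq norm_scaleR[of "\<phi> n _"] using \<phi>b by (intro AE_I2 mult_left_le_one_le) auto
    have ae: "AE s in lebesgue. s \<noteq> (0::real)" using AE_lborel_singleton[of "0::real"] by (rule AE_completion)
    then show "AE s in lebesgue. (\<lambda>n. indicator \<Omega> s *\<^sub>R \<phi> n s *\<^sub>R D s) \<longlonglongrightarrow> indicator {0..t} s *\<^sub>R D s"
    proof eventually_elim
      case (elim s)
      consider "s < 0" | "0 < s" "s \<le> t" | "t < s" using elim by linarith
      then show ?case
      proof cases
        case 1
        then have "\<phi> n s = 0" for n using e(1)[of n] by (intro \<phi>0) auto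
        then show ?thesis using 1 by simp
      next
        case 2
        have "eventually (\<lambda>n. e n < s / 2) sequentially" using order_tendstoD(2)[OF e0, of "s / 2"] 2 by simp
        then have "eventually (\<lambda>n. indicator \<Omega> s *\<^sub>R \<phi> n s *\<^sub>R D s = indicator {0..t} s *\<^sub>R D s) sequentially"
        proof eventually_elim
          case (elim n)
          have "\<phi> n s = 1" using 2 elim e(1)[of n] by (simp add: \<phi>_def smooth_step_0 smooth_step_1 field_simps)
          then show ?case using 2 t' \<Omega>I[of s] by simp
        qed
        then show ?thesis by (rule tendsto_eventually)
      next
        case 3
        have "eventually (\<lambda>n. e n < s - t) sequentially" using order_tendstoD(2)[OF e0, of "s - t"] 3 by simp
        then have "eventually (\<lambda>n. indicator \<Omega> s *\<^sub>R \<phi> n s *\<^sub>R D s = indicator {0..t} s *\<^sub>R D s) sequentially"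
          by eventually_elim (use 3 in \<open>simp add: \<phi>0\<close>)
        then show ?thesis by (rule tendsto_eventually)
      qed
    qed
  qed
  ultimately have "F 0 - F t = - (LINT s:{0..t}|lebesgue. D s)"
    unfolding weak by (rule LIMSEQ_unique)
  then show ?thesis by (simp add: algebra_simps)
qed

context
  fixes T :: ereal and F D :: "real \<Rightarrow> 'b::{banach, second_countable_topology}" and C :: real
  assumes D [measurable]: "D \<in> borel_measurable borel" and DC: "\<And>s. norm (D s) \<le> C"
    and F: "\<And>t. t \<in> time_int T \<Longrightarrow> F t = F 0 + (LINT s:{0..t}|lebesgue. D s)"
begin

text \<open>Conversely, an integral equation with a bounded right-hand side is an equation for the weak derivative:
  insert it into the definition, exchange the integrals and integrate the derivative of the test function.\<close>

lemma integral_curve_set_integrable: "set_integrable lebesgue {a..b} D"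
proof (rule set_integrable_lebesgue_bounded)
  show "set_borel_measurable lebesgue {a..b} D"
    unfolding set_borel_measurable_def by (intro borel_measurable_lebesgueI) measurable
qed (use DC in auto)

lemma integral_curve_lborel: "(LINT s:{a..b}|lebesgue. D s) = (LINT s:{a..b}|lborel. D s)"
  unfolding set_lebesgue_integral_def by (rule integral_completion) measurable

lemma integral_curve_continuous: "continuous_on (time_int T) F"
proof -
  have C0: "0 \<le> C" using DC[of 0] norm_ge_zero order_trans by blast
  have le: "norm (F t - F s) \<le> C * (t - s)" if s: "s \<in> time_int T" and t: "t \<in> time_int T" and st: "s \<le> t" for s t
  proof -
    have i: "integrable lebesgue (\<lambda>r. indicator {0..t} r *\<^sub>R D r)" "integrable lebesgue (\<lambda>r. indicator {0..s} r *\<^sub>R D r)"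
      using integral_curve_set_integrable by (auto simp: set_integrable_def)
    have "F t - F s = (LINT r|lebesgue. indicator {0..t} r *\<^sub>R D r - indicator {0..s} r *\<^sub>R D r)"
      using F[OF s] F[OF t] i by (simp add: set_lebesgue_integral_def)
    also have "norm \<dots> \<le> (LINT r|lebesgue. indicator {s..t} r * C)"
    proof (rule Bochner_Integration.integral_norm_bound_integral)
      show "integrable lebesgue (\<lambda>r. indicator {s..t} r * C)"
        by (intro integrable_mult_left integrable_real_indicator) (auto simp: emeasure_lborel_Icc_eq)
      show "norm (indicator {0..t} r *\<^sub>R D r - indicator {0..s} r *\<^sub>R D r) \<le> indicator {s..t} r * C" for r
        using s t st DC[of r] C0 by (auto simp: indicator_def time_int_def)
    qed (use i in auto)
    also have "\<dots> = C * (t - s)" using st by simp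
    finally show ?thesis .
  qed
  have "C-lipschitz_on (time_int T) F"
  proof (rule lipschitz_onI[OF _ C0])
    fix s t assume "s \<in> time_int T" "t \<in> time_int T"
    then show "dist (F s) (F t) \<le> C * dist s t"
      using le[of s t] le[of t s] by (cases "s \<le> t") (auto simp: dist_norm norm_minus_commute abs_minus_commute)
  qed
  then show ?thesis by (rule lipschitz_on_continuous_on)
qed

lemma integral_imp_weak_derivative: "has_weak_derivative T F D"
  unfolding has_weak_derivative_def
proof (intro conjI allI impI)
  fix a b :: real assume ab: "0 < a \<and> ereal b < T"
  show "set_integrable lebesgue {a..b} D" by (rule integral_curve_set_integrable)
  have "continuous_on {a..b} F"
  proof (rule continuous_on_subset[OF integral_curve_continuous])
    show "{a..b} \<subseteq> time_int T" using ab order.strict_trans1[of "ereal _" "ereal b" T] by (auto simp: time_int_def)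
  qed
  then have "set_integrable lborel {a..b} F" by (rule borel_integrable_atLeastAtMost')
  then show "set_integrable lebesgue {a..b} F"
    unfolding set_integrable_def by (subst integrable_completion) auto
next
  fix \<phi> assume "test_function T \<phi>"
  then obtain a b where diff: "\<And>n t. ((deriv ^^ n) \<phi>) differentiable (at t)"
    and ab: "0 < a" "a \<le> b" "ereal b < T" and supp: "\<And>t. t \<notin> {a..b} \<Longrightarrow> \<phi> t = 0"
    unfolding test_function_def by blast
  obtain b' where b': "b < b'" "ereal b' < T" using ereal_dense2[OF ab(3)] by auto
  have b'T: "b' \<in> time_int T" using ab b' by (auto simp: time_int_def)
  define I where "I = {0..b'}"
  define \<Omega> where "\<Omega> = {t. 0 < t \<and> ereal t < T}"
  have \<Omega>I: "s \<in> \<Omega>" if "0 < s" "s \<le> b'" for s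
    using that time_int_mono[OF b'T, of s] by (auto simp: \<Omega>_def time_int_def)
  have d: "(\<phi> has_real_derivative deriv \<phi> t) (at t)" for t
    using diff[of 0 t] by (simp add: DERIV_deriv_iff_real_differentiable)
  have "(deriv \<phi> has_real_derivative deriv (deriv \<phi>) t) (at t)" for t
    using diff[of 1 t] by (simp add: DERIV_deriv_iff_real_differentiable)
  then have dc: "continuous_on S (deriv \<phi>)" for S
    by (intro continuous_at_imp_continuous_on ballI DERIV_isCont)
  have \<phi>c: "continuous_on S \<phi>" for S
    using d by (intro continuous_at_imp_continuous_on ballI DERIV_isCont)
  have [measurable]: "deriv \<phi> \<in> borel_measurable borel" "\<phi> \<in> borel_measurable borel"
    using dc \<phi>c by (auto intro: borel_measurable_continuous_onI)
  have dsupp: "deriv \<phi> t = 0" if "t \<notin> {a..b}" for t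
  proof (rule DERIV_imp_deriv)
    show "(\<phi> has_real_derivative 0) (at t)"
      by (rule has_field_derivative_transform_within_open[where S="- {a..b}" and f="\<lambda>_. 0"])
        (use that supp in auto)
  qed
  have FI [measurable]: "(\<lambda>t. indicator I t *\<^sub>R F t) \<in> borel_measurable borel"
  proof (rule borel_measurable_continuous_on_indicator)
    show "continuous_on I F"
      by (rule continuous_on_subset[OF integral_curve_continuous]) (auto simp: I_def intro: time_int_mono[OF b'T])
  qed (simp add: I_def)
  have Im [measurable]: "I \<in> sets borel" by (simp add: I_def)
  have swap: "indicator \<Omega> t *\<^sub>R g t *\<^sub>R H t = g t *\<^sub>R (indicator I t *\<^sub>R H t)"
    if "\<And>t. t \<notin> {a..b} \<Longrightarrow> g t = 0" for g and H :: "real \<Rightarrow> 'b" and t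
  proof (cases "t \<in> {a..b}")
    case True
    then have "t \<in> \<Omega>" "t \<in> I" using ab b' \<Omega>I[of t] by (auto simp: I_def)
    then show ?thesis by simp
  qed (use that in simp)
  have swapF: "(\<lambda>t. indicator \<Omega> t *\<^sub>R deriv \<phi> t *\<^sub>R F t) = (\<lambda>t. deriv \<phi> t *\<^sub>R (indicator I t *\<^sub>R F t))"
    and swapD: "(\<lambda>t. indicator \<Omega> t *\<^sub>R \<phi> t *\<^sub>R D t) = (\<lambda>t. \<phi> t *\<^sub>R (indicator I t *\<^sub>R D t))"
    by (rule ext, rule swap, erule dsupp) (rule ext, rule swap, erule supp)
  have bnd: "\<exists>K. \<forall>t\<in>I. \<bar>deriv \<phi> t\<bar> \<le> K"
  proof -
    have "bounded (deriv \<phi> ` I)"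
      unfolding I_def by (intro compact_imp_bounded compact_continuous_image dc) auto
    then show ?thesis by (auto simp: bounded_iff)
  qed
  then obtain K where K: "\<And>t. t \<in> I \<Longrightarrow> \<bar>deriv \<phi> t\<bar> \<le> K" by blast
  have ftc: "(LINT t|lborel. indicator {s..b'} t *\<^sub>R deriv \<phi> t) = - \<phi> s" if "s \<le> b'" for s
  proof -
    have "(LINT t|lborel. indicator {s..b'} t *\<^sub>R deriv \<phi> t) = \<phi> b' - \<phi> s"
      by (rule integral_FTC_Icc[OF that])
        (use d dc in \<open>auto simp: has_real_derivative_iff_has_vector_derivative[symmetric] intro: has_field_derivative_at_within\<close>)
    then show ?thesis using supp[of b'] b' by simp
  qed
  have phi0: "\<phi> 0 = 0" using supp[of 0] ab by simp
  let ?k = "\<lambda>t s. (indicator I t * deriv \<phi> t * indicator {0..t} s) *\<^sub>R D s"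
  have kint: "integrable (lborel \<Otimes>\<^sub>M lborel) (\<lambda>(t, s). ?k t s)"
  proof (rule integrableI_bounded_set[where A="I \<times> I" and B="K * C"])
    have "emeasure (lborel \<Otimes>\<^sub>M lborel) (I \<times> I) = emeasure lborel I * emeasure lborel I"
      by (rule lborel.emeasure_pair_measure_Times) auto
    then show "emeasure (lborel \<Otimes>\<^sub>M lborel) (I \<times> I) < \<infinity>"
      by (simp add: I_def emeasure_lborel_Icc_eq ennreal_mult_less_top)
    show "(\<lambda>(t, s). ?k t s) \<in> borel_measurable (lborel \<Otimes>\<^sub>M lborel)"
      by (auto simp: indicator_def[of "{0.._}"] atLeastAtMost_iff split_beta')
    have "\<bar>deriv \<phi> t\<bar> * norm (D s) \<le> K * C" if "t \<in> I" for s t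
      using K[OF that] DC[of s] by (intro mult_mono) (auto intro: order_trans[OF abs_ge_zero])
    moreover have "0 \<le> K * C"
      using K[of 0] DC[of 0] b' ab by (intro mult_nonneg_nonneg)
        (auto simp: I_def intro: order_trans[OF abs_ge_zero] order_trans[OF norm_ge_zero])
    ultimately show "AE x in lborel \<Otimes>\<^sub>M lborel. x \<in> I \<times> I \<longrightarrow> norm (case x of (t, s) \<Rightarrow> ?k t s) \<le> K * C"
      by (intro AE_I2) (auto simp: indicator_def abs_mult)
  qed (auto simp: I_def indicator_def)
  have dint: "integrable lborel (\<lambda>t. indicator I t *\<^sub>R deriv \<phi> t)"
    using borel_integrable_atLeastAtMost'[OF dc, of 0 b'] by (simp add: I_def set_integrable_def)
  have "(LINT t:\<Omega>|lebesgue. deriv \<phi> t *\<^sub>R F t) = (LINT t|lborel. deriv \<phi> t *\<^sub>R (indicator I t *\<^sub>R F t))"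
    unfolding set_lebesgue_integral_def swapF
    by (rule integral_completion) measurable
  also have "\<dots> = (LINT t|lborel. (indicator I t *\<^sub>R deriv \<phi> t) *\<^sub>R F 0 + (LINT s|lborel. ?k t s))"
  proof (rule Bochner_Integration.integral_cong[OF refl])
    fix t
    show "deriv \<phi> t *\<^sub>R (indicator I t *\<^sub>R F t) = (indicator I t *\<^sub>R deriv \<phi> t) *\<^sub>R F 0 + (LINT s|lborel. ?k t s)"
    proof (cases "t \<in> I")
      case True
      then have "t \<in> time_int T" by (auto simp: I_def intro: time_int_mono[OF b'T])
      then have "F t = F 0 + (LINT s|lborel. indicator {0..t} s *\<^sub>R D s)"
        using F integral_curve_lborel by (simp add: set_lebesgue_integral_def)
      then show ?thesis using True by (simp add: scaleR_add_right scaleR_scaleR[symmetric] del: scaleR_scaleR)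
    qed simp
  qed
  also have "\<dots> = (LINT t|lborel. (indicator I t *\<^sub>R deriv \<phi> t) *\<^sub>R F 0) + (LINT t|lborel. (LINT s|lborel. ?k t s))"
  proof (rule Bochner_Integration.integral_add)
    show "integrable lborel (\<lambda>t. (indicator I t *\<^sub>R deriv \<phi> t) *\<^sub>R F 0)"
      using dint by (rule integrable_scaleR_left)
    show "integrable lborel (\<lambda>t. LINT s|lborel. ?k t s)"
      using lborel_pair.integrable_fst'[OF kint] by simp
  qed
  also have "(LINT t|lborel. (indicator I t *\<^sub>R deriv \<phi> t) *\<^sub>R F 0) = 0"
    using ftc[of 0] phi0 ab b' by (subst integral_scaleR_left[OF dint]) (simp add: I_def)
  also have "(LINT t|lborel. (LINT s|lborel. ?k t s)) = (LINT s|lborel. (LINT t|lborel. ?k t s))"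
    by (rule lborel_pair.Fubini_integral[symmetric, OF kint])
  also have "\<dots> = (LINT s|lborel. - (\<phi> s *\<^sub>R (indicator I s *\<^sub>R D s)))"
  proof (rule Bochner_Integration.integral_cong[OF refl])
    fix s
    show "(LINT t|lborel. ?k t s) = - (\<phi> s *\<^sub>R (indicator I s *\<^sub>R D s))"
    proof (cases "s \<in> I")
      case True
      have eq: "(\<lambda>t. ?k t s) = (\<lambda>t. (indicator {s..b'} t *\<^sub>R deriv \<phi> t) *\<^sub>R D s)"
        using True by (auto simp: I_def indicator_def)
      have "integrable lborel (\<lambda>t. indicator {s..b'} t *\<^sub>R deriv \<phi> t)"
        using borel_integrable_atLeastAtMost'[OF dc, of s b'] by (simp add: set_integrable_def)
      then show ?thesis unfolding eq using ftc[of s] True by (subst integral_scaleR_left) (auto simp: I_def)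
    next
      case False
      then have eq: "(\<lambda>t. ?k t s) = (\<lambda>t. 0)" by (auto simp: I_def indicator_def)
      show ?thesis unfolding eq using False by simp
    qed
  qed
  also have "0 + \<dots> = - (LINT s|lborel. \<phi> s *\<^sub>R (indicator I s *\<^sub>R D s))" by simp
  also have "(LINT s|lborel. \<phi> s *\<^sub>R (indicator I s *\<^sub>R D s)) = (LINT s:\<Omega>|lebesgue. \<phi> s *\<^sub>R D s)"
    unfolding set_lebesgue_integral_def swapD
    by (rule integral_completion[symmetric]) measurable
  finally show "(LINT t:{t. 0 < t \<and> ereal t < T}|lebesgue. deriv \<phi> t *\<^sub>R F t) =
    - (LINT t:{t. 0 < t \<and> ereal t < T}|lebesgue. \<phi> t *\<^sub>R D t)" by (simp add: \<Omega>_def)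
qed

end

section \<open>The scalar linear equation\<close>

lemma set_integrable_bounded_on:
  fixes f :: "real \<Rightarrow> real"
  assumes [measurable]: "f \<in> borel_measurable borel" and bd: "\<And>s. s \<in> {a..b} \<Longrightarrow> \<bar>f s\<bar> \<le> K"
  shows "set_integrable lborel {a..b} f"
  unfolding set_integrable_def
proof (rule integrableI_bounded_set[where A="{a..b}" and B=K])
  show "emeasure lborel {a..b} < \<infinity>" by (simp add: emeasure_lborel_Icc_eq)
qed (use bd in \<open>auto intro!: AE_I2\<close>)

lemma set_integral_abs_le:
  fixes f :: "real \<Rightarrow> real"
  assumes [measurable]: "f \<in> borel_measurable borel" and bd: "\<And>s. s \<in> {a..b} \<Longrightarrow> \<bar>f s\<bar> \<le> K" and ab: "a \<le> b"
  shows "\<bar>LINT s:{a..b}|lborel. f s\<bar> \<le> K * (b - a)"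
proof -
  have "norm (LINT s:{a..b}|lborel. f s) \<le> (LINT s|lborel. indicator {a..b} s * K)"
    unfolding set_lebesgue_integral_def
  proof (rule Bochner_Integration.integral_norm_bound_integral)
    show "integrable lborel (\<lambda>s. indicator {a..b} s *\<^sub>R f s)"
      using set_integrable_bounded_on[OF assms(1) bd] by (simp add: set_integrable_def)
    show "integrable lborel (\<lambda>s. indicator {a..b} s * K)"
      by (intro integrable_mult_left integrable_real_indicator) (auto simp: emeasure_lborel_Icc_eq)
    show "norm (indicator {a..b} s *\<^sub>R f s) \<le> indicator {a..b} s * K" for s
      using bd[of s] by (simp add: indicator_def)
  qed
  then show ?thesis using ab by (simp add: mult.commute)
qed

lemma borel_measurable_running_integral [measurable (raw)]:
  fixes f :: "'a \<Rightarrow> real \<Rightarrow> real"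
  assumes [measurable]: "case_prod f \<in> borel_measurable (N \<Otimes>\<^sub>M borel)" "T \<in> borel_measurable N"
  shows "(\<lambda>x. LINT s:{0..T x}|lborel. f x s) \<in> borel_measurable N"
proof -
  have "(\<lambda>x. LINT s:{0..T x}|lborel. f x s) = (\<lambda>x. LINT s|lborel. (if 0 \<le> s \<and> s \<le> T x then f x s else 0))"
    unfolding set_lebesgue_integral_def by (intro ext Bochner_Integration.integral_cong) auto
  also have "\<dots> \<in> borel_measurable N" by measurable
  finally show ?thesis .
qed

lemma set_integral_combine:
  fixes f :: "real \<Rightarrow> real"
  assumes f: "set_integrable lborel {a..c} f" and ab: "a \<le> b" and bc: "b \<le> c"
  shows "(LINT s:{a..c}|lborel. f s) = (LINT s:{a..b}|lborel. f s) + (LINT s:{b..c}|lborel. f s)"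
proof -
  have i: "set_integrable lborel {a..b} f" "set_integrable lborel {b..c} f"
    using ab bc by (auto intro: set_integrable_subset[OF f])
  have "(LINT s:{a..c}|lborel. f s) = (LINT s|lborel. indicator {a..b} s *\<^sub>R f s + indicator {b..c} s *\<^sub>R f s)"
    unfolding set_lebesgue_integral_def
  proof (rule Bochner_Integration.integral_cong_AE)
    have ae: "AE s in lborel. s \<noteq> b" by (rule AE_lborel_singleton)
    then show "AE s in lborel. indicator {a..c} s *\<^sub>R f s = indicator {a..b} s *\<^sub>R f s + indicator {b..c} s *\<^sub>R f s"
      by eventually_elim (use ab bc in \<open>auto simp: indicator_def\<close>)
  qed (use f i in \<open>auto simp: set_integrable_def\<close>)
  then show ?thesis using i by (simp add: set_integrable_def set_lebesgue_integral_def)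
qed

text \<open>A substitute for differentiation: the coefficients of the linear equation are merely bounded and
  measurable, so its solution need not be differentiable at any given time.\<close>

lemma quadratic_increments_imp_constant:
  fixes Z :: "real \<Rightarrow> real"
  assumes c: "0 \<le> c" and Z: "\<And>a b. 0 \<le> a \<Longrightarrow> a \<le> b \<Longrightarrow> b \<le> c \<Longrightarrow> \<bar>Z b - Z a\<bar> \<le> K * (b - a)\<^sup>2"
  shows "Z c = Z 0"
proof -
  have "\<bar>Z c - Z 0\<bar> \<le> K * c\<^sup>2 / real n" if n: "0 < n" for n
  proof -
    define p where "p i = c * real i / real n" for i
    have "p n = c" "p 0 = 0" using n by (auto simp: p_def)
    then have "Z c - Z 0 = (\<Sum>i<n. Z (p (Suc i)) - Z (p i))"
      using sum_lessThan_telescope[of "\<lambda>i. Z (p i)" n] by simp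
    also have "\<bar>\<dots>\<bar> \<le> (\<Sum>i<n. \<bar>Z (p (Suc i)) - Z (p i)\<bar>)" by (rule sum_abs)
    also have "\<dots> \<le> (\<Sum>i<n. K * (c / real n)\<^sup>2)"
    proof (rule sum_mono)
      fix i assume i: "i \<in> {..<n}"
      have d: "p (Suc i) - p i = c / real n" using n by (simp add: p_def field_simps)
      have "c * real (Suc i) \<le> c * real n" using i c by (intro mult_left_mono) auto
      then have "p (Suc i) \<le> c" using n by (simp add: p_def pos_divide_le_eq)
      moreover have "0 \<le> p i" "p i \<le> p (Suc i)" using c n d by (auto simp: p_def intro!: divide_right_mono mult_left_mono)
      ultimately show "\<bar>Z (p (Suc i)) - Z (p i)\<bar> \<le> K * (c / real n)\<^sup>2" using Z[of "p i" "p (Suc i)"] d by simp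
    qed
    also have "\<dots> = K * c\<^sup>2 / real n" using n by (simp add: power2_eq_square)
    finally show ?thesis .
  qed
  moreover have "(\<lambda>n. K * c\<^sup>2 / real n) \<longlonglongrightarrow> 0" by (rule lim_const_over_n)
  ultimately have "\<bar>Z c - Z 0\<bar> \<le> 0"
    by (intro LIMSEQ_le_const[where X="\<lambda>n. K * c\<^sup>2 / real n"] exI[of _ 1]) auto
  then show ?thesis by simp
qed

text \<open>The variation of constants formula for \<open>y' = h - r y\<close>.\<close>

definition lin_sol :: "real \<Rightarrow> (real \<Rightarrow> real) \<Rightarrow> (real \<Rightarrow> real) \<Rightarrow> real \<Rightarrow> real"
  where "lin_sol y0 h r t = exp (- (LINT s:{0..t}|lborel. r s)) *
    (y0 + (LINT s:{0..t}|lborel. h s * exp (LINT \<sigma>:{0..s}|lborel. r \<sigma>)))"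

lemma exp_remainder: "0 \<le> x \<Longrightarrow> \<bar>exp (- x) - 1 + x\<bar> \<le> (x::real)\<^sup>2"
proof -
  assume x: "0 \<le> x"
  have "exp (- x) \<ge> 1 - x" using exp_ge_add_one_self[of "- x"] by simp
  moreover have "exp (- x) \<le> 1 - x + x\<^sup>2"
  proof -
    have "exp (- x) \<le> 1 / (1 + x)"
      using exp_ge_add_one_self[of x] x by (simp add: exp_minus field_simps)
    also have "\<dots> \<le> 1 - x + x\<^sup>2"
      using x by (simp add: field_simps power2_eq_square)
    finally show ?thesis .
  qed
  ultimately show ?thesis by simp
qed

lemma exp_minus_one_le: "0 \<le> x \<Longrightarrow> \<bar>exp (- x) - 1\<bar> \<le> (x::real)"
  using exp_ge_add_one_self[of "- x"] by simp

locale linear_equation =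
  fixes h r :: "real \<Rightarrow> real" and H N y0 :: real
  assumes h_meas [measurable]: "h \<in> borel_measurable borel" and r_meas [measurable]: "r \<in> borel_measurable borel"
    and h: "\<And>s. 0 \<le> h s" "\<And>s. h s \<le> H" and r: "\<And>s. 0 \<le> r s" "\<And>s. r s \<le> N"
begin

definition \<phi> :: "real \<Rightarrow> real" where "\<phi> t = (LINT s:{0..t}|lborel. r s)"

lemma \<phi>_meas [measurable]: "\<phi> \<in> borel_measurable borel"
  unfolding \<phi>_def[abs_def] by measurable

lemma N_nonneg: "0 \<le> N" and H_nonneg: "0 \<le> H" using h[of 0] r[of 0] by auto

lemma \<phi>_diff: "0 \<le> a \<Longrightarrow> a \<le> b \<Longrightarrow> \<phi> b - \<phi> a = (LINT s:{a..b}|lborel. r s)"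
  unfolding \<phi>_def by (subst set_integral_combine[of 0 b r a])
    (auto intro!: set_integrable_bounded_on[where K=N] simp: r abs_le_iff intro: order_trans[of _ 0])

lemma \<phi>_diff_bounds:
  assumes "0 \<le> a" "a \<le> b"
  shows "0 \<le> \<phi> b - \<phi> a" "\<phi> b - \<phi> a \<le> N * (b - a)"
proof -
  have "\<bar>LINT s:{a..b}|lborel. r s\<bar> \<le> N * (b - a)"
    using assms r by (intro set_integral_abs_le) auto
  then show "\<phi> b - \<phi> a \<le> N * (b - a)" using \<phi>_diff[OF assms] by simp
  show "0 \<le> \<phi> b - \<phi> a"
    unfolding \<phi>_diff[OF assms] set_lebesgue_integral_def using r
    by (intro Bochner_Integration.integral_nonneg) simp
qed

lemma \<phi>_0: "\<phi> 0 = 0"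
  using \<phi>_diff_bounds[of 0 0] \<phi>_diff[of 0 0] by (simp add: \<phi>_def)

lemma \<phi>_nonneg: "0 \<le> t \<Longrightarrow> 0 \<le> \<phi> t"
  using \<phi>_diff_bounds[of 0 t] \<phi>_0 by simp

abbreviation y :: "real \<Rightarrow> real" where "y \<equiv> lin_sol y0 h r"

definition q :: "real \<Rightarrow> real" where "q t = y0 + (LINT s:{0..t}|lborel. h s * exp (\<phi> s))"

lemma y_eq: "y t = exp (- \<phi> t) * q t"
  by (simp add: lin_sol_def q_def \<phi>_def)

lemma q_meas [measurable]: "q \<in> borel_measurable borel"
  unfolding q_def[abs_def] by measurable

lemma y_meas [measurable]: "y \<in> borel_measurable borel"
  unfolding y_eq[abs_def] by measurable

lemma source_bound: "0 \<le> s \<Longrightarrow> \<bar>h s * exp (\<phi> s - \<phi> t)\<bar> \<le> H" if "s \<le> t" for s t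
  using that h[of s] \<phi>_diff_bounds[of s t] mult_mono[of "h s" H "exp (\<phi> s - \<phi> t)" 1]
  by (simp add: abs_mult H_nonneg)

lemma q_diff:
  assumes "0 \<le> a" "a \<le> b"
  shows "exp (- \<phi> b) * (q b - q a) = (LINT s:{a..b}|lborel. h s * exp (\<phi> s - \<phi> b))"
proof -
  have "set_integrable lborel {0..b} (\<lambda>s. h s * exp (\<phi> s))"
  proof (rule set_integrable_bounded_on[where K="exp (\<phi> b) * H"])
    fix s assume s: "s \<in> {0..b}"
    have "\<bar>h s * exp (\<phi> s)\<bar> = exp (\<phi> b) * \<bar>h s * exp (\<phi> s - \<phi> b)\<bar>"
      by (simp add: abs_mult exp_diff)
    also have "\<dots> \<le> exp (\<phi> b) * H" using s by (intro mult_left_mono source_bound) auto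
    finally show "\<bar>h s * exp (\<phi> s)\<bar> \<le> exp (\<phi> b) * H" .
  qed measurable
  then have "q b - q a = (LINT s:{a..b}|lborel. h s * exp (\<phi> s))"
    unfolding q_def using assms by (subst set_integral_combine[of 0 b _ a]) auto
  then have "exp (- \<phi> b) * (q b - q a) = (LINT s:{a..b}|lborel. exp (- \<phi> b) * (h s * exp (\<phi> s)))"
    by simp
  also have "\<dots> = (LINT s:{a..b}|lborel. h s * exp (\<phi> s - \<phi> b))"
    by (simp add: exp_diff exp_minus field_simps)
  finally show ?thesis .
qed

lemma y_increment:
  assumes "0 \<le> a" "a \<le> b"
  shows "y b - y a = (LINT s:{a..b}|lborel. h s * exp (\<phi> s - \<phi> b)) + y a * (exp (- (\<phi> b - \<phi> a)) - 1)"
proof -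
  have "y b - y a = exp (- \<phi> b) * (q b - q a) + (exp (- \<phi> b) - exp (- \<phi> a)) * q a"
    by (simp add: y_eq algebra_simps)
  also have "(exp (- \<phi> b) - exp (- \<phi> a)) * q a = y a * (exp (- (\<phi> b - \<phi> a)) - 1)"
    by (simp add: y_eq exp_diff exp_minus field_simps)
  finally show ?thesis using q_diff[OF assms] by simp
qed

lemma y_0: "y 0 = y0"
  using q_diff[of 0 0] set_integral_abs_le[of "\<lambda>s. h s * exp (\<phi> s)" 0 0 "H"] source_bound[of 0 0] \<phi>_0 h[of 0]
  by (simp add: y_eq q_def)

lemma y_bound:
  assumes "0 \<le> t" "t \<le> c"
  shows "\<bar>y t\<bar> \<le> \<bar>y0\<bar> + H * c"
proof -
  have "\<bar>LINT s:{0..t}|lborel. h s * exp (\<phi> s - \<phi> t)\<bar> \<le> H * t"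
    using set_integral_abs_le[of "\<lambda>s. h s * exp (\<phi> s - \<phi> t)" 0 t H] source_bound assms by simp
  moreover have "H * t \<le> H * c" using assms H_nonneg by (intro mult_left_mono)
  moreover have "\<bar>y0 * exp (- \<phi> t)\<bar> \<le> \<bar>y0\<bar>"
    using \<phi>_nonneg[of t] assms by (simp add: abs_mult mult_left_le)
  moreover have "y t = (LINT s:{0..t}|lborel. h s * exp (\<phi> s - \<phi> t)) + y0 * exp (- \<phi> t)"
    using y_increment[of 0 t] assms by (simp add: y_0 \<phi>_0 algebra_simps)
  ultimately show ?thesis by linarith
qed

text \<open>The difference of the two sides is constant, since its increments are of second order.\<close>

lemma y_integral_equation:
  assumes c: "0 \<le> c"
  shows "set_integrable lborel {0..c} (\<lambda>s. h s - r s * y s)"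
    and "y c = y0 + (LINT s:{0..c}|lborel. h s - r s * y s)"
proof -
  define Q where "Q = \<bar>y0\<bar> + H * c"
  have Q: "\<bar>y t\<bar> \<le> Q" if "0 \<le> t" "t \<le> c" for t using y_bound[OF that] by (simp add: Q_def)
  have Q0: "0 \<le> Q" using Q[of 0] c by simp
  have rate: "\<bar>h s - r s * y s\<bar> \<le> H + N * Q" if "s \<in> {0..c}" for s
  proof -
    have "\<bar>r s * y s\<bar> \<le> N * Q" using that r[of s] Q[of s] N_nonneg
      unfolding abs_mult by (intro mult_mono) auto
    then show ?thesis using h[of s] by linarith
  qed
  show i: "set_integrable lborel {0..c} (\<lambda>s. h s - r s * y s)"
    by (rule set_integrable_bounded_on[OF _ rate]) auto
  define Z where "Z t = y t - (LINT s:{0..t}|lborel. h s - r s * y s)" for t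
  have "Z c = Z 0"
  proof (rule quadratic_increments_imp_constant[OF c])
    fix a b assume ab: "0 \<le> a" "a \<le> b" "b \<le> c"
    have ib: "set_integrable lborel {0..b} (\<lambda>s. h s - r s * y s)"
      by (rule set_integrable_subset[OF i]) (use ab in auto)
    let ?\<Delta> = "\<phi> b - \<phi> a"
    have \<Delta>: "0 \<le> ?\<Delta>" "?\<Delta> \<le> N * (b - a)" using \<phi>_diff_bounds[OF ab(1,2)] by auto
    have Lip: "\<bar>y s - y a\<bar> \<le> (H + Q * N) * (b - a)" if s: "s \<in> {a..b}" for s
    proof -
      have "\<bar>LINT \<sigma>:{a..s}|lborel. h \<sigma> * exp (\<phi> \<sigma> - \<phi> s)\<bar> \<le> H * (s - a)"
        using s ab by (intro set_integral_abs_le source_bound) auto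
      also have "\<dots> \<le> H * (b - a)" using s H_nonneg by (intro mult_left_mono) auto
      finally have 1: "\<bar>LINT \<sigma>:{a..s}|lborel. h \<sigma> * exp (\<phi> \<sigma> - \<phi> s)\<bar> \<le> H * (b - a)" .
      have "\<bar>exp (- (\<phi> s - \<phi> a)) - 1\<bar> \<le> \<phi> s - \<phi> a"
        using \<phi>_diff_bounds[of a s] ab s by (intro exp_minus_one_le) auto
      also have "\<dots> \<le> N * (s - a)" using \<phi>_diff_bounds[of a s] ab s by auto
      also have "\<dots> \<le> N * (b - a)" using s N_nonneg by (intro mult_left_mono) auto
      finally have "\<bar>y a\<bar> * \<bar>exp (- (\<phi> s - \<phi> a)) - 1\<bar> \<le> Q * (N * (b - a))"
        using Q[of a] ab by (intro mult_mono) auto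
      then have "\<bar>y a * (exp (- (\<phi> s - \<phi> a)) - 1)\<bar> \<le> Q * N * (b - a)"
        by (simp add: abs_mult mult.assoc)
      then show ?thesis using 1 y_increment[of a s] ab s by (simp add: algebra_simps)
    qed
    have si: "set_integrable lborel {a..b} (\<lambda>s. h s * exp (\<phi> s - \<phi> b))" "set_integrable lborel {a..b} h"
      "set_integrable lborel {a..b} (\<lambda>s. r s * y s)" "set_integrable lborel {a..b} r"
    proof -
      show "set_integrable lborel {a..b} (\<lambda>s. h s * exp (\<phi> s - \<phi> b))"
        using ab by (intro set_integrable_bounded_on[where K=H] source_bound) auto
      show "set_integrable lborel {a..b} h" using h by (intro set_integrable_bounded_on[where K=H]) auto
      show "set_integrable lborel {a..b} r" using r by (intro set_integrable_bounded_on[where K=N]) auto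
      have "\<bar>r s * y s\<bar> \<le> N * Q" if "s \<in> {a..b}" for s
        using that r[of s] Q[of s] N_nonneg ab unfolding abs_mult by (intro mult_mono) auto
      then show "set_integrable lborel {a..b} (\<lambda>s. r s * y s)" by (intro set_integrable_bounded_on) auto
    qed
    have "Z b - Z a = y b - y a - (LINT s:{a..b}|lborel. h s - r s * y s)"
      unfolding Z_def using set_integral_combine[OF ib ab(1,2)] by simp
    also have "\<dots> = (LINT s:{a..b}|lborel. h s * exp (\<phi> s - \<phi> b)) - (LINT s:{a..b}|lborel. h s)
        + (LINT s:{a..b}|lborel. r s * y s) + y a * (exp (- ?\<Delta>) - 1)"
      using y_increment[OF ab(1,2)] si by (simp add: set_integral_diff)
    also have "\<dots> = (LINT s:{a..b}|lborel. h s * exp (\<phi> s - \<phi> b) - h s)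
        + (LINT s:{a..b}|lborel. r s * y s - y a * r s) + y a * (exp (- ?\<Delta>) - 1 + ?\<Delta>)"
      using si \<phi>_diff[OF ab(1,2)] by (simp add: set_integral_diff set_integrable_mult_right algebra_simps)
    \<comment> \<open>The integrands of the first two terms and the bracket of the third one are small with \<open>b - a\<close>.\<close>
    finally have eq: "Z b - Z a = (LINT s:{a..b}|lborel. h s * exp (\<phi> s - \<phi> b) - h s)
        + (LINT s:{a..b}|lborel. r s * y s - y a * r s) + y a * (exp (- ?\<Delta>) - 1 + ?\<Delta>)" .
    have 1: "\<bar>LINT s:{a..b}|lborel. h s * exp (\<phi> s - \<phi> b) - h s\<bar> \<le> H * (N * (b - a)) * (b - a)"
    proof (intro set_integral_abs_le)
      fix s assume s: "s \<in> {a..b}"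
      have "\<bar>exp (- (\<phi> b - \<phi> s)) - 1\<bar> \<le> \<phi> b - \<phi> s"
        using \<phi>_diff_bounds[of s b] ab s by (intro exp_minus_one_le) auto
      also have "\<dots> \<le> N * (b - s)" using \<phi>_diff_bounds[of s b] ab s by auto
      also have "\<dots> \<le> N * (b - a)" using s N_nonneg by (intro mult_left_mono) auto
      finally have "\<bar>h s\<bar> * \<bar>exp (- (\<phi> b - \<phi> s)) - 1\<bar> \<le> H * (N * (b - a))"
        using h[of s] H_nonneg by (intro mult_mono) auto
      moreover have "h s * exp (\<phi> s - \<phi> b) - h s = h s * (exp (- (\<phi> b - \<phi> s)) - 1)" by (simp add: algebra_simps)
      ultimately show "\<bar>h s * exp (\<phi> s - \<phi> b) - h s\<bar> \<le> H * (N * (b - a))" by (simp add: abs_mult)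
    qed (use ab in auto)
    have 2: "\<bar>LINT s:{a..b}|lborel. r s * y s - y a * r s\<bar> \<le> N * ((H + Q * N) * (b - a)) * (b - a)"
    proof (intro set_integral_abs_le)
      fix s assume s: "s \<in> {a..b}"
      have "\<bar>r s\<bar> * \<bar>y s - y a\<bar> \<le> N * ((H + Q * N) * (b - a))"
        using Lip[OF s] r[of s] N_nonneg by (intro mult_mono) auto
      then show "\<bar>r s * y s - y a * r s\<bar> \<le> N * ((H + Q * N) * (b - a))"
        by (simp add: abs_mult[symmetric] algebra_simps)
    qed (use ab in auto)
    have "\<bar>exp (- ?\<Delta>) - 1 + ?\<Delta>\<bar> \<le> ?\<Delta>\<^sup>2" using \<Delta> by (intro exp_remainder)
    also have "\<dots> \<le> (N * (b - a))\<^sup>2" using \<Delta> by (intro power_mono)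
    finally have "\<bar>y a\<bar> * \<bar>exp (- ?\<Delta>) - 1 + ?\<Delta>\<bar> \<le> Q * (N * (b - a))\<^sup>2"
      using Q[of a] ab by (intro mult_mono) auto
    then have 3: "\<bar>y a * (exp (- ?\<Delta>) - 1 + ?\<Delta>)\<bar> \<le> Q * (N * (b - a))\<^sup>2" by (simp add: abs_mult)
    have "\<bar>Z b - Z a\<bar> \<le> H * (N * (b - a)) * (b - a) + N * ((H + Q * N) * (b - a)) * (b - a) + Q * (N * (b - a))\<^sup>2"
      unfolding eq using 1 2 3 by linarith
    also have "\<dots> = (H * N + N * (H + Q * N) + Q * N\<^sup>2) * (b - a)\<^sup>2"
      by (simp add: power2_eq_square algebra_simps)
    finally show "\<bar>Z b - Z a\<bar> \<le> (H * N + N * (H + Q * N) + Q * N\<^sup>2) * (b - a)\<^sup>2" .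
  qed
  moreover have "Z 0 = y0"
  proof -
    have "\<bar>LINT s:{0..0}|lborel. h s - r s * y s\<bar> \<le> (H + N * Q) * (0 - 0)"
      by (rule set_integral_abs_le) (use rate c in auto)
    then have "(LINT s:{0..0}|lborel. h s - r s * y s) = 0"
      by (simp only: diff_self mult_zero_right abs_le_zero_iff)
    then show ?thesis unfolding Z_def y_0 by simp
  qed
  ultimately show "y c = y0 + (LINT s:{0..c}|lborel. h s - r s * y s)" by (simp add: Z_def)
qed

lemma y_nonneg: "0 \<le> y0 \<Longrightarrow> 0 \<le> y t"
  unfolding lin_sol_def set_lebesgue_integral_def using h
  by (intro mult_nonneg_nonneg add_nonneg_nonneg Bochner_Integration.integral_nonneg) auto

lemma y_Duhamel:
  assumes "0 \<le> t"
  shows "y t = y0 * exp (- \<phi> t) + (LINT s:{0..t}|lborel. h s * exp (- (\<phi> t - \<phi> s)))"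
  using y_increment[of 0 t] assms by (simp add: y_0 \<phi>_0 algebra_simps)

lemma Duhamel_integrable:
  assumes "0 \<le> t"
  shows "integrable lborel (\<lambda>s. indicator {0..t} s * (h s * exp (- (\<phi> t - \<phi> s))))"
proof -
  have "set_integrable lborel {0..t} (\<lambda>s. h s * exp (\<phi> s - \<phi> t))"
    using assms by (intro set_integrable_bounded_on[where K=H] source_bound) auto
  then show ?thesis by (simp add: set_integrable_def)
qed

end

text \<open>In Duhamel's formula the source enters with a positive factor and the rate only through the
  exponential damping.\<close>

lemma lin_sol_mono:
  assumes "linear_equation h r H N" "linear_equation h' r' H' N'" and t: "0 \<le> t" and y0: "0 \<le> y0"
    and hh: "AE s in lborel. s \<in> {0..t} \<longrightarrow> h s \<le> h' s" and rr: "AE s in lborel. s \<in> {0..t} \<longrightarrow> r' s \<le> r s"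
  shows "lin_sol y0 h r t \<le> lin_sol y0 h' r' t"
proof -
  interpret l: linear_equation h r H N y0 by fact
  interpret l': linear_equation h' r' H' N' y0 by fact
  have \<phi>: "l'.\<phi> t - l'.\<phi> s \<le> l.\<phi> t - l.\<phi> s" if s: "s \<in> {0..t}" for s
  proof -
    have "(LINT \<sigma>:{s..t}|lborel. r' \<sigma>) \<le> (LINT \<sigma>:{s..t}|lborel. r \<sigma>)"
      unfolding set_lebesgue_integral_def
    proof (rule integral_mono_AE)
      show "integrable lborel (\<lambda>\<sigma>. indicator {s..t} \<sigma> *\<^sub>R r' \<sigma>)"
        using set_integrable_bounded_on[OF l'.r_meas, of s t N'] l'.r by (simp add: set_integrable_def)
      show "integrable lborel (\<lambda>\<sigma>. indicator {s..t} \<sigma> *\<^sub>R r \<sigma>)"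
        using set_integrable_bounded_on[OF l.r_meas, of s t N] l.r by (simp add: set_integrable_def)
      show "AE \<sigma> in lborel. indicator {s..t} \<sigma> *\<^sub>R r' \<sigma> \<le> indicator {s..t} \<sigma> *\<^sub>R r \<sigma>"
        using rr by eventually_elim (use s in \<open>auto simp: indicator_def\<close>)
    qed
    then show ?thesis using l.\<phi>_diff[of s t] l'.\<phi>_diff[of s t] s by simp
  qed
  have "(LINT s:{0..t}|lborel. h s * exp (- (l.\<phi> t - l.\<phi> s))) \<le> (LINT s:{0..t}|lborel. h' s * exp (- (l'.\<phi> t - l'.\<phi> s)))"
    unfolding set_lebesgue_integral_def real_scaleR_def
  proof (rule integral_mono_AE[OF l.Duhamel_integrable[OF t] l'.Duhamel_integrable[OF t]])
    show "AE s in lborel. indicator {0..t} s * (h s * exp (- (l.\<phi> t - l.\<phi> s))) \<le>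
        indicator {0..t} s * (h' s * exp (- (l'.\<phi> t - l'.\<phi> s)))"
      using hh
    proof eventually_elim
      case (elim s)
      show ?case
      proof (cases "s \<in> {0..t}")
        case True
        then have "h s * exp (- (l.\<phi> t - l.\<phi> s)) \<le> h' s * exp (- (l'.\<phi> t - l'.\<phi> s))"
          using elim \<phi>[OF True] l.h[of s] l'.h[of s] by (intro mult_mono) auto
        then show ?thesis by (simp add: indicator_def)
      qed simp
    qed
  qed
  moreover have "y0 * exp (- l.\<phi> t) \<le> y0 * exp (- l'.\<phi> t)"
    using \<phi>[of 0] t y0 l.\<phi>_0 l'.\<phi>_0 by (intro mult_left_mono) auto
  ultimately show ?thesis using l.y_Duhamel[OF t] l'.y_Duhamel[OF t] by simp
qed

section \<open>The abstract Kaniel--Shinbrot iteration\<close>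

text \<open>The iterates are compared for almost every point at each time, whereas the linear equation is solved
  along almost every trajectory, for which almost every time must be good.\<close>

lemma AE_slices_swap:
  fixes Q :: "real \<Rightarrow> 'z::euclidean_space \<Rightarrow> bool"
  assumes [measurable]: "Measurable.pred (borel \<Otimes>\<^sub>M borel) (\<lambda>(s, z). Q s z)"
    and Q: "\<And>s. s \<in> time_int T \<Longrightarrow> AE z in lborel. Q s z" and t: "t \<in> time_int T"
  shows "AE z in lborel. AE s in lborel. s \<in> {0..t} \<longrightarrow> Q s z"
proof -
  have "AE s in lborel. AE z in lborel. s \<in> {0..t} \<longrightarrow> Q s z"
    by (rule AE_I2) (use Q time_int_mono[OF t] in auto)
  moreover have "{x \<in> space (lborel \<Otimes>\<^sub>M lborel). fst x \<in> {0..t} \<longrightarrow> Q (fst x) (snd x)} \<in> sets (lborel \<Otimes>\<^sub>M (lborel :: 'z measure))"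
    by measurable
  ultimately show ?thesis by (subst lborel_pair.AE_commute[symmetric]) auto
qed

text \<open>What the iteration needs to know about the collision operators, seen along the free flow. \<open>M\<close> is the
  Maxwellian and \<open>k M\<close> the largest density admitted; \<open>P t z\<close> is the collision frequency against \<open>k M\<close> at time \<open>t\<close>
  on the trajectory \<open>z\<close>, and \<open>\<rho>\<close> bounds it for all times. \<open>G\<close> is the gain and \<open>R\<close> the loss rate. The Lipschitz
  constants \<open>3\<close> and \<open>2\<close> are the degrees of the ternary gain and rate. The bound \<open>1 / 12\<close> expresses
  that a particle hardly ever collides.\<close>

locale kaniel_shinbrot =
  fixes M :: "'z::euclidean_space \<Rightarrow> real" and k :: real and P :: "real \<Rightarrow> 'z \<Rightarrow> real"
    and \<rho> :: "'z \<Rightarrow> real" and G R :: "('z \<Rightarrow> real) \<Rightarrow> real \<Rightarrow> 'z \<Rightarrow> real"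
  assumes k_pos: "0 < k" and M_pos: "\<And>z. 0 < M z" and M_int: "integrable lborel M"
    and \<rho>_meas [measurable]: "\<rho> \<in> borel_measurable borel" and M\<rho>_int: "integrable lborel (\<lambda>z. M z * \<rho> z)"
    and P_meas: "case_prod P \<in> borel_measurable (borel \<Otimes>\<^sub>M borel)"
    and P_nonneg: "\<And>t z. 0 \<le> P t z" and P_le: "\<And>t z. P t z \<le> \<rho> z"
    and P_int: "\<And>z. (\<integral>\<^sup>+s. ennreal (P s z) * indicator {0..} s \<partial>lborel) \<le> ennreal (1 / 12)"
    and G_meas: "\<And>a. case_prod a \<in> borel_measurable (borel \<Otimes>\<^sub>M borel) \<Longrightarrow>
      (\<lambda>(t, z). G (a t) t z) \<in> borel_measurable (borel \<Otimes>\<^sub>M borel)"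
    and R_meas: "\<And>a. case_prod a \<in> borel_measurable (borel \<Otimes>\<^sub>M borel) \<Longrightarrow>
      (\<lambda>(t, z). R (a t) t z) \<in> borel_measurable (borel \<Otimes>\<^sub>M borel)"
    and G_nonneg: "\<And>f t z. 0 \<le> G f t z"
    and G_bound: "\<And>f t z. f \<in> borel_measurable borel \<Longrightarrow> G f t z \<le> k * M z * P t z"
    and R_nonneg: "\<And>f t z. 0 \<le> R f t z"
    and R_bound: "\<And>f t z. f \<in> borel_measurable borel \<Longrightarrow> R f t z \<le> P t z"
    and G_mono: "\<And>f g t. f \<in> borel_measurable borel \<Longrightarrow> g \<in> borel_measurable borel \<Longrightarrow>
      AE z in lborel. f z \<le> g z \<Longrightarrow> AE z in lborel. G f t z \<le> G g t z"
    and R_mono: "\<And>f g t. f \<in> borel_measurable borel \<Longrightarrow> g \<in> borel_measurable borel \<Longrightarrow>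
      AE z in lborel. f z \<le> g z \<Longrightarrow> AE z in lborel. R f t z \<le> R g t z"
    and G_lip: "\<And>f g t \<epsilon>. f \<in> borel_measurable borel \<Longrightarrow> g \<in> borel_measurable borel \<Longrightarrow> 0 \<le> \<epsilon> \<Longrightarrow>
      AE z in lborel. \<bar>f z - g z\<bar> \<le> \<epsilon> * (k * M z) \<Longrightarrow>
      AE z in lborel. \<bar>G f t z - G g t z\<bar> \<le> 3 * \<epsilon> * (k * M z) * P t z"
    and R_lip: "\<And>f g t \<epsilon>. f \<in> borel_measurable borel \<Longrightarrow> g \<in> borel_measurable borel \<Longrightarrow> 0 \<le> \<epsilon> \<Longrightarrow>
      AE z in lborel. \<bar>f z - g z\<bar> \<le> \<epsilon> * (k * M z) \<Longrightarrow>
      AE z in lborel. \<bar>R f t z - R g t z\<bar> \<le> 2 * \<epsilon> * P t z"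
begin

lemma M_meas [measurable]: "M \<in> borel_measurable borel" using M_int by auto

lemma P_meas' [measurable (raw)]:
  "f \<in> borel_measurable N \<Longrightarrow> g \<in> borel_measurable N \<Longrightarrow> (\<lambda>x. P (f x) (g x)) \<in> borel_measurable N"
  using measurable_compose[OF measurable_Pair[of f N borel g borel] P_meas] by simp

definition jointly_borel :: "(real \<Rightarrow> 'z \<Rightarrow> real) \<Rightarrow> bool"
  where "jointly_borel a \<longleftrightarrow> case_prod a \<in> borel_measurable (borel \<Otimes>\<^sub>M borel)"

lemma jointly_borel_compose:
  assumes "jointly_borel a" and [measurable]: "f \<in> borel_measurable N" "g \<in> borel_measurable N"
  shows "(\<lambda>x. a (f x) (g x)) \<in> borel_measurable N"
  using measurable_compose[OF measurable_Pair[of f N borel g borel], of "case_prod a"] assms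
  by (simp add: jointly_borel_def)

lemma jointly_borel_slice: "jointly_borel a \<Longrightarrow> a t \<in> borel_measurable borel"
  by (rule jointly_borel_compose[where f="\<lambda>_. t" and g="\<lambda>z. z", simplified]) auto

lemma jointly_borel_gain: "jointly_borel a \<Longrightarrow> jointly_borel (\<lambda>t. G (a t) t)"
  using G_meas[of a] by (simp add: jointly_borel_def)

lemma jointly_borel_rate: "jointly_borel a \<Longrightarrow> jointly_borel (\<lambda>t. R (a t) t)"
  using R_meas[of a] by (simp add: jointly_borel_def)

lemma jointly_borel_const:
  assumes [measurable]: "f \<in> borel_measurable borel"
  shows "jointly_borel (\<lambda>_. f)"
  unfolding jointly_borel_def by measurable

lemma gain_slice_borel: "f \<in> borel_measurable borel \<Longrightarrow> (\<lambda>z. G f s z) \<in> borel_measurable borel"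
  and rate_slice_borel: "f \<in> borel_measurable borel \<Longrightarrow> (\<lambda>z. R f s z) \<in> borel_measurable borel"
  using jointly_borel_slice[OF jointly_borel_gain[OF jointly_borel_const]]
    jointly_borel_slice[OF jointly_borel_rate[OF jointly_borel_const]] by auto

lemma \<rho>_nonneg: "0 \<le> \<rho> z" using P_nonneg P_le order_trans by blast

text \<open>The solution of the linear problem with the gain of \<open>a\<close> and the loss rate of \<open>b\<close>. Negative times are moved
  to \<open>0\<close>, so that the bounds below hold for all real times.\<close>

definition step :: "('z \<Rightarrow> real) \<Rightarrow> (real \<Rightarrow> 'z \<Rightarrow> real) \<Rightarrow> (real \<Rightarrow> 'z \<Rightarrow> real) \<Rightarrow> real \<Rightarrow> 'z \<Rightarrow> real"
  where "step f0 a b t z = lin_sol (f0 z) (\<lambda>s. G (a s) s z) (\<lambda>s. R (b s) s z) (max 0 t)"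

definition rhs :: "(real \<Rightarrow> 'z \<Rightarrow> real) \<Rightarrow> (real \<Rightarrow> 'z \<Rightarrow> real) \<Rightarrow> (real \<Rightarrow> 'z \<Rightarrow> real) \<Rightarrow> real \<Rightarrow> 'z \<Rightarrow> real"
  where "rhs a b y s z = G (a s) s z - R (b s) s z * y s z"

lemma linear_equation_step:
  assumes a: "jointly_borel a" and b: "jointly_borel b"
  shows "linear_equation (\<lambda>s. G (a s) s z) (\<lambda>s. R (b s) s z) (k * M z * \<rho> z) (\<rho> z)"
proof
  show "(\<lambda>s. G (a s) s z) \<in> borel_measurable borel"
    by (rule jointly_borel_compose[OF jointly_borel_gain[OF a], where f="\<lambda>s. s" and g="\<lambda>s. z"]) auto
  show "(\<lambda>s. R (b s) s z) \<in> borel_measurable borel"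
    by (rule jointly_borel_compose[OF jointly_borel_rate[OF b], where f="\<lambda>s. s" and g="\<lambda>s. z"]) auto
  fix s
  show "0 \<le> G (a s) s z" "0 \<le> R (b s) s z" by (rule G_nonneg R_nonneg)+
  have "G (a s) s z \<le> k * M z * P s z" by (rule G_bound[OF jointly_borel_slice[OF a]])
  also have "\<dots> \<le> k * M z * \<rho> z" using k_pos M_pos[of z] by (intro mult_left_mono P_le) auto
  finally show "G (a s) s z \<le> k * M z * \<rho> z" .
  show "R (b s) s z \<le> \<rho> z" using R_bound[OF jointly_borel_slice[OF b]] P_le order_trans by blast
qed

lemma jointly_borel_step:
  assumes a: "jointly_borel a" and b: "jointly_borel b" and [measurable]: "f0 \<in> borel_measurable borel"
  shows "jointly_borel (step f0 a b)"
proof -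
  note [measurable (raw)] = jointly_borel_compose[OF jointly_borel_gain[OF a]] jointly_borel_compose[OF jointly_borel_rate[OF b]]
  show ?thesis unfolding jointly_borel_def step_def[abs_def] lin_sol_def by measurable
qed

lemma step_nonneg:
  assumes a: "jointly_borel a" and b: "jointly_borel b" and f0: "0 \<le> f0 z"
  shows "0 \<le> step f0 a b t z"
  unfolding step_def by (rule linear_equation.y_nonneg[OF linear_equation_step[OF a b] f0])

lemma P_integral_le: "(\<integral>\<^sup>+s. ennreal (P s z) * indicator {0..t} s \<partial>lborel) \<le> ennreal (1 / 12)"
proof -
  have "(\<integral>\<^sup>+s. ennreal (P s z) * indicator {0..t} s \<partial>lborel) \<le> (\<integral>\<^sup>+s. ennreal (P s z) * indicator {0..} s \<partial>lborel)"
    by (intro nn_integral_mono) (auto simp: indicator_def)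
  also have "\<dots> \<le> ennreal (1 / 12)" by (rule P_int)
  finally show ?thesis .
qed

lemma step_integral_equation:
  assumes a: "jointly_borel a" and b: "jointly_borel b" and t: "0 \<le> t"
  shows "set_integrable lborel {0..t} (\<lambda>s. rhs a b (step f0 a b) s z)"
    and "step f0 a b t z = f0 z + (LINT s:{0..t}|lborel. rhs a b (step f0 a b) s z)"
proof -
  interpret linear_equation "\<lambda>s. G (a s) s z" "\<lambda>s. R (b s) s z" "k * M z * \<rho> z" "\<rho> z" "f0 z"
    by (rule linear_equation_step[OF a b])
  have eq: "indicator {0..t} s *\<^sub>R rhs a b (step f0 a b) s z = indicator {0..t} s *\<^sub>R (G (a s) s z - R (b s) s z * y s)" for s
    by (simp add: indicator_def rhs_def step_def)
  show "set_integrable lborel {0..t} (\<lambda>s. rhs a b (step f0 a b) s z)"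
    using y_integral_equation(1)[OF t] unfolding set_integrable_def eq .
  show "step f0 a b t z = f0 z + (LINT s:{0..t}|lborel. rhs a b (step f0 a b) s z)"
    using y_integral_equation(2)[OF t] t unfolding set_lebesgue_integral_def eq by (simp add: step_def)
qed

text \<open>Dropping the loss leaves the integrated gain, which is at most \<open>k M / 12\<close>; the factor \<open>2\<close> is generous.\<close>

lemma step_bound:
  assumes a: "jointly_borel a" and b: "jointly_borel b" and f0: "0 \<le> f0 z" "f0 z \<le> k * M z"
  shows "step f0 a b t z \<le> 2 * (k * M z)"
proof -
  let ?t = "max 0 t"
  interpret linear_equation "\<lambda>s. G (a s) s z" "\<lambda>s. R (b s) s z" "k * M z * \<rho> z" "\<rho> z" "f0 z"
    by (rule linear_equation_step[OF a b])
  have t: "0 \<le> ?t" by simp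
  have hi: "set_integrable lborel {0..?t} (\<lambda>s. G (a s) s z)"
    using h by (intro set_integrable_bounded_on[where K="k * M z * \<rho> z"]) auto
  have "step f0 a b t z \<le> f0 z + (LINT s:{0..?t}|lborel. G (a s) s z)"
  proof -
    have "(LINT s:{0..?t}|lborel. G (a s) s z - R (b s) s z * y s) \<le> (LINT s:{0..?t}|lborel. G (a s) s z)"
      using y_integral_equation(1)[OF t] hi r(1) y_nonneg[OF f0(1)]
      by (intro set_integral_mono) auto
    then show ?thesis using y_integral_equation(2)[OF t] by (simp add: step_def)
  qed
  also have "(LINT s:{0..?t}|lborel. G (a s) s z) \<le> k * M z"
  proof -
    have "ennreal (LINT s:{0..?t}|lborel. G (a s) s z) = (\<integral>\<^sup>+s. ennreal (indicator {0..?t} s *\<^sub>R G (a s) s z) \<partial>lborel)"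
      unfolding set_lebesgue_integral_def using hi h(1)
      by (intro nn_integral_eq_integral[symmetric]) (auto simp: set_integrable_def)
    also have "\<dots> \<le> (\<integral>\<^sup>+s. ennreal (k * M z) * (ennreal (P s z) * indicator {0..?t} s) \<partial>lborel)"
      using G_bound[OF jointly_borel_slice[OF a]] k_pos M_pos[of z]
      by (intro nn_integral_mono) (auto simp: indicator_def ennreal_mult'[symmetric] intro!: ennreal_leI)
    also have "\<dots> = ennreal (k * M z) * (\<integral>\<^sup>+s. ennreal (P s z) * indicator {0..?t} s \<partial>lborel)"
      by (rule nn_integral_cmult) measurable
    also have "\<dots> \<le> ennreal (k * M z) * ennreal (1 / 12)" by (intro mult_left_mono P_integral_le) auto
    also have "\<dots> \<le> ennreal (k * M z)" using k_pos M_pos[of z] by (simp add: ennreal_mult'[symmetric] ennreal_leI)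
    finally show ?thesis using k_pos M_pos[of z] by (subst (asm) ennreal_le_iff) auto
  qed
  finally show ?thesis using f0 by simp
qed

text \<open>For \<open>0 \<le> y \<le> 2 k M\<close> the gain contributes \<open>k M \<rho>\<close> and the loss \<open>2 k M \<rho>\<close>.\<close>

definition envelope :: "'z \<Rightarrow> real" where "envelope z = 3 * k * (M z * \<rho> z)"

lemma envelope_int: "integrable lborel envelope"
  unfolding envelope_def[abs_def] using M\<rho>_int by auto

lemma rhs_bound:
  assumes a: "jointly_borel a" and b: "jointly_borel b" and y: "0 \<le> y s z" "y s z \<le> 2 * (k * M z)"
  shows "\<bar>rhs a b y s z\<bar> \<le> envelope z"
proof -
  interpret linear_equation "\<lambda>s. G (a s) s z" "\<lambda>s. R (b s) s z" "k * M z * \<rho> z" "\<rho> z" 0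
    by (rule linear_equation_step[OF a b])
  have "R (b s) s z * y s z \<le> \<rho> z * (2 * (k * M z))" using r y \<rho>_nonneg by (intro mult_mono) auto
  moreover have "0 \<le> R (b s) s z * y s z" using r y by simp
  moreover have "0 \<le> k * M z * \<rho> z" using k_pos M_pos[of z] \<rho>_nonneg[of z] by simp
  ultimately show ?thesis using h[of s] by (simp add: rhs_def envelope_def abs_le_iff algebra_simps)
qed

lemma jointly_borel_rhs:
  assumes a: "jointly_borel a" and b: "jointly_borel b" and y: "jointly_borel y"
  shows "jointly_borel (rhs a b y)"
proof -
  note [measurable (raw)] = jointly_borel_compose[OF jointly_borel_gain[OF a]] jointly_borel_compose[OF jointly_borel_rate[OF b]]
    jointly_borel_compose[OF y]
  show ?thesis unfolding jointly_borel_def rhs_def[abs_def] by measurable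
qed

text \<open>The pointwise integral equation becomes one for classes by \<open>dominated_curve_integral\<close>.\<close>

lemma step_evolves:
  assumes a: "jointly_borel a" and b: "jointly_borel b" and f0 [measurable]: "f0 \<in> borel_measurable borel"
    and f0_bound: "\<And>z. 0 \<le> f0 z" "\<And>z. f0 z \<le> k * M z"
  shows "evolves T (step f0 a b) (\<lambda>s. L1_class (rhs a b (step f0 a b) s))" and "step f0 a b 0 = f0"
proof -
  have y: "0 \<le> step f0 a b t z" "step f0 a b t z \<le> 2 * (k * M z)" for t z
    by (rule step_nonneg[OF a b f0_bound(1)], rule step_bound[OF a b f0_bound(1) f0_bound(2)])
  have jb: "case_prod (rhs a b (step f0 a b)) \<in> borel_measurable (borel \<Otimes>\<^sub>M borel)"
    using jointly_borel_rhs[OF a b jointly_borel_step[OF a b f0]] by (simp add: jointly_borel_def)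
  have bd: "\<bar>rhs a b (step f0 a b) s z\<bar> \<le> envelope z" for s z
    by (rule rhs_bound[OF a b]) (rule y)+
  note dom = dominated_curve_set_integrable[OF jb envelope_int bd] dominated_curve_integral[OF jb envelope_int bd]
    dominated_integral_integrable[OF jb envelope_int bd]
  have kM: "integrable lborel (\<lambda>z. 2 * (k * M z))" using M_int by auto
  have f0_int: "integrable lborel f0"
    by (rule Bochner_Integration.integrable_bound[OF kM]) (use f0_bound M_pos k_pos in \<open>auto intro!: AE_I2 order_trans[OF f0_bound(2)]\<close>)
  show 0: "step f0 a b 0 = f0"
  proof
    fix z
    interpret linear_equation "\<lambda>s. G (a s) s z" "\<lambda>s. R (b s) s z" "k * M z * \<rho> z" "\<rho> z" "f0 z"
      by (rule linear_equation_step[OF a b])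
    show "step f0 a b 0 z = f0 z" using y_0 by (simp add: step_def)
  qed
  show "evolves T (step f0 a b) (\<lambda>s. L1_class (rhs a b (step f0 a b) s))"
    unfolding evolves_def
  proof (intro ballI conjI)
    fix t assume "t \<in> time_int T"
    then have t: "0 \<le> t" by (simp add: time_int_def)
    have eq: "step f0 a b t = (\<lambda>z. f0 z + (LINT s:{0..t}|lborel. rhs a b (step f0 a b) s z))"
      by (rule ext) (rule step_integral_equation(2)[OF a b t])
    show "integrable lborel (step f0 a b t)" unfolding eq by (intro Bochner_Integration.integrable_add f0_int dom)
    show "set_integrable lebesgue {0..t} (\<lambda>s. L1_class (rhs a b (step f0 a b) s))" by (rule dom)
    show "L1_class (step f0 a b t) = L1_class (step f0 a b 0) + (LINT s:{0..t}|lebesgue. L1_class (rhs a b (step f0 a b) s))"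
      unfolding 0 dom(2) by (subst eq) (rule L1_class_add[OF f0_int dom(3)])
  qed
qed

lemma step_mono:
  assumes a: "jointly_borel a" "jointly_borel a'" and b: "jointly_borel b" "jointly_borel b'"
    and f0: "\<And>z. 0 \<le> f0 z"
    and aa: "\<And>s. s \<in> time_int T \<Longrightarrow> AE z in lborel. a s z \<le> a' s z"
    and bb: "\<And>s. s \<in> time_int T \<Longrightarrow> AE z in lborel. b' s z \<le> b s z" and t: "t \<in> time_int T"
  shows "AE z in lborel. step f0 a b t z \<le> step f0 a' b' t z"
proof -
  note [measurable (raw)] = jointly_borel_compose[OF jointly_borel_gain[OF a(1)]] jointly_borel_compose[OF jointly_borel_gain[OF a(2)]]
    jointly_borel_compose[OF jointly_borel_rate[OF b(1)]] jointly_borel_compose[OF jointly_borel_rate[OF b(2)]]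
  have "AE z in lborel. AE s in lborel. s \<in> {0..t} \<longrightarrow> G (a s) s z \<le> G (a' s) s z"
    by (rule AE_slices_swap[OF _ _ t]) (measurable, intro G_mono jointly_borel_slice a aa)
  moreover have "AE z in lborel. AE s in lborel. s \<in> {0..t} \<longrightarrow> R (b' s) s z \<le> R (b s) s z"
    by (rule AE_slices_swap[OF _ _ t]) (measurable, intro R_mono jointly_borel_slice b bb)
  ultimately show ?thesis
  proof eventually_elim
    case (elim z)
    then show ?case
      unfolding step_def using t
      by (intro lin_sol_mono[OF linear_equation_step[OF a(1) b(1)] linear_equation_step[OF a(2) b(2)]] f0)
        (auto simp: time_int_def)
  qed
qed

text \<open>The dissipative part of the equation contributes a term with \<open>w\<close> itself. An a priori bound
  \<open>\<eta>\<close> on \<open>|w| / M\<close> improves to \<open>(c + \<eta>) / 12\<close>; the fixed point of this map is \<open>c / 11\<close>.\<close>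

lemma evolves_contract:
  assumes ev: "evolves T w D" and w0: "AE z in lborel. w 0 z = 0"
    and c: "0 \<le> c" "0 \<le> c0" and apriori: "\<And>t. t \<in> time_int T \<Longrightarrow> AE z in lborel. \<bar>w t z\<bar> \<le> c0 * M z"
    and D: "AE s in lebesgue. s \<in> time_int T \<longrightarrow>
      (\<exists>d. integrable lborel d \<and> D s = L1_class d \<and> (AE z in lborel. \<bar>d z\<bar> \<le> P s z * (c * M z + \<bar>w s z\<bar>)))"
    and t: "t \<in> time_int T"
  shows "AE z in lborel. \<bar>w t z\<bar> \<le> c / 11 * M z"
proof -
  define \<eta> where "\<eta> j = c / 11 + (c0 - c / 11) / 12 ^ j" for j :: nat
  have bound: "0 \<le> \<eta> j \<and> (\<forall>t\<in>time_int T. AE z in lborel. \<bar>w t z\<bar> \<le> \<eta> j * M z)" for j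
  proof (induction j)
    case 0
    then show ?case using c apriori by (simp add: \<eta>_def)
  next
    case (Suc j)
    have Suc_\<eta>: "\<eta> (Suc j) = (c + \<eta> j) / 12" by (simp add: \<eta>_def field_simps)
    have "AE z in lborel. \<bar>w t z\<bar> \<le> \<eta> (Suc j) * M z" if t: "t \<in> time_int T" for t
    proof (rule evolves_bound[OF ev w0, where q="\<lambda>s z. P s z * ((c + \<eta> j) * M z)"])
      show "AE s in lebesgue. s \<in> {0..t} \<longrightarrow>
        (\<exists>d. integrable lborel d \<and> D s = L1_class d \<and> (AE z in lborel. \<bar>d z\<bar> \<le> P s z * ((c + \<eta> j) * M z)))"
        using D
      proof eventually_elim
        case (elim s)
        show ?case
        proof
          assume "s \<in> {0..t}"
          then have s: "s \<in> time_int T" using time_int_mono[OF t] by auto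
          then obtain d where d: "integrable lborel d" "D s = L1_class d"
            "AE z in lborel. \<bar>d z\<bar> \<le> P s z * (c * M z + \<bar>w s z\<bar>)" using elim by blast
          have "AE z in lborel. \<bar>w s z\<bar> \<le> \<eta> j * M z" using Suc s by blast
          with d(3) have "AE z in lborel. \<bar>d z\<bar> \<le> P s z * ((c + \<eta> j) * M z)"
          proof eventually_elim
            case (elim z)
            have "P s z * (c * M z + \<bar>w s z\<bar>) \<le> P s z * ((c + \<eta> j) * M z)"
              using elim(2) P_nonneg by (intro mult_left_mono) (auto simp: algebra_simps)
            then show ?case using elim(1) by linarith
          qed
          then show "\<exists>d. integrable lborel d \<and> D s = L1_class d \<and> (AE z in lborel. \<bar>d z\<bar> \<le> P s z * ((c + \<eta> j) * M z))"
            using d by blast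
        qed
      qed
      have cj: "0 \<le> c + \<eta> j" using Suc c by simp
      show "0 \<le> \<eta> (Suc j) * M z" for z unfolding Suc_\<eta> using cj M_pos[of z] by simp
      show "integrable lborel (\<lambda>z. \<eta> (Suc j) * M z)" using M_int by auto
      show "AE z in lborel. (\<integral>\<^sup>+s. ennreal (P s z * ((c + \<eta> j) * M z)) * indicator {0..t} s \<partial>lborel) \<le> ennreal (\<eta> (Suc j) * M z)"
      proof (rule AE_I2)
        fix z
        have m: "0 \<le> (c + \<eta> j) * M z" using cj M_pos[of z] by simp
        have "(\<integral>\<^sup>+s. ennreal (P s z * ((c + \<eta> j) * M z)) * indicator {0..t} s \<partial>lborel) =
          (\<integral>\<^sup>+s. ennreal ((c + \<eta> j) * M z) * (ennreal (P s z) * indicator {0..t} s) \<partial>lborel)"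
          by (intro nn_integral_cong, subst ennreal_mult[OF P_nonneg m]) (simp only: mult_ac)
        also have "\<dots> = ennreal ((c + \<eta> j) * M z) * (\<integral>\<^sup>+s. ennreal (P s z) * indicator {0..t} s \<partial>lborel)"
          by (rule nn_integral_cmult) measurable
        also have "\<dots> \<le> ennreal ((c + \<eta> j) * M z) * ennreal (1 / 12)" by (intro mult_left_mono P_integral_le) auto
        also have "\<dots> = ennreal (\<eta> (Suc j) * M z)" using m by (simp add: ennreal_mult'[symmetric] Suc_\<eta>)
        finally show "(\<integral>\<^sup>+s. ennreal (P s z * ((c + \<eta> j) * M z)) * indicator {0..t} s \<partial>lborel) \<le> ennreal (\<eta> (Suc j) * M z)" .
      qed
    qed (use t in \<open>measurable; simp\<close>)+
    moreover have "0 \<le> \<eta> (Suc j)" unfolding Suc_\<eta> using Suc c by simp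
    ultimately show ?case by blast
  qed
  then have all: "AE z in lborel. \<forall>j. \<bar>w t z\<bar> \<le> \<eta> j * M z" using t by (subst AE_all_countable) blast
  have lim: "\<eta> \<longlonglongrightarrow> c / 11 + 0"
    unfolding \<eta>_def
  proof (intro tendsto_add tendsto_const)
    have "(\<lambda>j. (c0 - c / 11) * (1 / 12) ^ j) \<longlonglongrightarrow> (c0 - c / 11) * 0"
      by (intro tendsto_mult tendsto_const LIMSEQ_power_zero) simp
    then show "(\<lambda>j. (c0 - c / 11) / 12 ^ j) \<longlonglongrightarrow> 0" by (simp add: power_one_over)
  qed
  from all show ?thesis
  proof eventually_elim
    case (elim z)
    have "(\<lambda>j. \<eta> j * M z) \<longlonglongrightarrow> (c / 11 + 0) * M z" using lim by (intro tendsto_intros)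
    then show ?case using elim by (intro LIMSEQ_le_const[where X="\<lambda>j. \<eta> j * M z"]) auto
  qed
qed

lemma rhs_integrable:
  assumes a: "f \<in> borel_measurable borel" and b: "g \<in> borel_measurable borel"
    and [measurable]: "y \<in> borel_measurable borel" and y: "AE z in lborel. \<bar>y z\<bar> \<le> k * M z"
  shows "integrable lborel (\<lambda>z. G f s z - R g s z * y z)"
proof (rule Bochner_Integration.integrable_bound[OF envelope_int])
  note [measurable] = gain_slice_borel[OF a] rate_slice_borel[OF b]
  show "(\<lambda>z. G f s z - R g s z * y z) \<in> borel_measurable lborel" by measurable
  show "AE z in lborel. norm (G f s z - R g s z * y z) \<le> norm (envelope z)"
    using y
  proof eventually_elim
    case (elim z)
    have "R g s z * \<bar>y z\<bar> \<le> \<rho> z * (k * M z)"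
      using elim R_bound[OF b, of s z] P_le[of s z] R_nonneg \<rho>_nonneg by (intro mult_mono) auto
    then have "\<bar>R g s z * y z\<bar> \<le> \<rho> z * (k * M z)" using R_nonneg[of g s z] by (simp add: abs_mult)
    moreover have "k * M z * P s z \<le> k * M z * \<rho> z" using k_pos M_pos[of z] by (intro mult_left_mono P_le) auto
    moreover have "0 \<le> k * (M z * \<rho> z)" using k_pos M_pos[of z] \<rho>_nonneg[of z] by simp
    ultimately show ?case
      using G_bound[OF a, of s z] G_nonneg[of f s z] by (simp add: envelope_def algebra_simps)
  qed
qed

text \<open>Of the coefficient \<open>5 \<epsilon>\<close>, the gain contributes \<open>3 \<epsilon>\<close> and the rate \<open>2 \<epsilon>\<close>; by \<open>evolves_contract\<close> the distance is
  at most \<open>5 / 11 \<epsilon> k M\<close>, and \<open>5 / 11 < 1 / 2\<close>.\<close>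

lemma contraction:
  assumes p: "evolves T p Dp" and q: "evolves T q Dq" and pq0: "AE z in lborel. p 0 z = q 0 z" and \<epsilon>: "0 \<le> \<epsilon>"
    and pb: "\<And>s. s \<in> time_int T \<Longrightarrow> AE z in lborel. 0 \<le> p s z \<and> p s z \<le> k * M z"
    and qb: "\<And>s. s \<in> time_int T \<Longrightarrow> AE z in lborel. 0 \<le> q s z \<and> q s z \<le> k * M z"
    and D: "AE s in lebesgue. s \<in> time_int T \<longrightarrow>
      (\<exists>p1 p2 q1 q2. p1 \<in> borel_measurable borel \<and> p2 \<in> borel_measurable borel \<and> q1 \<in> borel_measurable borel \<and>
        q2 \<in> borel_measurable borel \<and> (AE z in lborel. \<bar>p1 z - q1 z\<bar> \<le> \<epsilon> * (k * M z)) \<and>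
        (AE z in lborel. \<bar>p2 z - q2 z\<bar> \<le> \<epsilon> * (k * M z)) \<and>
        Dp s = L1_class (\<lambda>z. G p1 s z - R p2 s z * p s z) \<and> Dq s = L1_class (\<lambda>z. G q1 s z - R q2 s z * q s z))"
    and t: "t \<in> time_int T"
  shows "AE z in lborel. \<bar>p t z - q t z\<bar> \<le> \<epsilon> / 2 * (k * M z)"
proof -
  have "AE z in lborel. \<bar>p t z - q t z\<bar> \<le> 5 * \<epsilon> * k / 11 * M z"
  proof (rule evolves_contract[OF evolves_diff[OF p q], where ?c0.0=k])
    show "AE z in lborel. p 0 z - q 0 z = 0" using pq0 by eventually_elim simp
    show "AE z in lborel. \<bar>p s z - q s z\<bar> \<le> k * M z" if "s \<in> time_int T" for s
      using pb[OF that] qb[OF that] by eventually_elim auto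
    show "AE s in lebesgue. s \<in> time_int T \<longrightarrow> (\<exists>d. integrable lborel d \<and> Dp s - Dq s = L1_class d \<and>
      (AE z in lborel. \<bar>d z\<bar> \<le> P s z * (5 * \<epsilon> * k * M z + \<bar>p s z - q s z\<bar>)))"
      using D
    proof eventually_elim
      case (elim s)
      show ?case
      proof
        assume s: "s \<in> time_int T"
        then obtain p1 p2 q1 q2 where m: "p1 \<in> borel_measurable borel" "p2 \<in> borel_measurable borel"
          "q1 \<in> borel_measurable borel" "q2 \<in> borel_measurable borel"
          and d1: "AE z in lborel. \<bar>p1 z - q1 z\<bar> \<le> \<epsilon> * (k * M z)" and d2: "AE z in lborel. \<bar>p2 z - q2 z\<bar> \<le> \<epsilon> * (k * M z)"
          and D': "Dp s = L1_class (\<lambda>z. G p1 s z - R p2 s z * p s z)" "Dq s = L1_class (\<lambda>z. G q1 s z - R q2 s z * q s z)"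
          using elim by blast
        have pm: "p s \<in> borel_measurable borel" "q s \<in> borel_measurable borel"
          using p q s by (auto simp: evolves_def dest!: bspec[of _ _ s])
        have ab: "AE z in lborel. \<bar>p s z\<bar> \<le> k * M z" "AE z in lborel. \<bar>q s z\<bar> \<le> k * M z"
          by (rule eventually_mono[OF pb[OF s]], simp) (rule eventually_mono[OF qb[OF s]], simp)
        have i: "integrable lborel (\<lambda>z. G p1 s z - R p2 s z * p s z)" "integrable lborel (\<lambda>z. G q1 s z - R q2 s z * q s z)"
          by (intro rhs_integrable m pm ab)+
        let ?d = "\<lambda>z. (G p1 s z - R p2 s z * p s z) - (G q1 s z - R q2 s z * q s z)"
        have "AE z in lborel. \<bar>?d z\<bar> \<le> P s z * (5 * \<epsilon> * k * M z + \<bar>p s z - q s z\<bar>)"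
          using G_lip[OF m(1,3) \<epsilon> d1, of s] R_lip[OF m(2,4) \<epsilon> d2, of s] qb[OF s]
        proof eventually_elim
          case (elim z)
          have "?d z = (G p1 s z - G q1 s z) - R p2 s z * (p s z - q s z) - (R p2 s z - R q2 s z) * q s z"
            by (simp add: algebra_simps)
          then have "\<bar>?d z\<bar> \<le> \<bar>G p1 s z - G q1 s z\<bar> + \<bar>R p2 s z * (p s z - q s z)\<bar> + \<bar>(R p2 s z - R q2 s z) * q s z\<bar>"
            by linarith
          moreover have "\<bar>R p2 s z * (p s z - q s z)\<bar> \<le> P s z * \<bar>p s z - q s z\<bar>"
            using R_nonneg[of p2 s z] R_bound[OF m(2), of s z] by (simp add: abs_mult mult_right_mono)
          moreover have "\<bar>(R p2 s z - R q2 s z) * q s z\<bar> \<le> 2 * \<epsilon> * P s z * (k * M z)"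
            unfolding abs_mult using elim P_nonneg \<epsilon> by (intro mult_mono) auto
          ultimately show ?case using elim(1) by (simp add: algebra_simps)
        qed
        then show "\<exists>d. integrable lborel d \<and> Dp s - Dq s = L1_class d \<and>
          (AE z in lborel. \<bar>d z\<bar> \<le> P s z * (5 * \<epsilon> * k * M z + \<bar>p s z - q s z\<bar>))"
          unfolding D' using i L1_class_diff[OF i] by (intro exI[of _ ?d]) auto
      qed
    qed
  qed (use \<epsilon> k_pos t in auto)
  then show ?thesis
  proof eventually_elim
    case (elim z)
    have "0 \<le> \<epsilon> * (k * M z)" using \<epsilon> k_pos M_pos[of z] by simp
    then show ?case using elim by simp
  qed
qed

fun iterate :: "('z \<Rightarrow> real) \<Rightarrow> ('z \<Rightarrow> real) \<Rightarrow> ('z \<Rightarrow> real) \<Rightarrow> nat \<Rightarrow> (real \<Rightarrow> 'z \<Rightarrow> real) \<times> (real \<Rightarrow> 'z \<Rightarrow> real)"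
  where "iterate f0 l0 u0 0 = (\<lambda>_. l0, \<lambda>_. u0)"
  | "iterate f0 l0 u0 (Suc n) = (let (l, u) = iterate f0 l0 u0 n in (step f0 l u, step f0 u l))"

end

text \<open>The beginning condition. The bounds on \<open>f0\<close> are required everywhere, which a modification on a null set
  achieves, because they are used along every trajectory.\<close>

locale kaniel_shinbrot_start = kaniel_shinbrot M k P \<rho> G R
  for M :: "'z::euclidean_space \<Rightarrow> real" and k P \<rho> G R +
  fixes T :: ereal and f0 l0 u0 :: "'z \<Rightarrow> real"
  assumes f0_meas [measurable]: "f0 \<in> borel_measurable borel" and l0_meas [measurable]: "l0 \<in> borel_measurable borel"
    and u0_meas [measurable]: "u0 \<in> borel_measurable borel"
    and f0: "\<And>z. 0 \<le> f0 z" "\<And>z. f0 z \<le> k * M z"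
    and l0: "AE z in lborel. 0 \<le> l0 z" and u0: "AE z in lborel. u0 z \<le> k * M z"
    and start: "\<And>t. t \<in> time_int T \<Longrightarrow> AE z in lborel. l0 z \<le> step f0 (\<lambda>_. l0) (\<lambda>_. u0) t z \<and>
      step f0 (\<lambda>_. l0) (\<lambda>_. u0) t z \<le> step f0 (\<lambda>_. u0) (\<lambda>_. l0) t z \<and> step f0 (\<lambda>_. u0) (\<lambda>_. l0) t z \<le> u0 z"
begin

definition lo :: "nat \<Rightarrow> real \<Rightarrow> 'z \<Rightarrow> real" where "lo n = fst (iterate f0 l0 u0 n)"
definition up :: "nat \<Rightarrow> real \<Rightarrow> 'z \<Rightarrow> real" where "up n = snd (iterate f0 l0 u0 n)"

lemma lo_0: "lo 0 = (\<lambda>_. l0)" and up_0: "up 0 = (\<lambda>_. u0)"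
  by (simp_all add: lo_def up_def)

lemma lo_Suc: "lo (Suc n) = step f0 (lo n) (up n)" and up_Suc: "up (Suc n) = step f0 (up n) (lo n)"
  by (simp_all add: lo_def up_def Let_def split_beta)

lemma jointly_borel_iterates: "jointly_borel (lo n) \<and> jointly_borel (up n)"
  by (induction n) (auto simp: lo_0 up_0 lo_Suc up_Suc intro: jointly_borel_step f0_meas jointly_borel_const l0_meas u0_meas)

lemmas lo_borel = jointly_borel_iterates[THEN conjunct1] and up_borel = jointly_borel_iterates[THEN conjunct2]

text \<open>Monotonicity alone propagates the beginning condition: a larger lower bound and a smaller upper bound
  mean more gain and less loss for the next lower bound, and the reverse for the next upper bound.\<close>

lemma ordered: "t \<in> time_int T \<Longrightarrow> AE z in lborel. lo n t z \<le> lo (Suc n) t z \<and>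
    lo (Suc n) t z \<le> up (Suc n) t z \<and> up (Suc n) t z \<le> up n t z"
proof (induction n arbitrary: t)
  case 0
  then show ?case using start by (simp add: lo_0 up_0 lo_Suc up_Suc)
next
  case (Suc n)
  have ih: "AE z in lborel. lo n s z \<le> lo (Suc n) s z" "AE z in lborel. lo (Suc n) s z \<le> up (Suc n) s z"
    "AE z in lborel. up (Suc n) s z \<le> up n s z" if "s \<in> time_int T" for s
    using Suc.IH[OF that] by (auto elim!: eventually_mono)
  have 1: "AE z in lborel. lo (Suc n) t z \<le> lo (Suc (Suc n)) t z"
    using step_mono[OF lo_borel lo_borel up_borel up_borel f0(1) ih(1,3) Suc.prems] by (simp only: lo_Suc up_Suc)
  have 2: "AE z in lborel. lo (Suc (Suc n)) t z \<le> up (Suc (Suc n)) t z"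
    using step_mono[OF lo_borel up_borel up_borel lo_borel f0(1) ih(2,2) Suc.prems] by (simp only: lo_Suc up_Suc)
  have 3: "AE z in lborel. up (Suc (Suc n)) t z \<le> up (Suc n) t z"
    using step_mono[OF up_borel up_borel lo_borel lo_borel f0(1) ih(3,1) Suc.prems] by (simp only: lo_Suc up_Suc)
  show ?case using 1 2 3 by eventually_elim simp
qed

lemma enclosed:
  assumes t: "t \<in> time_int T"
  shows "AE z in lborel. \<forall>n. 0 \<le> l0 z \<and> l0 z \<le> lo n t z \<and> lo n t z \<le> lo (Suc n) t z \<and> lo n t z \<le> up n t z \<and>
    up (Suc n) t z \<le> up n t z \<and> up n t z \<le> u0 z \<and> u0 z \<le> k * M z"
proof -
  have "AE z in lborel. \<forall>n. lo n t z \<le> lo (Suc n) t z \<and> lo (Suc n) t z \<le> up (Suc n) t z \<and> up (Suc n) t z \<le> up n t z"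
    using ordered[OF t] by (subst AE_all_countable) blast
  with l0 u0 show ?thesis
  proof eventually_elim
    case (elim z)
    have "l0 z \<le> lo n t z \<and> up n t z \<le> u0 z" for n
      using elim(3) by (induction n) (auto simp: lo_0 up_0 intro: order_trans)
    moreover have "lo n t z \<le> up n t z" for n
    proof (cases n)
      case 0
      then show ?thesis using elim(3)[rule_format, of 0] by simp
    next
      case (Suc m)
      then show ?thesis using elim(3)[rule_format, of m] by simp
    qed
    ultimately show ?case using elim by auto
  qed
qed

lemma
  assumes t: "t \<in> time_int T"
  shows lo_range: "AE z in lborel. 0 \<le> lo n t z \<and> lo n t z \<le> k * M z"
    and up_range: "AE z in lborel. 0 \<le> up n t z \<and> up n t z \<le> k * M z"
  by (rule eventually_mono[OF enclosed[OF t]], meson order_trans)+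

lemma lo_evolves: "evolves T (lo (Suc n)) (\<lambda>s. L1_class (rhs (lo n) (up n) (lo (Suc n)) s))"
  and up_evolves: "evolves T (up (Suc n)) (\<lambda>s. L1_class (rhs (up n) (lo n) (up (Suc n)) s))"
  unfolding lo_Suc up_Suc by (intro step_evolves lo_borel up_borel f0 f0_meas)+

lemma iterates_initial: "lo (Suc n) 0 = f0" "up (Suc n) 0 = f0"
  unfolding lo_Suc up_Suc by (intro step_evolves lo_borel up_borel f0 f0_meas)+

text \<open>The step for the upper bounds uses \<open>(up n, lo n)\<close> and the one for the lower bounds \<open>(lo n, up n)\<close>, so that the
  data of the two differ by the previous gap and \<open>contraction\<close> halves it. This is why both
  sequences have the same limit.\<close>

lemma gap: "t \<in> time_int T \<Longrightarrow> AE z in lborel. \<bar>up n t z - lo n t z\<bar> \<le> (1 / 2) ^ n * (k * M z)"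
proof (induction n arbitrary: t)
  case 0
  show ?case
    using enclosed[OF 0]
  proof eventually_elim
    case (elim z)
    then have "0 \<le> l0 z" "l0 z \<le> lo 0 t z" "lo 0 t z \<le> up 0 t z" "up 0 t z \<le> u0 z" "u0 z \<le> k * M z" by blast+
    then show ?case by simp
  qed
next
  case (Suc n)
  have "AE z in lborel. \<bar>up (Suc n) t z - lo (Suc n) t z\<bar> \<le> (1 / 2) ^ n / 2 * (k * M z)"
  proof (rule contraction[OF up_evolves lo_evolves])
    show "AE s in lebesgue. s \<in> time_int T \<longrightarrow>
      (\<exists>p1 p2 q1 q2. p1 \<in> borel_measurable borel \<and> p2 \<in> borel_measurable borel \<and> q1 \<in> borel_measurable borel \<and>
        q2 \<in> borel_measurable borel \<and> (AE z in lborel. \<bar>p1 z - q1 z\<bar> \<le> (1 / 2) ^ n * (k * M z)) \<and>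
        (AE z in lborel. \<bar>p2 z - q2 z\<bar> \<le> (1 / 2) ^ n * (k * M z)) \<and>
        L1_class (rhs (up n) (lo n) (up (Suc n)) s) = L1_class (\<lambda>z. G p1 s z - R p2 s z * up (Suc n) s z) \<and>
        L1_class (rhs (lo n) (up n) (lo (Suc n)) s) = L1_class (\<lambda>z. G q1 s z - R q2 s z * lo (Suc n) s z))"
    proof (intro AE_I2 impI)
      fix s assume s: "s \<in> time_int T"
      show "\<exists>p1 p2 q1 q2. p1 \<in> borel_measurable borel \<and> p2 \<in> borel_measurable borel \<and> q1 \<in> borel_measurable borel \<and>
        q2 \<in> borel_measurable borel \<and> (AE z in lborel. \<bar>p1 z - q1 z\<bar> \<le> (1 / 2) ^ n * (k * M z)) \<and>
        (AE z in lborel. \<bar>p2 z - q2 z\<bar> \<le> (1 / 2) ^ n * (k * M z)) \<and>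
        L1_class (rhs (up n) (lo n) (up (Suc n)) s) = L1_class (\<lambda>z. G p1 s z - R p2 s z * up (Suc n) s z) \<and>
        L1_class (rhs (lo n) (up n) (lo (Suc n)) s) = L1_class (\<lambda>z. G q1 s z - R q2 s z * lo (Suc n) s z)"
        using Suc.IH[OF s]
        by (intro exI[of _ "up n s"] exI[of _ "lo n s"] exI[of _ "lo n s"] exI[of _ "up n s"])
          (auto simp: rhs_def[abs_def] abs_minus_commute jointly_borel_slice lo_borel up_borel)
    qed
  qed (use lo_range up_range iterates_initial Suc.prems in auto)
  then show ?case by simp
qed

text \<open>The clipping changes the limit on a null set only and makes \<open>limit_range\<close> hold everywhere.\<close>

definition limit :: "real \<Rightarrow> 'z \<Rightarrow> real"
  where "limit t z = max 0 (min (lim (\<lambda>n. lo n t z)) (k * M z))"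

lemma limit_borel: "jointly_borel limit"
proof -
  note [measurable (raw)] = jointly_borel_compose[OF lo_borel]
  show ?thesis unfolding jointly_borel_def limit_def[abs_def] by measurable
qed

lemma limit_range: "0 \<le> limit t z" "limit t z \<le> k * M z"
  using k_pos M_pos[of z] by (auto simp: limit_def)

lemma limit_enclosed:
  assumes t: "t \<in> time_int T"
  shows "AE z in lborel. \<forall>n. lo n t z \<le> limit t z \<and> limit t z \<le> up n t z \<and>
    \<bar>lo n t z - limit t z\<bar> \<le> (1 / 2) ^ n * (k * M z) \<and> \<bar>up n t z - limit t z\<bar> \<le> (1 / 2) ^ n * (k * M z)"
proof -
  have "AE z in lborel. \<forall>n. \<bar>up n t z - lo n t z\<bar> \<le> (1 / 2) ^ n * (k * M z)"
    using gap[OF t] by (subst AE_all_countable) blast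
  with enclosed[OF t] show ?thesis
  proof eventually_elim
    case (elim z)
    have inc: "incseq (\<lambda>n. lo n t z)" using elim(1) by (intro incseq_SucI) blast
    have dec: "decseq (\<lambda>n. up n t z)" using elim(1) by (intro decseq_SucI) blast
    have le: "lo n t z \<le> up m t z" for n m
    proof -
      have "lo n t z \<le> lo (max n m) t z" using inc by (simp add: incseq_def)
      also have "\<dots> \<le> up (max n m) t z" using elim(1) by blast
      also have "\<dots> \<le> up m t z" using dec by (simp add: decseq_def)
      finally show ?thesis .
    qed
    have bdd: "\<forall>n. lo n t z \<le> up 0 t z" using le by blast
    obtain L where L: "(\<lambda>n. lo n t z) \<longlonglongrightarrow> L" using incseq_convergent[OF inc bdd] .
    have lo: "lo n t z \<le> L" for n using incseq_le[OF inc L] .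
    have up: "L \<le> up n t z" for n by (rule LIMSEQ_le_const2[OF L]) (use le in auto)
    have "0 \<le> L" "L \<le> k * M z" using lo[of 0] up[of 0] elim(1)[rule_format, of 0] by auto
    then have lim: "limit t z = L" using limI[OF L] by (simp add: limit_def)
    show ?case
    proof (rule allI)
      fix n
      have "\<bar>up n t z - lo n t z\<bar> \<le> (1 / 2) ^ n * (k * M z)" using elim(2) by blast
      then show "lo n t z \<le> limit t z \<and> limit t z \<le> up n t z \<and>
        \<bar>lo n t z - limit t z\<bar> \<le> (1 / 2) ^ n * (k * M z) \<and> \<bar>up n t z - limit t z\<bar> \<le> (1 / 2) ^ n * (k * M z)"
        using lo[of n] up[of n] unfolding lim by linarith
    qed
  qed
qed

text \<open>By their Lipschitz bounds, gain and rate of the iterates converge almost everywhere; dominated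
  convergence in the space variable and then in time carries the integral equation to the limit.\<close>

lemma limit_evolves: "evolves T limit (\<lambda>s. L1_class (rhs limit limit limit s))" and limit_initial: "0 < T \<Longrightarrow> AE z in lborel. limit 0 z = f0 z"
proof -
  have kM: "integrable lborel (\<lambda>z. k * M z)" using M_int by auto
  have lim_int: "integrable lborel (limit t)" for t
    by (rule Bochner_Integration.integrable_bound[OF kM])
      (use limit_range jointly_borel_slice[OF limit_borel] in \<open>auto intro!: AE_I2 order_trans[OF limit_range(2)] abs_ge_self\<close>)
  have jb: "case_prod (rhs limit limit limit) \<in> borel_measurable (borel \<Otimes>\<^sub>M borel)"
    using jointly_borel_rhs[OF limit_borel limit_borel limit_borel] by (simp add: jointly_borel_def)
  have bd: "\<bar>rhs limit limit limit s z\<bar> \<le> envelope z" for s z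
  proof (rule rhs_bound[OF limit_borel limit_borel])
    show "0 \<le> limit s z" "limit s z \<le> 2 * (k * M z)" using limit_range[of s z] by linarith+
  qed
  note dom = dominated_curve_set_integrable[OF jb envelope_int bd] dominated_slice_integrable[OF jb envelope_int bd]
    dominated_curve_norm[OF jb envelope_int bd] dominated_curve_measurable[OF jb envelope_int bd]
  have conv: "(\<lambda>n. L1_class (lo (Suc n) t)) \<longlonglongrightarrow> L1_class (limit t)" if t: "t \<in> time_int T" for t
  proof (rule L1_class_tendsto[OF _ kM])
    show "integrable lborel (lo (Suc n) t)" for n using lo_evolves t by (auto simp: evolves_def)
    show "limit t \<in> borel_measurable borel" by (rule jointly_borel_slice[OF limit_borel])
    show "AE z in lborel. (\<lambda>n. lo (Suc n) t z) \<longlonglongrightarrow> limit t z"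
      using limit_enclosed[OF t]
    proof eventually_elim
      case (elim z)
      have "(\<lambda>n. (1 / 2) ^ n * (k * M z)) \<longlonglongrightarrow> 0 * (k * M z)"
        by (intro tendsto_mult tendsto_const LIMSEQ_power_zero) simp
      then have g0: "(\<lambda>n. (1 / 2) ^ n * (k * M z)) \<longlonglongrightarrow> 0" by simp
      have "norm (lo n t z - limit t z) \<le> (1 / 2) ^ n * (k * M z)" for n
        unfolding real_norm_def using elim by blast
      then have "(\<lambda>n. lo n t z - limit t z) \<longlonglongrightarrow> 0"
        by (intro Lim_null_comparison[OF _ g0] always_eventually allI)
      then show ?case by (rule LIMSEQ_Suc[OF LIM_zero_cancel])
    qed
    show "AE z in lborel. \<bar>lo (Suc n) t z\<bar> \<le> k * M z" for n
      using lo_range[OF t, of "Suc n"] by eventually_elim simp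
  qed
  have Dconv: "(\<lambda>n. L1_class (rhs (lo n) (up n) (lo (Suc n)) s)) \<longlonglongrightarrow> L1_class (rhs limit limit limit s)"
    and Dint: "\<And>n. integrable lborel (rhs (lo n) (up n) (lo (Suc n)) s)"
    and Dbd: "\<And>n. AE z in lborel. \<bar>rhs (lo n) (up n) (lo (Suc n)) s z\<bar> \<le> envelope z" if s: "s \<in> time_int T" for s
  proof -
    show bd': "AE z in lborel. \<bar>rhs (lo n) (up n) (lo (Suc n)) s z\<bar> \<le> envelope z" for n
      using lo_range[OF s, of "Suc n"]
    proof eventually_elim
      case (elim z)
      then show ?case by (intro rhs_bound lo_borel up_borel) auto
    qed
    show int': "integrable lborel (rhs (lo n) (up n) (lo (Suc n)) s)" for n
      by (rule Bochner_Integration.integrable_bound[OF envelope_int])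
        (use bd'[of n] jointly_borel_slice[OF jointly_borel_rhs[OF lo_borel up_borel lo_borel]] in \<open>auto elim!: eventually_mono\<close>)
    have "AE z in lborel. \<forall>n. \<bar>G (lo n s) s z - G (limit s) s z\<bar> \<le> 3 * (1 / 2) ^ n * (k * M z) * P s z \<and>
        \<bar>R (up n s) s z - R (limit s) s z\<bar> \<le> 2 * (1 / 2) ^ n * P s z"
    proof (subst AE_all_countable, intro allI)
      fix n
      have 1: "AE z in lborel. \<bar>lo n s z - limit s z\<bar> \<le> (1 / 2) ^ n * (k * M z)"
        and 2: "AE z in lborel. \<bar>up n s z - limit s z\<bar> \<le> (1 / 2) ^ n * (k * M z)"
        using limit_enclosed[OF s] by (auto elim!: eventually_mono)
      show "AE z in lborel. \<bar>G (lo n s) s z - G (limit s) s z\<bar> \<le> 3 * (1 / 2) ^ n * (k * M z) * P s z \<and>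
          \<bar>R (up n s) s z - R (limit s) s z\<bar> \<le> 2 * (1 / 2) ^ n * P s z"
        by (intro AE_conjI G_lip R_lip jointly_borel_slice lo_borel up_borel limit_borel 1 2) auto
    qed
    with limit_enclosed[OF s] have lim: "AE z in lborel. (\<lambda>n. rhs (lo n) (up n) (lo (Suc n)) s z) \<longlonglongrightarrow> rhs limit limit limit s z"
    proof eventually_elim
      case (elim z)
      have e: "norm (lo n s z - limit s z) \<le> (1 / 2) ^ n * (k * M z)"
        "norm (G (lo n s) s z - G (limit s) s z) \<le> 3 * (1 / 2) ^ n * (k * M z) * P s z"
        "norm (R (up n s) s z - R (limit s) s z) \<le> 2 * (1 / 2) ^ n * P s z" for n
        unfolding real_norm_def using elim by blast+
      have half: "(\<lambda>n. (1 / 2 :: real) ^ n) \<longlonglongrightarrow> 0" by (rule LIMSEQ_power_zero) simp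
      have "(\<lambda>n. G (lo n s) s z - G (limit s) s z) \<longlonglongrightarrow> 0"
      proof (rule Lim_null_comparison)
        show "(\<lambda>n. 3 * (1 / 2) ^ n * (k * M z) * P s z) \<longlonglongrightarrow> 0"
          using tendsto_mult_left[OF half, of "3 * (k * M z) * P s z"] by (simp add: mult_ac)
      qed (intro always_eventually allI e)
      moreover have "(\<lambda>n. R (up n s) s z - R (limit s) s z) \<longlonglongrightarrow> 0"
      proof (rule Lim_null_comparison)
        show "(\<lambda>n. 2 * (1 / 2) ^ n * P s z) \<longlonglongrightarrow> 0"
          using tendsto_mult_left[OF half, of "2 * P s z"] by (simp add: mult_ac)
      qed (intro always_eventually allI e)
      moreover have "(\<lambda>n. lo (Suc n) s z - limit s z) \<longlonglongrightarrow> 0"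
      proof (rule LIMSEQ_Suc, rule Lim_null_comparison)
        show "(\<lambda>n. (1 / 2) ^ n * (k * M z)) \<longlonglongrightarrow> 0"
          using tendsto_mult_left[OF half, of "k * M z"] by (simp add: mult_ac)
      qed (intro always_eventually allI e)
      ultimately have "(\<lambda>n. G (lo n s) s z) \<longlonglongrightarrow> G (limit s) s z" "(\<lambda>n. R (up n s) s z) \<longlonglongrightarrow> R (limit s) s z"
        "(\<lambda>n. lo (Suc n) s z) \<longlonglongrightarrow> limit s z"
        by (blast intro: LIM_zero_cancel)+
      then show ?case unfolding rhs_def by (intro tendsto_diff tendsto_mult)
    qed
    show "(\<lambda>n. L1_class (rhs (lo n) (up n) (lo (Suc n)) s)) \<longlonglongrightarrow> L1_class (rhs limit limit limit s)"
      by (rule L1_class_tendsto[OF int' envelope_int _ lim bd'])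
        (rule jointly_borel_slice[OF jointly_borel_rhs[OF limit_borel limit_borel limit_borel]])
  qed
  have lim0: "L1_class (limit 0) = L1_class f0" if "t \<in> time_int T" for t
    using conv[OF zero_in_time_int[OF that]] by (simp add: iterates_initial LIMSEQ_const_iff)
  show "evolves T limit (\<lambda>s. L1_class (rhs limit limit limit s))"
    unfolding evolves_def
  proof (intro ballI conjI lim_int dom(1))
    fix t assume t: "t \<in> time_int T"
    have "(\<lambda>n. L1_class (lo (Suc n) t)) \<longlonglongrightarrow> L1_class f0 + (LINT s:{0..t}|lebesgue. L1_class (rhs limit limit limit s))"
    proof -
      have "(\<lambda>n. LINT s:{0..t}|lebesgue. L1_class (rhs (lo n) (up n) (lo (Suc n)) s)) \<longlonglongrightarrow>
        (LINT s:{0..t}|lebesgue. L1_class (rhs limit limit limit s))"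
        unfolding set_lebesgue_integral_def
      proof (rule integral_dominated_convergence[where w="\<lambda>s. indicator {0..t} s * (\<integral>z. envelope z \<partial>lborel)"])
        show "(\<lambda>s. indicator {0..t} s *\<^sub>R L1_class (rhs limit limit limit s)) \<in> borel_measurable lebesgue"
          using dom(1)[of 0 t] by (simp add: set_integrable_def)
        show "(\<lambda>s. indicator {0..t} s *\<^sub>R L1_class (rhs (lo n) (up n) (lo (Suc n)) s)) \<in> borel_measurable lebesgue" for n
          using lo_evolves[of n] t by (auto simp: evolves_def set_integrable_def)
        show "integrable lebesgue (\<lambda>s. indicator {0..t} s * (\<integral>z. envelope z \<partial>lborel))"
          by (intro integrable_mult_left integrable_real_indicator) (auto simp: emeasure_lborel_Icc_eq)
        show "AE s in lebesgue. (\<lambda>n. indicator {0..t} s *\<^sub>R L1_class (rhs (lo n) (up n) (lo (Suc n)) s)) \<longlonglongrightarrow>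
            indicator {0..t} s *\<^sub>R L1_class (rhs limit limit limit s)"
          using Dconv time_int_mono[OF t] by (intro AE_I2) (auto simp: indicator_def)
        show "AE s in lebesgue. norm (indicator {0..t} s *\<^sub>R L1_class (rhs (lo n) (up n) (lo (Suc n)) s)) \<le>
            indicator {0..t} s * (\<integral>z. envelope z \<partial>lborel)" for n
        proof (rule AE_I2)
          fix s
          show "norm (indicator {0..t} s *\<^sub>R L1_class (rhs (lo n) (up n) (lo (Suc n)) s)) \<le>
            indicator {0..t} s * (\<integral>z. envelope z \<partial>lborel)"
          proof (cases "s \<in> {0..t}")
            case True
            then have s: "s \<in> time_int T" using time_int_mono[OF t] by auto
            have "norm (L1_class (rhs (lo n) (up n) (lo (Suc n)) s)) \<le> (\<integral>z. envelope z \<partial>lborel)"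
              unfolding norm_L1_class[OF Dint[OF s]]
              using Dint[OF s] Dbd[OF s] envelope_int by (intro integral_mono_AE) auto
            then show ?thesis using True by simp
          qed simp
        qed
      qed
      then have "(\<lambda>n. L1_class f0 + (LINT s:{0..t}|lebesgue. L1_class (rhs (lo n) (up n) (lo (Suc n)) s))) \<longlonglongrightarrow>
        L1_class f0 + (LINT s:{0..t}|lebesgue. L1_class (rhs limit limit limit s))" by (intro tendsto_intros)
      moreover have "L1_class (lo (Suc n) t) = L1_class f0 + (LINT s:{0..t}|lebesgue. L1_class (rhs (lo n) (up n) (lo (Suc n)) s))" for n
        using lo_evolves[of n] t iterates_initial by (auto simp: evolves_def)
      ultimately show ?thesis by simp
    qed
    then show "L1_class (limit t) = L1_class (limit 0) + (LINT s:{0..t}|lebesgue. L1_class (rhs limit limit limit s))"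
      using LIMSEQ_unique[OF conv[OF t]] lim0[OF t] by simp
  qed
  assume "0 < T"
  then have "0 \<in> time_int T" by (simp add: time_int_def zero_ereal_def)
  then have "L1_class (limit 0) = L1_class f0" by (rule lim0)
  moreover have "integrable lborel f0"
    by (rule Bochner_Integration.integrable_bound[OF kM]) (use f0 in \<open>auto intro!: AE_I2 order_trans[OF f0(2)]\<close>)
  ultimately show "AE z in lborel. limit 0 z = f0 z" using L1_class_eq_iff[OF lim_int] by blast
qed

end

section \<open>Collision operators on nonnegative functions\<close>

lemma borel_fst [measurable]: "fst \<in> borel_measurable (borel :: ('a::second_countable_topology \<times> 'b::second_countable_topology) measure)"
  by (simp add: borel_prod[symmetric])

lemma borel_snd [measurable]: "snd \<in> borel_measurable (borel :: ('a::second_countable_topology \<times> 'b::second_countable_topology) measure)"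
  by (simp add: borel_prod[symmetric])

interpretation sphere: finite_measure "sphere_measure :: 'a::euclidean_space measure"
  by (rule finite_sphere_measure)

interpretation sphere_pair: pair_sigma_finite "sphere_measure :: 'a::euclidean_space measure" "lborel :: 'b::euclidean_space measure"
  ..

text \<open>The functions \<open>b2\<close> and \<open>b3\<close> are measurable only on the sets where they matter. These versions of \<open>B2\<close> and \<open>B3\<close>
  are set to \<open>0\<close> elsewhere, which makes them Borel and changes nothing on the unit sphere.\<close>

definition kB2 :: "kernels \<Rightarrow> 'a::euclidean_space \<Rightarrow> 'a \<Rightarrow> real"
  where "kB2 K u \<omega> = norm u powr gam2 K * (indicator {-1..1} (sgn u \<bullet> \<omega>) *\<^sub>R b2 K (sgn u \<bullet> \<omega>))"

definition kB3 :: "kernels \<Rightarrow> 'a::euclidean_space \<times> 'a \<Rightarrow> 'a \<times> 'a \<Rightarrow> real"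
  where "kB3 K u \<omega> = tnorm u powr gam3 K *
    (indicator ({-1..1} \<times> {-1/2..1/2}) ((u /\<^sub>R tnorm u) \<bullet> \<omega>, fst \<omega> \<bullet> snd \<omega>) *\<^sub>R
      b3 K ((u /\<^sub>R tnorm u) \<bullet> \<omega>) (fst \<omega> \<bullet> snd \<omega>))"

definition gain2 :: "kernels \<Rightarrow> ('a::euclidean_space \<times> 'a \<Rightarrow> ennreal) \<Rightarrow> 'a \<times> 'a \<Rightarrow> ennreal"
  where "gain2 K f = (\<lambda>(x, v). \<integral>\<^sup>+(\<omega>, v1). ennreal (kB2 K (v1 - v) \<omega>) *
    (f (x, v + (\<omega> \<bullet> (v1 - v)) *\<^sub>R \<omega>) * f (x, v1 - (\<omega> \<bullet> (v1 - v)) *\<^sub>R \<omega>)) \<partial>(sphere_measure \<Otimes>\<^sub>M lborel))"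

text \<open>The loss term at a point is the density there times the rate.\<close>

definition rate2 :: "kernels \<Rightarrow> ('a::euclidean_space \<times> 'a \<Rightarrow> ennreal) \<Rightarrow> 'a \<times> 'a \<Rightarrow> ennreal"
  where "rate2 K f = (\<lambda>(x, v). \<integral>\<^sup>+(\<omega>, v1). ennreal (kB2 K (v1 - v) \<omega>) * f (x, v1) \<partial>(sphere_measure \<Otimes>\<^sub>M lborel))"

definition cpar :: "'a::euclidean_space \<times> 'a \<Rightarrow> 'a \<times> 'a \<Rightarrow> real"
  where "cpar \<omega> u = (fst \<omega> \<bullet> fst u + snd \<omega> \<bullet> snd u) / (1 + fst \<omega> \<bullet> snd \<omega>)"

definition gain3 :: "kernels \<Rightarrow> ('a::euclidean_space \<times> 'a \<Rightarrow> ennreal) \<Rightarrow> 'a \<times> 'a \<Rightarrow> ennreal"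
  where "gain3 K f = (\<lambda>(x, v). \<integral>\<^sup>+(\<omega>, V). ennreal (kB3 K (V - (v, v)) \<omega>) *
    (f (x, v + cpar \<omega> (V - (v, v)) *\<^sub>R (fst \<omega> + snd \<omega>)) * f (x, fst V - cpar \<omega> (V - (v, v)) *\<^sub>R fst \<omega>) *
      f (x, snd V - cpar \<omega> (V - (v, v)) *\<^sub>R snd \<omega>)) \<partial>(sphere_measure \<Otimes>\<^sub>M lborel))"

definition rate3 :: "kernels \<Rightarrow> ('a::euclidean_space \<times> 'a \<Rightarrow> ennreal) \<Rightarrow> 'a \<times> 'a \<Rightarrow> ennreal"
  where "rate3 K f = (\<lambda>(x, v). \<integral>\<^sup>+(\<omega>, V). ennreal (kB3 K (V - (v, v)) \<omega>) * (f (x, fst V) * f (x, snd V))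
    \<partial>(sphere_measure \<Otimes>\<^sub>M lborel))"

lemma tnorm_measurable [measurable]: "tnorm \<in> borel_measurable borel"
  unfolding tnorm_def case_prod_beta by measurable

lemma cpar_measurable [measurable (raw)]:
  assumes [measurable]: "f \<in> N \<rightarrow>\<^sub>M borel" "g \<in> N \<rightarrow>\<^sub>M borel"
  shows "(\<lambda>x. cpar (f x) (g x)) \<in> borel_measurable N"
  unfolding cpar_def by measurable

lemma norm_le_tnorm: "norm u \<le> tnorm u"
  by (cases u) (auto simp: tnorm_def norm_Pair)

lemma tnorm_le: "tnorm u \<le> 2 * norm u"
proof (cases u)
  case (Pair a b)
  have "(norm (a - b))\<^sup>2 \<le> 2 * (norm a)\<^sup>2 + 2 * (norm b)\<^sup>2"
  proof -
    have "(norm (a - b))\<^sup>2 + (norm (a + b))\<^sup>2 = 2 * (norm a)\<^sup>2 + 2 * (norm b)\<^sup>2"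
      by (simp add: power2_norm_eq_inner inner_diff_left inner_diff_right inner_add_left inner_add_right)
    then show ?thesis using zero_le_power2[of "norm (a + b)"] by linarith
  qed
  then have "(norm a)\<^sup>2 + (norm b)\<^sup>2 + (norm (a - b))\<^sup>2 \<le> 4 * ((norm a)\<^sup>2 + (norm b)\<^sup>2)"
  proof -
    have gen: "x \<le> 2 * p + 2 * q \<Longrightarrow> 0 \<le> p \<Longrightarrow> 0 \<le> q \<Longrightarrow> p + q + x \<le> 4 * (p + q)" for p q x :: real by simp
    show ?thesis by (rule gen[OF \<open>(norm (a - b))\<^sup>2 \<le> _\<close>]) simp_all
  qed
  then have "tnorm u \<le> sqrt (4 * ((norm a)\<^sup>2 + (norm b)\<^sup>2))" by (simp add: tnorm_def Pair)
  also have "\<dots> = 2 * norm u" by (simp only: Pair norm_Pair real_sqrt_mult) simp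
  finally show ?thesis .
qed

lemma AE_pair_fst:
  assumes "sigma_finite_measure N" and Q: "AE x in M. Q x"
  shows "AE p in M \<Otimes>\<^sub>M N. Q (fst p)"
proof -
  interpret N: sigma_finite_measure N by fact
  obtain A where A: "{x \<in> space M. \<not> Q x} \<subseteq> A" "emeasure M A = 0" "A \<in> sets M" using Q by (rule AE_E)
  show ?thesis
  proof (rule AE_I[of _ _ "A \<times> space N"])
    show "{p \<in> space (M \<Otimes>\<^sub>M N). \<not> Q (fst p)} \<subseteq> A \<times> space N" using A by (auto simp: space_pair_measure)
    show "emeasure (M \<Otimes>\<^sub>M N) (A \<times> space N) = 0" using A by (simp add: N.emeasure_pair_measure_Times)
    show "A \<times> space N \<in> sets (M \<Otimes>\<^sub>M N)" using A by auto
  qed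
qed

lemma AE_sphere_pair: "AE p in sphere_measure \<Otimes>\<^sub>M (lborel :: 'b::euclidean_space measure). norm (fst p :: 'a::euclidean_space) = 1"
  by (rule AE_pair_fst[OF sigma_finite_lborel AE_sphere_measure])

text \<open>Null sets are not charged by collisions: for each collision parameter \<open>p\<close> the map \<open>T p\<close> preserves
  Lebesgue measure, and the order of integration may be exchanged.\<close>

lemma AE_collision:
  fixes T :: "'p::euclidean_space \<Rightarrow> 'z::euclidean_space \<times> 'w::euclidean_space \<Rightarrow> 'z \<times> 'w"
  assumes T [measurable]: "(\<lambda>(p, y). T p y) \<in> borel \<Otimes>\<^sub>M borel \<rightarrow>\<^sub>M borel"
    and iso: "AE p in sphere_measure. linear (T p) \<and> (\<forall>y. norm (T p y) = norm y)"
    and Q: "AE y in lborel. Q y"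
  shows "AE z in lborel. AE (p, w) in sphere_measure \<Otimes>\<^sub>M lborel. Q (T p (z, w))"
proof -
  obtain N where N: "{y. \<not> Q y} \<subseteq> N" "emeasure lborel N = 0" "N \<in> sets lborel" using Q by (auto elim: AE_E)
  then have [measurable]: "N \<in> sets borel" by simp
  let ?h = "\<lambda>p z w. indicator N (T p (z, w)) :: ennreal"
  have "(\<integral>\<^sup>+z. (\<integral>\<^sup>+(p, w). ?h p z w \<partial>(sphere_measure \<Otimes>\<^sub>M lborel)) \<partial>lborel) =
    (\<integral>\<^sup>+z. (\<integral>\<^sup>+p. (\<integral>\<^sup>+w. ?h p z w \<partial>lborel) \<partial>sphere_measure) \<partial>lborel)"
    by (intro nn_integral_cong, subst lborel.nn_integral_fst[symmetric]) (auto simp: case_prod_beta)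
  also have "\<dots> = (\<integral>\<^sup>+p. (\<integral>\<^sup>+z. (\<integral>\<^sup>+w. ?h p z w \<partial>lborel) \<partial>lborel) \<partial>sphere_measure)"
    by (rule sphere_pair.Fubini') measurable
  also have "\<dots> = (\<integral>\<^sup>+p. 0 \<partial>(sphere_measure :: 'p measure))"
  proof (rule nn_integral_cong_AE, use iso in eventually_elim)
    case (elim p)
    have [measurable]: "T p \<in> borel \<rightarrow>\<^sub>M borel" by measurable
    have "(\<integral>\<^sup>+z. (\<integral>\<^sup>+w. ?h p z w \<partial>lborel) \<partial>lborel) = (\<integral>\<^sup>+y. indicator N (T p y) \<partial>(lborel \<Otimes>\<^sub>M lborel))"
      by (subst lborel.nn_integral_fst[symmetric]) (auto simp: lborel_prod)
    also have "\<dots> = (\<integral>\<^sup>+y. indicator N (T p y) \<partial>lborel)" by (simp add: lborel_prod)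
    also have "\<dots> = (\<integral>\<^sup>+y. indicator N y \<partial>distr lborel borel (T p))" by (subst nn_integral_distr) auto
    also have "distr lborel borel (T p) = lborel" using elim by (intro lborel_linear_isometry) auto
    also have "(\<integral>\<^sup>+y. indicator N y \<partial>lborel) = 0" using N by simp
    finally show ?case .
  qed
  finally have "(\<integral>\<^sup>+z. (\<integral>\<^sup>+(p, w). ?h p z w \<partial>(sphere_measure \<Otimes>\<^sub>M lborel)) \<partial>lborel) = 0" by simp
  then have "AE z in lborel. (\<integral>\<^sup>+(p, w). ?h p z w \<partial>(sphere_measure \<Otimes>\<^sub>M lborel)) = 0"
    by (subst (asm) nn_integral_0_iff_AE) (auto simp: case_prod_beta)
  then show ?thesis
  proof eventually_elim
    case (elim z)
    then have "AE pw in sphere_measure \<Otimes>\<^sub>M lborel. ?h (fst pw) z (snd pw) = 0"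
      by (subst (asm) nn_integral_0_iff_AE) (auto simp: case_prod_beta)
    then show ?case by eventually_elim (use N(1) in \<open>auto simp: indicator_def split: if_splits\<close>)
  qed
qed

text \<open>The collision maps act on the position and velocity of one particle together with the velocities of its
  partners; this is the space on which they are reflections.\<close>

definition post2 :: "'a::euclidean_space \<Rightarrow> ('a \<times> 'a) \<times> 'a \<Rightarrow> ('a \<times> 'a) \<times> 'a"
  where "post2 \<omega> y = (let c = \<omega> \<bullet> (snd y - snd (fst y)) in
    ((fst (fst y), snd (fst y) + c *\<^sub>R \<omega>), snd y - c *\<^sub>R \<omega>))"

definition post3 :: "'a::euclidean_space \<times> 'a \<Rightarrow> ('a \<times> 'a) \<times> ('a \<times> 'a) \<Rightarrow> ('a \<times> 'a) \<times> ('a \<times> 'a)"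
  where "post3 \<omega> y = (let v = snd (fst y); c = cpar \<omega> (snd y - (v, v)) in
    ((fst (fst y), v + c *\<^sub>R (fst \<omega> + snd \<omega>)), (fst (snd y) - c *\<^sub>R fst \<omega>, snd (snd y) - c *\<^sub>R snd \<omega>)))"

text \<open>The component of the relative velocity along \<open>\<omega>\<close> is exchanged, which reverses the coordinate along the
  vector \<open>(\<omega>, - \<omega>)\<close> of velocity space.\<close>

lemma post2_eq_reflection:
  assumes "norm \<omega> = 1"
  shows "post2 \<omega> = reflection ((0, \<omega>), - \<omega>)"
proof
  fix y :: "('a \<times> 'a) \<times> 'a"
  obtain x v v1 where y: "y = ((x, v), v1)" by (cases y) auto
  have "\<omega> \<bullet> \<omega> = 1" using assms by (simp add: norm_eq_1)
  then have "2 * (y \<bullet> ((0, \<omega>), - \<omega>)) / (((0::'a, \<omega>), - \<omega>) \<bullet> ((0, \<omega>), - \<omega>)) = - (\<omega> \<bullet> (v1 - v))"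
    by (simp add: y inner_prod_def inner_diff_right inner_commute)
  then show "post2 \<omega> y = reflection ((0, \<omega>), - \<omega>) y"
    by (simp add: post2_def y reflection_def Let_def)
qed

lemma sphere_inner_bound:
  fixes \<omega> :: "'a::real_inner \<times> 'a"
  assumes "norm \<omega> = 1"
  shows "\<bar>fst \<omega> \<bullet> snd \<omega>\<bar> \<le> 1 / 2"
proof -
  have "(norm (fst \<omega>))\<^sup>2 + (norm (snd \<omega>))\<^sup>2 = 1" using assms by (cases \<omega>) (simp add: norm_Pair)
  moreover have "(norm (fst \<omega> + snd \<omega>))\<^sup>2 \<ge> 0" "(norm (fst \<omega> - snd \<omega>))\<^sup>2 \<ge> 0" by simp_all
  ultimately show ?thesis
    by (simp add: power2_norm_eq_inner inner_diff_left inner_diff_right inner_add_left inner_add_right inner_commute abs_le_iff)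
qed

lemma post3_eq_reflection:
  assumes "norm \<omega> = 1"
  shows "post3 \<omega> = reflection ((0, fst \<omega> + snd \<omega>), (- fst \<omega>, - snd \<omega>))"
proof
  fix y :: "('a \<times> 'a) \<times> ('a \<times> 'a)"
  obtain x v v1 v2 where y: "y = ((x, v), (v1, v2))" by (cases y) auto
  obtain w1 w2 where w: "\<omega> = (w1, w2)" by (cases \<omega>)
  let ?n = "((0::'a, w1 + w2), (- w1, - w2))"
  have one: "w1 \<bullet> w1 + w2 \<bullet> w2 = 1"
    using assms by (simp add: w norm_eq_1 inner_prod_def)
  have pos: "1 + w1 \<bullet> w2 > 0" using sphere_inner_bound[OF assms] by (simp add: w)
  have nn: "?n \<bullet> ?n = 2 * (1 + w1 \<bullet> w2)"
    using one by (simp add: inner_prod_def inner_add_left inner_add_right inner_commute)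
  have yn: "y \<bullet> ?n = - (w1 \<bullet> (v1 - v) + w2 \<bullet> (v2 - v))"
    by (simp add: y inner_prod_def inner_diff_right inner_add_right inner_commute)
  have "2 * (y \<bullet> ?n) / (?n \<bullet> ?n) = - cpar \<omega> (v1 - v, v2 - v)"
    using pos unfolding nn yn by (simp add: cpar_def w field_simps)
  then show "post3 \<omega> y = reflection ((0, fst \<omega> + snd \<omega>), (- fst \<omega>, - snd \<omega>)) y"
    by (simp add: reflection_def w post3_def y Let_def)
qed

lemma post2_measurable [measurable (raw)]:
  assumes [measurable]: "f \<in> N \<rightarrow>\<^sub>M borel" "g \<in> N \<rightarrow>\<^sub>M borel"
  shows "(\<lambda>x. post2 (f x) (g x)) \<in> N \<rightarrow>\<^sub>M borel"
  unfolding post2_def Let_def by measurable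

lemma post3_measurable [measurable (raw)]:
  assumes [measurable]: "f \<in> N \<rightarrow>\<^sub>M borel" "g \<in> N \<rightarrow>\<^sub>M borel"
  shows "(\<lambda>x. post3 (f x) (g x)) \<in> N \<rightarrow>\<^sub>M borel"
  unfolding post3_def Let_def by measurable

lemma AE_lborel_fst:
  assumes "AE z in lborel. Q (z :: 'z::euclidean_space)"
  shows "AE y in lborel. Q (fst (y :: 'z \<times> 'w::euclidean_space))"
proof -
  have "AE p in lborel \<Otimes>\<^sub>M (lborel :: 'w measure). Q (fst p)"
    by (rule AE_pair_fst[OF sigma_finite_lborel assms])
  then show ?thesis by (simp only: lborel_prod)
qed

text \<open>Each velocity occurring in the collision is, up to exchanging the particles, the velocity of the first
  particle before or after the collision; the exchange is an isometry as well.\<close>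

lemma AE_binary:
  fixes Q :: "'a::euclidean_space \<times> 'a \<Rightarrow> bool"
  assumes Q: "AE z in lborel. Q z"
  shows "AE z in lborel. AE (\<omega>, v1) in sphere_measure \<Otimes>\<^sub>M lborel. case z of (x, v) \<Rightarrow> Q (x, v) \<and> Q (x, v1) \<and>
    Q (x, v + (\<omega> \<bullet> (v1 - v)) *\<^sub>R \<omega>) \<and> Q (x, v1 - (\<omega> \<bullet> (v1 - v)) *\<^sub>R \<omega>)"
proof -
  let ?sw = "\<lambda>y::('a \<times> 'a) \<times> 'a. ((fst (fst y), snd y), snd (fst y))"
  have "AE y in lborel. Q (fst (y :: ('a \<times> 'a) \<times> 'a))" by (rule AE_lborel_fst[OF Q])
  moreover from this have "AE y in lborel. Q (fst (?sw y))"
    by (rule AE_linear_isometry[rotated 2]) (auto intro!: linearI simp: norm_prod_def)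
  ultimately have both: "AE y in lborel. Q (fst y) \<and> Q (fst (?sw y))" by eventually_elim simp
  have "AE z in lborel. AE (p, w) in (sphere_measure :: 'a measure) \<Otimes>\<^sub>M lborel. (\<lambda>y. Q (fst y) \<and> Q (fst (?sw y))) ((\<lambda>p y. y) p (z, w))"
    by (rule AE_collision[OF _ _ both]) (auto intro!: linear_id[unfolded id_def])
  moreover have "AE z in lborel. AE (p, w) in (sphere_measure :: 'a measure) \<Otimes>\<^sub>M lborel. (\<lambda>y. Q (fst y) \<and> Q (fst (?sw y))) (post2 p (z, w))"
  proof (rule AE_collision[OF _ _ both])
    show "AE p in sphere_measure. linear (post2 p) \<and> (\<forall>y. norm (post2 (p :: 'a) y) = norm y)"
      using AE_sphere_measure by eventually_elim (simp add: post2_eq_reflection linear_reflection norm_reflection)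
  qed measurable
  ultimately show ?thesis
  proof eventually_elim
    case (elim z)
    from elim(1) elim(2) show ?case
      by eventually_elim (auto simp: post2_def Let_def split: prod.splits)
  qed
qed

lemma AE_ternary:
  fixes Q :: "'a::euclidean_space \<times> 'a \<Rightarrow> bool"
  assumes Q: "AE z in lborel. Q z"
  shows "AE z in lborel. AE (\<omega>, V) in sphere_measure \<Otimes>\<^sub>M lborel. case z of (x, v) \<Rightarrow> Q (x, v) \<and> Q (x, fst V) \<and> Q (x, snd V) \<and>
    Q (x, v + cpar \<omega> (V - (v, v)) *\<^sub>R (fst \<omega> + snd \<omega>)) \<and> Q (x, fst V - cpar \<omega> (V - (v, v)) *\<^sub>R fst \<omega>) \<and>
    Q (x, snd V - cpar \<omega> (V - (v, v)) *\<^sub>R snd \<omega>)"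
proof -
  let ?s1 = "\<lambda>y::('a \<times> 'a) \<times> ('a \<times> 'a). ((fst (fst y), fst (snd y)), (snd (fst y), snd (snd y)))"
  let ?s2 = "\<lambda>y::('a \<times> 'a) \<times> ('a \<times> 'a). ((fst (fst y), snd (snd y)), (fst (snd y), snd (fst y)))"
  have 0: "AE y in lborel. Q (fst (y :: ('a \<times> 'a) \<times> ('a \<times> 'a)))" by (rule AE_lborel_fst[OF Q])
  have 1: "AE y in lborel. Q (fst (?s1 y))"
    by (rule AE_linear_isometry[OF _ _ 0]) (auto intro!: linearI simp: norm_prod_def)
  have 2: "AE y in lborel. Q (fst (?s2 y))"
    by (rule AE_linear_isometry[OF _ _ 0]) (auto intro!: linearI simp: norm_prod_def)
  let ?R = "\<lambda>y. Q (fst y) \<and> Q (fst (?s1 y)) \<and> Q (fst (?s2 y))"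
  have all: "AE y in lborel. ?R y" using 0 1 2 by eventually_elim simp
  have "AE z in lborel. AE (p, w) in (sphere_measure :: ('a \<times> 'a) measure) \<Otimes>\<^sub>M lborel. ?R ((\<lambda>p y. y) p (z, w))"
    by (rule AE_collision[OF _ _ all]) (auto intro!: linear_id[unfolded id_def])
  moreover have "AE z in lborel. AE (p, w) in (sphere_measure :: ('a \<times> 'a) measure) \<Otimes>\<^sub>M lborel. ?R (post3 p (z, w))"
  proof (rule AE_collision[OF _ _ all])
    show "AE p in sphere_measure. linear (post3 p) \<and> (\<forall>y. norm (post3 (p :: 'a \<times> 'a) y) = norm y)"
      using AE_sphere_measure by eventually_elim (simp add: post3_eq_reflection linear_reflection norm_reflection)
  qed measurable
  ultimately show ?thesis
  proof eventually_elim
    case (elim z)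
    from elim(1) elim(2) show ?case
      by eventually_elim (auto simp: post3_def Let_def split: prod.splits)
  qed
qed

lemma AE_shear:
  fixes Q :: "'a::euclidean_space \<times> 'a \<Rightarrow> bool"
  assumes Q: "AE z in lborel. Q z"
  shows "AE (x, v) in lborel. Q (x + t *\<^sub>R v, v)"
proof -
  obtain N where N: "{y. \<not> Q y} \<subseteq> N" "emeasure lborel N = 0" "N \<in> sets lborel" using Q by (auto elim: AE_E)
  then have [measurable]: "N \<in> sets borel" by simp
  have "(\<integral>\<^sup>+z. indicator N (fst z + t *\<^sub>R snd z, snd z) \<partial>lborel) =
    (\<integral>\<^sup>+z. indicator N (fst z + t *\<^sub>R snd z, snd z) \<partial>(lborel \<Otimes>\<^sub>M lborel))" by (simp add: lborel_prod)
  also have "\<dots> = (\<integral>\<^sup>+v. (\<integral>\<^sup>+x. indicator N (x + t *\<^sub>R v, v) \<partial>lborel) \<partial>lborel)"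
    by (subst lborel_pair.nn_integral_snd[symmetric]) (auto simp: lborel_prod)
  also have "\<dots> = (\<integral>\<^sup>+v. (\<integral>\<^sup>+x. indicator N (x, v) \<partial>lborel) \<partial>lborel)"
  proof (rule nn_integral_cong)
    fix v :: 'a
    show "(\<integral>\<^sup>+x. indicator N (x + t *\<^sub>R v, v) \<partial>lborel) = (\<integral>\<^sup>+x. indicator N (x, v) \<partial>lborel)"
      using nn_integral_lborel_add[of "\<lambda>x. indicator N (x, v)" "t *\<^sub>R v"] by (simp add: add.commute)
  qed
  also have "\<dots> = (\<integral>\<^sup>+z. indicator N z \<partial>(lborel \<Otimes>\<^sub>M lborel))"
    by (subst lborel_pair.nn_integral_snd[symmetric]) (auto simp: lborel_prod)
  also have "\<dots> = 0" using N by (simp add: lborel_prod)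
  finally have "AE z in lborel. indicator N (fst z + t *\<^sub>R snd z, snd z) = (0::ennreal)"
    by (subst (asm) nn_integral_0_iff_AE) auto
  then show ?thesis by eventually_elim (use N(1) in \<open>auto simp: indicator_def split: if_splits\<close>)
qed

section \<open>Conservation laws\<close>

definition shifted_maxwellian :: "real \<Rightarrow> real \<Rightarrow> real \<Rightarrow> 'a::euclidean_space \<times> 'a \<Rightarrow> real"
  where "shifted_maxwellian \<alpha> \<beta> t = (\<lambda>(x, v). maxwellian \<alpha> \<beta> (x - t *\<^sub>R v, v))"

text \<open>All particles of a collision are at the same position, so that the common position is orthogonal to the
  vector of the reflection. This is conservation of momentum.\<close>

lemma reflection_affine:
  "X \<bullet> n = 0 \<Longrightarrow> reflection n (X - t *\<^sub>R V) = X - t *\<^sub>R reflection n V"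
  by (simp add: reflection_def inner_diff_left algebra_simps)

text \<open>The product of the densities depends on the Euclidean norms of the velocities and of the initial
  positions of all particles; a reflection preserves both.\<close>

lemma maxwellian_binary:
  assumes w: "norm \<omega> = 1"
  shows "shifted_maxwellian \<alpha> \<beta> t (x, v + (\<omega> \<bullet> (v1 - v)) *\<^sub>R \<omega>) * shifted_maxwellian \<alpha> \<beta> t (x, v1 - (\<omega> \<bullet> (v1 - v)) *\<^sub>R \<omega>) =
    shifted_maxwellian \<alpha> \<beta> t (x, v) * shifted_maxwellian \<alpha> \<beta> t (x, v1)"
proof -
  let ?n = "(\<omega>, - \<omega>)" and ?V = "(v, v1)" and ?X = "(x, x)"
  have prod: "shifted_maxwellian \<alpha> \<beta> t (x, a) * shifted_maxwellian \<alpha> \<beta> t (x, b) =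
    exp (- \<alpha> * (norm (?X - t *\<^sub>R (a, b)))\<^sup>2 - \<beta> * (norm (a, b))\<^sup>2)" for a b
    by (simp add: shifted_maxwellian_def maxwellian_def exp_add[symmetric] norm_Pair algebra_simps)
  have "\<omega> \<bullet> \<omega> = 1" using w by (simp add: norm_eq_1)
  then have "2 * (?V \<bullet> ?n) / (?n \<bullet> ?n) = - (\<omega> \<bullet> (v1 - v))"
    by (simp add: inner_prod_def inner_diff_right inner_commute)
  then have r: "reflection ?n ?V = (v + (\<omega> \<bullet> (v1 - v)) *\<^sub>R \<omega>, v1 - (\<omega> \<bullet> (v1 - v)) *\<^sub>R \<omega>)"
    by (simp add: reflection_def)
  have "norm (?X - t *\<^sub>R reflection ?n ?V) = norm (?X - t *\<^sub>R ?V)"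
    by (subst reflection_affine[symmetric]) (simp_all add: inner_prod_def norm_reflection del: scaleR_Pair diff_Pair)
  then show ?thesis unfolding prod r[symmetric] norm_reflection by simp
qed

lemma maxwellian_ternary:
  assumes w: "norm \<omega> = 1"
  shows "shifted_maxwellian \<alpha> \<beta> t (x, v + cpar \<omega> (V - (v, v)) *\<^sub>R (fst \<omega> + snd \<omega>)) *
      shifted_maxwellian \<alpha> \<beta> t (x, fst V - cpar \<omega> (V - (v, v)) *\<^sub>R fst \<omega>) *
      shifted_maxwellian \<alpha> \<beta> t (x, snd V - cpar \<omega> (V - (v, v)) *\<^sub>R snd \<omega>) =
    shifted_maxwellian \<alpha> \<beta> t (x, v) * shifted_maxwellian \<alpha> \<beta> t (x, fst V) * shifted_maxwellian \<alpha> \<beta> t (x, snd V)"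
proof -
  obtain v1 v2 where V: "V = (v1, v2)" by (cases V)
  let ?w1 = "fst \<omega>" and ?w2 = "snd \<omega>"
  let ?n = "(?w1 + ?w2, (- ?w1, - ?w2))" and ?V = "(v, (v1, v2))" and ?X = "(x, (x, x))"
  have prod: "shifted_maxwellian \<alpha> \<beta> t (x, a) * shifted_maxwellian \<alpha> \<beta> t (x, b) * shifted_maxwellian \<alpha> \<beta> t (x, c) =
    exp (- \<alpha> * (norm (?X - t *\<^sub>R (a, (b, c))))\<^sup>2 - \<beta> * (norm (a, (b, c)))\<^sup>2)" for a b c
    by (simp add: shifted_maxwellian_def maxwellian_def exp_add[symmetric] norm_Pair algebra_simps)
  let ?c = "cpar \<omega> (v1 - v, v2 - v)"
  have one: "?w1 \<bullet> ?w1 + ?w2 \<bullet> ?w2 = 1" using w by (simp add: norm_eq_1 inner_prod_def)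
  have pos: "1 + ?w1 \<bullet> ?w2 > 0" using sphere_inner_bound[OF w] by simp
  have nn: "?n \<bullet> ?n = 2 * (1 + ?w1 \<bullet> ?w2)"
    using one by (simp add: inner_prod_def inner_add_left inner_add_right inner_commute)
  have yn: "?V \<bullet> ?n = - (?w1 \<bullet> (v1 - v) + ?w2 \<bullet> (v2 - v))"
    by (simp add: inner_prod_def inner_diff_right inner_add_right inner_commute)
  have "2 * (?V \<bullet> ?n) / (?n \<bullet> ?n) = - ?c"
    using pos unfolding nn yn by (simp add: cpar_def field_simps)
  then have r: "reflection ?n ?V = (v + ?c *\<^sub>R (?w1 + ?w2), (v1 - ?c *\<^sub>R ?w1, v2 - ?c *\<^sub>R ?w2))"
    by (simp add: reflection_def)
  have "norm (?X - t *\<^sub>R reflection ?n ?V) = norm (?X - t *\<^sub>R ?V)"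
    by (subst reflection_affine[symmetric]) (simp_all add: inner_prod_def inner_add_right norm_reflection del: scaleR_Pair diff_Pair)
  moreover have "shifted_maxwellian \<alpha> \<beta> t (x, v + ?c *\<^sub>R (?w1 + ?w2)) * shifted_maxwellian \<alpha> \<beta> t (x, v1 - ?c *\<^sub>R ?w1) *
      shifted_maxwellian \<alpha> \<beta> t (x, v2 - ?c *\<^sub>R ?w2) =
    exp (- \<alpha> * (norm (?X - t *\<^sub>R reflection ?n ?V))\<^sup>2 - \<beta> * (norm (reflection ?n ?V))\<^sup>2)"
    unfolding prod r ..
  ultimately show ?thesis
    unfolding V diff_Pair fst_conv snd_conv prod[of v v1 v2] by (simp only: norm_reflection)
qed

section \<open>Estimates for the collision operators\<close>

text \<open>Replace the factors one at a time and bound the other factors by the \<open>W\<close>s.\<close>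

lemma product_perturb2:
  fixes f1 f2 g1 g2 W1 W2 e :: ennreal
  assumes "f1 \<le> g1 + e * W1" "f2 \<le> g2 + e * W2" "f2 \<le> W2" "g1 \<le> W1"
  shows "f1 * f2 \<le> g1 * g2 + 2 * e * (W1 * W2)"
proof -
  have "f1 * f2 \<le> (g1 + e * W1) * f2" using assms by (intro mult_right_mono) auto
  also have "\<dots> = g1 * f2 + e * W1 * f2" by (simp add: distrib_right)
  also have "\<dots> \<le> g1 * (g2 + e * W2) + e * W1 * W2" using assms by (intro add_mono mult_left_mono) auto
  also have "\<dots> = g1 * g2 + (e * (g1 * W2) + e * (W1 * W2))" by (simp add: distrib_left mult_ac add_ac)
  also have "\<dots> \<le> g1 * g2 + (e * (W1 * W2) + e * (W1 * W2))"
    using assms by (intro add_mono mult_left_mono mult_right_mono order_refl) auto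
  also have "\<dots> = g1 * g2 + 2 * e * (W1 * W2)" by (simp add: mult_2 distrib_right mult.assoc)
  finally show ?thesis .
qed

lemma product_perturb3:
  fixes f1 f2 f3 g1 g2 g3 W1 W2 W3 e :: ennreal
  assumes f: "f1 \<le> g1 + e * W1" "f2 \<le> g2 + e * W2" "f3 \<le> g3 + e * W3" "f2 \<le> W2" "f3 \<le> W3" "g1 \<le> W1" "g2 \<le> W2"
  shows "f1 * f2 * f3 \<le> g1 * g2 * g3 + 3 * e * (W1 * W2 * W3)"
proof -
  have "f1 * f2 * f3 \<le> (g1 * g2 + 2 * e * (W1 * W2)) * f3"
    using f by (intro mult_right_mono product_perturb2) auto
  also have "\<dots> = g1 * g2 * f3 + 2 * e * (W1 * W2) * f3" by (simp add: distrib_right)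
  also have "\<dots> \<le> g1 * g2 * (g3 + e * W3) + 2 * e * (W1 * W2) * W3"
    using f by (intro add_mono mult_left_mono) auto
  also have "\<dots> = g1 * g2 * g3 + (e * (g1 * g2 * W3) + 2 * e * (W1 * W2 * W3))"
    by (simp add: distrib_left mult_ac add_ac)
  also have "\<dots> \<le> g1 * g2 * g3 + (e * (W1 * W2 * W3) + 2 * e * (W1 * W2 * W3))"
    using f by (intro add_mono mult_left_mono mult_mono order_refl) auto
  also have "e * (W1 * W2 * W3) + 2 * e * (W1 * W2 * W3) = 3 * e * (W1 * W2 * W3)"
  proof -
    have "(3 :: ennreal) = 1 + 2" by simp
    then show ?thesis by (simp only: distrib_right mult_1)
  qed
  finally show ?thesis .
qed

locale collision_kernels =
  fixes K :: kernels and TA :: "'a::euclidean_space itself" and k \<alpha> \<beta> :: real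
  assumes adm: "admissible TYPE('a) K" and dim: "2 \<le> DIM('a)" and k_pos: "0 < k" and \<alpha>_pos: "0 < \<alpha>" and \<beta>_pos: "0 < \<beta>"
begin

definition b2t :: "real \<Rightarrow> real" where "b2t z = indicator {-1..1} z *\<^sub>R b2 K z"
definition b3t :: "real \<times> real \<Rightarrow> real" where "b3t p = indicator ({-1..1} \<times> {-1/2..1/2}) p *\<^sub>R (case p of (z, w) \<Rightarrow> b3 K z w)"

lemma b2t_measurable [measurable]: "b2t \<in> borel_measurable borel"
  using adm by (simp add: admissible_def set_borel_measurable_def b2t_def[abs_def])

lemma b3t_measurable [measurable]: "b3t \<in> borel_measurable borel"
  using adm by (simp add: admissible_def set_borel_measurable_def b3t_def[abs_def])

lemma kB2_eq: "kB2 K u \<omega> = norm u powr gam2 K * b2t (sgn u \<bullet> \<omega>)"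
  by (simp add: kB2_def b2t_def)

lemma kB3_eq: "kB3 K u \<omega> = tnorm u powr gam3 K * b3t ((u /\<^sub>R tnorm u) \<bullet> \<omega>, fst \<omega> \<bullet> snd \<omega>)"
  by (simp add: kB3_def b3t_def)

lemma kB2_measurable [measurable (raw)]:
  assumes [measurable]: "f \<in> N \<rightarrow>\<^sub>M borel" "g \<in> N \<rightarrow>\<^sub>M borel"
  shows "(\<lambda>x. kB2 K (f x) (g x)) \<in> borel_measurable N"
  unfolding kB2_eq by measurable

lemma kB3_measurable [measurable (raw)]:
  assumes [measurable]: "f \<in> N \<rightarrow>\<^sub>M borel" "g \<in> N \<rightarrow>\<^sub>M borel"
  shows "(\<lambda>x. kB3 K (f x) (g x)) \<in> borel_measurable N"
  unfolding kB3_eq by measurable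

lemma b2t_nonneg: "0 \<le> b2t z"
  using adm by (auto simp: admissible_def b2t_def indicator_def)

lemma b3t_nonneg: "0 \<le> b3t p"
  using adm by (auto simp: admissible_def b3t_def indicator_def split: prod.splits)

lemma kB2_nonneg: "0 \<le> kB2 K u \<omega>" and kB3_nonneg: "0 \<le> kB3 K v \<eta>"
  unfolding kB2_eq kB3_eq using b2t_nonneg b3t_nonneg by simp_all

lemma kB2_sphere: "norm \<omega> = 1 \<Longrightarrow> kB2 K u \<omega> = B2 K u \<omega>"
proof -
  assume "norm \<omega> = 1"
  then have "\<bar>sgn u \<bullet> \<omega>\<bar> \<le> 1"
    using Cauchy_Schwarz_ineq2[of "sgn u" \<omega>] by (simp add: norm_sgn split: if_splits)
  then show ?thesis by (simp add: kB2_def B2_def abs_le_iff)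
qed

lemma kB3_sphere: "norm \<omega> = 1 \<Longrightarrow> kB3 K u \<omega> = B3 K u \<omega>"
proof -
  assume w: "norm \<omega> = 1"
  have "\<bar>(u /\<^sub>R tnorm u) \<bullet> \<omega>\<bar> \<le> norm (u /\<^sub>R tnorm u)"
    using Cauchy_Schwarz_ineq2[of "u /\<^sub>R tnorm u" \<omega>] w by simp
  also have "\<dots> \<le> 1"
  proof -
    have t0: "0 \<le> tnorm u" using norm_le_tnorm[of u] norm_ge_zero order_trans by blast
    then have "norm (u /\<^sub>R tnorm u) = norm u / tnorm u" by (simp add: divide_inverse mult.commute)
    then show ?thesis using norm_le_tnorm[of u] t0 by (cases "tnorm u = 0") (auto simp: divide_le_eq_1)
  qed
  finally have "((u /\<^sub>R tnorm u) \<bullet> \<omega>, fst \<omega> \<bullet> snd \<omega>) \<in> {-1..1} \<times> {-1/2..1/2}"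
    using sphere_inner_bound[OF w] by (auto simp: abs_le_iff)
  then show ?thesis unfolding kB3_def B3_def by (simp only: indicator_simps scaleR_one)
qed

text \<open>The factor \<open>2\<close> is the loss in \<open>nn_integral_sphere_zonal_le\<close>.\<close>

definition A2 :: real where "A2 = 2 * enn2real (b2_norm TYPE('a) K)"
definition A3 :: real where "A3 = enn2real (b3_norm TYPE('a) K)"

lemma A2_nonneg: "0 \<le> A2" and A3_nonneg: "0 \<le> A3" by (simp_all add: A2_def A3_def)

text \<open>For \<open>u = 0\<close> the left-hand side vanishes because of the convention \<open>0 powr g = 0\<close>.\<close>

lemma sphere_integral_kB2: "(\<integral>\<^sup>+\<omega>. ennreal (kB2 K u \<omega>) \<partial>sphere_measure) \<le> ennreal A2 * ennreal (norm (u::'a) powr gam2 K)"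
proof (cases "u = 0")
  case False
  let ?d = "real DIM('a)"
  let ?I = "\<integral>\<^sup>+z\<in>{-1..1}. ennreal (b2 K z * (1 - z\<^sup>2) powr ((?d - 3) / 2)) \<partial>lborel"
  have fin: "b2_norm TYPE('a) K < \<infinity>" using adm by (simp add: admissible_def)
  have b2n: "b2_norm TYPE('a) K = ennreal ((?d - 1) * unit_ball_vol (?d - 1)) * ?I"
    by (simp add: b2_norm_def Let_def)
  have "(\<integral>\<^sup>+\<omega>. ennreal (b2t (sgn u \<bullet> \<omega>)) \<partial>sphere_measure) \<le> ennreal (?d * unit_ball_vol (?d - 1)) *
    (\<integral>\<^sup>+z. ennreal (b2t z) * ennreal ((1 - z\<^sup>2) powr ((?d - 3) / 2)) * indicator {-1..1} z \<partial>lborel)"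
    using False by (intro nn_integral_sphere_zonal_le dim) (auto simp: norm_sgn)
  also have "(\<integral>\<^sup>+z. ennreal (b2t z) * ennreal ((1 - z\<^sup>2) powr ((?d - 3) / 2)) * indicator {-1..1} z \<partial>lborel) = ?I"
  proof (rule nn_integral_cong)
    fix z :: real
    show "ennreal (b2t z) * ennreal ((1 - z\<^sup>2) powr ((?d - 3) / 2)) * indicator {-1..1} z =
      ennreal (b2 K z * (1 - z\<^sup>2) powr ((?d - 3) / 2)) * indicator {-1..1} z"
      by (auto simp: indicator_def b2t_def ennreal_mult''[symmetric])
  qed
  also have "ennreal (?d * unit_ball_vol (?d - 1)) \<le> 2 * ennreal ((?d - 1) * unit_ball_vol (?d - 1))"
  proof -
    have "?d * unit_ball_vol (?d - 1) \<le> 2 * ((?d - 1) * unit_ball_vol (?d - 1))"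
      using dim by (simp add: mult_right_mono)
    then have "ennreal (?d * unit_ball_vol (?d - 1)) \<le> ennreal (2 * ((?d - 1) * unit_ball_vol (?d - 1)))" by (rule ennreal_leI)
    also have "\<dots> = 2 * ennreal ((?d - 1) * unit_ball_vol (?d - 1))" using dim by (simp add: ennreal_mult)
    finally show ?thesis .
  qed
  also have "2 * ennreal ((?d - 1) * unit_ball_vol (?d - 1)) * ?I = 2 * b2_norm TYPE('a) K" by (simp add: b2n mult.assoc)
  also have "\<dots> = ennreal A2" using fin by (simp add: A2_def ennreal_mult ennreal_enn2real)
  finally have main: "(\<integral>\<^sup>+\<omega>. ennreal (b2t (sgn u \<bullet> \<omega>)) \<partial>sphere_measure) \<le> ennreal A2" by (simp add: mult_right_mono)
  have "(\<integral>\<^sup>+\<omega>. ennreal (kB2 K u \<omega>) \<partial>sphere_measure) = (\<integral>\<^sup>+\<omega>. ennreal (norm u powr gam2 K) * ennreal (b2t (sgn u \<bullet> \<omega>)) \<partial>sphere_measure)"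
    unfolding kB2_eq by (simp add: ennreal_mult')
  also have "\<dots> = ennreal (norm u powr gam2 K) * (\<integral>\<^sup>+\<omega>. ennreal (b2t (sgn u \<bullet> \<omega>)) \<partial>sphere_measure)"
    by (rule nn_integral_cmult) measurable
  also have "\<dots> \<le> ennreal (norm u powr gam2 K) * ennreal A2" by (intro mult_left_mono main) simp
  finally show ?thesis by (simp add: mult.commute)
qed (simp add: kB2_def)

lemma sphere_integral_kB3: "(\<integral>\<^sup>+\<omega>. ennreal (kB3 K u \<omega>) \<partial>sphere_measure) \<le> ennreal A3 * ennreal (tnorm (u::'a \<times> 'a) powr gam3 K)"
proof (cases "u = 0")
  case True
  then show ?thesis by (simp add: kB3_def tnorm_def zero_prod_def)
next
  case False
  have fin: "b3_norm TYPE('a) K < \<infinity>" using adm by (simp add: admissible_def)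
  have tpos: "0 < tnorm u" using norm_le_tnorm[of u] False by (meson less_le_trans zero_less_norm_iff)
  obtain u1 u2 where u: "u = (u1, u2)" by (cases u)
  have scale: "norm (a /\<^sub>R tnorm u) = norm a / tnorm u" for a :: 'a using tpos by (simp add: divide_inverse_commute)
  have tn: "(norm u1)\<^sup>2 + (norm u2)\<^sup>2 + (norm (u1 - u2))\<^sup>2 = (tnorm u)\<^sup>2" by (simp add: tnorm_def u)
  have "(norm u1 / tnorm u)\<^sup>2 + (norm u2 / tnorm u)\<^sup>2 + (norm (u1 - u2) / tnorm u)\<^sup>2 = (tnorm u)\<^sup>2 / (tnorm u)\<^sup>2"
    by (simp only: tn[symmetric] power_divide add_divide_distrib[symmetric])
  then have "(norm u1 / tnorm u)\<^sup>2 + (norm u2 / tnorm u)\<^sup>2 + (norm (u1 - u2) / tnorm u)\<^sup>2 = 1"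
    using tpos by simp
  moreover have "u /\<^sub>R tnorm u = (u1 /\<^sub>R tnorm u, u2 /\<^sub>R tnorm u)" by (simp add: u)
  ultimately have ell: "u /\<^sub>R tnorm u \<in> ellipsoid"
    by (simp add: ellipsoid_def scaleR_diff_right[symmetric] scale del: norm_scaleR)
  have "(\<integral>\<^sup>+\<omega>. ennreal (kB3 K u \<omega>) \<partial>sphere_measure) \<le>
    (\<integral>\<^sup>+\<omega>. ennreal (tnorm u powr gam3 K) * ennreal (b3 K ((u /\<^sub>R tnorm u) \<bullet> \<omega>) (fst \<omega> \<bullet> snd \<omega>)) \<partial>sphere_measure)"
  proof (rule nn_integral_mono_AE, use AE_sphere_measure in eventually_elim)
    case (elim \<omega>)
    then show ?case by (simp add: kB3_sphere B3_def ennreal_mult')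
  qed
  also have "\<dots> = (\<integral>\<^sup>+\<omega>. ennreal (tnorm u powr gam3 K) * ennreal (b3t ((u /\<^sub>R tnorm u) \<bullet> \<omega>, fst \<omega> \<bullet> snd \<omega>)) \<partial>sphere_measure)"
  proof (rule nn_integral_cong_AE, use AE_sphere_measure in eventually_elim)
    case (elim \<omega>)
    then show ?case using kB3_sphere[OF elim, of u] tpos by (simp add: kB3_eq B3_def)
  qed
  also have "\<dots> = ennreal (tnorm u powr gam3 K) * (\<integral>\<^sup>+\<omega>. ennreal (b3t ((u /\<^sub>R tnorm u) \<bullet> \<omega>, fst \<omega> \<bullet> snd \<omega>)) \<partial>sphere_measure)"
    by (rule nn_integral_cmult) measurable
  finally have 1: "(\<integral>\<^sup>+\<omega>. ennreal (kB3 K u \<omega>) \<partial>sphere_measure) \<le> \<dots>" .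
  have "(\<integral>\<^sup>+\<omega>. ennreal (b3t ((u /\<^sub>R tnorm u) \<bullet> \<omega>, fst \<omega> \<bullet> snd \<omega>)) \<partial>sphere_measure) =
    (\<integral>\<^sup>+\<omega>. ennreal (b3 K ((u /\<^sub>R tnorm u) \<bullet> \<omega>) (fst \<omega> \<bullet> snd \<omega>)) \<partial>sphere_measure)"
  proof (rule nn_integral_cong_AE, use AE_sphere_measure in eventually_elim)
    case (elim \<omega>)
    then show ?case using kB3_sphere[OF elim, of u] tpos by (simp add: kB3_eq B3_def)
  qed
  also have "\<dots> \<le> b3_norm TYPE('a) K" unfolding b3_norm_def by (rule SUP_upper[OF ell])
  also have "\<dots> = ennreal A3" using fin by (simp add: A3_def ennreal_enn2real)
  finally show ?thesis using order_trans[OF 1 mult_left_mono] by (simp add: mult.commute)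
qed

lemma gain2_measurable [measurable (raw)]:
  fixes f :: "'c \<Rightarrow> 'a \<times> 'a \<Rightarrow> ennreal"
  assumes [measurable]: "case_prod f \<in> borel_measurable (N \<Otimes>\<^sub>M borel)" "Z \<in> N \<rightarrow>\<^sub>M borel"
  shows "(\<lambda>y. gain2 K (f y) (Z y)) \<in> borel_measurable N"
  unfolding gain2_def case_prod_beta by measurable

lemma rate2_measurable [measurable (raw)]:
  fixes f :: "'c \<Rightarrow> 'a \<times> 'a \<Rightarrow> ennreal"
  assumes [measurable]: "case_prod f \<in> borel_measurable (N \<Otimes>\<^sub>M borel)" "Z \<in> N \<rightarrow>\<^sub>M borel"
  shows "(\<lambda>y. rate2 K (f y) (Z y)) \<in> borel_measurable N"
  unfolding rate2_def case_prod_beta by measurable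

lemma gain3_measurable [measurable (raw)]:
  fixes f :: "'c \<Rightarrow> 'a \<times> 'a \<Rightarrow> ennreal"
  assumes [measurable]: "case_prod f \<in> borel_measurable (N \<Otimes>\<^sub>M borel)" "Z \<in> N \<rightarrow>\<^sub>M borel"
  shows "(\<lambda>y. gain3 K (f y) (Z y)) \<in> borel_measurable N"
  unfolding gain3_def case_prod_beta by measurable

lemma rate3_measurable [measurable (raw)]:
  fixes f :: "'c \<Rightarrow> 'a \<times> 'a \<Rightarrow> ennreal"
  assumes [measurable]: "case_prod f \<in> borel_measurable (N \<Otimes>\<^sub>M borel)" "Z \<in> N \<rightarrow>\<^sub>M borel"
  shows "(\<lambda>y. rate3 K (f y) (Z y)) \<in> borel_measurable N"
  unfolding rate3_def case_prod_beta by measurable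

text \<open>The density \<open>k M\<close> along the free flow, in laboratory coordinates at time \<open>t\<close>.\<close>

definition W :: "real \<Rightarrow> 'a \<times> 'a \<Rightarrow> ennreal" where "W t z = ennreal (k * shifted_maxwellian \<alpha> \<beta> t z)"

lemma shifted_maxwellian_pos: "0 < shifted_maxwellian \<alpha> \<beta> t z"
  by (cases z) (simp add: shifted_maxwellian_def maxwellian_def)

lemma shifted_maxwellian_measurable [measurable (raw)]:
  assumes [measurable]: "T \<in> borel_measurable N" "Z \<in> N \<rightarrow>\<^sub>M (borel :: ('a \<times> 'a) measure)"
  shows "(\<lambda>x. shifted_maxwellian \<alpha> \<beta> (T x) (Z x)) \<in> borel_measurable N"
  unfolding shifted_maxwellian_def maxwellian_def case_prod_beta by measurable

lemma W_measurable [measurable (raw)]: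
  assumes [measurable]: "T \<in> borel_measurable N" "Z \<in> N \<rightarrow>\<^sub>M borel"
  shows "(\<lambda>x. W (T x) (Z x)) \<in> borel_measurable N"
  unfolding W_def by measurable

lemma W_prod2: "W t a * W t b = ennreal (k\<^sup>2 * (shifted_maxwellian \<alpha> \<beta> t a * shifted_maxwellian \<alpha> \<beta> t b))"
  and W_prod3: "W t a * W t b * W t c =
    ennreal (k ^ 3 * (shifted_maxwellian \<alpha> \<beta> t a * shifted_maxwellian \<alpha> \<beta> t b * shifted_maxwellian \<alpha> \<beta> t c))"
proof -
  have nn: "0 \<le> k * shifted_maxwellian \<alpha> \<beta> t z" for z
    using k_pos shifted_maxwellian_pos[of t z] by simp
  show "W t a * W t b = ennreal (k\<^sup>2 * (shifted_maxwellian \<alpha> \<beta> t a * shifted_maxwellian \<alpha> \<beta> t b))"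
    unfolding W_def ennreal_mult[OF nn nn, symmetric] by (simp add: power2_eq_square mult_ac)
  show "W t a * W t b * W t c =
    ennreal (k ^ 3 * (shifted_maxwellian \<alpha> \<beta> t a * shifted_maxwellian \<alpha> \<beta> t b * shifted_maxwellian \<alpha> \<beta> t c))"
    unfolding W_def ennreal_mult[OF nn nn, symmetric] ennreal_mult[OF mult_nonneg_nonneg[OF nn nn] nn, symmetric]
    by (simp add: power3_eq_cube mult_ac)
qed

text \<open>The collision frequencies against this density. The ternary one has the square of \<open>k\<close>, for two partners.\<close>

definition F2 :: "real \<Rightarrow> 'a \<times> 'a \<Rightarrow> ennreal"
  where "F2 t = (\<lambda>(x, v). ennreal (k * A2) * coll_freq norm (gam2 K) \<alpha> \<beta> t x v)"
definition F3 :: "real \<Rightarrow> 'a \<times> 'a \<Rightarrow> ennreal"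
  where "F3 t = (\<lambda>(x, v). ennreal (k\<^sup>2 * A3) * coll_freq tnorm (gam3 K) \<alpha> \<beta> t (x, x) (v, v))"

lemma rate2_W: "rate2 K (W t) (x + t *\<^sub>R v, v) \<le> F2 t (x, v)"
proof -
  let ?y = "x + t *\<^sub>R v"
  have "rate2 K (W t) (?y, v) = (\<integral>\<^sup>+v1. (\<integral>\<^sup>+\<omega>. ennreal (kB2 K (v1 - v) \<omega>) * W t (?y, v1) \<partial>sphere_measure) \<partial>lborel)"
    unfolding rate2_def by (simp, subst sphere_pair.nn_integral_snd[symmetric]) (auto simp: case_prod_beta)
  also have "\<dots> = (\<integral>\<^sup>+v1. (\<integral>\<^sup>+\<omega>. ennreal (kB2 K (v1 - v) \<omega>) \<partial>sphere_measure) * W t (?y, v1) \<partial>lborel)"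
    by (intro nn_integral_cong nn_integral_multc) measurable
  also have "\<dots> \<le> (\<integral>\<^sup>+v1. ennreal A2 * ennreal (norm (v1 - v) powr gam2 K) * W t (?y, v1) \<partial>lborel)"
    by (intro nn_integral_mono mult_right_mono sphere_integral_kB2) simp
  also have "\<dots> = (\<integral>\<^sup>+v1. ennreal (k * A2) * ennreal (norm (v1 - v) powr gam2 K *
      exp (- \<alpha> * (norm (x - t *\<^sub>R (v1 - v)))\<^sup>2 - \<beta> * (norm v1)\<^sup>2)) \<partial>lborel)"
  proof (rule nn_integral_cong)
    fix v1 :: 'a
    have "W t (?y, v1) = ennreal (k * exp (- \<alpha> * (norm (x - t *\<^sub>R (v1 - v)))\<^sup>2 - \<beta> * (norm v1)\<^sup>2))"
      by (simp add: W_def shifted_maxwellian_def maxwellian_def algebra_simps)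
    then show "ennreal A2 * ennreal (norm (v1 - v) powr gam2 K) * W t (?y, v1) =
      ennreal (k * A2) * ennreal (norm (v1 - v) powr gam2 K * exp (- \<alpha> * (norm (x - t *\<^sub>R (v1 - v)))\<^sup>2 - \<beta> * (norm v1)\<^sup>2))"
      using A2_nonneg k_pos by (simp add: ennreal_mult mult_ac)
  qed
  also have "\<dots> = F2 t (x, v)" unfolding F2_def coll_freq_def by (simp add: nn_integral_cmult)
  finally show ?thesis .
qed

lemma rate3_W: "rate3 K (W t) (x + t *\<^sub>R v, v) \<le> F3 t (x, v)"
proof -
  let ?y = "x + t *\<^sub>R v"
  have "rate3 K (W t) (?y, v) = (\<integral>\<^sup>+V. (\<integral>\<^sup>+\<omega>. ennreal (kB3 K (V - (v, v)) \<omega>) * (W t (?y, fst V) * W t (?y, snd V)) \<partial>sphere_measure) \<partial>lborel)"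
    unfolding rate3_def by (simp, subst sphere_pair.nn_integral_snd[symmetric]) (auto simp: case_prod_beta)
  also have "\<dots> = (\<integral>\<^sup>+V. (\<integral>\<^sup>+\<omega>. ennreal (kB3 K (V - (v, v)) \<omega>) \<partial>sphere_measure) * (W t (?y, fst V) * W t (?y, snd V)) \<partial>lborel)"
    by (intro nn_integral_cong nn_integral_multc) measurable
  also have "\<dots> \<le> (\<integral>\<^sup>+V. ennreal A3 * ennreal (tnorm (V - (v, v)) powr gam3 K) * (W t (?y, fst V) * W t (?y, snd V)) \<partial>lborel)"
    by (intro nn_integral_mono mult_right_mono sphere_integral_kB3) simp
  also have "\<dots> = (\<integral>\<^sup>+V. ennreal (k\<^sup>2 * A3) * ennreal (tnorm (V - (v, v)) powr gam3 K *
      exp (- \<alpha> * (norm ((x, x) - t *\<^sub>R (V - (v, v))))\<^sup>2 - \<beta> * (norm V)\<^sup>2)) \<partial>lborel)"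
  proof (rule nn_integral_cong)
    fix V :: "'a \<times> 'a"
    obtain v1 v2 where V: "V = (v1, v2)" by (cases V)
    have 1: "W t (?y, b) = ennreal (k * exp (- \<alpha> * (norm (x - t *\<^sub>R (b - v)))\<^sup>2 - \<beta> * (norm b)\<^sup>2))" for b
      by (simp add: W_def shifted_maxwellian_def maxwellian_def algebra_simps)
    have "W t (?y, fst V) * W t (?y, snd V) = ennreal (k\<^sup>2 * exp (- \<alpha> * (norm ((x, x) - t *\<^sub>R (V - (v, v))))\<^sup>2 - \<beta> * (norm V)\<^sup>2))"
    proof -
      have "W t (?y, fst V) * W t (?y, snd V) = ennreal (k * exp (- \<alpha> * (norm (x - t *\<^sub>R (v1 - v)))\<^sup>2 - \<beta> * (norm v1)\<^sup>2) *
        (k * exp (- \<alpha> * (norm (x - t *\<^sub>R (v2 - v)))\<^sup>2 - \<beta> * (norm v2)\<^sup>2)))"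
        unfolding V fst_conv snd_conv 1 using k_pos by (subst ennreal_mult) auto
      also have "k * exp (- \<alpha> * (norm (x - t *\<^sub>R (v1 - v)))\<^sup>2 - \<beta> * (norm v1)\<^sup>2) *
        (k * exp (- \<alpha> * (norm (x - t *\<^sub>R (v2 - v)))\<^sup>2 - \<beta> * (norm v2)\<^sup>2)) =
        k\<^sup>2 * exp ((- \<alpha> * (norm (x - t *\<^sub>R (v1 - v)))\<^sup>2 - \<beta> * (norm v1)\<^sup>2) + (- \<alpha> * (norm (x - t *\<^sub>R (v2 - v)))\<^sup>2 - \<beta> * (norm v2)\<^sup>2))"
        unfolding exp_add by (simp add: power2_eq_square[of k])
      also have "(- \<alpha> * (norm (x - t *\<^sub>R (v1 - v)))\<^sup>2 - \<beta> * (norm v1)\<^sup>2) + (- \<alpha> * (norm (x - t *\<^sub>R (v2 - v)))\<^sup>2 - \<beta> * (norm v2)\<^sup>2)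
        = - \<alpha> * (norm ((x, x) - t *\<^sub>R (V - (v, v))))\<^sup>2 - \<beta> * (norm V)\<^sup>2"
        by (simp add: V norm_Pair ring_distribs)
      finally show ?thesis .
    qed
    then show "ennreal A3 * ennreal (tnorm (V - (v, v)) powr gam3 K) * (W t (?y, fst V) * W t (?y, snd V)) =
      ennreal (k\<^sup>2 * A3) * ennreal (tnorm (V - (v, v)) powr gam3 K * exp (- \<alpha> * (norm ((x, x) - t *\<^sub>R (V - (v, v))))\<^sup>2 - \<beta> * (norm V)\<^sup>2))"
      using A3_nonneg k_pos by (simp add: ennreal_mult mult_ac)
  qed
  also have "\<dots> = F3 t (x, v)" unfolding F3_def coll_freq_def by (simp add: nn_integral_cmult)
  finally show ?thesis .
qed

text \<open>By \<open>maxwellian_binary\<close> the gain of this density equals its loss, whence it is bounded by the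
  density times the frequency.\<close>

lemma gain2_W: "gain2 K (W t) (x + t *\<^sub>R v, v) \<le> ennreal (k * maxwellian \<alpha> \<beta> (x, v)) * F2 t (x, v)"
proof -
  let ?y = "x + t *\<^sub>R v"
  have "gain2 K (W t) (?y, v) = (\<integral>\<^sup>+(\<omega>, v1). W t (?y, v) * (ennreal (kB2 K (v1 - v) \<omega>) * W t (?y, v1)) \<partial>(sphere_measure \<Otimes>\<^sub>M lborel))"
    unfolding gain2_def split
  proof (rule nn_integral_cong_AE, use AE_sphere_pair[where 'a='a and 'b='a] in eventually_elim)
    case (elim p)
    obtain \<omega> v1 where p: "p = (\<omega>, v1)" by (cases p)
    have "W t (?y, v + (\<omega> \<bullet> (v1 - v)) *\<^sub>R \<omega>) * W t (?y, v1 - (\<omega> \<bullet> (v1 - v)) *\<^sub>R \<omega>) = W t (?y, v) * W t (?y, v1)"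
      unfolding W_prod2 using maxwellian_binary[of \<omega> \<alpha> \<beta> t ?y v v1] elim by (simp add: p)
    then show ?case by (simp add: p mult_ac)
  qed
  also have "\<dots> = W t (?y, v) * rate2 K (W t) (?y, v)"
    unfolding rate2_def by (simp add: case_prod_unfold nn_integral_cmult)
  also have "W t (?y, v) = ennreal (k * maxwellian \<alpha> \<beta> (x, v))"
    by (simp add: W_def shifted_maxwellian_def)
  also have "ennreal (k * maxwellian \<alpha> \<beta> (x, v)) * rate2 K (W t) (?y, v) \<le> ennreal (k * maxwellian \<alpha> \<beta> (x, v)) * F2 t (x, v)"
    by (intro mult_left_mono rate2_W) simp
  finally show ?thesis .
qed

lemma gain3_W: "gain3 K (W t) (x + t *\<^sub>R v, v) \<le> ennreal (k * maxwellian \<alpha> \<beta> (x, v)) * F3 t (x, v)"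
proof -
  let ?y = "x + t *\<^sub>R v"
  have "gain3 K (W t) (?y, v) = (\<integral>\<^sup>+(\<omega>, V). W t (?y, v) * (ennreal (kB3 K (V - (v, v)) \<omega>) * (W t (?y, fst V) * W t (?y, snd V))) \<partial>(sphere_measure \<Otimes>\<^sub>M lborel))"
    unfolding gain3_def split
  proof (rule nn_integral_cong_AE, use AE_sphere_pair[where 'a="'a \<times> 'a" and 'b="'a \<times> 'a"] in eventually_elim)
    case (elim p)
    obtain \<omega> V where p: "p = (\<omega>, V)" by (cases p)
    let ?c = "cpar \<omega> (V - (v, v))"
    have "W t (?y, v + ?c *\<^sub>R (fst \<omega> + snd \<omega>)) * W t (?y, fst V - ?c *\<^sub>R fst \<omega>) * W t (?y, snd V - ?c *\<^sub>R snd \<omega>) =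
      W t (?y, v) * W t (?y, fst V) * W t (?y, snd V)"
      unfolding W_prod3 using maxwellian_ternary[of \<omega> \<alpha> \<beta> t ?y v V] elim by (simp add: p)
    then show ?case by (simp add: p mult_ac)
  qed
  also have "\<dots> = W t (?y, v) * rate3 K (W t) (?y, v)"
    unfolding rate3_def by (simp add: case_prod_unfold nn_integral_cmult)
  also have "W t (?y, v) = ennreal (k * maxwellian \<alpha> \<beta> (x, v))"
    by (simp add: W_def shifted_maxwellian_def)
  also have "ennreal (k * maxwellian \<alpha> \<beta> (x, v)) * rate3 K (W t) (?y, v) \<le> ennreal (k * maxwellian \<alpha> \<beta> (x, v)) * F3 t (x, v)"
    by (intro mult_left_mono rate3_W) simp
  finally show ?thesis .
qed

text \<open>Both monotonicity, for \<open>e = 0\<close>, and the Lipschitz bounds follow from this one-sided estimate. The factors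
  are the degrees of the operators.\<close>

lemma collision_perturb:
  fixes f g :: "'a \<times> 'a \<Rightarrow> ennreal"
  assumes [measurable]: "f \<in> borel_measurable borel" "g \<in> borel_measurable borel"
    and fW: "\<And>z. f z \<le> W t z" and gW: "\<And>z. g z \<le> W t z" and fg: "AE z in lborel. f z \<le> g z + e * W t z"
  shows "AE z in lborel. gain2 K f z \<le> gain2 K g z + 2 * e * gain2 K (W t) z"
    and "AE z in lborel. rate2 K f z \<le> rate2 K g z + e * rate2 K (W t) z"
    and "AE z in lborel. gain3 K f z \<le> gain3 K g z + 3 * e * gain3 K (W t) z"
    and "AE z in lborel. rate3 K f z \<le> rate3 K g z + 2 * e * rate3 K (W t) z"
proof -
  show "AE z in lborel. gain2 K f z \<le> gain2 K g z + 2 * e * gain2 K (W t) z"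
    using AE_binary[OF fg]
  proof eventually_elim
    case (elim z)
    obtain x v where z: "z = (x, v)" by (cases z)
    have "gain2 K f z \<le> (\<integral>\<^sup>+(\<omega>, v1). ennreal (kB2 K (v1 - v) \<omega>) *
      (g (x, v + (\<omega> \<bullet> (v1 - v)) *\<^sub>R \<omega>) * g (x, v1 - (\<omega> \<bullet> (v1 - v)) *\<^sub>R \<omega>)) + 2 * e * (ennreal (kB2 K (v1 - v) \<omega>) *
      (W t (x, v + (\<omega> \<bullet> (v1 - v)) *\<^sub>R \<omega>) * W t (x, v1 - (\<omega> \<bullet> (v1 - v)) *\<^sub>R \<omega>))) \<partial>(sphere_measure \<Otimes>\<^sub>M lborel))"
      unfolding gain2_def z split
    proof (rule nn_integral_mono_AE, use elim in eventually_elim)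
      case (elim p)
      obtain \<omega> v1 where p: "p = (\<omega>, v1)" by (cases p)
      have "ennreal (kB2 K (v1 - v) \<omega>) * (f (x, v + (\<omega> \<bullet> (v1 - v)) *\<^sub>R \<omega>) * f (x, v1 - (\<omega> \<bullet> (v1 - v)) *\<^sub>R \<omega>)) \<le>
        ennreal (kB2 K (v1 - v) \<omega>) * (g (x, v + (\<omega> \<bullet> (v1 - v)) *\<^sub>R \<omega>) * g (x, v1 - (\<omega> \<bullet> (v1 - v)) *\<^sub>R \<omega>) +
          2 * e * (W t (x, v + (\<omega> \<bullet> (v1 - v)) *\<^sub>R \<omega>) * W t (x, v1 - (\<omega> \<bullet> (v1 - v)) *\<^sub>R \<omega>)))"
        using elim by (intro mult_left_mono product_perturb2 fW gW) (auto simp: p z)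
      then show ?case by (simp add: p distrib_left mult_ac)
    qed
    also have "\<dots> = gain2 K g z + 2 * e * gain2 K (W t) z"
      unfolding gain2_def z split by (simp add: case_prod_unfold nn_integral_add nn_integral_cmult)
    finally show ?case .
  qed
  show "AE z in lborel. rate2 K f z \<le> rate2 K g z + e * rate2 K (W t) z"
    using AE_binary[OF fg]
  proof eventually_elim
    case (elim z)
    obtain x v where z: "z = (x, v)" by (cases z)
    have "rate2 K f z \<le> (\<integral>\<^sup>+(\<omega>, v1). ennreal (kB2 K (v1 - v) \<omega>) * g (x, v1) + e * (ennreal (kB2 K (v1 - v) \<omega>) * W t (x, v1)) \<partial>(sphere_measure \<Otimes>\<^sub>M lborel))"
      unfolding rate2_def z split
    proof (rule nn_integral_mono_AE, use elim in eventually_elim)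
      case (elim p)
      obtain \<omega> v1 where p: "p = (\<omega>, v1)" by (cases p)
      have "ennreal (kB2 K (v1 - v) \<omega>) * f (x, v1) \<le> ennreal (kB2 K (v1 - v) \<omega>) * (g (x, v1) + e * W t (x, v1))"
        using elim by (intro mult_left_mono) (auto simp: p z)
      then show ?case by (simp add: p distrib_left mult_ac)
    qed
    also have "\<dots> = rate2 K g z + e * rate2 K (W t) z"
      unfolding rate2_def z split by (simp add: case_prod_unfold nn_integral_add nn_integral_cmult)
    finally show ?case .
  qed
  show "AE z in lborel. gain3 K f z \<le> gain3 K g z + 3 * e * gain3 K (W t) z"
    using AE_ternary[OF fg]
  proof eventually_elim
    case (elim z)
    obtain x v where z: "z = (x, v)" by (cases z)
    let ?g = "\<lambda>g \<omega> V. g (x, v + cpar \<omega> (V - (v, v)) *\<^sub>R (fst \<omega> + snd \<omega>)) * g (x, fst V - cpar \<omega> (V - (v, v)) *\<^sub>R fst \<omega>) *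
      g (x, snd V - cpar \<omega> (V - (v, v)) *\<^sub>R snd \<omega>) :: ennreal"
    have "gain3 K f z \<le> (\<integral>\<^sup>+(\<omega>, V). ennreal (kB3 K (V - (v, v)) \<omega>) * ?g g \<omega> V +
      3 * e * (ennreal (kB3 K (V - (v, v)) \<omega>) * ?g (W t) \<omega> V) \<partial>(sphere_measure \<Otimes>\<^sub>M lborel))"
      unfolding gain3_def z split
    proof (rule nn_integral_mono_AE, use elim in eventually_elim)
      case (elim p)
      obtain \<omega> V where p: "p = (\<omega>, V)" by (cases p)
      have "ennreal (kB3 K (V - (v, v)) \<omega>) * ?g f \<omega> V \<le> ennreal (kB3 K (V - (v, v)) \<omega>) * (?g g \<omega> V + 3 * e * ?g (W t) \<omega> V)"
        using elim by (intro mult_left_mono product_perturb3 fW gW) (auto simp: p z)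
      then show ?case by (simp add: p distrib_left mult_ac)
    qed
    also have "\<dots> = gain3 K g z + 3 * e * gain3 K (W t) z"
      unfolding gain3_def z split by (simp add: case_prod_unfold nn_integral_add nn_integral_cmult)
    finally show ?case .
  qed
  show "AE z in lborel. rate3 K f z \<le> rate3 K g z + 2 * e * rate3 K (W t) z"
    using AE_ternary[OF fg]
  proof eventually_elim
    case (elim z)
    obtain x v where z: "z = (x, v)" by (cases z)
    have "rate3 K f z \<le> (\<integral>\<^sup>+(\<omega>, V). ennreal (kB3 K (V - (v, v)) \<omega>) * (g (x, fst V) * g (x, snd V)) +
      2 * e * (ennreal (kB3 K (V - (v, v)) \<omega>) * (W t (x, fst V) * W t (x, snd V))) \<partial>(sphere_measure \<Otimes>\<^sub>M lborel))"
      unfolding rate3_def z split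
    proof (rule nn_integral_mono_AE, use elim in eventually_elim)
      case (elim p)
      obtain \<omega> V where p: "p = (\<omega>, V)" by (cases p)
      have "ennreal (kB3 K (V - (v, v)) \<omega>) * (f (x, fst V) * f (x, snd V)) \<le>
        ennreal (kB3 K (V - (v, v)) \<omega>) * (g (x, fst V) * g (x, snd V) + 2 * e * (W t (x, fst V) * W t (x, snd V)))"
        using elim by (intro mult_left_mono product_perturb2 fW gW) (auto simp: p z)
      then show ?case by (simp add: p distrib_left mult_ac)
    qed
    also have "\<dots> = rate3 K g z + 2 * e * rate3 K (W t) z"
      unfolding rate3_def z split by (simp add: case_prod_unfold nn_integral_add nn_integral_cmult)
    finally show ?case .
  qed
qed

end

lemma collision_operators_mono:
  assumes "\<And>z. f z \<le> g z"
  shows "gain2 K f z \<le> gain2 K g z" "gain3 K f z \<le> gain3 K g z" "rate2 K f z \<le> rate2 K g z" "rate3 K f z \<le> rate3 K g z"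
  unfolding gain2_def gain3_def rate2_def rate3_def case_prod_beta
  by (intro nn_integral_mono mult_left_mono mult_mono assms; simp)+

lemma maxwellian_pos: "0 < maxwellian \<alpha> \<beta> z"
  by (cases z) (simp add: maxwellian_def)

lemma maxwellian_measurable [measurable (raw)]:
  fixes Z :: "'c \<Rightarrow> 'a::euclidean_space \<times> 'a"
  assumes [measurable]: "Z \<in> N \<rightarrow>\<^sub>M borel"
  shows "(\<lambda>x. maxwellian \<alpha> \<beta> (Z x)) \<in> borel_measurable N"
  unfolding maxwellian_def case_prod_beta by measurable

lemma integrable_gaussian_euclidean:
  assumes c: "0 < c"
  shows "integrable lborel (\<lambda>x::'b::euclidean_space. exp (- c * (norm x)\<^sup>2))"
proof (rule integrableI_bounded)
  show "(\<integral>\<^sup>+(x::'b). ennreal (norm (exp (- c * (norm x)\<^sup>2))) \<partial>lborel) < \<infinity>"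
    using nn_integral_gaussian_euclidean[OF c, where 'a='b] by simp
qed measurable

lemma
  fixes \<alpha> \<beta> :: real
  assumes \<alpha>: "0 < \<alpha>" and \<beta>: "0 < \<beta>"
  shows integrable_maxwellian: "integrable lborel (maxwellian \<alpha> \<beta> :: 'a::euclidean_space \<times> 'a \<Rightarrow> real)"
    and integrable_maxwellian_norm: "integrable lborel (\<lambda>z::'a \<times> 'a. maxwellian \<alpha> \<beta> z * norm (snd z))"
proof -
  define c where "c = min \<alpha> \<beta>"
  have c: "0 < c" "c / 2 > 0" using \<alpha> \<beta> by (auto simp: c_def)
  have M: "maxwellian \<alpha> \<beta> z \<le> exp (- c * (norm z)\<^sup>2)" for z :: "'a \<times> 'a"
  proof -
    obtain x v where z: "z = (x, v)" by (cases z)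
    have "c * (norm x)\<^sup>2 \<le> \<alpha> * (norm x)\<^sup>2" "c * (norm v)\<^sup>2 \<le> \<beta> * (norm v)\<^sup>2"
      by (intro mult_right_mono; simp add: c_def)+
    then show ?thesis by (simp add: z maxwellian_def norm_Pair algebra_simps)
  qed
  show "integrable lborel (maxwellian \<alpha> \<beta> :: 'a \<times> 'a \<Rightarrow> real)"
  proof (rule Bochner_Integration.integrable_bound[OF integrable_gaussian_euclidean[OF c(1)]])
    have "norm (maxwellian \<alpha> \<beta> z) \<le> norm (exp (- c * (norm z)\<^sup>2))" for z :: "'a \<times> 'a"
      using M[of z] maxwellian_pos[of \<alpha> \<beta> z] by simp
    then show "AE (z::'a \<times> 'a) in lborel. norm (maxwellian \<alpha> \<beta> z) \<le> norm (exp (- c * (norm z)\<^sup>2))" by (rule AE_I2)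
  qed measurable
  show "integrable lborel (\<lambda>z::'a \<times> 'a. maxwellian \<alpha> \<beta> z * norm (snd z))"
  proof (rule Bochner_Integration.integrable_bound)
    show "integrable lborel (\<lambda>z::'a \<times> 'a. 1 / (2 * sqrt (c / 2)) * exp (- (c / 2) * (norm z)\<^sup>2))"
      by (intro integrable_mult_right integrable_gaussian_euclidean c)
    have "maxwellian \<alpha> \<beta> z * norm (snd z) \<le> 1 / (2 * sqrt (c / 2)) * exp (- (c / 2) * (norm z)\<^sup>2)" for z :: "'a \<times> 'a"
    proof -
      have "norm (snd z) \<le> norm z" by (cases z) (simp add: norm_Pair)
      then have "maxwellian \<alpha> \<beta> z * norm (snd z) \<le> exp (- c * (norm z)\<^sup>2) * norm z"
        using M by (intro mult_mono) (auto simp: maxwellian_pos less_imp_le)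
      also have "\<dots> = norm z * exp (- (c / 2) * (norm z)\<^sup>2) * exp (- (c / 2) * (norm z)\<^sup>2)"
        by (simp add: exp_add[symmetric])
      also have "\<dots> \<le> 1 / (2 * sqrt (c / 2)) * exp (- (c / 2) * (norm z)\<^sup>2)"
        by (intro mult_right_mono linear_times_gaussian_le c) auto
      finally show ?thesis .
    qed
    then show "AE (z::'a \<times> 'a) in lborel. norm (maxwellian \<alpha> \<beta> z * norm (snd z)) \<le> norm (1 / (2 * sqrt (c / 2)) * exp (- (c / 2) * (norm z)\<^sup>2))"
      using c by (simp add: abs_mult maxwellian_pos less_imp_le)
  qed measurable
qed

context collision_kernels
begin

lemma exponents: "1 - real DIM('a) < gam2 K" "gam2 K \<le> 1" "1 - real DIM('a \<times> 'a) < gam3 K" "gam3 K \<le> 1"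
  using adm by (auto simp: admissible_def)

text \<open>The functions of the iteration lie in the range of the clipping almost everywhere. The operators clip
  their arguments, so that the bounds on them hold for all arguments and at every point.\<close>

definition clip :: "('a \<times> 'a \<Rightarrow> real) \<Rightarrow> 'a \<times> 'a \<Rightarrow> real"
  where "clip f z = max 0 (min (f z) (k * maxwellian \<alpha> \<beta> z))"

text \<open>The argument is given along the free flow and converted to laboratory coordinates at time \<open>t\<close>.\<close>

definition lab :: "real \<Rightarrow> ('a \<times> 'a \<Rightarrow> real) \<Rightarrow> 'a \<times> 'a \<Rightarrow> ennreal"
  where "lab t f z = ennreal (clip f (fst z - t *\<^sub>R snd z, snd z))"

definition shear :: "real \<Rightarrow> 'a \<times> 'a \<Rightarrow> 'a \<times> 'a" where "shear t z = (fst z + t *\<^sub>R snd z, snd z)"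

definition gain_sharp :: "('a \<times> 'a \<Rightarrow> real) \<Rightarrow> real \<Rightarrow> 'a \<times> 'a \<Rightarrow> real"
  where "gain_sharp f t z = enn2real (gain2 K (lab t f) (shear t z) + gain3 K (lab t f) (shear t z))"

definition rate_sharp :: "('a \<times> 'a \<Rightarrow> real) \<Rightarrow> real \<Rightarrow> 'a \<times> 'a \<Rightarrow> real"
  where "rate_sharp f t z = enn2real (rate2 K (lab t f) (shear t z) + rate3 K (lab t f) (shear t z))"

definition freq :: "real \<Rightarrow> 'a \<times> 'a \<Rightarrow> ennreal" where "freq t z = F2 t z + F3 t z"
definition freq_real :: "real \<Rightarrow> 'a \<times> 'a \<Rightarrow> real" where "freq_real t z = enn2real (freq t z)"

definition freq_bound :: "'a \<times> 'a \<Rightarrow> real"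
  where "freq_bound z =
    k * A2 * (2 * (norm (snd z) + 1 / (2 * sqrt (\<beta> / 2))) * singular_const TYPE('a) (gam2 K - 1) (\<beta> / 2)) +
    k\<^sup>2 * A3 * (2 * (norm (snd z, snd z) + 1 / (2 * sqrt (\<beta> / 2))) * singular_const TYPE('a \<times> 'a) (gam3 K - 1) (\<beta> / 2))"

lemma singular_const_nonneg:
  assumes "- real DIM('b::euclidean_space) < p" "0 < c"
  shows "0 \<le> singular_const TYPE('b) p c"
  unfolding singular_const_def using assms by (intro add_nonneg_nonneg divide_nonneg_pos) auto

lemma freq_le: "freq t z \<le> ennreal (freq_bound z)"
proof -
  obtain x v where z: "z = (x, v)" by (cases z)
  let ?q = "1 / (2 * sqrt (\<beta> / 2))"
  have s: "0 \<le> singular_const TYPE('a) (gam2 K - 1) (\<beta> / 2)" "0 \<le> singular_const TYPE('a \<times> 'a) (gam3 K - 1) (\<beta> / 2)"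
    using exponents \<beta>_pos by (auto intro!: singular_const_nonneg)
  have q: "0 \<le> ?q" using \<beta>_pos by simp
  have "F2 t z \<le> ennreal (k * A2) * ennreal (2 * (norm v + ?q) * singular_const TYPE('a) (gam2 K - 1) (\<beta> / 2))"
    unfolding F2_def z split
    by (intro mult_left_mono coll_freq_le exponents \<alpha>_pos \<beta>_pos) auto
  also have "\<dots> = ennreal (k * A2 * (2 * (norm v + ?q) * singular_const TYPE('a) (gam2 K - 1) (\<beta> / 2)))"
    using k_pos A2_nonneg by (simp add: ennreal_mult')
  finally have 2: "F2 t z \<le> \<dots>" .
  have "F3 t z \<le> ennreal (k\<^sup>2 * A3) * ennreal (2 * (norm (v, v) + ?q) * singular_const TYPE('a \<times> 'a) (gam3 K - 1) (\<beta> / 2))"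
    unfolding F3_def z split
    by (intro mult_left_mono coll_freq_le exponents \<alpha>_pos \<beta>_pos norm_le_tnorm tnorm_le) auto
  also have "\<dots> = ennreal (k\<^sup>2 * A3 * (2 * (norm (v, v) + ?q) * singular_const TYPE('a \<times> 'a) (gam3 K - 1) (\<beta> / 2)))"
    using k_pos A3_nonneg by (simp add: ennreal_mult')
  finally have 3: "F3 t z \<le> \<dots>" .
  show ?thesis
    unfolding freq_def freq_bound_def z snd_conv
    using add_mono[OF 2 3] s q k_pos A2_nonneg A3_nonneg
    by (subst ennreal_plus) (auto simp: z intro!: mult_nonneg_nonneg add_nonneg_nonneg)
qed

lemma freq_finite: "freq t z < top"
  using freq_le[of t z] by (simp add: le_less_trans)

lemma ennreal_freq_real: "ennreal (freq_real t z) = freq t z"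
  unfolding freq_real_def using freq_finite[of t z] by simp

lemma freq_bound_nonneg: "0 \<le> freq_bound z"
proof -
  have "0 \<le> singular_const TYPE('a) (gam2 K - 1) (\<beta> / 2)" "0 \<le> singular_const TYPE('a \<times> 'a) (gam3 K - 1) (\<beta> / 2)"
    using exponents \<beta>_pos by (auto intro!: singular_const_nonneg)
  then show ?thesis unfolding freq_bound_def using k_pos A2_nonneg A3_nonneg \<beta>_pos
    by (intro add_nonneg_nonneg mult_nonneg_nonneg) auto
qed

lemma freq_real_le: "freq_real t z \<le> freq_bound z"
  using freq_le[of t z] freq_bound_nonneg[of z] unfolding ennreal_freq_real[symmetric] by simp

lemma freq_measurable [measurable (raw)]:
  assumes [measurable]: "T \<in> borel_measurable N" "Z \<in> N \<rightarrow>\<^sub>M borel"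
  shows "(\<lambda>x. freq (T x) (Z x)) \<in> borel_measurable N"
  unfolding freq_def F2_def F3_def coll_freq_def case_prod_beta by measurable

text \<open>The smallness condition makes this bound at most \<open>1 / 12\<close>.\<close>

lemma nn_integral_freq: "(\<integral>\<^sup>+t. freq t z \<partial>lborel) \<le>
  ennreal (k * A2 * (2 * sqrt (pi / \<alpha>) * singular_const TYPE('a) (gam2 K - 1) \<beta>) +
    k\<^sup>2 * A3 * (2 * sqrt (pi / \<alpha>) * singular_const TYPE('a \<times> 'a) (gam3 K - 1) \<beta>))"
proof -
  obtain x v where z: "z = (x, v)" by (cases z)
  have m: "(\<lambda>t. coll_freq norm (gam2 K) \<alpha> \<beta> t x v) \<in> borel_measurable lborel"
    "(\<lambda>t. coll_freq tnorm (gam3 K) \<alpha> \<beta> t (x, x) (v, v)) \<in> borel_measurable lborel"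
    unfolding coll_freq_def by measurable
  have s: "0 \<le> singular_const TYPE('a) (gam2 K - 1) \<beta>" "0 \<le> singular_const TYPE('a \<times> 'a) (gam3 K - 1) \<beta>"
    using exponents \<beta>_pos by (auto intro!: singular_const_nonneg)
  have "(\<integral>\<^sup>+t. freq t z \<partial>lborel) = ennreal (k * A2) * (\<integral>\<^sup>+t. coll_freq norm (gam2 K) \<alpha> \<beta> t x v \<partial>lborel) +
    ennreal (k\<^sup>2 * A3) * (\<integral>\<^sup>+t. coll_freq tnorm (gam3 K) \<alpha> \<beta> t (x, x) (v, v) \<partial>lborel)"
    unfolding freq_def F2_def F3_def z split using m by (simp add: nn_integral_add nn_integral_cmult)
  also have "\<dots> \<le> ennreal (k * A2) * ennreal (2 * sqrt (pi / \<alpha>) * singular_const TYPE('a) (gam2 K - 1) \<beta>) +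
    ennreal (k\<^sup>2 * A3) * ennreal (2 * sqrt (pi / \<alpha>) * singular_const TYPE('a \<times> 'a) (gam3 K - 1) \<beta>)"
    by (intro add_mono mult_left_mono nn_integral_coll_freq exponents \<alpha>_pos \<beta>_pos norm_le_tnorm tnorm_le) auto
  also have "\<dots> = ennreal (k * A2 * (2 * sqrt (pi / \<alpha>) * singular_const TYPE('a) (gam2 K - 1) \<beta>)) +
    ennreal (k\<^sup>2 * A3 * (2 * sqrt (pi / \<alpha>) * singular_const TYPE('a \<times> 'a) (gam3 K - 1) \<beta>))"
    using k_pos A2_nonneg A3_nonneg by (simp add: ennreal_mult')
  also have "\<dots> = ennreal (k * A2 * (2 * sqrt (pi / \<alpha>) * singular_const TYPE('a) (gam2 K - 1) \<beta>) +
    k\<^sup>2 * A3 * (2 * sqrt (pi / \<alpha>) * singular_const TYPE('a \<times> 'a) (gam3 K - 1) \<beta>))"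
    using k_pos A2_nonneg A3_nonneg s \<alpha>_pos by (intro ennreal_plus[symmetric]) auto
  finally show ?thesis .
qed

lemma lab_le_W: "lab t f z \<le> W t z"
  unfolding lab_def W_def clip_def shifted_maxwellian_def case_prod_beta
  using k_pos maxwellian_pos[of \<alpha> \<beta> "(fst z - t *\<^sub>R snd z, snd z)"] by (intro ennreal_leI) auto

lemma lab_measurable [measurable (raw)]:
  fixes f :: "'c \<Rightarrow> 'a \<times> 'a \<Rightarrow> real"
  assumes [measurable]: "case_prod f \<in> borel_measurable (N \<Otimes>\<^sub>M borel)" "T \<in> borel_measurable N" "Z \<in> N \<rightarrow>\<^sub>M borel"
  shows "(\<lambda>y. lab (T y) (f y) (Z y)) \<in> borel_measurable N"
  unfolding lab_def clip_def by measurable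

lemma gain_le: "gain2 K (lab t f) (shear t z) + gain3 K (lab t f) (shear t z) \<le> ennreal (k * maxwellian \<alpha> \<beta> z) * freq t z"
proof -
  have "gain2 K (lab t f) (shear t z) \<le> gain2 K (W t) (shear t z)" "gain3 K (lab t f) (shear t z) \<le> gain3 K (W t) (shear t z)"
    by (intro collision_operators_mono lab_le_W)+
  moreover have "gain2 K (W t) (shear t z) \<le> ennreal (k * maxwellian \<alpha> \<beta> z) * F2 t z"
    "gain3 K (W t) (shear t z) \<le> ennreal (k * maxwellian \<alpha> \<beta> z) * F3 t z"
    using gain2_W[of t "fst z" "snd z"] gain3_W[of t "fst z" "snd z"] by (simp_all add: shear_def)
  ultimately show ?thesis unfolding freq_def distrib_left by (meson add_mono order_trans)
qed

lemma rate_le: "rate2 K (lab t f) (shear t z) + rate3 K (lab t f) (shear t z) \<le> freq t z"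
proof -
  have "rate2 K (lab t f) (shear t z) \<le> rate2 K (W t) (shear t z)" "rate3 K (lab t f) (shear t z) \<le> rate3 K (W t) (shear t z)"
    by (intro collision_operators_mono lab_le_W)+
  moreover have "rate2 K (W t) (shear t z) \<le> F2 t z" "rate3 K (W t) (shear t z) \<le> F3 t z"
    using rate2_W[of t "fst z" "snd z"] rate3_W[of t "fst z" "snd z"] by (simp_all add: shear_def)
  ultimately show ?thesis unfolding freq_def by (meson add_mono order_trans)
qed

lemma gain_finite: "gain2 K (lab t f) (shear t z) + gain3 K (lab t f) (shear t z) < top"
  by (rule le_less_trans[OF gain_le]) (use freq_finite[of t z] in \<open>simp add: ennreal_mult_less_top\<close>)

lemma rate_finite: "rate2 K (lab t f) (shear t z) + rate3 K (lab t f) (shear t z) < top"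
  using rate_le[of t f z] freq_finite[of t z] by (rule le_less_trans)

lemma ennreal_gain_sharp: "ennreal (gain_sharp f t z) = gain2 K (lab t f) (shear t z) + gain3 K (lab t f) (shear t z)"
  unfolding gain_sharp_def using gain_finite[of t f z] by simp

lemma ennreal_rate_sharp: "ennreal (rate_sharp f t z) = rate2 K (lab t f) (shear t z) + rate3 K (lab t f) (shear t z)"
  unfolding rate_sharp_def using rate_finite[of t f z] by simp

text \<open>The estimate of \<open>collision_perturb\<close>, with the two operators combined by the larger of their factors,
  moved to the free flow and back; the shear preserves null sets.\<close>

lemma sharp_perturb:
  assumes [measurable]: "f \<in> borel_measurable borel" "g \<in> borel_measurable borel" and \<epsilon>: "0 \<le> \<epsilon>"
    and fg: "AE z in lborel. f z \<le> g z + \<epsilon> * (k * maxwellian \<alpha> \<beta> z)"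
  shows "AE z in lborel. gain_sharp f t z \<le> gain_sharp g t z + 3 * \<epsilon> * (k * maxwellian \<alpha> \<beta> z) * freq_real t z \<and>
    rate_sharp f t z \<le> rate_sharp g t z + 2 * \<epsilon> * freq_real t z"
proof -
  have "AE z in lborel. clip f z \<le> clip g z + \<epsilon> * (k * maxwellian \<alpha> \<beta> z)"
    using fg
  proof eventually_elim
    case (elim z)
    have "0 \<le> \<epsilon> * (k * maxwellian \<alpha> \<beta> z)" using \<epsilon> k_pos maxwellian_pos[of \<alpha> \<beta> z] by simp
    then show ?case using elim by (auto simp: clip_def)
  qed
  from AE_shear[OF this, of "- t"]
  have lab: "AE z in lborel. lab t f z \<le> lab t g z + ennreal \<epsilon> * W t z"
  proof eventually_elim
    case (elim z)
    have nn: "0 \<le> clip g (fst z - t *\<^sub>R snd z, snd z)" "0 \<le> k * shifted_maxwellian \<alpha> \<beta> t z"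
      using k_pos shifted_maxwellian_pos[of t z] by (auto simp: clip_def)
    have "lab t f z \<le> ennreal (clip g (fst z - t *\<^sub>R snd z, snd z) + \<epsilon> * (k * shifted_maxwellian \<alpha> \<beta> t z))"
      using elim by (cases z) (simp add: lab_def shifted_maxwellian_def ennreal_leI)
    also have "\<dots> = lab t g z + ennreal \<epsilon> * W t z"
      using nn \<epsilon> by (simp add: lab_def W_def ennreal_mult)
    finally show ?case .
  qed
  have labm: "lab t f \<in> borel_measurable borel" "lab t g \<in> borel_measurable borel" by measurable
  note P = collision_perturb[OF labm lab_le_W lab_le_W lab]
  have "AE z in lborel. gain2 K (lab t f) z + gain3 K (lab t f) z \<le> gain2 K (lab t g) z + gain3 K (lab t g) z +
      3 * ennreal \<epsilon> * (gain2 K (W t) z + gain3 K (W t) z) \<and>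
    rate2 K (lab t f) z + rate3 K (lab t f) z \<le> rate2 K (lab t g) z + rate3 K (lab t g) z +
      2 * ennreal \<epsilon> * (rate2 K (W t) z + rate3 K (W t) z)"
    using P
  proof eventually_elim
    case (elim z)
    have "gain2 K (lab t f) z + gain3 K (lab t f) z \<le>
      (gain2 K (lab t g) z + 2 * ennreal \<epsilon> * gain2 K (W t) z) + (gain3 K (lab t g) z + 3 * ennreal \<epsilon> * gain3 K (W t) z)"
      using elim by (intro add_mono) auto
    also have "\<dots> \<le> (gain2 K (lab t g) z + 3 * ennreal \<epsilon> * gain2 K (W t) z) + (gain3 K (lab t g) z + 3 * ennreal \<epsilon> * gain3 K (W t) z)"
      by (intro add_mono mult_right_mono order_refl) auto
    finally have 1: "gain2 K (lab t f) z + gain3 K (lab t f) z \<le> \<dots>" .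
    have "rate2 K (lab t f) z + rate3 K (lab t f) z \<le>
      (rate2 K (lab t g) z + 1 * ennreal \<epsilon> * rate2 K (W t) z) + (rate3 K (lab t g) z + 2 * ennreal \<epsilon> * rate3 K (W t) z)"
      using elim by (intro add_mono) auto
    also have "\<dots> \<le> (rate2 K (lab t g) z + 2 * ennreal \<epsilon> * rate2 K (W t) z) + (rate3 K (lab t g) z + 2 * ennreal \<epsilon> * rate3 K (W t) z)"
      by (intro add_mono mult_right_mono order_refl) auto
    finally have 2: "rate2 K (lab t f) z + rate3 K (lab t f) z \<le> \<dots>" .
    show ?case using 1 2 by (simp add: distrib_left add_ac)
  qed
  from AE_shear[OF this, of t] show ?thesis
  proof eventually_elim
    case (elim z)
    have sh: "(case z of (x, v) \<Rightarrow> (x + t *\<^sub>R v, v)) = shear t z" by (cases z) (simp add: shear_def)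
    have G: "gain2 K (lab t f) (shear t z) + gain3 K (lab t f) (shear t z) \<le> gain2 K (lab t g) (shear t z) + gain3 K (lab t g) (shear t z) +
        3 * ennreal \<epsilon> * (gain2 K (W t) (shear t z) + gain3 K (W t) (shear t z))"
      and R: "rate2 K (lab t f) (shear t z) + rate3 K (lab t f) (shear t z) \<le> rate2 K (lab t g) (shear t z) + rate3 K (lab t g) (shear t z) +
        2 * ennreal \<epsilon> * (rate2 K (W t) (shear t z) + rate3 K (W t) (shear t z))"
      using elim by (cases z; simp add: shear_def)+
    have nn: "0 \<le> k * maxwellian \<alpha> \<beta> z" "0 \<le> freq_real t z" "0 \<le> gain_sharp g t z" "0 \<le> rate_sharp g t z"
      using k_pos maxwellian_pos[of \<alpha> \<beta> z] by (simp_all add: freq_real_def gain_sharp_def rate_sharp_def)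
    have "gain2 K (W t) (shear t z) + gain3 K (W t) (shear t z) \<le> ennreal (k * maxwellian \<alpha> \<beta> z) * ennreal (freq_real t z)"
      using gain2_W[of t "fst z" "snd z"] gain3_W[of t "fst z" "snd z"]
      by (simp add: shear_def ennreal_freq_real freq_def distrib_left add_mono)
    then have "ennreal (gain_sharp f t z) \<le> ennreal (gain_sharp g t z) + 3 * ennreal \<epsilon> * (ennreal (k * maxwellian \<alpha> \<beta> z) * ennreal (freq_real t z))"
      unfolding ennreal_gain_sharp by (intro order_trans[OF G] add_left_mono mult_left_mono) auto
    also have "\<dots> = ennreal (gain_sharp g t z + 3 * \<epsilon> * (k * maxwellian \<alpha> \<beta> z) * freq_real t z)"
    proof -
      have "ennreal a + 3 * ennreal e * (ennreal m * ennreal p) = ennreal (a + 3 * e * m * p)"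
        if "0 \<le> a" "0 \<le> e" "0 \<le> m" "0 \<le> p" for a e m p :: real
        using that by (simp add: ennreal_mult mult.assoc)
      then show ?thesis using nn \<epsilon> by blast
    qed
    finally have 1: "gain_sharp f t z \<le> gain_sharp g t z + 3 * \<epsilon> * (k * maxwellian \<alpha> \<beta> z) * freq_real t z"
      using nn \<epsilon> by (subst (asm) ennreal_le_iff) (auto intro!: add_nonneg_nonneg mult_nonneg_nonneg)
    have "rate2 K (W t) (shear t z) + rate3 K (W t) (shear t z) \<le> ennreal (freq_real t z)"
      using rate2_W[of t "fst z" "snd z"] rate3_W[of t "fst z" "snd z"]
      by (simp add: shear_def ennreal_freq_real freq_def add_mono)
    then have "ennreal (rate_sharp f t z) \<le> ennreal (rate_sharp g t z) + 2 * ennreal \<epsilon> * ennreal (freq_real t z)"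
      unfolding ennreal_rate_sharp by (intro order_trans[OF R] add_left_mono mult_left_mono) auto
    also have "\<dots> = ennreal (rate_sharp g t z + 2 * \<epsilon> * freq_real t z)"
      using nn \<epsilon> by (simp add: ennreal_mult mult.assoc)
    finally have 2: "rate_sharp f t z \<le> rate_sharp g t z + 2 * \<epsilon> * freq_real t z"
      using nn \<epsilon> by (subst (asm) ennreal_le_iff) (auto intro!: add_nonneg_nonneg mult_nonneg_nonneg)
    show ?case using 1 2 by simp
  qed
qed

end

locale small_collisions = collision_kernels K TA k \<alpha> \<beta>
  for K :: kernels and TA :: "'a::euclidean_space itself" and k \<alpha> \<beta> +
  assumes small: "k * A2 * (2 * sqrt (pi / \<alpha>) * singular_const TYPE('a) (gam2 K - 1) \<beta>) +
    k\<^sup>2 * A3 * (2 * sqrt (pi / \<alpha>) * singular_const TYPE('a \<times> 'a) (gam3 K - 1) \<beta>) \<le> 1 / 12"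

sublocale small_collisions \<subseteq> ks: kaniel_shinbrot "maxwellian \<alpha> \<beta> :: 'a \<times> 'a \<Rightarrow> real" k freq_real freq_bound gain_sharp rate_sharp
proof
  show "0 < k" by (rule k_pos)
  show "0 < maxwellian \<alpha> \<beta> z" for z :: "'a \<times> 'a" by (rule maxwellian_pos)
  show Mi: "integrable lborel (maxwellian \<alpha> \<beta> :: 'a \<times> 'a \<Rightarrow> real)" by (rule integrable_maxwellian[OF \<alpha>_pos \<beta>_pos])
  show "freq_bound \<in> borel_measurable borel" unfolding freq_bound_def[abs_def] by measurable
  have n2: "norm (v, v) = sqrt 2 * norm v" for v :: 'a
    by (simp add: norm_Pair real_sqrt_mult flip: mult_2)
  show "integrable lborel (\<lambda>z. maxwellian \<alpha> \<beta> z * freq_bound z)"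
  proof -
    define s2 where "s2 = singular_const TYPE('a) (gam2 K - 1) (\<beta> / 2)"
    define s3 where "s3 = singular_const TYPE('a \<times> 'a) (gam3 K - 1) (\<beta> / 2)"
    define q where "q = 1 / (2 * sqrt (\<beta> / 2))"
    have "(\<lambda>z. maxwellian \<alpha> \<beta> z * freq_bound z) =
      (\<lambda>z. (k * A2 * 2 * q * s2 + k\<^sup>2 * A3 * 2 * q * s3) * maxwellian \<alpha> \<beta> z +
        (k * A2 * 2 * s2 + k\<^sup>2 * A3 * 2 * sqrt 2 * s3) * (maxwellian \<alpha> \<beta> z * norm (snd z)))"
      unfolding freq_bound_def n2 s2_def[symmetric] s3_def[symmetric] q_def[symmetric] by (simp add: algebra_simps)
    then show ?thesis
      using Mi integrable_maxwellian_norm[OF \<alpha>_pos \<beta>_pos, where 'a='a] by simp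
  qed
  show "case_prod freq_real \<in> borel_measurable (borel \<Otimes>\<^sub>M borel)"
    unfolding freq_real_def[abs_def] by measurable
  show "0 \<le> freq_real t z" for t z by (simp add: freq_real_def)
  show "freq_real t z \<le> freq_bound z" for t z by (rule freq_real_le)
  show "(\<integral>\<^sup>+s. ennreal (freq_real s z) * indicator {0..} s \<partial>lborel) \<le> ennreal (1 / 12)" for z
  proof -
    have "(\<integral>\<^sup>+s. ennreal (freq_real s z) * indicator {0..} s \<partial>lborel) \<le> (\<integral>\<^sup>+s. freq s z \<partial>lborel)"
      by (intro nn_integral_mono) (auto simp: indicator_def ennreal_freq_real)
    also have "\<dots> \<le> ennreal (1 / 12)" by (rule order_trans[OF nn_integral_freq ennreal_leI[OF small]])
    finally show ?thesis .
  qed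
  show "(\<lambda>(t, z). gain_sharp (a t) t z) \<in> borel_measurable (borel \<Otimes>\<^sub>M borel)"
    if [measurable]: "case_prod a \<in> borel_measurable (borel \<Otimes>\<^sub>M borel)" for a
    unfolding gain_sharp_def[abs_def] shear_def by measurable
  show "(\<lambda>(t, z). rate_sharp (a t) t z) \<in> borel_measurable (borel \<Otimes>\<^sub>M borel)"
    if [measurable]: "case_prod a \<in> borel_measurable (borel \<Otimes>\<^sub>M borel)" for a
    unfolding rate_sharp_def[abs_def] shear_def by measurable
  show "0 \<le> gain_sharp f t z" "0 \<le> rate_sharp f t z" for f t z by (simp_all add: gain_sharp_def rate_sharp_def)
  show "gain_sharp f t z \<le> k * maxwellian \<alpha> \<beta> z * freq_real t z" for f t z
  proof -
    have nn: "0 \<le> k * maxwellian \<alpha> \<beta> z" "0 \<le> freq_real t z" using k_pos maxwellian_pos[of \<alpha> \<beta> z] by (simp_all add: freq_real_def)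
    have "ennreal (gain_sharp f t z) \<le> ennreal (k * maxwellian \<alpha> \<beta> z * freq_real t z)"
      unfolding ennreal_gain_sharp using gain_le[of t f z] nn by (simp add: ennreal_mult ennreal_freq_real)
    then show ?thesis using nn by simp
  qed
  show "rate_sharp f t z \<le> freq_real t z" for f t z
  proof -
    have "ennreal (rate_sharp f t z) \<le> ennreal (freq_real t z)"
      unfolding ennreal_rate_sharp ennreal_freq_real by (rule rate_le)
    then show ?thesis by (simp add: freq_real_def)
  qed
  fix f g :: "'a \<times> 'a \<Rightarrow> real" and t :: real
  assume fg: "f \<in> borel_measurable borel" "g \<in> borel_measurable borel"
  show "AE z in lborel. gain_sharp f t z \<le> gain_sharp g t z" "AE z in lborel. rate_sharp f t z \<le> rate_sharp g t z"
    if "AE z in lborel. f z \<le> g z"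
    using sharp_perturb[OF fg, of 0 t] that by (auto elim!: eventually_mono)
  fix \<epsilon> :: real assume \<epsilon>: "0 \<le> \<epsilon>" and d: "AE z in lborel. \<bar>f z - g z\<bar> \<le> \<epsilon> * (k * maxwellian \<alpha> \<beta> z)"
  have 1: "AE z in lborel. f z \<le> g z + \<epsilon> * (k * maxwellian \<alpha> \<beta> z)" and 2: "AE z in lborel. g z \<le> f z + \<epsilon> * (k * maxwellian \<alpha> \<beta> z)"
    using d by (eventually_elim, simp add: abs_le_iff)+
  from sharp_perturb[OF fg \<epsilon> 1, of t] sharp_perturb[OF fg(2,1) \<epsilon> 2, of t]
  show "AE z in lborel. \<bar>gain_sharp f t z - gain_sharp g t z\<bar> \<le> 3 * \<epsilon> * (k * maxwellian \<alpha> \<beta> z) * freq_real t z"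
    by eventually_elim (simp add: abs_le_iff)
  from sharp_perturb[OF fg \<epsilon> 1, of t] sharp_perturb[OF fg(2,1) \<epsilon> 2, of t]
  show "AE z in lborel. \<bar>rate_sharp f t z - rate_sharp g t z\<bar> \<le> 2 * \<epsilon> * freq_real t z"
    by eventually_elim (simp add: abs_le_iff)
qed

section \<open>From the collision operators to their nonnegative forms\<close>

lemma ereal_integral_cong_AE: "AE x in N. f x = g x \<Longrightarrow> ereal_integral N f = ereal_integral N g"
  unfolding ereal_integral_def
  by (intro arg_cong2[where f="(-)"] arg_cong[where f=enn2ereal] nn_integral_cong_AE) (auto elim: eventually_mono)

lemma ereal_integral_enn2ereal: "ereal_integral N (\<lambda>x. enn2ereal (g x)) = enn2ereal (\<integral>\<^sup>+x. g x \<partial>N)"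
  by (simp add: ereal_integral_def e2ennreal_neg zero_ennreal.rep_eq)

lemma ereal_integral_measurable [measurable (raw)]:
  assumes "sigma_finite_measure N" and [measurable]: "case_prod f \<in> borel_measurable (L \<Otimes>\<^sub>M N)"
  shows "(\<lambda>y. ereal_integral N (f y)) \<in> borel_measurable L"
proof -
  interpret sigma_finite_measure N by fact
  show ?thesis unfolding ereal_integral_def by measurable
qed

lemma F_pos_e2ennreal:
  assumes "f \<in> F_pos"
  shows "AE z in lborel. f z = enn2ereal (e2ennreal (f z))"
  using assms by (auto simp: F_pos_def enn2ereal_e2ennreal elim!: eventually_mono)

lemma L1_space_AE_finite:
  assumes "f \<in> L1_space"
  shows "AE z in lborel. f z = ereal (real_of_ereal (f z))" and "integrable lborel (\<lambda>z. real_of_ereal (f z))"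
proof -
  have [measurable]: "f \<in> borel_measurable borel" and fin: "(\<integral>\<^sup>+z. e2ennreal \<bar>f z\<bar> \<partial>lborel) < \<infinity>"
    using assms by (auto simp: L1_space_def F_space_def)
  have "AE z in lborel. e2ennreal \<bar>f z\<bar> \<noteq> \<infinity>"
    using fin by (intro nn_integral_noteq_infinite) auto
  then show "AE z in lborel. f z = ereal (real_of_ereal (f z))"
  proof eventually_elim
    case (elim z)
    then show ?case by (cases "f z") auto
  qed
  show "integrable lborel (\<lambda>z. real_of_ereal (f z))"
  proof (rule integrableI_bounded)
    have "(\<integral>\<^sup>+z. ennreal (norm (real_of_ereal (f z))) \<partial>lborel) \<le> (\<integral>\<^sup>+z. e2ennreal \<bar>f z\<bar> \<partial>lborel)"
    proof (rule nn_integral_mono)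
      fix z show "ennreal (norm (real_of_ereal (f z))) \<le> e2ennreal \<bar>f z\<bar>"
        by (cases "f z") (auto simp: ennreal.abs_eq[symmetric] e2ennreal_ereal)
    qed
    then show "(\<integral>\<^sup>+z. ennreal (norm (real_of_ereal (f z))) \<partial>lborel) < \<infinity>" using fin by (rule le_less_trans)
  qed measurable
qed

lemma L1_space_I:
  assumes [measurable]: "f \<in> borel_measurable borel" and eq: "AE z in lborel. f z = ereal (y z)" and y: "integrable lborel y"
  shows "f \<in> L1_space" and "to_L1 f = L1_class y"
proof -
  have [measurable]: "y \<in> borel_measurable borel" using y by auto
  have "(\<integral>\<^sup>+z. e2ennreal \<bar>f z\<bar> \<partial>lborel) = (\<integral>\<^sup>+z. ennreal (norm (y z)) \<partial>lborel)"
    using eq by (intro nn_integral_cong_AE, eventually_elim) (simp add: e2ennreal_ereal)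
  also have "\<dots> < \<infinity>" using y by (simp add: integrable_iff_bounded)
  finally show "f \<in> L1_space" by (simp add: L1_space_def F_space_def)
  show "to_L1 f = L1_class y"
    unfolding to_L1_def using eq by (intro L1_class_cong_AE) (auto elim!: eventually_mono)
qed

lemma norm_M_le_iff:
  assumes f: "f \<in> F_space"
  shows "norm_M \<alpha> \<beta> f \<le> ereal c \<longleftrightarrow> (AE z in lborel. \<bar>f z\<bar> \<le> ereal (c * maxwellian \<alpha> \<beta> z))"
proof -
  have [measurable]: "f \<in> borel_measurable borel" using f by (simp add: F_space_def)
  have m: "(\<lambda>z. \<bar>f z\<bar> / ereal (maxwellian \<alpha> \<beta> z)) \<in> borel_measurable lborel" by measurable
  have iff: "\<bar>x\<bar> / ereal (maxwellian \<alpha> \<beta> z) \<le> ereal c \<longleftrightarrow> \<bar>x\<bar> \<le> ereal (c * maxwellian \<alpha> \<beta> z)" for x :: ereal and z :: "'a \<times> 'a"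
    using maxwellian_pos[of \<alpha> \<beta> z] by (cases x) (auto simp: pos_divide_le_eq)
  show ?thesis
  proof
    assume le: "norm_M \<alpha> \<beta> f \<le> ereal c"
    have "AE z in lborel. \<bar>f z\<bar> / ereal (maxwellian \<alpha> \<beta> z) \<le> norm_M \<alpha> \<beta> f"
      unfolding norm_M_def by (rule esssup_AE)
    then show "AE z in lborel. \<bar>f z\<bar> \<le> ereal (c * maxwellian \<alpha> \<beta> z)"
      by eventually_elim (use le iff order_trans in blast)
  next
    assume "AE z in lborel. \<bar>f z\<bar> \<le> ereal (c * maxwellian \<alpha> \<beta> z)"
    then show "norm_M \<alpha> \<beta> f \<le> ereal c"
      unfolding norm_M_def by (intro esssup_I m) (simp add: iff)
  qed
qed

lemma sharp_eq: "sharp f t z = f t (fst z + t *\<^sub>R snd z, snd z)"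
  by (simp add: sharp_def case_prod_beta)

lemma sharp_unsharp: "sharp (unsharp f) = f"
  by (auto simp: sharp_def unsharp_def fun_eq_iff)

lemma sharp_borel:
  assumes [measurable]: "f t \<in> borel_measurable borel"
  shows "sharp f t \<in> borel_measurable borel"
  unfolding sharp_eq by measurable

lemma unsharp_borel:
  assumes [measurable]: "f t \<in> borel_measurable borel"
  shows "unsharp f t \<in> borel_measurable borel"
  unfolding unsharp_def case_prod_beta by measurable

text \<open>The shear and its inverse preserve null sets.\<close>

lemma AE_sharp_iff: "(AE z in lborel. Q (sharp f t z) (sharp g t z)) \<longleftrightarrow> (AE z in lborel. Q (f t z) (g t z))"
proof
  assume "AE z in lborel. Q (f t z) (g t z)"
  from AE_shear[OF this, of t] show "AE z in lborel. Q (sharp f t z) (sharp g t z)"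
    by eventually_elim (auto simp: sharp_def)
next
  assume "AE z in lborel. Q (sharp f t z) (sharp g t z)"
  from AE_shear[OF this, of "- t"] show "AE z in lborel. Q (f t z) (g t z)"
    by eventually_elim (auto simp: sharp_def)
qed

lemma sharp_F_pos: "f t \<in> F_pos \<Longrightarrow> sharp f t \<in> F_pos"
  using AE_sharp_iff[where Q="\<lambda>a b. 0 \<le> a" and f=f and g=f and t=t] sharp_borel[of f t] by (simp add: F_pos_def F_space_def)

context collision_kernels
begin

lemma AE_sphere_pair_split: "AE (\<omega>, w) in sphere_measure \<Otimes>\<^sub>M (lborel :: 'c::euclidean_space measure). norm (\<omega> :: 'b::euclidean_space) = 1"
  using AE_sphere_pair[where 'a='b and 'b='c] by eventually_elim (simp add: case_prod_beta)

lemma G2_kB2: "G2 K f g (x, v :: 'a) = ereal_integral (sphere_measure \<Otimes>\<^sub>M lborel)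
    (\<lambda>(\<omega>, v1). ereal (kB2 K (v1 - v) \<omega>) * f (x, v + (\<omega> \<bullet> (v1 - v)) *\<^sub>R \<omega>) * g (x, v1 - (\<omega> \<bullet> (v1 - v)) *\<^sub>R \<omega>))"
  unfolding G2_def split Let_def
  by (rule ereal_integral_cong_AE, use AE_sphere_pair_split in eventually_elim) (auto simp: kB2_sphere)

lemma L2_kB2: "L2 K f g (x, v :: 'a) = ereal_integral (sphere_measure \<Otimes>\<^sub>M lborel)
    (\<lambda>(\<omega>, v1). ereal (kB2 K (v1 - v) \<omega>) * f (x, v) * g (x, v1))"
  unfolding L2_def split
  by (rule ereal_integral_cong_AE, use AE_sphere_pair_split in eventually_elim) (auto simp: kB2_sphere)

lemma G3_kB3: "G3 K f g h (x, v :: 'a) = ereal_integral (sphere_measure \<Otimes>\<^sub>M lborel)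
    (\<lambda>(\<omega>, V). ereal (kB3 K (V - (v, v)) \<omega>) * f (x, v + cpar \<omega> (V - (v, v)) *\<^sub>R (fst \<omega> + snd \<omega>)) *
      g (x, fst V - cpar \<omega> (V - (v, v)) *\<^sub>R fst \<omega>) * h (x, snd V - cpar \<omega> (V - (v, v)) *\<^sub>R snd \<omega>))"
  unfolding G3_def split Let_def
  by (rule ereal_integral_cong_AE, use AE_sphere_pair_split in eventually_elim) (auto simp: kB3_sphere cpar_def)

lemma L3_kB3: "L3 K f g h (x, v :: 'a) = ereal_integral (sphere_measure \<Otimes>\<^sub>M lborel)
    (\<lambda>(\<omega>, V). ereal (kB3 K (V - (v, v)) \<omega>) * f (x, v) * g (x, fst V) * h (x, snd V))"
  unfolding L3_def split
  by (rule ereal_integral_cong_AE, use AE_sphere_pair_split in eventually_elim) (auto simp: kB3_sphere)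

lemma sigma_finite_sphere_pair: "sigma_finite_measure (sphere_measure \<Otimes>\<^sub>M (lborel :: 'c::euclidean_space measure) :: ('b::euclidean_space \<times> 'c) measure)"
  ..

text \<open>Membership in \<open>F_pos\<close> asks for measurability at every time, irrespective of the bounds.\<close>

lemma gain_borel:
  assumes [measurable]: "f t \<in> borel_measurable borel"
  shows "gain K f f f t \<in> borel_measurable (borel :: ('a \<times> 'a) measure)"
proof -
  have "gain K f f f t = (\<lambda>z. G2 K (f t) (f t) (fst z, snd z) + G3 K (f t) (f t) (f t) (fst z, snd z))"
    by (simp add: gain_def)
  also have "\<dots> \<in> borel_measurable borel"
    unfolding G2_kB2 G3_kB3 case_prod_beta
    by (intro borel_measurable_ereal_add ereal_integral_measurable sigma_finite_sphere_pair) measurable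
  finally show ?thesis .
qed

lemma loss_borel:
  assumes [measurable]: "f t \<in> borel_measurable borel" "g t \<in> borel_measurable borel"
  shows "loss K f g g t \<in> borel_measurable (borel :: ('a \<times> 'a) measure)"
proof -
  have "loss K f g g t = (\<lambda>z. L2 K (f t) (g t) (fst z, snd z) + L3 K (f t) (g t) (g t) (fst z, snd z))"
    by (simp add: loss_def)
  also have "\<dots> \<in> borel_measurable borel"
    unfolding L2_kB2 L3_kB3 case_prod_beta
    by (intro borel_measurable_ereal_add ereal_integral_measurable sigma_finite_sphere_pair) measurable
  finally show ?thesis .
qed

text \<open>The equality of the densities holds almost everywhere, and collisions do not charge null sets.\<close>

lemma gain_nonneg_form:
  assumes f: "AE z in lborel. f t z = enn2ereal (\<Phi> z)"
  shows "AE z in lborel. gain K f f f t (z :: 'a \<times> 'a) = enn2ereal (gain2 K \<Phi> z + gain3 K \<Phi> z)"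
  using AE_binary[OF f] AE_ternary[OF f]
proof eventually_elim
  case (elim z)
  obtain x v where z: "z = (x, v)" by (cases z)
  have "G2 K (f t) (f t) z = ereal_integral (sphere_measure \<Otimes>\<^sub>M lborel) (\<lambda>p. enn2ereal (case p of (\<omega>, v1) \<Rightarrow>
      ennreal (kB2 K (v1 - v) \<omega>) * (\<Phi> (x, v + (\<omega> \<bullet> (v1 - v)) *\<^sub>R \<omega>) * \<Phi> (x, v1 - (\<omega> \<bullet> (v1 - v)) *\<^sub>R \<omega>))))"
    unfolding z G2_kB2
    by (rule ereal_integral_cong_AE, use elim(1) in eventually_elim)
      (auto simp: z times_ennreal.rep_eq kB2_nonneg mult.assoc)
  then have 2: "G2 K (f t) (f t) z = enn2ereal (gain2 K \<Phi> z)"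
    unfolding ereal_integral_enn2ereal by (simp add: gain2_def z)
  have "G3 K (f t) (f t) (f t) z = ereal_integral (sphere_measure \<Otimes>\<^sub>M lborel) (\<lambda>p. enn2ereal (case p of (\<omega>, V) \<Rightarrow>
      ennreal (kB3 K (V - (v, v)) \<omega>) * (\<Phi> (x, v + cpar \<omega> (V - (v, v)) *\<^sub>R (fst \<omega> + snd \<omega>)) *
        \<Phi> (x, fst V - cpar \<omega> (V - (v, v)) *\<^sub>R fst \<omega>) * \<Phi> (x, snd V - cpar \<omega> (V - (v, v)) *\<^sub>R snd \<omega>))))"
    unfolding z G3_kB3
    by (rule ereal_integral_cong_AE, use elim(2) in eventually_elim)
      (auto simp: z times_ennreal.rep_eq kB3_nonneg mult.assoc)
  then have 3: "G3 K (f t) (f t) (f t) z = enn2ereal (gain3 K \<Phi> z)"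
    unfolding ereal_integral_enn2ereal by (simp add: gain3_def z)
  show ?case by (simp add: gain_def 2 3 plus_ennreal.rep_eq)
qed

lemma loss_nonneg_form:
  assumes f: "AE z in lborel. f t z = enn2ereal (\<Phi> z)" and g: "AE z in lborel. g t z = enn2ereal (\<Psi> z)"
    and [measurable]: "\<Psi> \<in> borel_measurable borel"
  shows "AE z in lborel. loss K f g g t (z :: 'a \<times> 'a) = enn2ereal (\<Phi> z * (rate2 K \<Psi> z + rate3 K \<Psi> z))"
  using f AE_binary[OF g] AE_ternary[OF g]
proof eventually_elim
  case (elim z)
  obtain x v where z: "z = (x, v)" by (cases z)
  have "L2 K (f t) (g t) z = ereal_integral (sphere_measure \<Otimes>\<^sub>M lborel) (\<lambda>p. enn2ereal (case p of (\<omega>, v1) \<Rightarrow>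
      \<Phi> (x, v) * (ennreal (kB2 K (v1 - v) \<omega>) * \<Psi> (x, v1))))"
    unfolding z L2_kB2
    by (rule ereal_integral_cong_AE, use elim(2) in eventually_elim)
      (use elim(1) in \<open>auto simp: z times_ennreal.rep_eq kB2_nonneg mult_ac\<close>)
  then have 2: "L2 K (f t) (g t) z = enn2ereal (\<Phi> z * rate2 K \<Psi> z)"
    unfolding ereal_integral_enn2ereal by (simp add: rate2_def z case_prod_unfold nn_integral_cmult)
  have "L3 K (f t) (g t) (g t) z = ereal_integral (sphere_measure \<Otimes>\<^sub>M lborel) (\<lambda>p. enn2ereal (case p of (\<omega>, V) \<Rightarrow>
      \<Phi> (x, v) * (ennreal (kB3 K (V - (v, v)) \<omega>) * (\<Psi> (x, fst V) * \<Psi> (x, snd V)))))"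
    unfolding z L3_kB3
    by (rule ereal_integral_cong_AE, use elim(3) in eventually_elim)
      (use elim(1) in \<open>auto simp: z times_ennreal.rep_eq kB3_nonneg mult_ac\<close>)
  then have 3: "L3 K (f t) (g t) (g t) z = enn2ereal (\<Phi> z * rate3 K \<Psi> z)"
    unfolding ereal_integral_enn2ereal by (simp add: rate3_def z case_prod_unfold nn_integral_cmult)
  show ?case by (simp add: loss_def 2 3 plus_ennreal.rep_eq[symmetric] distrib_left)
qed

text \<open>The real function \<open>y\<close> describes the density \<open>f\<close> at time \<open>t\<close> along the free flow, within the range where the
  operators do not clip.\<close>

definition represents :: "(real \<Rightarrow> 'a \<times> 'a \<Rightarrow> ereal) \<Rightarrow> real \<Rightarrow> ('a \<times> 'a \<Rightarrow> real) \<Rightarrow> bool"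
  where "represents f t y \<longleftrightarrow> f t \<in> borel_measurable borel \<and> y \<in> borel_measurable borel \<and>
    (AE z in lborel. sharp f t z = ereal (y z)) \<and> (AE z in lborel. 0 \<le> y z \<and> y z \<le> k * maxwellian \<alpha> \<beta> z)"

lemma represents_lab:
  assumes "represents f t y"
  shows "AE z in lborel. f t z = enn2ereal (lab t y z)"
proof -
  have "AE z in lborel. sharp f t z = enn2ereal (ennreal (clip y z))"
    using assms unfolding represents_def by (auto simp: clip_def elim!: eventually_mono[OF AE_conjI])
  from AE_shear[OF this, of "- t"] show ?thesis
    by eventually_elim (auto simp: sharp_def lab_def)
qed

lemma sharp_gain:
  assumes "represents f t y"
  shows "AE z in lborel. sharp (gain K f f f) t z = ereal (gain_sharp y t z)"
proof -
  from AE_shear[OF gain_nonneg_form[where f=f and t=t and \<Phi>="lab t y", OF represents_lab[OF assms]], of t]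
  show ?thesis
  proof eventually_elim
    case (elim z)
    then have "sharp (gain K f f f) t z = enn2ereal (ennreal (gain_sharp y t z))"
      unfolding ennreal_gain_sharp by (cases z) (simp add: sharp_def shear_def)
    then show ?case by (simp add: gain_sharp_def)
  qed
qed

text \<open>Only the partners need to be bounded by \<open>k M\<close>: solutions of the linear problem, about which nothing but
  nonnegativity is assumed, must be covered as well.\<close>

lemma sharp_loss:
  assumes g: "represents g t y" and f: "f t \<in> F_pos"
  shows "AE z in lborel. sharp (loss K f g g) t z = sharp f t z * ereal (rate_sharp y t z)"
proof -
  have [measurable]: "y \<in> borel_measurable borel" using g by (simp add: represents_def)
  have m: "lab t y \<in> borel_measurable borel" by measurable
  from AE_shear[OF loss_nonneg_form[where f=f and g=g and t=t and \<Phi>="\<lambda>z. e2ennreal (f t z)" and \<Psi>="lab t y", OF F_pos_e2ennreal[OF f] represents_lab[OF g] m], of t]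
    AE_shear[OF F_pos_e2ennreal[OF f], of t]
  show ?thesis
  proof eventually_elim
    case (elim z)
    obtain x v where z: "z = (x, v)" by (cases z)
    have "sharp (loss K f g g) t z = enn2ereal (e2ennreal (sharp f t z) * ennreal (rate_sharp y t z))"
      unfolding ennreal_rate_sharp using elim(1) by (simp add: z sharp_def shear_def)
    also have "\<dots> = sharp f t z * ereal (rate_sharp y t z)"
      using elim(2) by (simp add: z sharp_def times_ennreal.rep_eq rate_sharp_def)
    finally show ?case .
  qed
qed

end

section \<open>Mild solutions and evolutions of real functions\<close>

lemma has_weak_derivative_cong:
  assumes F: "\<And>t. 0 < t \<Longrightarrow> ereal t < T \<Longrightarrow> F t = F' t" and D: "\<And>t. 0 < t \<Longrightarrow> ereal t < T \<Longrightarrow> D t = D' t"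
  shows "has_weak_derivative T F D \<longleftrightarrow> has_weak_derivative T F' D'"
proof -
  have in_T: "0 < t \<and> ereal t < T" if "0 < a \<and> ereal b < T" "t \<in> {a..b}" for a b t
    using that by (auto intro: le_less_trans[of "ereal t" "ereal b"])
  have "set_integrable lebesgue {a..b} F \<longleftrightarrow> set_integrable lebesgue {a..b} F'"
    and "set_integrable lebesgue {a..b} D \<longleftrightarrow> set_integrable lebesgue {a..b} D'" if "0 < a \<and> ereal b < T" for a b
    using in_T[OF that] by (intro set_integrable_cong F D; blast)+
  moreover have "set_lebesgue_integral lebesgue {t. 0 < t \<and> ereal t < T} (\<lambda>t. c t *\<^sub>R F t) =
      set_lebesgue_integral lebesgue {t. 0 < t \<and> ereal t < T} (\<lambda>t. c t *\<^sub>R F' t)"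
    and "set_lebesgue_integral lebesgue {t. 0 < t \<and> ereal t < T} (\<lambda>t. c t *\<^sub>R D t) =
      set_lebesgue_integral lebesgue {t. 0 < t \<and> ereal t < T} (\<lambda>t. c t *\<^sub>R D' t)" for c
    unfolding set_lebesgue_integral_def using F D
    by (auto intro!: Bochner_Integration.integral_cong simp: indicator_def)
  ultimately show ?thesis unfolding has_weak_derivative_def by auto
qed

lemma time_int_measurable [measurable]: "time_int T \<in> sets borel"
  unfolding time_int_def by measurable

text \<open>A pointwise majorant provides all the regularity in time that gain and loss terms must have.\<close>

lemma dominated_curve_spaces:
  fixes d :: "real \<Rightarrow> 'a::euclidean_space \<times> 'a \<Rightarrow> real"
  assumes d: "case_prod d \<in> borel_measurable (borel \<Otimes>\<^sub>M borel)" and q: "integrable lborel q"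
    and nonneg: "\<And>s z. 0 \<le> d s z" and le: "\<And>s z. d s z \<le> q z"
    and hm: "\<And>t. t \<in> time_int T \<Longrightarrow> h t \<in> borel_measurable borel"
    and hd: "\<And>t. t \<in> time_int T \<Longrightarrow> AE z in lborel. h t z = ereal (d t z)"
  shows "h \<in> L1loc_L1_pos T" and "h \<in> Linf_L1_pos T" and "t \<in> time_int T \<Longrightarrow> to_L1 (h t) = L1_class (d t)"
proof -
  have bound: "\<bar>d s z\<bar> \<le> q z" for s z using nonneg[of s z] le[of s z] by simp
  note slice = dominated_slice_integrable[OF d q bound]
  have cls: "h t \<in> L1_space" "to_L1 (h t) = L1_class (d t)" if "t \<in> time_int T" for t
    using L1_space_I[OF hm[OF that] hd[OF that] slice] by auto
  then show "t \<in> time_int T \<Longrightarrow> to_L1 (h t) = L1_class (d t)" by simp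
  have pos: "h \<in> FT_pos T"
    unfolding FT_pos_def F_pos_def F_space_def
  proof (intro CollectI ballI conjI)
    fix t assume t: "t \<in> time_int T"
    show "h t \<in> borel_measurable borel" by (rule hm[OF t])
    from hd[OF t] show "AE z in lborel. 0 \<le> h t z" by eventually_elim (simp add: nonneg)
  qed
  have "set_integrable lebesgue {0..s} (\<lambda>t. to_L1 (h t))" if "s \<in> time_int T" for s
  proof -
    have "set_integrable lebesgue {0..s} (\<lambda>t. to_L1 (h t)) \<longleftrightarrow> set_integrable lebesgue {0..s} (\<lambda>t. L1_class (d t))"
      using cls(2) time_int_mono[OF that] by (intro set_integrable_cong) auto
    then show ?thesis using dominated_curve_set_integrable[OF d q bound, of 0 s] by simp
  qed
  then show "h \<in> L1loc_L1_pos T" using pos cls unfolding L1loc_L1_pos_def by simp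
  have "(\<lambda>t. indicator (time_int T) t *\<^sub>R to_L1 (h t)) = (\<lambda>t. indicator (time_int T) t *\<^sub>R L1_class (d t))"
  proof
    fix t show "indicator (time_int T) t *\<^sub>R to_L1 (h t) = indicator (time_int T) t *\<^sub>R L1_class (d t)"
      by (cases "t \<in> time_int T") (simp_all add: cls(2))
  qed
  moreover have "(\<lambda>t. indicator (time_int T) t *\<^sub>R L1_class (d t)) \<in> borel_measurable borel"
    using dominated_curve_measurable[OF d q bound] by measurable
  ultimately have "set_borel_measurable lebesgue (time_int T) (\<lambda>t. to_L1 (h t))"
    unfolding set_borel_measurable_def by (simp add: borel_measurable_lebesgueI)
  moreover have "norm (to_L1 (h t)) \<le> (\<integral>z. q z \<partial>lborel)" if "t \<in> time_int T" for t
    using dominated_curve_norm[OF d q bound] cls(2)[OF that] by simp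
  ultimately show "h \<in> Linf_L1_pos T" using pos cls unfolding Linf_L1_pos_def by blast
qed

lemma Linf_L1_set_integrable:
  assumes h: "h \<in> Linf_L1_pos T" and s: "s \<in> time_int T"
  shows "set_integrable lebesgue {0..s} (\<lambda>t. to_L1 (h t))"
proof -
  have sub: "{0..s} \<subseteq> time_int T" using time_int_mono[OF s] by auto
  obtain C where "AE t in lebesgue. t \<in> time_int T \<longrightarrow> norm (to_L1 (h t)) \<le> C"
    using h unfolding Linf_L1_pos_def by blast
  then have "AE t in lebesgue. t \<in> {0..s} \<longrightarrow> norm (to_L1 (h t)) \<le> C"
    by eventually_elim (use sub in blast)
  moreover have "set_borel_measurable lebesgue {0..s} (\<lambda>t. to_L1 (h t))"
    by (rule set_borel_measurable_subset[where A="time_int T"]) (use h sub in \<open>auto simp: Linf_L1_pos_def\<close>)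
  ultimately show ?thesis by (rule set_integrable_lebesgue_bounded[rotated])
qed

text \<open>A mild solution is converted to an integral equation for its real representatives.\<close>

lemma C0_L1_evolves:
  assumes F: "F \<in> C0_L1_pos T" and wd: "has_weak_derivative T (\<lambda>t. to_L1 (F t)) D"
    and D: "\<And>s. s \<in> time_int T \<Longrightarrow> set_integrable lebesgue {0..s} D"
  shows "evolves T (\<lambda>t z. real_of_ereal (F t z)) D"
  unfolding evolves_def
proof (intro ballI conjI)
  fix t assume t: "t \<in> time_int T"
  show "integrable lborel (\<lambda>z. real_of_ereal (F t z))"
    by (rule L1_space_AE_finite) (use F t in \<open>auto simp: C0_L1_pos_def\<close>)
  show "set_integrable lebesgue {0..t} D" by (rule D[OF t])
  show "L1_class (\<lambda>z. real_of_ereal (F t z)) = L1_class (\<lambda>z. real_of_ereal (F 0 z)) + (LINT s:{0..t}|lebesgue. D s)"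
    using weak_derivative_imp_integral[OF wd _ D t] F by (simp add: C0_L1_pos_def to_L1_def)
qed

context small_collisions
begin

lemma represents_Linf:
  assumes B: "\<And>t. t \<in> time_int T \<Longrightarrow> represents B t (b t)"
  shows "sharp B \<in> Linf_M_pos T \<alpha> \<beta>" and "norm_sup T \<alpha> \<beta> (sharp B) \<le> ereal k"
proof -
  have *: "sharp B t \<in> F_pos \<and> norm_M \<alpha> \<beta> (sharp B t) \<le> ereal k" if t: "t \<in> time_int T" for t
  proof -
    have m: "sharp B t \<in> F_space" using B[OF t] sharp_borel[of B t] by (simp add: represents_def F_space_def)
    have "AE z in lborel. sharp B t z = ereal (b t z)" "AE z in lborel. 0 \<le> b t z \<and> b t z \<le> k * maxwellian \<alpha> \<beta> z"
      using B[OF t] by (auto simp: represents_def)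
    then have "AE z in lborel. 0 \<le> sharp B t z \<and> \<bar>sharp B t z\<bar> \<le> ereal (k * maxwellian \<alpha> \<beta> z)"
      by eventually_elim simp
    then show ?thesis unfolding F_pos_def norm_M_le_iff[OF m] using m by auto
  qed
  then show le: "norm_sup T \<alpha> \<beta> (sharp B) \<le> ereal k" unfolding norm_sup_def by (intro SUP_least) auto
  have "norm_sup T \<alpha> \<beta> (sharp B) < \<infinity>" using le by (rule le_less_trans) simp
  then show "sharp B \<in> Linf_M_pos T \<alpha> \<beta>" using * by (simp add: Linf_M_pos_def FT_pos_def)
qed

text \<open>An evolution of the real functions \<open>Y t\<close>, with gain and rate taken from \<open>a\<close> and \<open>b\<close>, has all the
  regularity asked of a mild solution, because everything in it is dominated by the integrable \<open>ks.envelope\<close>.\<close>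

context
  fixes T :: ereal and a b Y :: "real \<Rightarrow> 'a \<times> 'a \<Rightarrow> real" and A B F :: "'a evol"
  assumes a: "ks.jointly_borel a" and b: "ks.jointly_borel b" and Y: "ks.jointly_borel Y"
    and Y_nonneg: "\<And>t z. 0 \<le> Y t z" and Y_le: "\<And>t z. Y t z \<le> 2 * (k * maxwellian \<alpha> \<beta> z)"
    and ev: "evolves T Y (\<lambda>s. L1_class (ks.rhs a b Y s))"
    and A: "\<And>t. t \<in> time_int T \<Longrightarrow> represents A t (a t)" and B: "\<And>t. t \<in> time_int T \<Longrightarrow> represents B t (b t)"
    and F: "F = unsharp (\<lambda>t z. ereal (Y t z))"
begin

lemma evolution_slice: "Y t \<in> borel_measurable borel"
  by (rule ks.jointly_borel_slice[OF Y])

lemma evolution_F_pos: "F t \<in> F_pos"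
proof -
  have "(\<lambda>z. ereal (Y t z)) \<in> borel_measurable borel" using evolution_slice by measurable
  from unsharp_borel[of "\<lambda>t z. ereal (Y t z)", OF this] show ?thesis
    using Y_nonneg by (auto simp: F F_pos_def F_space_def unsharp_def)
qed

lemma evolution_sharp: "sharp F t z = ereal (Y t z)"
  by (simp add: F sharp_unsharp)

lemma evolution_gain:
  shows "sharp (gain K A A A) \<in> L1loc_L1_pos T" and "sharp (gain K A A A) \<in> Linf_L1_pos T"
    and "t \<in> time_int T \<Longrightarrow> to_L1 (sharp (gain K A A A) t) = L1_class (gain_sharp (a t) t)"
proof -
  have "(\<lambda>(t, z). gain_sharp (a t) t z) \<in> borel_measurable (borel \<Otimes>\<^sub>M borel)"
    using ks.jointly_borel_gain[OF a] by (simp add: ks.jointly_borel_def)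
  moreover have "gain_sharp (a s) s z \<le> ks.envelope z" for s z
  proof -
    have "gain_sharp (a s) s z \<le> k * maxwellian \<alpha> \<beta> z * freq_real s z"
      by (rule ks.G_bound[OF ks.jointly_borel_slice[OF a]])
    also have "\<dots> \<le> k * maxwellian \<alpha> \<beta> z * freq_bound z"
      using k_pos maxwellian_pos[of \<alpha> \<beta> z] by (intro mult_left_mono ks.P_le) auto
    also have "\<dots> \<le> ks.envelope z"
      using k_pos maxwellian_pos[of \<alpha> \<beta> z] freq_bound_nonneg[of z] by (simp add: ks.envelope_def)
    finally show ?thesis .
  qed
  moreover have "sharp (gain K A A A) t \<in> borel_measurable borel" if "t \<in> time_int T" for t
    using A[OF that] by (intro sharp_borel gain_borel) (simp add: represents_def)
  ultimately show "sharp (gain K A A A) \<in> L1loc_L1_pos T" "sharp (gain K A A A) \<in> Linf_L1_pos T"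
    "t \<in> time_int T \<Longrightarrow> to_L1 (sharp (gain K A A A) t) = L1_class (gain_sharp (a t) t)"
    using dominated_curve_spaces[of "\<lambda>t. gain_sharp (a t) t" ks.envelope T "sharp (gain K A A A)"]
      ks.envelope_int ks.G_nonneg sharp_gain[OF A] by auto
qed

lemma evolution_loss:
  shows "sharp (loss K F B B) \<in> L1loc_L1_pos T" and "sharp (loss K F B B) \<in> Linf_L1_pos T"
    and "t \<in> time_int T \<Longrightarrow> to_L1 (sharp (loss K F B B) t) = L1_class (\<lambda>z. rate_sharp (b t) t z * Y t z)"
proof -
  have [measurable]: "(\<lambda>(t, z). rate_sharp (b t) t z) \<in> borel_measurable (borel \<Otimes>\<^sub>M borel)"
    "(\<lambda>(t, z). Y t z) \<in> borel_measurable (borel \<Otimes>\<^sub>M borel)"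
    using ks.jointly_borel_rate[OF b] Y by (simp_all add: ks.jointly_borel_def)
  have "(\<lambda>(t, z). rate_sharp (b t) t z * Y t z) \<in> borel_measurable (borel \<Otimes>\<^sub>M borel)"
    by measurable
  moreover have "rate_sharp (b s) s z * Y s z \<le> ks.envelope z" for s z
  proof -
    have "rate_sharp (b s) s z * Y s z \<le> freq_bound z * (2 * (k * maxwellian \<alpha> \<beta> z))"
      using ks.R_bound[OF ks.jointly_borel_slice[OF b], of s s z] ks.P_le[of s z]
      by (intro mult_mono Y_le Y_nonneg freq_bound_nonneg) auto
    also have "\<dots> \<le> ks.envelope z"
      using k_pos maxwellian_pos[of \<alpha> \<beta> z] freq_bound_nonneg[of z] by (simp add: ks.envelope_def mult_ac)
    finally show ?thesis .
  qed
  moreover have "sharp (loss K F B B) t \<in> borel_measurable borel" if "t \<in> time_int T" for t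
    using B[OF that] evolution_F_pos[of t] by (intro sharp_borel loss_borel) (simp_all add: represents_def F_pos_def F_space_def)
  moreover have "AE z in lborel. sharp (loss K F B B) t z = ereal (rate_sharp (b t) t z * Y t z)" if "t \<in> time_int T" for t
    using sharp_loss[where f=F and t=t, OF B[OF that] evolution_F_pos[of t]] by (simp add: evolution_sharp mult.commute)
  moreover have "0 \<le> rate_sharp (b s) s z * Y s z" for s z by (intro mult_nonneg_nonneg ks.R_nonneg Y_nonneg)
  ultimately show "sharp (loss K F B B) \<in> L1loc_L1_pos T" "sharp (loss K F B B) \<in> Linf_L1_pos T"
    "t \<in> time_int T \<Longrightarrow> to_L1 (sharp (loss K F B B) t) = L1_class (\<lambda>z. rate_sharp (b t) t z * Y t z)"
    using dominated_curve_spaces[of "\<lambda>t z. rate_sharp (b t) t z * Y t z" ks.envelope T "sharp (loss K F B B)"]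
      ks.envelope_int by auto
qed

lemma rhs_dominated:
  shows "case_prod (ks.rhs a b Y) \<in> borel_measurable (borel \<Otimes>\<^sub>M borel)" and "\<bar>ks.rhs a b Y s z\<bar> \<le> ks.envelope z"
  using ks.jointly_borel_rhs[OF a b Y] ks.rhs_bound[where y=Y and s=s and z=z, OF a b Y_nonneg Y_le] by (auto simp: ks.jointly_borel_def)

lemma evolution_rhs:
  assumes "t \<in> time_int T"
  shows "L1_class (ks.rhs a b Y t) = to_L1 (sharp (gain K A A A) t) - to_L1 (sharp (loss K F B B) t)"
proof -
  have "AE z in lborel. sharp (gain K A A A) t z = ereal (gain_sharp (a t) t z)" by (rule sharp_gain[OF A[OF assms]])
  have i1: "integrable lborel (gain_sharp (a t) t)"
  proof (rule Bochner_Integration.integrable_bound[OF ks.envelope_int])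
    show "gain_sharp (a t) t \<in> borel_measurable lborel"
      using ks.jointly_borel_slice[OF ks.jointly_borel_gain[OF a], of t] by simp
    have "\<bar>gain_sharp (a t) t z\<bar> \<le> ks.envelope z" for z
      using ks.rhs_bound[OF a b, where y="\<lambda>_ _. 0" and s=t and z=z] ks.k_pos maxwellian_pos[of \<alpha> \<beta> z]
      by (simp add: ks.rhs_def)
    then show "AE z in lborel. norm (gain_sharp (a t) t z) \<le> norm (ks.envelope z)"
      by (intro AE_I2) (metis real_norm_def abs_ge_self order_trans)
  qed
  have i2: "integrable lborel (\<lambda>z. rate_sharp (b t) t z * Y t z)"
    using Bochner_Integration.integrable_diff[OF i1 dominated_slice_integrable[OF rhs_dominated(1) ks.envelope_int rhs_dominated(2), of t]]
    by (simp add: ks.rhs_def)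
  show ?thesis
    using L1_class_diff[OF i1 i2] evolution_gain(3)[OF assms] evolution_loss(3)[OF assms]
    by (simp add: ks.rhs_def[abs_def])
qed

lemma evolution_to_L1: "to_L1 (sharp F t) = L1_class (Y t)"
  by (simp add: to_L1_def evolution_sharp)

lemma evolution_integral:
  assumes "t \<in> time_int T"
  shows "L1_class (Y t) = L1_class (Y 0) + (LINT s:{0..t}|lebesgue. L1_class (ks.rhs a b Y s))"
  using ev assms by (simp add: evolves_def)

lemma evolution_C0: "sharp F \<in> C0_L1_pos T"
proof -
  have "continuous_on (time_int T) (\<lambda>t. L1_class (Y t))"
    using dominated_curve_measurable[OF rhs_dominated(1) ks.envelope_int rhs_dominated(2)]
      dominated_curve_norm[OF rhs_dominated(1) ks.envelope_int rhs_dominated(2)] evolution_integral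
    by (rule integral_curve_continuous)
  moreover have "sharp F t \<in> L1_space" if "t \<in> time_int T" for t
    by (rule L1_space_I[where y="Y t"])
      (use ev that evolution_slice sharp_borel[of F t] evolution_F_pos[of t] in \<open>auto simp: evolves_def evolution_sharp F_pos_def F_space_def\<close>)
  ultimately show ?thesis
    using sharp_F_pos[OF evolution_F_pos] by (simp add: C0_L1_pos_def FT_pos_def evolution_to_L1)
qed

lemma evolution_weak_derivative:
  "has_weak_derivative T (\<lambda>t. to_L1 (sharp F t)) (\<lambda>t. to_L1 (sharp (gain K A A A) t) - to_L1 (sharp (loss K F B B) t))"
proof -
  have "has_weak_derivative T (\<lambda>t. L1_class (Y t)) (\<lambda>s. L1_class (ks.rhs a b Y s))"
    using dominated_curve_measurable[OF rhs_dominated(1) ks.envelope_int rhs_dominated(2)]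
      dominated_curve_norm[OF rhs_dominated(1) ks.envelope_int rhs_dominated(2)] evolution_integral
    by (rule integral_imp_weak_derivative)
  then show ?thesis
    by (subst has_weak_derivative_cong[where F'="\<lambda>t. L1_class (Y t)" and D'="\<lambda>s. L1_class (ks.rhs a b Y s)"])
      (auto simp: evolution_to_L1 evolution_rhs time_int_def)
qed

lemma evolution_integral_equation:
  assumes t: "t \<in> time_int T"
  shows "to_L1 (sharp F t) + (LINT \<tau>:{0..t}|lebesgue. to_L1 (sharp (loss K F B B) \<tau>)) =
    to_L1 (sharp F 0) + (LINT \<tau>:{0..t}|lebesgue. to_L1 (sharp (gain K A A A) \<tau>))"
proof -
  have g: "set_integrable lebesgue {0..t} (\<lambda>s. to_L1 (sharp (gain K A A A) s))"
    and l: "set_integrable lebesgue {0..t} (\<lambda>s. to_L1 (sharp (loss K F B B) s))"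
    using evolution_gain(1) evolution_loss(1) t by (simp_all add: L1loc_L1_pos_def)
  have "(LINT s:{0..t}|lebesgue. L1_class (ks.rhs a b Y s)) =
      (LINT s:{0..t}|lebesgue. to_L1 (sharp (gain K A A A) s) - to_L1 (sharp (loss K F B B) s))"
    using time_int_mono[OF t] by (intro set_lebesgue_integral_cong) (auto simp: evolution_rhs)
  also have "\<dots> = (LINT s:{0..t}|lebesgue. to_L1 (sharp (gain K A A A) s)) -
      (LINT s:{0..t}|lebesgue. to_L1 (sharp (loss K F B B) s))"
    by (rule set_integral_diff(2)[OF g l])
  finally show ?thesis using evolution_integral[OF t] by (simp add: evolution_to_L1)
qed

lemma evolution_mild_linear:
  assumes "f0 \<in> L1_space" "f0 \<in> F_pos" and "AE z in lborel. f0 z = ereal (Y 0 z)"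
  shows "mild_linear K T \<alpha> \<beta> f0 B (gain K A A A) F"
  unfolding mild_linear_def
  using assms represents_Linf(1)[OF B] evolution_gain(1) evolution_loss(1) evolution_F_pos evolution_C0 evolution_weak_derivative
  by (auto simp: FT_pos_def evolution_sharp elim!: eventually_mono)

end

lemma rate_sharp_le: "y \<in> borel_measurable borel \<Longrightarrow> rate_sharp y s z \<le> freq_bound z"
  by (rule order_trans[OF ks.R_bound ks.P_le])

lemma to_L1_cong_AE:
  "f \<in> borel_measurable borel \<Longrightarrow> g \<in> borel_measurable borel \<Longrightarrow> (AE z in lborel. f z = g z) \<Longrightarrow> to_L1 f = to_L1 g"
  unfolding to_L1_def by (intro L1_class_cong_AE) (auto elim!: eventually_mono)

lemma represents_gain_to_L1:
  assumes "represents A t y" "represents A' t y"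
  shows "to_L1 (sharp (gain K A A A) t) = to_L1 (sharp (gain K A' A' A') t)"
proof (rule to_L1_cong_AE)
  show "AE z in lborel. sharp (gain K A A A) t z = sharp (gain K A' A' A') t z"
    using sharp_gain[OF assms(1)] sharp_gain[OF assms(2)] by eventually_elim simp
qed (use assms in \<open>auto simp: represents_def intro!: sharp_borel gain_borel\<close>)

text \<open>The integrability of the loss is assumed, not derived, because \<open>F\<close> need not be bounded.\<close>

lemma loss_to_L1:
  assumes B: "represents B s y" and F: "F s \<in> F_pos" and fin: "sharp F s \<in> L1_space" and L: "sharp (loss K F B B) s \<in> L1_space"
  shows "integrable lborel (\<lambda>z. rate_sharp y s z * real_of_ereal (sharp F s z))" and
    "to_L1 (sharp (loss K F B B) s) = L1_class (\<lambda>z. rate_sharp y s z * real_of_ereal (sharp F s z))"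
proof -
  have [measurable]: "sharp F s \<in> borel_measurable borel" "sharp (loss K F B B) s \<in> borel_measurable borel" "y \<in> borel_measurable borel"
    using fin L B by (auto simp: L1_space_def F_space_def represents_def)
  have [measurable]: "rate_sharp y s \<in> borel_measurable borel"
    using ks.rate_slice_borel[of y s] by simp
  have eq: "AE z in lborel. real_of_ereal (sharp (loss K F B B) s z) = rate_sharp y s z * real_of_ereal (sharp F s z)"
    using sharp_loss[where f=F and t=s, OF B F] by eventually_elim simp
  show "to_L1 (sharp (loss K F B B) s) = L1_class (\<lambda>z. rate_sharp y s z * real_of_ereal (sharp F s z))"
    unfolding to_L1_def using eq by (intro L1_class_cong_AE) auto
  show "integrable lborel (\<lambda>z. rate_sharp y s z * real_of_ereal (sharp F s z))"
    using L1_space_AE_finite(2)[OF L] by (rule integrable_cong_AE_imp) (use eq in \<open>auto elim: eventually_mono\<close>)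
qed

lemma mild_linear_evolves:
  assumes "mild_linear K T \<alpha> \<beta> f0 g h f"
  shows "evolves T (\<lambda>t z. real_of_ereal (sharp f t z)) (\<lambda>t. to_L1 (sharp h t) - to_L1 (sharp (loss K f g g) t))"
proof (rule C0_L1_evolves)
  fix s assume "s \<in> time_int T"
  then show "set_integrable lebesgue {0..s} (\<lambda>t. to_L1 (sharp h t) - to_L1 (sharp (loss K f g g) t))"
    using assms by (intro set_integral_diff(1)) (auto simp: mild_linear_def L1loc_L1_pos_def)
qed (use assms in \<open>auto simp: mild_linear_def\<close>)

text \<open>The difference of two solutions is damped at a rate that is locally bounded in velocity and
  starts from zero.\<close>

lemma mild_linear_unique:
  assumes F: "mild_linear K T \<alpha> \<beta> f0 B (gain K A A A) F" and F': "mild_linear K T \<alpha> \<beta> f0 B' (gain K A' A' A') F'"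
    and A: "\<And>t. t \<in> time_int T \<Longrightarrow> represents A t (a t)" "\<And>t. t \<in> time_int T \<Longrightarrow> represents A' t (a t)"
    and B: "\<And>t. t \<in> time_int T \<Longrightarrow> represents B t (b t)" "\<And>t. t \<in> time_int T \<Longrightarrow> represents B' t (b t)"
    and t: "t \<in> time_int T"
  shows "AE z in lborel. sharp F t z = sharp F' t z"
proof -
  let ?y = "\<lambda>t z. real_of_ereal (sharp F t z)" and ?y' = "\<lambda>t z. real_of_ereal (sharp F' t z)"
  let ?D = "\<lambda>A B F t. to_L1 (sharp (gain K A A A) t) - to_L1 (sharp (loss K F B B) t)"
  have "AE z in lborel. ?y t z - ?y' t z = 0"
  proof (rule evolves_eq_zero[OF evolves_diff[OF mild_linear_evolves[OF F] mild_linear_evolves[OF F']] _ ks.\<rho>_meas _ t])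
    have "AE z in lborel. sharp F 0 z = f0 z" "AE z in lborel. sharp F' 0 z = f0 z"
      using F F' by (auto simp: mild_linear_def)
    then show "AE z in lborel. ?y 0 z - ?y' 0 z = 0" by eventually_elim simp
    have "AE s in lebesgue. s \<in> time_int T \<longrightarrow> sharp (loss K F B B) s \<in> L1_space"
      "AE s in lebesgue. s \<in> time_int T \<longrightarrow> sharp (loss K F' B' B') s \<in> L1_space"
      using F F' by (auto simp: mild_linear_def L1loc_L1_pos_def)
    then show "AE s in lebesgue. s \<in> time_int T \<longrightarrow> (\<exists>d. integrable lborel d \<and> ?D A B F s - ?D A' B' F' s = L1_class d \<and>
      (AE z in lborel. \<bar>d z\<bar> \<le> freq_bound z * \<bar>?y s z - ?y' s z\<bar>))"
    proof eventually_elim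
      case (elim s)
      show ?case
      proof
        assume s: "s \<in> time_int T"
        let ?r = "rate_sharp (b s) s"
        have Fs: "F s \<in> F_pos" "sharp F s \<in> L1_space" "F' s \<in> F_pos" "sharp F' s \<in> L1_space"
          using F F' s by (auto simp: mild_linear_def FT_pos_def C0_L1_pos_def)
        note l = loss_to_L1[OF B(1)[OF s] Fs(1,2) elim(1)[rule_format, OF s]]
          and l' = loss_to_L1[OF B(2)[OF s] Fs(3,4) elim(2)[rule_format, OF s]]
        show "\<exists>d. integrable lborel d \<and> ?D A B F s - ?D A' B' F' s = L1_class d \<and>
          (AE z in lborel. \<bar>d z\<bar> \<le> freq_bound z * \<bar>?y s z - ?y' s z\<bar>)"
        proof (intro exI conjI AE_I2)
          let ?d = "\<lambda>z. ?r z * ?y' s z - ?r z * ?y s z"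
          show "integrable lborel ?d" using l(1) l'(1) by simp
          show "?D A B F s - ?D A' B' F' s = L1_class ?d"
            using represents_gain_to_L1[OF A(1)[OF s] A(2)[OF s]] l(2) l'(2) L1_class_diff[OF l'(1) l(1)] by simp
          fix z
          have "\<bar>?d z\<bar> = ?r z * \<bar>?y s z - ?y' s z\<bar>"
            using ks.R_nonneg[of "b s" s z] by (simp add: abs_mult right_diff_distrib[symmetric] abs_minus_commute)
          also have "\<dots> \<le> freq_bound z * \<bar>?y s z - ?y' s z\<bar>"
            using B(1)[OF s] by (intro mult_right_mono rate_sharp_le) (auto simp: represents_def)
          finally show "\<bar>?d z\<bar> \<le> freq_bound z * \<bar>?y s z - ?y' s z\<bar>" .
        qed
      qed
    qed
  qed
  moreover have "AE z in lborel. sharp F t z = ereal (?y t z)" "AE z in lborel. sharp F' t z = ereal (?y' t z)"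
    using F F' t by (auto simp: mild_linear_def C0_L1_pos_def intro!: L1_space_AE_finite(1))
  ultimately show ?thesis by eventually_elim simp
qed

lemma mild_boltzmann_represents:
  assumes F: "mild_boltzmann K T \<alpha> \<beta> f0 F" and bound: "norm_sup T \<alpha> \<beta> (sharp F) \<le> ereal k" and t: "t \<in> time_int T"
  shows "represents F t (\<lambda>z. real_of_ereal (sharp F t z))"
proof -
  have pos: "F t \<in> F_pos" using F t by (auto simp: mild_boltzmann_def FT_pos_def)
  have m: "sharp F t \<in> F_space" using sharp_F_pos[of F t, OF pos] by (simp add: F_pos_def)
  have "norm_M \<alpha> \<beta> (sharp F t) \<le> norm_sup T \<alpha> \<beta> (sharp F)" unfolding norm_sup_def using t by (rule SUP_upper)
  then have "AE z in lborel. \<bar>sharp F t z\<bar> \<le> ereal (k * maxwellian \<alpha> \<beta> z)"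
    using norm_M_le_iff[OF m] bound order_trans by blast
  moreover have "AE z in lborel. 0 \<le> sharp F t z" using sharp_F_pos[of F t, OF pos] by (simp add: F_pos_def)
  ultimately have "AE z in lborel. sharp F t z = ereal (real_of_ereal (sharp F t z)) \<and>
      0 \<le> real_of_ereal (sharp F t z) \<and> real_of_ereal (sharp F t z) \<le> k * maxwellian \<alpha> \<beta> z"
  proof eventually_elim
    case (elim z)
    then show ?case by (cases "sharp F t z") auto
  qed
  then show ?thesis
    unfolding represents_def using pos m by (auto simp: F_pos_def F_space_def elim!: eventually_mono)
qed

lemma mild_boltzmann_evolves:
  assumes "mild_boltzmann K T \<alpha> \<beta> f0 f"
  shows "evolves T (\<lambda>t z. real_of_ereal (sharp f t z)) (\<lambda>t. to_L1 (sharp (gain K f f f) t) - to_L1 (sharp (loss K f f f) t))"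
proof (rule C0_L1_evolves)
  fix s assume "s \<in> time_int T"
  then show "set_integrable lebesgue {0..s} (\<lambda>t. to_L1 (sharp (gain K f f f) t) - to_L1 (sharp (loss K f f f) t))"
    using assms by (intro set_integral_diff(1) Linf_L1_set_integrable) (auto simp: mild_boltzmann_def)
qed (use assms in \<open>auto simp: mild_boltzmann_def\<close>)

lemma mild_boltzmann_rhs:
  assumes F: "mild_boltzmann K T \<alpha> \<beta> f0 F" and bound: "norm_sup T \<alpha> \<beta> (sharp F) \<le> ereal k"
  defines "y \<equiv> \<lambda>t z. real_of_ereal (sharp F t z)"
  shows "AE s in lebesgue. s \<in> time_int T \<longrightarrow> to_L1 (sharp (gain K F F F) s) - to_L1 (sharp (loss K F F F) s) =
    L1_class (\<lambda>z. gain_sharp (y s) s z - rate_sharp (y s) s z * y s z)"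
proof -
  have "AE s in lebesgue. s \<in> time_int T \<longrightarrow> sharp (gain K F F F) s \<in> L1_space"
    "AE s in lebesgue. s \<in> time_int T \<longrightarrow> sharp (loss K F F F) s \<in> L1_space"
    using F by (auto simp: mild_boltzmann_def Linf_L1_pos_def)
  then show ?thesis
  proof eventually_elim
    case (elim s)
    show ?case
    proof
      assume s: "s \<in> time_int T"
      have rep: "represents F s (y s)" unfolding y_def by (rule mild_boltzmann_represents[OF F bound s])
      have G: "sharp (gain K F F F) s \<in> L1_space" using elim(1) s by simp
      have [measurable]: "y s \<in> borel_measurable borel" using rep by (simp add: represents_def)
      have [measurable]: "gain_sharp (y s) s \<in> borel_measurable borel"
        using ks.gain_slice_borel[of "y s" s] by simp
      have eq: "AE z in lborel. real_of_ereal (sharp (gain K F F F) s z) = gain_sharp (y s) s z"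
        using sharp_gain[OF rep] by eventually_elim simp
      have g: "integrable lborel (gain_sharp (y s) s)"
        using L1_space_AE_finite(2)[OF G] by (rule integrable_cong_AE_imp) (use eq in \<open>auto elim: eventually_mono\<close>)
      have "to_L1 (sharp (gain K F F F) s) = L1_class (gain_sharp (y s) s)"
        using sharp_gain[OF rep] g G by (intro L1_space_I(2)) (auto simp: L1_space_def F_space_def)
      moreover have "integrable lborel (\<lambda>z. rate_sharp (y s) s z * y s z)"
        "to_L1 (sharp (loss K F F F) s) = L1_class (\<lambda>z. rate_sharp (y s) s z * y s z)"
        using loss_to_L1[OF rep, of F] F s elim(2) unfolding y_def by (auto simp: mild_boltzmann_def FT_pos_def C0_L1_pos_def)
      ultimately show "to_L1 (sharp (gain K F F F) s) - to_L1 (sharp (loss K F F F) s) =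
          L1_class (\<lambda>z. gain_sharp (y s) s z - rate_sharp (y s) s z * y s z)"
        using g L1_class_diff[of "gain_sharp (y s) s" "\<lambda>z. rate_sharp (y s) s z * y s z"] by simp
    qed
  qed
qed

text \<open>By \<open>ks.contraction\<close> every bound on the distance of the two solutions may be halved; it starts with \<open>k M\<close>,
  as both lie between \<open>0\<close> and \<open>k M\<close>.\<close>

lemma mild_boltzmann_unique:
  fixes F F' :: "'a evol"
  assumes F: "mild_boltzmann K T \<alpha> \<beta> f0 F" "norm_sup T \<alpha> \<beta> (sharp F) \<le> ereal k"
    and F': "mild_boltzmann K T \<alpha> \<beta> f0 F'" "norm_sup T \<alpha> \<beta> (sharp F') \<le> ereal k" and t: "t \<in> time_int T"
  shows "AE z in lborel. sharp F t z = sharp F' t z"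
proof -
  let ?p = "\<lambda>t z. real_of_ereal (sharp F t z)" and ?q = "\<lambda>t z. real_of_ereal (sharp F' t z)"
  have rep: "represents F s (?p s)" "represents F' s (?q s)" if "s \<in> time_int T" for s
    using mild_boltzmann_represents[OF F that] mild_boltzmann_represents[OF F' that] by auto
  have pq0: "AE z in lborel. ?p 0 z = ?q 0 z"
  proof -
    have "AE z in lborel. sharp F 0 z = f0 z" "AE z in lborel. sharp F' 0 z = f0 z"
      using F(1) F'(1) by (auto simp: mild_boltzmann_def)
    then show ?thesis by eventually_elim simp
  qed
  have p: "AE z in lborel. 0 \<le> ?p s z \<and> ?p s z \<le> k * maxwellian \<alpha> \<beta> z"
    and q: "AE z in lborel. 0 \<le> ?q s z \<and> ?q s z \<le> k * maxwellian \<alpha> \<beta> z" if "s \<in> time_int T" for s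
    using rep[OF that] by (auto simp: represents_def)
  have close: "AE z in lborel. \<bar>?p t z - ?q t z\<bar> \<le> (1 / 2) ^ j * (k * maxwellian \<alpha> \<beta> z)" if "t \<in> time_int T" for t j
    using that
  proof (induction j arbitrary: t)
    case 0
    from p[OF 0] q[OF 0] show ?case by eventually_elim auto
  next
    case (Suc j)
    have "AE z in lborel. \<bar>?p t z - ?q t z\<bar> \<le> (1 / 2) ^ j / 2 * (k * maxwellian \<alpha> \<beta> z)"
    proof (rule ks.contraction[OF mild_boltzmann_evolves[OF F(1)] mild_boltzmann_evolves[OF F'(1)] pq0 _ p q _ Suc.prems])
      show "AE s in lebesgue. s \<in> time_int T \<longrightarrow> (\<exists>p1 p2 q1 q2. p1 \<in> borel_measurable borel \<and> p2 \<in> borel_measurable borel \<and>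
        q1 \<in> borel_measurable borel \<and> q2 \<in> borel_measurable borel \<and>
        (AE z in lborel. \<bar>p1 z - q1 z\<bar> \<le> (1 / 2) ^ j * (k * maxwellian \<alpha> \<beta> z)) \<and>
        (AE z in lborel. \<bar>p2 z - q2 z\<bar> \<le> (1 / 2) ^ j * (k * maxwellian \<alpha> \<beta> z)) \<and>
        to_L1 (sharp (gain K F F F) s) - to_L1 (sharp (loss K F F F) s) =
          L1_class (\<lambda>z. gain_sharp p1 s z - rate_sharp p2 s z * ?p s z) \<and>
        to_L1 (sharp (gain K F' F' F') s) - to_L1 (sharp (loss K F' F' F') s) =
          L1_class (\<lambda>z. gain_sharp q1 s z - rate_sharp q2 s z * ?q s z))"
        using mild_boltzmann_rhs[OF F] mild_boltzmann_rhs[OF F']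
      proof eventually_elim
        case (elim s)
        show ?case
        proof
          assume s: "s \<in> time_int T"
          show "\<exists>p1 p2 q1 q2. p1 \<in> borel_measurable borel \<and> p2 \<in> borel_measurable borel \<and>
            q1 \<in> borel_measurable borel \<and> q2 \<in> borel_measurable borel \<and>
            (AE z in lborel. \<bar>p1 z - q1 z\<bar> \<le> (1 / 2) ^ j * (k * maxwellian \<alpha> \<beta> z)) \<and>
            (AE z in lborel. \<bar>p2 z - q2 z\<bar> \<le> (1 / 2) ^ j * (k * maxwellian \<alpha> \<beta> z)) \<and>
            to_L1 (sharp (gain K F F F) s) - to_L1 (sharp (loss K F F F) s) =
              L1_class (\<lambda>z. gain_sharp p1 s z - rate_sharp p2 s z * ?p s z) \<and>
            to_L1 (sharp (gain K F' F' F') s) - to_L1 (sharp (loss K F' F' F') s) =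
              L1_class (\<lambda>z. gain_sharp q1 s z - rate_sharp q2 s z * ?q s z)"
            using rep[OF s] Suc.IH[OF s] elim s
            by (intro exI[of _ "?p s"] exI[of _ "?q s"] conjI) (simp_all add: represents_def)
        qed
      qed
    qed simp_all
    then show ?case by simp
  qed
  have "AE z in lborel. \<forall>j. \<bar>?p t z - ?q t z\<bar> \<le> (1 / 2) ^ j * (k * maxwellian \<alpha> \<beta> z)"
    using close[OF t] by (simp add: AE_all_countable)
  moreover have "AE z in lborel. sharp F t z = ereal (?p t z)" "AE z in lborel. sharp F' t z = ereal (?q t z)"
    using rep[OF t] by (auto simp: represents_def)
  ultimately show ?thesis
  proof eventually_elim
    case (elim z)
    have "(\<lambda>j. (1 / 2) ^ j * (k * maxwellian \<alpha> \<beta> z)) \<longlonglongrightarrow> 0 * (k * maxwellian \<alpha> \<beta> (z :: 'a \<times> 'a))"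
      by (intro tendsto_intros LIMSEQ_power_zero) simp
    then have "\<bar>?p t z - ?q t z\<bar> \<le> 0"
      using elim(1) by (intro tendsto_lowerbound[of _ 0 sequentially]) auto
    then show ?case using elim(2,3) by simp
  qed
qed

end

section \<open>The smallness condition\<close>

text \<open>Dominates the constants of \<open>singular_const\<close> in the dimensions \<open>d\<close> and \<open>2 d\<close> of binary and ternary
  collisions.\<close>

definition dimension_const :: "'a::euclidean_space itself \<Rightarrow> real"
  where "dimension_const _ = (let d = DIM('a) in
    unit_ball_vol (real d) * real d + sqrt pi ^ d + unit_ball_vol (real (2 * d)) * real (2 * d) + sqrt pi ^ (2 * d))"

lemma dimension_const_pos: "0 < dimension_const TYPE('a::euclidean_space)"
  unfolding dimension_const_def Let_def by (intro add_nonneg_pos add_nonneg_nonneg mult_nonneg_nonneg) auto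

lemma dimension_const_bounds:
  shows "unit_ball_vol (real DIM('a)) * real DIM('a) \<le> dimension_const TYPE('a::euclidean_space)"
    and "sqrt pi ^ DIM('a) \<le> dimension_const TYPE('a)"
    and "unit_ball_vol (real DIM('a \<times> 'a)) * real DIM('a \<times> 'a) \<le> dimension_const TYPE('a)"
    and "sqrt pi ^ DIM('a \<times> 'a) \<le> dimension_const TYPE('a)"
proof -
  have nonneg: "0 \<le> unit_ball_vol (real n) * real n" "0 \<le> sqrt pi ^ n" for n :: nat
    by (auto intro!: mult_nonneg_nonneg)
  have dd: "DIM('a \<times> 'a) = 2 * DIM('a)" by simp
  note nn = nonneg[of "DIM('a)"] nonneg[of "2 * DIM('a)"]
  show "unit_ball_vol (real DIM('a)) * real DIM('a) \<le> dimension_const TYPE('a)" "sqrt pi ^ DIM('a) \<le> dimension_const TYPE('a)"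
    "unit_ball_vol (real DIM('a \<times> 'a)) * real DIM('a \<times> 'a) \<le> dimension_const TYPE('a)"
    "sqrt pi ^ DIM('a \<times> 'a) \<le> dimension_const TYPE('a)"
    unfolding dd dimension_const_def Let_def using nn by linarith+
qed

lemma singular_const_le:
  assumes p: "0 < real DIM('b::euclidean_space) + p" and c: "0 < c"
    and C: "unit_ball_vol (real DIM('b)) * real DIM('b) \<le> C" "sqrt pi ^ DIM('b) \<le> C"
  shows "singular_const TYPE('b) p c \<le> C * (c powr (- real DIM('b) / 2) + 1 / (real DIM('b) + p))"
proof -
  have "sqrt c ^ DIM('b) = c powr (real DIM('b) / 2)"
    using c by (simp add: powr_half_sqrt[symmetric] powr_realpow[symmetric] powr_powr)
  then have "sqrt (pi / c) ^ DIM('b) = sqrt pi ^ DIM('b) * c powr (- real DIM('b) / 2)"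
    using c by (simp add: real_sqrt_divide power_divide powr_minus_divide)
  also have "\<dots> \<le> C * c powr (- real DIM('b) / 2)" by (intro mult_right_mono C) auto
  finally have 1: "sqrt (pi / c) ^ DIM('b) \<le> C * c powr (- real DIM('b) / 2)" .
  have 2: "unit_ball_vol (real DIM('b)) * real DIM('b) / (real DIM('b) + p) \<le> C / (real DIM('b) + p)"
    using p by (intro divide_right_mono C) auto
  show ?thesis using 1 2 by (simp add: singular_const_def distrib_left)
qed

lemma K_const_pos:
  assumes "admissible TYPE('a::euclidean_space) K" and "0 < \<beta>" "0 < C"
  shows "0 < K_const TYPE('a) C K \<beta>"
proof -
  let ?X2 = "\<beta> powr (- real DIM('a) / 2) + 1 / (real DIM('a) + gam2 K - 1)"
    and ?X3 = "\<beta> powr (- real DIM('a)) + 1 / (2 * real DIM('a) + gam3 K - 1)"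
  have X: "0 < ?X2" "0 < ?X3" using assms by (auto simp: admissible_def intro!: add_pos_nonneg)
  have fin: "b2_norm TYPE('a) K < \<infinity>" "b3_norm TYPE('a) K < \<infinity>" and pos: "0 < b2_norm TYPE('a) K + b3_norm TYPE('a) K"
    using assms(1) by (auto simp: admissible_def)
  have nn: "0 \<le> enn2real (b2_norm TYPE('a) K)" "0 \<le> enn2real (b3_norm TYPE('a) K)" by simp_all
  have "0 < enn2real (b2_norm TYPE('a) K) \<or> 0 < enn2real (b3_norm TYPE('a) K)"
    using pos fin by (auto simp: enn2real_positive_iff zero_less_iff_neq_zero)
  moreover have "0 < p * x + q * y" if "0 < p \<or> 0 < q" "0 \<le> p" "0 \<le> q" "0 < x" "0 < y" for p q x y :: real
    using that by (auto intro: add_pos_nonneg add_nonneg_pos)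
  ultimately have "0 < enn2real (b2_norm TYPE('a) K) * ?X2 + enn2real (b3_norm TYPE('a) K) * ?X3"
    using X nn by blast
  then show ?thesis using assms(3) unfolding K_const_def Let_def by (rule mult_pos_pos[rotated])
qed

text \<open>The two terms of \<open>lambda_const\<close> bound \<open>k\<close> and \<open>k\<^sup>2\<close>, respectively, by \<open>sqrt \<alpha> / (24 * K)\<close>: the binary collisions
  are of first and the ternary ones of second order in \<open>k\<close>.\<close>

lemma small_collisions_lambda:
  assumes adm: "admissible TYPE('a::euclidean_space) K" and dim: "2 \<le> DIM('a)" and \<alpha>: "0 < \<alpha>" and \<beta>: "0 < \<beta>"
    and k: "0 < k" "k \<le> lambda_const TYPE('a) (4 * sqrt pi * dimension_const TYPE('a)) K \<alpha> \<beta>"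
  shows "small_collisions TYPE('a) K k \<alpha> \<beta>"
proof -
  interpret collision_kernels K "TYPE('a)" k \<alpha> \<beta> by standard (use assms in auto)
  let ?c = "dimension_const TYPE('a)" and ?d = "real DIM('a)"
  let ?K = "K_const TYPE('a) (4 * sqrt pi * ?c) K \<beta>"
  let ?S2 = "singular_const TYPE('a) (gam2 K - 1) \<beta>" and ?S3 = "singular_const TYPE('a \<times> 'a) (gam3 K - 1) \<beta>"
  let ?B2 = "enn2real (b2_norm TYPE('a) K)" and ?B3 = "enn2real (b3_norm TYPE('a) K)"
  let ?X2 = "\<beta> powr (- ?d / 2) + 1 / (?d + gam2 K - 1)" and ?X3 = "\<beta> powr (- ?d) + 1 / (2 * ?d + gam3 K - 1)"
  have c: "0 < ?c" by (rule dimension_const_pos)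
  have K: "0 < ?K" using K_const_pos[OF adm \<beta>, of "4 * sqrt pi * ?c"] c by simp
  have S2: "?S2 \<le> ?c * ?X2"
    using singular_const_le[where 'b='a and p="gam2 K - 1" and C="?c", OF _ \<beta> dimension_const_bounds(1,2)] exponents(1)
    by (simp add: add_diff_eq)
  have d2: "real DIM('a \<times> 'a) = 2 * ?d" by simp
  have S3: "?S3 \<le> ?c * ?X3"
    using singular_const_le[where 'b="'a \<times> 'a" and p="gam3 K - 1" and C="?c", OF _ \<beta> dimension_const_bounds(3,4)] exponents(3)
    unfolding d2 by (simp add: add_diff_eq)
  have le: "k \<le> \<alpha> powr (1 / 2) / (24 * ?K)" "k \<le> \<alpha> powr (1 / 4) / (2 * sqrt (6 * ?K))"
    using k(2) by (auto simp: lambda_const_def Let_def)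
  have sqrt\<alpha>: "\<alpha> powr (1 / 2) = sqrt \<alpha>" using \<alpha> by (simp add: powr_half_sqrt)
  define m where "m = sqrt \<alpha> / (24 * ?K)"
  have k1: "k \<le> m" using le(1) by (simp add: m_def sqrt\<alpha>)
  have k2: "k\<^sup>2 \<le> m"
  proof -
    have "k\<^sup>2 \<le> (\<alpha> powr (1 / 4) / (2 * sqrt (6 * ?K)))\<^sup>2" using le(2) k(1) by (intro power_mono) auto
    also have "\<dots> = (\<alpha> powr (1 / 4))\<^sup>2 / (24 * ?K)" using K by (simp add: power_divide power_mult_distrib)
    also have "(\<alpha> powr (1 / 4))\<^sup>2 = sqrt \<alpha>"
      using \<alpha> by (simp add: powr_half_sqrt[symmetric] power2_eq_square powr_add[symmetric])
    finally show ?thesis by (simp add: m_def)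
  qed
  have m: "0 \<le> m" using k k1 by simp
  have X: "0 \<le> ?X2" "0 \<le> ?X3" using exponents by auto
  have "k * A2 * (2 * sqrt (pi / \<alpha>) * ?S2) + k\<^sup>2 * A3 * (2 * sqrt (pi / \<alpha>) * ?S3)
      \<le> m * A2 * (2 * sqrt (pi / \<alpha>) * (?c * ?X2)) + m * A3 * (2 * sqrt (pi / \<alpha>) * (?c * ?X3))"
    using k1 k2 m S2 S3 A2_nonneg A3_nonneg \<alpha> c X singular_const_nonneg[where 'b='a, of "gam2 K - 1" \<beta>]
      singular_const_nonneg[where 'b="'a \<times> 'a", of "gam3 K - 1" \<beta>] exponents \<beta>
    by (intro add_mono mult_mono mult_left_mono mult_right_mono mult_nonneg_nonneg) auto
  also have "\<dots> \<le> m * (4 * sqrt (pi / \<alpha>) * ?c * (?B2 * ?X2 + ?B3 * ?X3))"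
  proof -
    have "m * (2 * p) * (2 * s * (c * x)) + m * q * (2 * s * (c * y)) \<le> m * (4 * s * c * (p * x + q * y))"
      if "0 \<le> s" "0 \<le> c" "0 \<le> q" "0 \<le> y" for s c p q x y :: real
    proof -
      have "0 \<le> m * (2 * s * c * (q * y))" using m that by (intro mult_nonneg_nonneg) auto
      then show ?thesis by (simp add: algebra_simps)
    qed
    from this[of "sqrt (pi / \<alpha>)" ?c ?B3 ?X3 ?B2 ?X2] show ?thesis using c X \<alpha> unfolding A2_def A3_def by simp
  qed
  also have "4 * sqrt (pi / \<alpha>) * ?c * (?B2 * ?X2 + ?B3 * ?X3) = ?K / sqrt \<alpha>"
    by (simp add: K_const_def Let_def real_sqrt_divide)
  also have "m * (?K / sqrt \<alpha>) = 1 / 24" using K \<alpha> by (simp add: m_def)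
  finally show ?thesis by unfold_locales simp
qed

section \<open>Convergence of the iteration for the Boltzmann equation\<close>

lemma norm_M_mono:
  fixes f g :: "'a::euclidean_space phase_fun"
  assumes "f \<in> F_space" and "AE z in lborel. \<bar>f z\<bar> \<le> \<bar>g z\<bar>"
  shows "norm_M \<alpha> \<beta> f \<le> norm_M \<alpha> \<beta> g"
  unfolding norm_M_def
proof (rule esssup_AE_mono)
  have [measurable]: "f \<in> borel_measurable borel" using assms by (simp add: F_space_def)
  show "(\<lambda>z. \<bar>f z\<bar> / ereal (maxwellian \<alpha> \<beta> z)) \<in> borel_measurable lborel" by measurable
  show "AE z in lborel. \<bar>f z\<bar> / ereal (maxwellian \<alpha> \<beta> z) \<le> \<bar>g z\<bar> / ereal (maxwellian \<alpha> \<beta> z)"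
    using assms(2)
  proof eventually_elim
    case (elim z)
    then show ?case using maxwellian_pos[of \<alpha> \<beta> z] by (intro ereal_divide_right_mono) auto
  qed
qed

text \<open>The hypotheses of the theorem, for a number \<open>k\<close> between the norm of \<open>u\<^sub>0\<close> and the smallness threshold.\<close>

locale kaniel_shinbrot_data = small_collisions K TA k \<alpha> \<beta>
  for K :: kernels and TA :: "'a::euclidean_space itself" and k \<alpha> \<beta> +
  fixes T :: ereal and f0 l0s u0s :: "'a phase_fun" and l1 u1 :: "'a evol"
  assumes T: "0 < T" and f0_pos: "f0 \<in> M_pos \<alpha> \<beta>" and l0s_pos: "l0s \<in> M_pos \<alpha> \<beta>" and u0s_pos: "u0s \<in> M_pos \<alpha> \<beta>"
    and u0s_small: "norm_M \<alpha> \<beta> u0s \<le> ereal k"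
    and l1: "mild_linear K T \<alpha> \<beta> f0 (unsharp (\<lambda>t. u0s)) (gain K (unsharp (\<lambda>t. l0s)) (unsharp (\<lambda>t. l0s)) (unsharp (\<lambda>t. l0s))) l1"
    and u1: "mild_linear K T \<alpha> \<beta> f0 (unsharp (\<lambda>t. l0s)) (gain K (unsharp (\<lambda>t. u0s)) (unsharp (\<lambda>t. u0s)) (unsharp (\<lambda>t. u0s))) u1"
    and beginning: "\<And>t. t \<in> time_int T \<Longrightarrow> AE z in lborel.
      0 \<le> l0s z \<and> l0s z \<le> sharp l1 t z \<and> sharp l1 t z \<le> sharp u1 t z \<and> sharp u1 t z \<le> u0s z"
begin

lemma zero_time: "0 \<in> time_int T"
  using T by (simp add: time_int_def zero_ereal_def)

lemma data_borel [measurable]: "f0 \<in> borel_measurable borel" "l0s \<in> borel_measurable borel" "u0s \<in> borel_measurable borel"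
  using f0_pos l0s_pos u0s_pos by (auto simp: M_pos_def M_space_def F_space_def)

definition f0r :: "'a \<times> 'a \<Rightarrow> real" where "f0r = clip (\<lambda>z. real_of_ereal (f0 z))"
definition l0r :: "'a \<times> 'a \<Rightarrow> real" where "l0r z = real_of_ereal (l0s z)"
definition u0r :: "'a \<times> 'a \<Rightarrow> real" where "u0r z = real_of_ereal (u0s z)"

lemma real_data_borel [measurable]: "f0r \<in> borel_measurable borel" "l0r \<in> borel_measurable borel" "u0r \<in> borel_measurable borel"
  unfolding f0r_def clip_def[abs_def] l0r_def[abs_def] u0r_def[abs_def] by measurable

lemma f0r_bounds: "0 \<le> f0r z" "f0r z \<le> k * maxwellian \<alpha> \<beta> z"
  using k_pos maxwellian_pos[of \<alpha> \<beta> z] by (auto simp: f0r_def clip_def)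

text \<open>At time \<open>0\<close> the beginning condition says that \<open>f\<^sub>0\<close> lies between \<open>l\<^sub>0\<close> and \<open>u\<^sub>0\<close>.\<close>

lemma real_data:
  "AE z in lborel. f0 z = ereal (f0r z) \<and> l0s z = ereal (l0r z) \<and> u0s z = ereal (u0r z) \<and>
    0 \<le> l0r z \<and> l0r z \<le> u0r z \<and> 0 \<le> u0r z \<and> u0r z \<le> k * maxwellian \<alpha> \<beta> z"
proof -
  have "u0s \<in> F_space" by (simp add: F_space_def)
  then have "AE z in lborel. \<bar>u0s z\<bar> \<le> ereal (k * maxwellian \<alpha> \<beta> z)" using u0s_small norm_M_le_iff by blast
  moreover have "AE z in lborel. sharp l1 0 z = f0 z" using l1 by (simp add: mild_linear_def)
  ultimately show ?thesis using beginning[OF zero_time]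
  proof eventually_elim
    case (elim z)
    then have "0 \<le> l0s z" "l0s z \<le> f0 z" "f0 z \<le> u0s z" "u0s z \<le> ereal (k * maxwellian \<alpha> \<beta> z)" by auto
    then show ?case
      by (cases "l0s z"; cases "f0 z"; cases "u0s z") (auto simp: f0r_def l0r_def u0r_def clip_def)
  qed
qed

lemma represents_unsharp:
  assumes "g \<in> borel_measurable borel" "y \<in> borel_measurable borel"
    and "AE z in lborel. g z = ereal (y z) \<and> 0 \<le> y z \<and> y z \<le> k * maxwellian \<alpha> \<beta> z"
  shows "represents (unsharp (\<lambda>t. g)) t y"
  using assms unsharp_borel[of "\<lambda>t. g" t]
  by (auto simp: represents_def sharp_unsharp elim!: eventually_mono)

lemma represents_l0: "represents (unsharp (\<lambda>t. l0s)) t l0r" and represents_u0: "represents (unsharp (\<lambda>t. u0s)) t u0r"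
proof -
  have "AE z in lborel. l0s z = ereal (l0r z) \<and> 0 \<le> l0r z \<and> l0r z \<le> k * maxwellian \<alpha> \<beta> z"
    "AE z in lborel. u0s z = ereal (u0r z) \<and> 0 \<le> u0r z \<and> u0r z \<le> k * maxwellian \<alpha> \<beta> z"
    using real_data by (eventually_elim, simp)+
  then show "represents (unsharp (\<lambda>t. l0s)) t l0r" "represents (unsharp (\<lambda>t. u0s)) t u0r"
    using data_borel real_data_borel by (auto intro!: represents_unsharp simp del: AE_conj_iff)
qed

lemma f0_spaces: "f0 \<in> L1_space" "f0 \<in> F_pos"
  using l1 by (auto simp: mild_linear_def)

lemma step_mild_linear:
  assumes a: "ks.jointly_borel a" and b: "ks.jointly_borel b"
    and A: "\<And>t. t \<in> time_int T \<Longrightarrow> represents A t (a t)" and B: "\<And>t. t \<in> time_int T \<Longrightarrow> represents B t (b t)"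
  shows "mild_linear K T \<alpha> \<beta> f0 B (gain K A A A) (unsharp (\<lambda>t z. ereal (ks.step f0r a b t z)))"
proof (rule evolution_mild_linear[OF a b ks.jointly_borel_step[OF a b real_data_borel(1)] _ _ _ A B refl f0_spaces])
  show "AE z in lborel. f0 z = ereal (ks.step f0r a b 0 z)"
    using real_data ks.step_evolves(2)[OF a b real_data_borel(1) f0r_bounds] by (auto elim: eventually_mono)
qed (use f0r_bounds in \<open>auto intro!: ks.step_nonneg[OF a b] ks.step_bound[OF a b] ks.step_evolves(1)[OF a b]\<close>)

text \<open>The given solutions \<open>l\<^sub>1\<close>, \<open>u\<^sub>1\<close> are the explicit ones by uniqueness, so that the latter satisfy the beginning
  condition.\<close>

lemma first_steps:
  assumes t: "t \<in> time_int T"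
  shows "AE z in lborel. sharp l1 t z = ereal (ks.step f0r (\<lambda>_. l0r) (\<lambda>_. u0r) t z)"
    and "AE z in lborel. sharp u1 t z = ereal (ks.step f0r (\<lambda>_. u0r) (\<lambda>_. l0r) t z)"
  using mild_linear_unique[OF l1 step_mild_linear[OF ks.jointly_borel_const[OF real_data_borel(2)] ks.jointly_borel_const[OF real_data_borel(3)] represents_l0 represents_u0]
      represents_l0 represents_l0 represents_u0 represents_u0 t]
    mild_linear_unique[OF u1 step_mild_linear[OF ks.jointly_borel_const[OF real_data_borel(3)] ks.jointly_borel_const[OF real_data_borel(2)] represents_u0 represents_l0]
      represents_u0 represents_u0 represents_l0 represents_l0 t]
  by (simp_all add: sharp_unsharp)

end

sublocale kaniel_shinbrot_data \<subseteq> it: kaniel_shinbrot_start "maxwellian \<alpha> \<beta> :: 'a \<times> 'a \<Rightarrow> real" k freq_real freq_bound gain_sharp rate_sharp T f0r l0r u0r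
proof
  fix t assume t: "t \<in> time_int T"
  show "AE z in lborel. l0r z \<le> ks.step f0r (\<lambda>_. l0r) (\<lambda>_. u0r) t z \<and>
      ks.step f0r (\<lambda>_. l0r) (\<lambda>_. u0r) t z \<le> ks.step f0r (\<lambda>_. u0r) (\<lambda>_. l0r) t z \<and> ks.step f0r (\<lambda>_. u0r) (\<lambda>_. l0r) t z \<le> u0r z"
    using beginning[OF t] first_steps[OF t] real_data by eventually_elim simp
qed (use real_data f0r_bounds in \<open>auto elim: eventually_mono\<close>)

context kaniel_shinbrot_data
begin

text \<open>The terms of index \<open>0\<close> are the given data and not their real versions, as the theorem asks for equality.\<close>

definition ls :: "nat \<Rightarrow> 'a evol" where "ls n = (if n = 0 then unsharp (\<lambda>t. l0s) else unsharp (\<lambda>t z. ereal (it.lo n t z)))"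
definition us :: "nat \<Rightarrow> 'a evol" where "us n = (if n = 0 then unsharp (\<lambda>t. u0s) else unsharp (\<lambda>t z. ereal (it.up n t z)))"
definition fs :: "'a evol" where "fs = unsharp (\<lambda>t z. ereal (it.limit t z))"

lemma represents_unsharp_ereal:
  assumes Y: "ks.jointly_borel Y" and "AE z in lborel. 0 \<le> Y t z \<and> Y t z \<le> k * maxwellian \<alpha> \<beta> z"
  shows "represents (unsharp (\<lambda>t z. ereal (Y t z))) t (Y t)"
proof -
  have "Y t \<in> borel_measurable borel" by (rule ks.jointly_borel_slice[OF Y])
  then show ?thesis using assms(2) unsharp_borel[of "\<lambda>t z. ereal (Y t z)" t] by (simp add: represents_def sharp_unsharp)
qed

lemma represents_iterates:
  assumes "t \<in> time_int T"
  shows "represents (ls n) t (it.lo n t)" and "represents (us n) t (it.up n t)"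
  using represents_l0 represents_u0 represents_unsharp_ereal[where t=t, OF it.lo_borel it.lo_range[OF assms], of n]
    represents_unsharp_ereal[where t=t, OF it.up_borel it.up_range[OF assms], of n]
  by (auto simp: ls_def us_def it.lo_0 it.up_0)

lemma represents_fs: "represents fs t (it.limit t)"
  unfolding fs_def using it.limit_range by (intro represents_unsharp_ereal it.limit_borel) simp

lemma ks_iteration_iterates: "ks_iteration K T \<alpha> \<beta> f0 ls us"
  unfolding ks_iteration_def
proof (intro allI impI)
  fix n :: nat assume "1 \<le> n"
  then obtain m where n: "n = Suc m" by (cases n) auto
  show "mild_linear K T \<alpha> \<beta> f0 (us (n - 1)) (gain K (ls (n - 1)) (ls (n - 1)) (ls (n - 1))) (ls n) \<and>
    mild_linear K T \<alpha> \<beta> f0 (ls (n - 1)) (gain K (us (n - 1)) (us (n - 1)) (us (n - 1))) (us n)"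
    using step_mild_linear[OF it.lo_borel it.up_borel represents_iterates, of m m]
      step_mild_linear[OF it.up_borel it.lo_borel represents_iterates(2) represents_iterates(1), of m m]
    by (simp add: n ls_def[of "Suc m"] us_def[of "Suc m"] it.lo_Suc it.up_Suc)
qed

lemma iterates_unique:
  assumes start: "ls' 0 = unsharp (\<lambda>t. l0s)" "us' 0 = unsharp (\<lambda>t. u0s)" and it: "ks_iteration K T \<alpha> \<beta> f0 ls' us'"
    and t: "t \<in> time_int T"
  shows "represents (ls' n) t (it.lo n t) \<and> represents (us' n) t (it.up n t)"
  using t
proof (induction n arbitrary: t)
  case 0
  then show ?case using represents_iterates[OF 0, of 0] by (simp add: start ls_def us_def)
next
  case (Suc n)
  have lin': "mild_linear K T \<alpha> \<beta> f0 (us' n) (gain K (ls' n) (ls' n) (ls' n)) (ls' (Suc n))"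
      "mild_linear K T \<alpha> \<beta> f0 (ls' n) (gain K (us' n) (us' n) (us' n)) (us' (Suc n))"
    using it unfolding ks_iteration_def by (metis diff_Suc_1 le_add1 plus_1_eq_Suc)+
  have lin: "mild_linear K T \<alpha> \<beta> f0 (us n) (gain K (ls n) (ls n) (ls n)) (ls (Suc n))"
      "mild_linear K T \<alpha> \<beta> f0 (ls n) (gain K (us n) (us n) (us n)) (us (Suc n))"
    using ks_iteration_iterates unfolding ks_iteration_def by (metis diff_Suc_1 le_add1 plus_1_eq_Suc)+
  note IH = conjunct1[OF Suc.IH] conjunct2[OF Suc.IH]
  have "AE z in lborel. sharp (ls' (Suc n)) t z = sharp (ls (Suc n)) t z"
    by (rule mild_linear_unique[OF lin'(1) lin(1) IH(1) represents_iterates(1) IH(2) represents_iterates(2) Suc.prems])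
  moreover have "AE z in lborel. sharp (us' (Suc n)) t z = sharp (us (Suc n)) t z"
    by (rule mild_linear_unique[OF lin'(2) lin(2) IH(2) represents_iterates(2) IH(1) represents_iterates(1) Suc.prems])
  moreover have "ls' (Suc n) t \<in> borel_measurable borel" "us' (Suc n) t \<in> borel_measurable borel"
    using lin' Suc.prems by (auto simp: mild_linear_def FT_pos_def F_pos_def F_space_def)
  ultimately show ?case
    using represents_iterates[OF Suc.prems, of "Suc n"] by (auto simp: represents_def elim: eventually_elim2)
qed

lemma represents_unique:
  assumes "represents f t y" "represents g t y"
  shows "AE z in lborel. f t z = g t z"
proof -
  have "AE z in lborel. sharp f t z = sharp g t z"
    using assms by (auto simp: represents_def elim: eventually_elim2)
  then show ?thesis using AE_sharp_iff[where Q="(=)" and f=f and g=g and t=t] by simp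
qed

lemma first_iterates:
  assumes t: "t \<in> time_int T"
  shows "AE z in lborel. ls 1 t z = l1 t z \<and> us 1 t z = u1 t z"
proof -
  have "AE z in lborel. sharp (ls 1) t z = sharp l1 t z" "AE z in lborel. sharp (us 1) t z = sharp u1 t z"
    using first_steps[OF t] by (simp_all add: ls_def us_def sharp_unsharp it.lo_Suc[of 0, simplified] it.up_Suc[of 0, simplified] it.lo_0 it.up_0
      eq_commute)
  then show ?thesis
    using AE_sharp_iff[where Q="(=)" and f="ls 1" and g=l1 and t=t] AE_sharp_iff[where Q="(=)" and f="us 1" and g=u1 and t=t]
    by (simp add: AE_conj_iff)
qed

lemma sharp_iterates:
  assumes t: "t \<in> time_int T"
  shows "AE z in lborel. \<forall>n. sharp (ls n) t z = ereal (it.lo n t z) \<and> sharp (us n) t z = ereal (it.up n t z)"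
  unfolding AE_all_countable using represents_iterates[OF t] by (simp add: represents_def)

lemma iterates_ordered:
  assumes t: "t \<in> time_int T"
  shows "AE z in lborel. 0 \<le> l0s z \<and> sharp (ls 0) t z = l0s z \<and> (\<forall>k<n. sharp (ls k) t z \<le> sharp (ls (Suc k)) t z) \<and>
    sharp (ls n) t z \<le> sharp (us n) t z \<and> (\<forall>k<n. sharp (us (Suc k)) t z \<le> sharp (us k) t z) \<and> sharp (us 0) t z = u0s z"
  using sharp_iterates[OF t] it.enclosed[OF t] beginning[OF t]
proof eventually_elim
  case (elim z)
  show ?case using elim(1,2,3) by (simp add: ls_def[of 0] us_def[of 0] sharp_unsharp)
qed

lemma iterates_converge:
  assumes t: "t \<in> time_int T"
  shows "converges_M \<alpha> \<beta> (\<lambda>n. sharp (ls n) t) (sharp fs t)" and "converges_M \<alpha> \<beta> (\<lambda>n. sharp (us n) t) (sharp fs t)"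
proof -
  have m: "sharp f t \<in> F_space" if "represents f t y" for f y
    using that by (auto simp: represents_def F_space_def intro!: sharp_borel)
  have bound: "norm_M \<alpha> \<beta> (sharp f t) \<le> ereal k" if r: "represents f t y" for f y
    unfolding norm_M_le_iff[OF m[OF r]] using r by (auto simp: represents_def elim: eventually_elim2)
  have lim: "AE z in lborel. (\<lambda>n. sharp (ls n) t z) \<longlonglongrightarrow> sharp fs t z \<and> (\<lambda>n. sharp (us n) t z) \<longlonglongrightarrow> sharp fs t z"
    using sharp_iterates[OF t] it.limit_enclosed[OF t]
  proof eventually_elim
    case (elim z)
    have "(\<lambda>n. (1 / 2) ^ n * (k * maxwellian \<alpha> \<beta> (z :: 'a \<times> 'a))) \<longlonglongrightarrow> 0 * (k * maxwellian \<alpha> \<beta> z)"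
      by (intro tendsto_intros LIMSEQ_power_zero) simp
    then have 0: "(\<lambda>n. (1 / 2) ^ n * (k * maxwellian \<alpha> \<beta> z)) \<longlonglongrightarrow> 0" by simp
    have "(\<lambda>n. it.lo n t z - it.limit t z) \<longlonglongrightarrow> 0" "(\<lambda>n. it.up n t z - it.limit t z) \<longlonglongrightarrow> 0"
      using elim(2) by (auto intro!: Lim_null_comparison[OF _ 0] always_eventually)
    then have "(\<lambda>n. it.lo n t z) \<longlonglongrightarrow> it.limit t z" "(\<lambda>n. it.up n t z) \<longlonglongrightarrow> it.limit t z"
      by (simp_all add: LIM_zero_iff)
    then show ?case using elim(1) by (simp add: fs_def sharp_unsharp)
  qed
  have "(SUP n. norm_M \<alpha> \<beta> (sharp (ls n) t)) \<le> ereal k" "(SUP n. norm_M \<alpha> \<beta> (sharp (us n) t)) \<le> ereal k"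
    using represents_iterates[OF t] by (auto intro!: SUP_least bound)
  then have "(SUP n. norm_M \<alpha> \<beta> (sharp (ls n) t)) < \<infinity>" "(SUP n. norm_M \<alpha> \<beta> (sharp (us n) t)) < \<infinity>"
    by (auto elim: le_less_trans)
  then show "converges_M \<alpha> \<beta> (\<lambda>n. sharp (ls n) t) (sharp fs t)" "converges_M \<alpha> \<beta> (\<lambda>n. sharp (us n) t) (sharp fs t)"
    unfolding converges_M_def using lim m[OF represents_fs] m represents_iterates[OF t] by (auto elim: eventually_mono)
qed

lemma limit_evolution:
  shows "fs \<in> FT_pos T" and "sharp fs \<in> C0_L1_pos T" and "sharp fs \<in> Linf_M_pos T \<alpha> \<beta>"
    and "sharp (loss K fs fs fs) \<in> Linf_L1_pos T" and "sharp (gain K fs fs fs) \<in> Linf_L1_pos T"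
    and "has_weak_derivative T (\<lambda>t. to_L1 (sharp fs t))
      (\<lambda>t. to_L1 (sharp (gain K fs fs fs) t) - to_L1 (sharp (loss K fs fs fs) t))"
    and "t \<in> time_int T \<Longrightarrow> to_L1 (sharp fs t) + (LINT \<tau>:{0..t}|lebesgue. to_L1 (sharp (loss K fs fs fs) \<tau>)) =
      to_L1 (sharp fs 0) + (LINT \<tau>:{0..t}|lebesgue. to_L1 (sharp (gain K fs fs fs) \<tau>))"
proof -
  have le: "it.limit t z \<le> 2 * (k * maxwellian \<alpha> \<beta> z)" for t z
    using it.limit_range[of t z] by linarith
  note args = it.limit_borel it.limit_borel it.limit_borel it.limit_range(1) le it.limit_evolves represents_fs represents_fs fs_def
  show "fs \<in> FT_pos T" using evolution_F_pos[OF args] by (simp add: FT_pos_def)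
  show "sharp fs \<in> C0_L1_pos T" by (rule evolution_C0[OF args])
  show "sharp fs \<in> Linf_M_pos T \<alpha> \<beta>" by (rule represents_Linf(1)[OF represents_fs])
  show "sharp (loss K fs fs fs) \<in> Linf_L1_pos T" by (rule evolution_loss(2)[OF args])
  show "sharp (gain K fs fs fs) \<in> Linf_L1_pos T" by (rule evolution_gain(2)[OF args])
  show "has_weak_derivative T (\<lambda>t. to_L1 (sharp fs t)) (\<lambda>t. to_L1 (sharp (gain K fs fs fs) t) - to_L1 (sharp (loss K fs fs fs) t))"
    by (rule evolution_weak_derivative[OF args])
  show "t \<in> time_int T \<Longrightarrow> to_L1 (sharp fs t) + (LINT \<tau>:{0..t}|lebesgue. to_L1 (sharp (loss K fs fs fs) \<tau>)) =
      to_L1 (sharp fs 0) + (LINT \<tau>:{0..t}|lebesgue. to_L1 (sharp (gain K fs fs fs) \<tau>))"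
    by (rule evolution_integral_equation[OF args])
qed

lemma fs_initial: "AE z in lborel. sharp fs 0 z = f0 z" and fs_initial_to_L1: "to_L1 (sharp fs 0) = to_L1 f0"
proof -
  show eq: "AE z in lborel. sharp fs 0 z = f0 z"
    using it.limit_initial[OF T] real_data by eventually_elim (simp add: fs_def sharp_unsharp)
  show "to_L1 (sharp fs 0) = to_L1 f0"
    using eq represents_fs[of 0] by (intro to_L1_cong_AE sharp_borel) (auto simp: represents_def)
qed

lemma fs_mild_boltzmann: "mild_boltzmann K T \<alpha> \<beta> f0 fs"
  unfolding mild_boltzmann_def using f0_pos limit_evolution fs_initial by simp

lemma fs_bound: "norm_sup T \<alpha> \<beta> (sharp fs) \<le> norm_M \<alpha> \<beta> u0s"
  unfolding norm_sup_def
proof (rule SUP_least)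
  fix t assume t: "t \<in> time_int T"
  show "norm_M \<alpha> \<beta> (sharp fs t) \<le> norm_M \<alpha> \<beta> u0s"
  proof (rule norm_M_mono)
    show "sharp fs t \<in> F_space" using represents_fs[of t] by (auto simp: represents_def F_space_def intro!: sharp_borel)
    show "AE z in lborel. \<bar>sharp fs t z\<bar> \<le> \<bar>u0s z\<bar>"
      using it.limit_enclosed[OF t] real_data
    proof eventually_elim
      case (elim z)
      then have "it.limit t z \<le> u0r z" using it.up_0 by metis
      then show ?case using elim(2) it.limit_range(1)[of t z] by (simp add: fs_def sharp_unsharp)
    qed
  qed
qed

lemma fs_unique:
  assumes g: "mild_boltzmann K T \<alpha> \<beta> f0 g" "norm_sup T \<alpha> \<beta> (sharp g) \<le> norm_M \<alpha> \<beta> u0s" and t: "t \<in> time_int T"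
  shows "AE z in lborel. g t z = fs t z"
proof -
  have "AE z in lborel. sharp g t z = sharp fs t z"
    by (rule mild_boltzmann_unique[OF g(1) _ fs_mild_boltzmann _ t]) (use g(2) fs_bound u0s_small order_trans in blast)+
  then show ?thesis using AE_sharp_iff[where Q="(=)" and f=g and g=fs and t=t] by simp
qed

end

theorem theorem4p7:
  assumes dim: "2 \<le> CARD('n::finite)"
  shows "\<exists>C>0. \<forall>(K :: kernels) (T :: ereal) (\<alpha> :: real) (\<beta> :: real)
      (f0 :: (real ^ 'n) phase_fun) (l0s :: (real ^ 'n) phase_fun) (u0s :: (real ^ 'n) phase_fun)
      (l1 :: (real ^ 'n) evol) (u1 :: (real ^ 'n) evol) (l0 :: (real ^ 'n) evol) (u0 :: (real ^ 'n) evol).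
    admissible TYPE(real ^ 'n) K \<and> 0 < T \<and> 0 < \<alpha> \<and> 0 < \<beta> \<and>
    f0 \<in> M_pos \<alpha> \<beta> \<and> l0s \<in> M_pos \<alpha> \<beta> \<and> u0s \<in> M_pos \<alpha> \<beta> \<and>
    norm_M \<alpha> \<beta> u0s < ereal (lambda_const TYPE(real ^ 'n) C K \<alpha> \<beta>) \<and>
    l0 = unsharp (\<lambda>t. l0s) \<and> u0 = unsharp (\<lambda>t. u0s) \<and>
    mild_linear K T \<alpha> \<beta> f0 u0 (gain K l0 l0 l0) l1 \<and>
    mild_linear K T \<alpha> \<beta> f0 l0 (gain K u0 u0 u0) u1 \<and>
    (\<forall>t\<in>time_int T. AE z in lborel.
      0 \<le> l0s z \<and> l0s z \<le> sharp l1 t z \<and> sharp l1 t z \<le> sharp u1 t z \<and> sharp u1 t z \<le> u0s z)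
    \<longrightarrow>
    (\<exists>(ls :: nat \<Rightarrow> (real ^ 'n) evol) (us :: nat \<Rightarrow> (real ^ 'n) evol)
      (l :: (real ^ 'n) evol) (u :: (real ^ 'n) evol).
      \<comment> \<open>(i)\<close>
      ls 0 = l0 \<and> us 0 = u0 \<and> ks_iteration K T \<alpha> \<beta> f0 ls us \<and>
      (\<forall>t\<in>time_int T. AE z in lborel. ls 1 t z = l1 t z \<and> us 1 t z = u1 t z) \<and>
      (\<forall>ls' us'. ls' 0 = l0 \<and> us' 0 = u0 \<and> ks_iteration K T \<alpha> \<beta> f0 ls' us' \<longrightarrow>
        (\<forall>n. \<forall>t\<in>time_int T. AE z in lborel. ls' n t z = ls n t z \<and> us' n t z = us n t z)) \<and>
      (\<forall>n. \<forall>t\<in>time_int T. AE z in lborel.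
        0 \<le> l0s z \<and> sharp (ls 0) t z = l0s z \<and>
        (\<forall>k<n. sharp (ls k) t z \<le> sharp (ls (Suc k)) t z) \<and>
        sharp (ls n) t z \<le> sharp (us n) t z \<and>
        (\<forall>k<n. sharp (us (Suc k)) t z \<le> sharp (us k) t z) \<and>
        sharp (us 0) t z = u0s z) \<and>
      \<comment> \<open>(ii)\<close>
      (\<forall>t\<in>time_int T. converges_M \<alpha> \<beta> (\<lambda>n. sharp (ls n) t) (sharp l t) \<and>
        converges_M \<alpha> \<beta> (\<lambda>n. sharp (us n) t) (sharp u t)) \<and>
      sharp l \<in> C0_L1_pos T \<inter> Linf_M_pos T \<alpha> \<beta> \<and> sharp u \<in> C0_L1_pos T \<inter> Linf_M_pos T \<alpha> \<beta> \<and>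
      sharp (loss K l u u) \<in> Linf_L1_pos T \<and> sharp (loss K u l l) \<in> Linf_L1_pos T \<and>
      sharp (gain K l l l) \<in> Linf_L1_pos T \<and> sharp (gain K u u u) \<in> Linf_L1_pos T \<and>
      (\<forall>t\<in>time_int T.
        to_L1 (sharp l t) + (LINT \<tau>:{0..t}|lebesgue. to_L1 (sharp (loss K l u u) \<tau>)) =
        to_L1 f0 + (LINT \<tau>:{0..t}|lebesgue. to_L1 (sharp (gain K l l l) \<tau>)) \<and>
        to_L1 (sharp u t) + (LINT \<tau>:{0..t}|lebesgue. to_L1 (sharp (loss K u l l) \<tau>)) =
        to_L1 f0 + (LINT \<tau>:{0..t}|lebesgue. to_L1 (sharp (gain K u u u) \<tau>))) \<and>
      \<comment> \<open>(iii)\<close>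
      (\<forall>t\<in>time_int T. AE z in lborel. u t z = l t z) \<and>
      \<comment> \<open>(iv)\<close>
      mild_boltzmann K T \<alpha> \<beta> f0 l \<and> norm_sup T \<alpha> \<beta> (sharp l) \<le> norm_M \<alpha> \<beta> u0s \<and>
      (\<forall>g. mild_boltzmann K T \<alpha> \<beta> f0 g \<and> norm_sup T \<alpha> \<beta> (sharp g) \<le> norm_M \<alpha> \<beta> u0s \<longrightarrow>
        (\<forall>t\<in>time_int T. AE z in lborel. g t z = l t z)))"
proof (intro exI[of _ "4 * sqrt pi * dimension_const TYPE(real ^ 'n)"] conjI allI impI, goal_cases)
  case 1
  show ?case using dimension_const_pos[where 'a="real ^ 'n"] by simp
next
  case (2 K T \<alpha> \<beta> f0 l0s u0s l1 u1 l0 u0)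
  let ?lam = "lambda_const TYPE(real ^ 'n) (4 * sqrt pi * dimension_const TYPE(real ^ 'n)) K \<alpha> \<beta>"
  from 2 have adm: "admissible TYPE(real ^ 'n) K" and pos: "0 < \<alpha>" "0 < \<beta>" and small: "norm_M \<alpha> \<beta> u0s < ereal ?lam"
    and l0: "l0 = unsharp (\<lambda>t. l0s)" and u0: "u0 = unsharp (\<lambda>t. u0s)" by simp_all
  \<comment> \<open>Any \<open>k\<close> strictly between the norm of \<open>u\<^sub>0\<close> and the threshold will do; it is positive even if \<open>u\<^sub>0 = 0\<close>.\<close>
  have "0 < ?lam"
    using pos K_const_pos[OF adm pos(2), of "4 * sqrt pi * dimension_const TYPE(real ^ 'n)"] dimension_const_pos[where 'a="real ^ 'n"]
    by (simp add: lambda_const_def Let_def)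
  then have "max 0 (norm_M \<alpha> \<beta> u0s) < ereal ?lam" using small by simp
  then obtain k' where k': "max 0 (norm_M \<alpha> \<beta> u0s) < k'" "k' < ereal ?lam" using dense by blast
  then obtain k where k: "k' = ereal k" by (cases k') auto
  have "small_collisions TYPE(real ^ 'n) K k \<alpha> \<beta>"
    by (rule small_collisions_lambda) (use adm dim pos k' in \<open>auto simp: k\<close>)
  then interpret small_collisions K "TYPE(real ^ 'n)" k \<alpha> \<beta> .
  interpret kaniel_shinbrot_data K "TYPE(real ^ 'n)" k \<alpha> \<beta> T f0 l0s u0s l1 u1
    by standard (use 2 k' in \<open>simp_all add: k l0 u0 less_imp_le\<close>)
  have start: "ls 0 = l0" "us 0 = u0" by (simp_all add: ls_def us_def l0 u0)
  have unique: "AE z in lborel. ls' n t z = ls n t z \<and> us' n t z = us n t z"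
    if "ls' 0 = l0 \<and> us' 0 = u0 \<and> ks_iteration K T \<alpha> \<beta> f0 ls' us'" "t \<in> time_int T" for ls' us' n t
  proof -
    have "represents (ls' n) t (it.lo n t) \<and> represents (us' n) t (it.up n t)"
      using iterates_unique[of ls' us' t n] that by (simp add: l0 u0)
    then have "AE z in lborel. ls' n t z = ls n t z" "AE z in lborel. us' n t z = us n t z"
      using represents_iterates[OF that(2), of n] represents_unique by blast+
    then show ?thesis by (rule AE_conjI)
  qed
  show ?case
    by (rule exI[of _ ls], rule exI[of _ us], rule exI[of _ fs], rule exI[of _ fs], intro conjI allI ballI impI IntI
        start ks_iteration_iterates first_iterates iterates_ordered iterates_converge limit_evolution(1-6)
        limit_evolution(7)[unfolded fs_initial_to_L1] fs_mild_boltzmann fs_bound fs_unique)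
      (use unique in blast)+
qed

end
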